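(* Let $\Pi$ be a preprojective algebra of Dynkin type. Then the third syzygy is naturally isomorphic to the inverse Nakayama functor: for every right $\Pi$-module $X$, the kernel of the left hand map $X\otimes_A\Pi\to X\otimes_A(M\oplus DM)\otimes_A\Pi$ in the standard projective presentation of $X$ is naturally isomorphic to $\nu^-X=\operatorname{Hom}_\Pi(D\Pi,X)$.
   Context: $k$ is a field, $D=\operatorname{Hom}_k(-,k)$, and $k$ acts centrally on bimodules. $\Lambda$ is a basic finite dimensional hereditary $k$-algebra of Dynkin type, i.e. representation-finite; such $\Lambda$ is a tensor algebra $\Lambda=T_A(M)$ with $A$ a product of finite dimensional division algebras and $M$ a finite dimensional $A$-bimodule. Fix a symmetrising element $\sigma\in DA$ ($\sigma(ab)=\sigma(ba)$, and $\sigma(a\,\cdot)=0$ implies $a=0$). For $\mu\in DM$ let $\overrightarrow{\mu}\colon M\to A$ (resp. $\overleftarrow{\mu}$) be the unique right (resp. left) $A$-linear map whose composite with $\sigma$ is $\mu$. Let $\rho=\sum m_i\otimes\mu_i\in M\otimes_ADM$ and $\ell=\sum\nu_j\otimes n_j\in DM\otimes_AM$ be such that $m=\sum m_i\overrightarrow{\mu_i}(m)=\sum\overleftarrow{\nu_j}(m)n_j$ for all $m\in M$. The preprojective algebra of $\Lambda$ is $\Pi=T_A(M\oplus DM)/\langle\rho-\ell\rangle$ (finite dimensional in Dynkin type). The standard projective presentation of a right $\Pi$-module $X$ is the exact sequence, functorial in $X$, with projective first three terms $$X\otimes_A\Pi\to X\otimes_A(M\oplus DM)\otimes_A\Pi\to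 X\otimes_A\Pi\to X\to0,$$ whose left hand map sends $x\otimes1$ to $\sum(xm_i\otimes\mu_i\otimes1+x\otimes m_i\otimes\mu_i)-\sum(x\nu_j\otimes n_j\otimes1+x\otimes\nu_j\otimes n_j)$, whose middle map sends $x\otimes\gamma\otimes1$ to $x\otimes\gamma-x\gamma\otimes1$, and whose last map is the action. The third syzygy of $X$ is the kernel of the left hand map. *)

theory Defs
  imports "HOL-Algebra.Module" "HOL-Algebra.QuotRing"
begin

text \<open>
  Vector spaces, algebras and (bi)modules over the field \<open>K\<close> are carrier-based records extending
  the \<^type>\<open>module\<close> record of HOL-Algebra.  For plain vector spaces and modules the fields
  \<open>mult\<close> and \<open>one\<close> inherited from that record carry no meaning.
  Homomorphisms are extensional functions (\<open>\<rightarrow>\<^sub>E\<close>), so that a map is determined by its values on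
  the carrier.
\<close>

section \<open>Algebras, modules and bimodules\<close>

locale assoc_algebra = module K A + A?: ring A for K (structure) and A (structure) +
  assumes smult_mult_left:
      "\<lbrakk>c \<in> carrier K; a \<in> carrier A; b \<in> carrier A\<rbrakk> \<Longrightarrow> (c \<odot>\<^bsub>A\<^esub> a) \<otimes>\<^bsub>A\<^esub> b = c \<odot>\<^bsub>A\<^esub> (a \<otimes>\<^bsub>A\<^esub> b)"
    and smult_mult_right:
      "\<lbrakk>c \<in> carrier K; a \<in> carrier A; b \<in> carrier A\<rbrakk> \<Longrightarrow> a \<otimes>\<^bsub>A\<^esub> (c \<odot>\<^bsub>A\<^esub> b) = c \<odot>\<^bsub>A\<^esub> (a \<otimes>\<^bsub>A\<^esub> b)"

record ('k, 'b, 'x) rmodule = "('k, 'x) module" +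
  ract :: "'x \<Rightarrow> 'b \<Rightarrow> 'x" (infixl "\<triangleleft>\<index>" 70)

record ('k, 'a, 'b, 'x) bimodule = "('k, 'b, 'x) rmodule" +
  lact :: "'a \<Rightarrow> 'x \<Rightarrow> 'x" (infixr "\<triangleright>\<index>" 70)

locale right_module =
  assoc_algebra K B + N?: module K N
  for K :: "('k, 'c) ring_scheme" (structure) and B :: "('k, 'b, 'y) module_scheme" (structure)
    and N :: "('k, 'b, 'n, 'z) rmodule_scheme" (structure) +
  assumes ract_closed: "\<lbrakk>n \<in> carrier N; b \<in> carrier B\<rbrakk> \<Longrightarrow> n \<triangleleft>\<^bsub>N\<^esub> b \<in> carrier N"
    and ract_add_left: "\<lbrakk>n \<in> carrier N; n' \<in> carrier N; b \<in> carrier B\<rbrakk>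
      \<Longrightarrow> (n \<oplus>\<^bsub>N\<^esub> n') \<triangleleft>\<^bsub>N\<^esub> b = n \<triangleleft>\<^bsub>N\<^esub> b \<oplus>\<^bsub>N\<^esub> n' \<triangleleft>\<^bsub>N\<^esub> b"
    and ract_add_right: "\<lbrakk>n \<in> carrier N; b \<in> carrier B; b' \<in> carrier B\<rbrakk>
      \<Longrightarrow> n \<triangleleft>\<^bsub>N\<^esub> (b \<oplus>\<^bsub>B\<^esub> b') = n \<triangleleft>\<^bsub>N\<^esub> b \<oplus>\<^bsub>N\<^esub> n \<triangleleft>\<^bsub>N\<^esub> b'"
    and ract_assoc: "\<lbrakk>n \<in> carrier N; b \<in> carrier B; b' \<in> carrier B\<rbrakk>
      \<Longrightarrow> n \<triangleleft>\<^bsub>N\<^esub> (b \<otimes>\<^bsub>B\<^esub> b') = (n \<triangleleft>\<^bsub>N\<^esub> b) \<triangleleft>\<^bsub>N\<^esub> b'"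
    and ract_one: "n \<in> carrier N \<Longrightarrow> n \<triangleleft>\<^bsub>N\<^esub> \<one>\<^bsub>B\<^esub> = n"
    and ract_smult_left: "\<lbrakk>c \<in> carrier K; n \<in> carrier N; b \<in> carrier B\<rbrakk>
      \<Longrightarrow> (c \<odot>\<^bsub>N\<^esub> n) \<triangleleft>\<^bsub>N\<^esub> b = c \<odot>\<^bsub>N\<^esub> (n \<triangleleft>\<^bsub>N\<^esub> b)"
    and ract_smult_right: "\<lbrakk>c \<in> carrier K; n \<in> carrier N; b \<in> carrier B\<rbrakk>
      \<Longrightarrow> n \<triangleleft>\<^bsub>N\<^esub> (c \<odot>\<^bsub>B\<^esub> b) = c \<odot>\<^bsub>N\<^esub> (n \<triangleleft>\<^bsub>N\<^esub> b)"

text \<open>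
  The two actions of \<open>K\<close> on a bimodule, through either algebra, both agree with \<open>smult\<close>:
  \<open>K\<close> acts centrally.
\<close>

locale bimodule =
  right_module K B N + A?: assoc_algebra K A
  for K :: "('k, 'c) ring_scheme" (structure) and A :: "('k, 'a, 'x) module_scheme" (structure)
    and B :: "('k, 'b, 'y) module_scheme" (structure)
    and N :: "('k, 'a, 'b, 'n, 'z) bimodule_scheme" (structure) +
  assumes lact_closed: "\<lbrakk>a \<in> carrier A; n \<in> carrier N\<rbrakk> \<Longrightarrow> a \<triangleright>\<^bsub>N\<^esub> n \<in> carrier N"
    and lact_add_right: "\<lbrakk>a \<in> carrier A; n \<in> carrier N; n' \<in> carrier N\<rbrakk>
      \<Longrightarrow> a \<triangleright>\<^bsub>N\<^esub> (n \<oplus>\<^bsub>N\<^esub> n') = (a \<triangleright>\<^bsub>N\<^esub> n) \<oplus>\<^bsub>N\<^esub> (a \<triangleright>\<^bsub>N\<^esub> n')"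
    and lact_add_left: "\<lbrakk>a \<in> carrier A; a' \<in> carrier A; n \<in> carrier N\<rbrakk>
      \<Longrightarrow> (a \<oplus>\<^bsub>A\<^esub> a') \<triangleright>\<^bsub>N\<^esub> n = (a \<triangleright>\<^bsub>N\<^esub> n) \<oplus>\<^bsub>N\<^esub> (a' \<triangleright>\<^bsub>N\<^esub> n)"
    and lact_assoc: "\<lbrakk>a \<in> carrier A; a' \<in> carrier A; n \<in> carrier N\<rbrakk>
      \<Longrightarrow> (a \<otimes>\<^bsub>A\<^esub> a') \<triangleright>\<^bsub>N\<^esub> n = a \<triangleright>\<^bsub>N\<^esub> (a' \<triangleright>\<^bsub>N\<^esub> n)"
    and lact_one: "n \<in> carrier N \<Longrightarrow> \<one>\<^bsub>A\<^esub> \<triangleright>\<^bsub>N\<^esub> n = n"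
    and lact_smult_left: "\<lbrakk>c \<in> carrier K; a \<in> carrier A; n \<in> carrier N\<rbrakk>
      \<Longrightarrow> (c \<odot>\<^bsub>A\<^esub> a) \<triangleright>\<^bsub>N\<^esub> n = c \<odot>\<^bsub>N\<^esub> (a \<triangleright>\<^bsub>N\<^esub> n)"
    and lact_smult_right: "\<lbrakk>c \<in> carrier K; a \<in> carrier A; n \<in> carrier N\<rbrakk>
      \<Longrightarrow> a \<triangleright>\<^bsub>N\<^esub> (c \<odot>\<^bsub>N\<^esub> n) = c \<odot>\<^bsub>N\<^esub> (a \<triangleright>\<^bsub>N\<^esub> n)"
    and lact_ract: "\<lbrakk>a \<in> carrier A; n \<in> carrier N; b \<in> carrier B\<rbrakk>
      \<Longrightarrow> (a \<triangleright>\<^bsub>N\<^esub> n) \<triangleleft>\<^bsub>N\<^esub> b = a \<triangleright>\<^bsub>N\<^esub> (n \<triangleleft>\<^bsub>N\<^esub> b)"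

definition regular :: "('k, 'a) module \<Rightarrow> ('k, 'a, 'a, 'a) bimodule" where
  "regular A = \<lparr>carrier = carrier A, mult = mult A, one = one A, zero = zero A, add = add A,
     smult = smult A, ract = mult A, lact = mult A\<rparr>"

text \<open>Restriction of scalars along a map \<open>\<phi>\<close> from the new to the old algebra.\<close>

definition restrict_right :: "('a \<Rightarrow> 'b) \<Rightarrow> ('k, 'b, 'x) rmodule \<Rightarrow> ('k, 'a, 'x) rmodule" where
  "restrict_right \<phi> X = \<lparr>carrier = carrier X, mult = mult X, one = one X, zero = zero X, add = add X,
     smult = smult X, ract = (\<lambda>x a. x \<triangleleft>\<^bsub>X\<^esub> \<phi> a)\<rparr>"

definition restrict_left :: "('a \<Rightarrow> 'b) \<Rightarrow> ('k, 'b, 'c, 'x) bimodule \<Rightarrow> ('k, 'a, 'c, 'x) bimodule" where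
  "restrict_left \<phi> N = \<lparr>carrier = carrier N, mult = mult N, one = one N, zero = zero N, add = add N,
     smult = smult N, ract = ract N, lact = (\<lambda>a n. \<phi> a \<triangleright>\<^bsub>N\<^esub> n)\<rparr>"

definition bimodule_sum ::
  "('k, 'a, 'b, 'm) bimodule \<Rightarrow> ('k, 'a, 'b, 'n) bimodule \<Rightarrow> ('k, 'a, 'b, 'm \<times> 'n) bimodule" where
  "bimodule_sum M N = \<lparr>carrier = carrier M \<times> carrier N, mult = undefined, one = undefined,
     zero = (\<zero>\<^bsub>M\<^esub>, \<zero>\<^bsub>N\<^esub>),
     add = (\<lambda>(m, n) (m', n'). (m \<oplus>\<^bsub>M\<^esub> m', n \<oplus>\<^bsub>N\<^esub> n')),
     smult = (\<lambda>c (m, n). (c \<odot>\<^bsub>M\<^esub> m, c \<odot>\<^bsub>N\<^esub> n)),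
     ract = (\<lambda>(m, n) b. (m \<triangleleft>\<^bsub>M\<^esub> b, n \<triangleleft>\<^bsub>N\<^esub> b)),
     lact = (\<lambda>a (m, n). (a \<triangleright>\<^bsub>M\<^esub> m, a \<triangleright>\<^bsub>N\<^esub> n))\<rparr>"

definition lsum :: "('x, 'z) ring_scheme \<Rightarrow> 'x list \<Rightarrow> 'x" where
  "lsum V xs = foldr (add V) xs \<zero>\<^bsub>V\<^esub>"

section \<open>Homomorphisms and duals\<close>

definition lin_maps :: "('k, 'c) ring_scheme \<Rightarrow> ('k, 'v, 'y) module_scheme
    \<Rightarrow> ('k, 'w, 'z) module_scheme \<Rightarrow> ('v \<Rightarrow> 'w) set" where
  "lin_maps K V W = {f \<in> carrier V \<rightarrow>\<^sub>E carrier W.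
     (\<forall>u\<in>carrier V. \<forall>v\<in>carrier V. f (u \<oplus>\<^bsub>V\<^esub> v) = f u \<oplus>\<^bsub>W\<^esub> f v) \<and>
     (\<forall>c\<in>carrier K. \<forall>v\<in>carrier V. f (c \<odot>\<^bsub>V\<^esub> v) = c \<odot>\<^bsub>W\<^esub> f v)}"

definition linear_forms ::
  "('k, 'c) ring_scheme \<Rightarrow> ('k, 'v, 'z) module_scheme \<Rightarrow> ('v \<Rightarrow> 'k) set" where
  "linear_forms K V = {f \<in> carrier V \<rightarrow>\<^sub>E carrier K.
     (\<forall>u\<in>carrier V. \<forall>v\<in>carrier V. f (u \<oplus>\<^bsub>V\<^esub> v) = f u \<oplus>\<^bsub>K\<^esub> f v) \<and>
     (\<forall>c\<in>carrier K. \<forall>v\<in>carrier V. f (c \<odot>\<^bsub>V\<^esub> v) = c \<otimes>\<^bsub>K\<^esub> f v)}"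

definition dual :: "('k, 'c) ring_scheme \<Rightarrow> ('k, 'a, 'b, 'n) bimodule
    \<Rightarrow> ('k, 'b, 'a, 'n \<Rightarrow> 'k) bimodule" where
  "dual K N = \<lparr>carrier = linear_forms K N, mult = undefined, one = undefined,
     zero = (\<lambda>n\<in>carrier N. \<zero>\<^bsub>K\<^esub>),
     add = (\<lambda>\<phi> \<psi>. \<lambda>n\<in>carrier N. \<phi> n \<oplus>\<^bsub>K\<^esub> \<psi> n),
     smult = (\<lambda>c \<phi>. \<lambda>n\<in>carrier N. c \<otimes>\<^bsub>K\<^esub> \<phi> n),
     ract = (\<lambda>\<phi> a. \<lambda>n\<in>carrier N. \<phi> (a \<triangleright>\<^bsub>N\<^esub> n)),
     lact = (\<lambda>b \<phi>. \<lambda>n\<in>carrier N. \<phi> (n \<triangleleft>\<^bsub>N\<^esub> b))\<rparr>"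

definition rmod_hom :: "('k, 'b, 'y) module_scheme \<Rightarrow> ('k, 'b, 'x, 'z) rmodule_scheme
    \<Rightarrow> ('k, 'b, 'x', 'z') rmodule_scheme \<Rightarrow> ('x \<Rightarrow> 'x') set" where
  "rmod_hom B X Y = {f \<in> carrier X \<rightarrow>\<^sub>E carrier Y.
     (\<forall>x\<in>carrier X. \<forall>x'\<in>carrier X. f (x \<oplus>\<^bsub>X\<^esub> x') = f x \<oplus>\<^bsub>Y\<^esub> f x') \<and>
     (\<forall>x\<in>carrier X. \<forall>b\<in>carrier B. f (x \<triangleleft>\<^bsub>X\<^esub> b) = f x \<triangleleft>\<^bsub>Y\<^esub> b)}"

definition lmod_hom :: "('k, 'a, 'y) module_scheme \<Rightarrow> ('k, 'a, 'b, 'x, 'z) bimodule_scheme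
    \<Rightarrow> ('k, 'a, 'b', 'x', 'z') bimodule_scheme \<Rightarrow> ('x \<Rightarrow> 'x') set" where
  "lmod_hom A X Y = {f \<in> carrier X \<rightarrow>\<^sub>E carrier Y.
     (\<forall>x\<in>carrier X. \<forall>x'\<in>carrier X. f (x \<oplus>\<^bsub>X\<^esub> x') = f x \<oplus>\<^bsub>Y\<^esub> f x') \<and>
     (\<forall>a\<in>carrier A. \<forall>x\<in>carrier X. f (a \<triangleright>\<^bsub>X\<^esub> x) = a \<triangleright>\<^bsub>Y\<^esub> f x)}"

definition rmod_iso :: "('k, 'b, 'y) module_scheme \<Rightarrow> ('k, 'b, 'x, 'z) rmodule_scheme
    \<Rightarrow> ('k, 'b, 'x', 'z') rmodule_scheme \<Rightarrow> ('x \<Rightarrow> 'x') set" where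
  "rmod_iso B X Y = {f \<in> rmod_hom B X Y. bij_betw f (carrier X) (carrier Y)}"

text \<open>
  \<open>Hom\<^sub>B(N, X)\<close> as a right \<open>C\<close>-module, for a \<open>C\<close>-\<open>B\<close>-bimodule \<open>N\<close> and a right \<open>B\<close>-module \<open>X\<close>.
\<close>

definition hom_module :: "('k, 'b) module \<Rightarrow> ('k, 'c, 'b, 'n) bimodule \<Rightarrow> ('k, 'b, 'x) rmodule
    \<Rightarrow> ('k, 'c, 'n \<Rightarrow> 'x) rmodule" where
  "hom_module B N X = \<lparr>carrier = rmod_hom B N X, mult = undefined, one = undefined,
     zero = (\<lambda>n\<in>carrier N. \<zero>\<^bsub>X\<^esub>),
     add = (\<lambda>f g. \<lambda>n\<in>carrier N. f n \<oplus>\<^bsub>X\<^esub> g n),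
     smult = (\<lambda>c f. \<lambda>n\<in>carrier N. c \<odot>\<^bsub>X\<^esub> f n),
     ract = (\<lambda>f p. \<lambda>n\<in>carrier N. f (p \<triangleright>\<^bsub>N\<^esub> n))\<rparr>"

section \<open>Spans, quotients and tensor products\<close>

definition kspan :: "('k, 'c) ring_scheme \<Rightarrow> ('k, 'v, 'z) module_scheme \<Rightarrow> 'v set \<Rightarrow> 'v set" where
  "kspan K V S = \<Inter>{W. submodule W K V \<and> S \<subseteq> W}"

definition fin_dim :: "('k, 'c) ring_scheme \<Rightarrow> ('k, 'v, 'z) module_scheme \<Rightarrow> bool" where
  "fin_dim K V \<longleftrightarrow> (\<exists>S. finite S \<and> S \<subseteq> carrier V \<and> kspan K V S = carrier V)"

text \<open>
  \<^const>\<open>FactRing\<close> with its scalar multiplication; used for quotients of algebras by ideals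
  and for quotients of vector spaces by subspaces.
\<close>

definition quotient :: "('k, 'v, 'z) module_scheme \<Rightarrow> 'v set \<Rightarrow> ('k, 'v set) module" where
  "quotient V W = \<lparr>carrier = a_rcosets\<^bsub>V\<^esub> W, mult = rcoset_mult V W, one = W +>\<^bsub>V\<^esub> \<one>\<^bsub>V\<^esub>,
     zero = W, add = set_add V, smult = (\<lambda>c C. \<Union>v\<in>C. W +>\<^bsub>V\<^esub> (c \<odot>\<^bsub>V\<^esub> v))\<rparr>"

definition free_space :: "('k, 'c) ring_scheme \<Rightarrow> 's set \<Rightarrow> ('k, 's \<Rightarrow> 'k) module" where
  "free_space K S = \<lparr>carrier = {f. (\<forall>s\<in>S. f s \<in> carrier K) \<and> (\<forall>s. s \<notin> S \<longrightarrow> f s = \<zero>\<^bsub>K\<^esub>) \<and>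
       finite {s. f s \<noteq> \<zero>\<^bsub>K\<^esub>}},
     mult = undefined, one = undefined, zero = (\<lambda>s. \<zero>\<^bsub>K\<^esub>),
     add = (\<lambda>f g s. f s \<oplus>\<^bsub>K\<^esub> g s), smult = (\<lambda>c f s. c \<otimes>\<^bsub>K\<^esub> f s)\<rparr>"

definition unit_vec :: "('k, 'c) ring_scheme \<Rightarrow> 's \<Rightarrow> 's \<Rightarrow> 'k" where
  "unit_vec K s = (\<lambda>t. if t = s then \<one>\<^bsub>K\<^esub> else \<zero>\<^bsub>K\<^esub>)"

definition tensor_rels :: "('k, 'c) ring_scheme \<Rightarrow> ('k, 'a) module \<Rightarrow> ('k, 'a, 'x) rmodule
    \<Rightarrow> ('k, 'a, 'b, 'n) bimodule \<Rightarrow> ('x \<times> 'n \<Rightarrow> 'k) set" where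
  "tensor_rels K A X N =
    (let F = free_space K (carrier X \<times> carrier N); e = (\<lambda>x n. unit_vec K (x, n)) in
       {e (x \<oplus>\<^bsub>X\<^esub> x') n \<ominus>\<^bsub>F\<^esub> (e x n \<oplus>\<^bsub>F\<^esub> e x' n) | x x' n.
          x \<in> carrier X \<and> x' \<in> carrier X \<and> n \<in> carrier N} \<union>
       {e x (n \<oplus>\<^bsub>N\<^esub> n') \<ominus>\<^bsub>F\<^esub> (e x n \<oplus>\<^bsub>F\<^esub> e x n') | x n n'.
          x \<in> carrier X \<and> n \<in> carrier N \<and> n' \<in> carrier N} \<union>
       {e (c \<odot>\<^bsub>X\<^esub> x) n \<ominus>\<^bsub>F\<^esub> (c \<odot>\<^bsub>F\<^esub> e x n) | c x n.
          c \<in> carrier K \<and> x \<in> carrier X \<and> n \<in> carrier N} \<union>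
       {e x (c \<odot>\<^bsub>N\<^esub> n) \<ominus>\<^bsub>F\<^esub> (c \<odot>\<^bsub>F\<^esub> e x n) | c x n.
          c \<in> carrier K \<and> x \<in> carrier X \<and> n \<in> carrier N} \<union>
       {e (x \<triangleleft>\<^bsub>X\<^esub> a) n \<ominus>\<^bsub>F\<^esub> e x (a \<triangleright>\<^bsub>N\<^esub> n) | x a n.
          x \<in> carrier X \<and> a \<in> carrier A \<and> n \<in> carrier N})"

definition tensor_null :: "('k, 'c) ring_scheme \<Rightarrow> ('k, 'a) module \<Rightarrow> ('k, 'a, 'x) rmodule
    \<Rightarrow> ('k, 'a, 'b, 'n) bimodule \<Rightarrow> ('x \<times> 'n \<Rightarrow> 'k) set" where
  "tensor_null K A X N =
     kspan K (free_space K (carrier X \<times> carrier N)) (tensor_rels K A X N)"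

definition tensor_space :: "('k, 'c) ring_scheme \<Rightarrow> ('k, 'a) module \<Rightarrow> ('k, 'a, 'x) rmodule
    \<Rightarrow> ('k, 'a, 'b, 'n) bimodule \<Rightarrow> ('k, ('x \<times> 'n \<Rightarrow> 'k) set) module" where
  "tensor_space K A X N =
     quotient (free_space K (carrier X \<times> carrier N)) (tensor_null K A X N)"

definition pure_tensor :: "('k, 'c) ring_scheme \<Rightarrow> ('k, 'a) module \<Rightarrow> ('k, 'a, 'x) rmodule
    \<Rightarrow> ('k, 'a, 'b, 'n) bimodule \<Rightarrow> 'x \<Rightarrow> 'n \<Rightarrow> ('x \<times> 'n \<Rightarrow> 'k) set" where
  "pure_tensor K A X N x n =
     tensor_null K A X N +>\<^bsub>free_space K (carrier X \<times> carrier N)\<^esub> unit_vec K (x, n)"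

text \<open>
  The map \<open>f \<otimes> g\<close> between tensor products over \<open>A\<close>; it exists for right linear \<open>f\<close> and left
  linear \<open>g\<close>, and is unique because pure tensors span.
\<close>

definition tensor_map :: "('k, 'c) ring_scheme \<Rightarrow> ('k, 'a) module \<Rightarrow> ('k, 'a, 'x) rmodule
    \<Rightarrow> ('k, 'a, 'b, 'n) bimodule \<Rightarrow> ('k, 'a, 'x') rmodule \<Rightarrow> ('k, 'a, 'b', 'n') bimodule
    \<Rightarrow> ('x \<Rightarrow> 'x') \<Rightarrow> ('n \<Rightarrow> 'n') \<Rightarrow> ('x \<times> 'n \<Rightarrow> 'k) set \<Rightarrow> ('x' \<times> 'n' \<Rightarrow> 'k) set" where
  "tensor_map K A X N X' N' f g =
     (THE h. h \<in> lin_maps K (tensor_space K A X N) (tensor_space K A X' N') \<and>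
        (\<forall>x\<in>carrier X. \<forall>n\<in>carrier N.
           h (pure_tensor K A X N x n) = pure_tensor K A X' N' (f x) (g n)))"

text \<open>\<open>X \<otimes>\<^sub>A N\<close> as a right \<open>B\<close>-module, with \<open>B\<close> acting on \<open>N\<close>.\<close>

definition tensor :: "('k, 'c) ring_scheme \<Rightarrow> ('k, 'a) module \<Rightarrow> ('k, 'a, 'x) rmodule
    \<Rightarrow> ('k, 'a, 'b, 'n) bimodule \<Rightarrow> ('k, 'b, ('x \<times> 'n \<Rightarrow> 'k) set) rmodule" where
  "tensor K A X N = module.extend (tensor_space K A X N)
     (rmodule.fields (\<lambda>t b. tensor_map K A X N X N (\<lambda>x. x) (\<lambda>n. n \<triangleleft>\<^bsub>N\<^esub> b) t))"

section \<open>Tensor algebras\<close>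

text \<open>
  \<open>T\<^sub>A(V) = A \<oplus> V \<oplus> (V \<otimes>\<^sub>A V) \<oplus> \<dots>\<close>.  As the iterated tensor products \<open>V \<otimes>\<^sub>A \<dots> \<otimes>\<^sub>A V\<close> would
  live in different types, all of them are built at once: \<open>Scalar a\<close> stands for \<open>a \<in> A\<close> in degree
  \<open>0\<close> and \<open>Word [v\<^sub>1, \<dots>, v\<^sub>n]\<close> with \<open>n \<ge> 1\<close> for \<open>v\<^sub>1 \<otimes> \<dots> \<otimes> v\<^sub>n\<close>.  The relations are linearity in
  degree \<open>0\<close>, and multilinearity and \<open>A\<close>-balancedness in each degree \<open>n \<ge> 1\<close>; they are
  homogeneous, so the quotient is the direct sum of its degree \<open>n\<close> parts.
\<close>

datatype ('a, 'v) tword = Scalar 'a | Word "'v list"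

definition twords :: "('k, 'a) module \<Rightarrow> ('k, 'a, 'a, 'v) bimodule \<Rightarrow> ('a, 'v) tword set" where
  "twords A V = Scalar ` carrier A \<union> Word ` {vs. vs \<noteq> [] \<and> set vs \<subseteq> carrier V}"

fun tword_mult :: "('k, 'a) module \<Rightarrow> ('k, 'a, 'a, 'v) bimodule
    \<Rightarrow> ('a, 'v) tword \<Rightarrow> ('a, 'v) tword \<Rightarrow> ('a, 'v) tword" where
  "tword_mult A V (Scalar a) (Scalar b) = Scalar (a \<otimes>\<^bsub>A\<^esub> b)"
| "tword_mult A V (Scalar a) (Word vs) = Word ((a \<triangleright>\<^bsub>V\<^esub> hd vs) # tl vs)"
| "tword_mult A V (Word us) (Scalar b) = Word (butlast us @ [last us \<triangleleft>\<^bsub>V\<^esub> b])"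
| "tword_mult A V (Word us) (Word vs) = Word (us @ vs)"

text \<open>
  The bilinear extension of \<^const>\<open>tword_mult\<close> is associative only modulo the relations.
\<close>

definition tword_algebra :: "('k, 'c) ring_scheme \<Rightarrow> ('k, 'a) module \<Rightarrow> ('k, 'a, 'a, 'v) bimodule
    \<Rightarrow> ('k, ('a, 'v) tword \<Rightarrow> 'k) module" where
  "tword_algebra K A V = (free_space K (twords A V))
     \<lparr>mult := (\<lambda>f g w. \<Oplus>\<^bsub>K\<^esub>p \<in> {(u, v). f u \<noteq> \<zero>\<^bsub>K\<^esub> \<and> g v \<noteq> \<zero>\<^bsub>K\<^esub> \<and> tword_mult A V u v = w}.
        f (fst p) \<otimes>\<^bsub>K\<^esub> g (snd p)),
      one := unit_vec K (Scalar \<one>\<^bsub>A\<^esub>)\<rparr>"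

definition tword_rels :: "('k, 'c) ring_scheme \<Rightarrow> ('k, 'a) module \<Rightarrow> ('k, 'a, 'a, 'v) bimodule
    \<Rightarrow> (('a, 'v) tword \<Rightarrow> 'k) set" where
  "tword_rels K A V =
    (let F = tword_algebra K A V; s = (\<lambda>a. unit_vec K (Scalar a)); w = (\<lambda>vs. unit_vec K (Word vs)) in
       {s (a \<oplus>\<^bsub>A\<^esub> b) \<ominus>\<^bsub>F\<^esub> (s a \<oplus>\<^bsub>F\<^esub> s b) | a b. a \<in> carrier A \<and> b \<in> carrier A} \<union>
       {s (c \<odot>\<^bsub>A\<^esub> a) \<ominus>\<^bsub>F\<^esub> (c \<odot>\<^bsub>F\<^esub> s a) | c a. c \<in> carrier K \<and> a \<in> carrier A} \<union>
       {w (us @ [v \<oplus>\<^bsub>V\<^esub> v'] @ vs) \<ominus>\<^bsub>F\<^esub> (w (us @ [v] @ vs) \<oplus>\<^bsub>F\<^esub> w (us @ [v'] @ vs)) | us v v' vs.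
          set us \<subseteq> carrier V \<and> v \<in> carrier V \<and> v' \<in> carrier V \<and> set vs \<subseteq> carrier V} \<union>
       {w (us @ [c \<odot>\<^bsub>V\<^esub> v] @ vs) \<ominus>\<^bsub>F\<^esub> (c \<odot>\<^bsub>F\<^esub> w (us @ [v] @ vs)) | us c v vs.
          set us \<subseteq> carrier V \<and> c \<in> carrier K \<and> v \<in> carrier V \<and> set vs \<subseteq> carrier V} \<union>
       {w (us @ [v \<triangleleft>\<^bsub>V\<^esub> a, v'] @ vs) \<ominus>\<^bsub>F\<^esub> w (us @ [v, a \<triangleright>\<^bsub>V\<^esub> v'] @ vs) | us v a v' vs.
          set us \<subseteq> carrier V \<and> v \<in> carrier V \<and> a \<in> carrier A \<and> v' \<in> carrier V \<and>
          set vs \<subseteq> carrier V})"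

definition tword_null :: "('k, 'c) ring_scheme \<Rightarrow> ('k, 'a) module \<Rightarrow> ('k, 'a, 'a, 'v) bimodule
    \<Rightarrow> (('a, 'v) tword \<Rightarrow> 'k) set" where
  "tword_null K A V = kspan K (tword_algebra K A V) (tword_rels K A V)"

definition tensor_algebra :: "('k, 'c) ring_scheme \<Rightarrow> ('k, 'a) module \<Rightarrow> ('k, 'a, 'a, 'v) bimodule
    \<Rightarrow> ('k, (('a, 'v) tword \<Rightarrow> 'k) set) module" where
  "tensor_algebra K A V = quotient (tword_algebra K A V) (tword_null K A V)"

definition tscalar :: "('k, 'c) ring_scheme \<Rightarrow> ('k, 'a) module \<Rightarrow> ('k, 'a, 'a, 'v) bimodule
    \<Rightarrow> 'a \<Rightarrow> (('a, 'v) tword \<Rightarrow> 'k) set" where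
  "tscalar K A V a = tword_null K A V +>\<^bsub>tword_algebra K A V\<^esub> unit_vec K (Scalar a)"

definition tgen :: "('k, 'c) ring_scheme \<Rightarrow> ('k, 'a) module \<Rightarrow> ('k, 'a, 'a, 'v) bimodule
    \<Rightarrow> 'v \<Rightarrow> (('a, 'v) tword \<Rightarrow> 'k) set" where
  "tgen K A V v = tword_null K A V +>\<^bsub>tword_algebra K A V\<^esub> unit_vec K (Word [v])"

section \<open>Classes of algebras\<close>

definition division_algebra :: "('k, 'c) ring_scheme \<Rightarrow> ('k, 'd) module \<Rightarrow> bool" where
  "division_algebra K D \<longleftrightarrow> assoc_algebra K D \<and> Units D = carrier D - {\<zero>\<^bsub>D\<^esub>}"

definition product_algebra :: "'i set \<Rightarrow> ('i \<Rightarrow> ('k, 'd) module) \<Rightarrow> ('k, 'i \<Rightarrow> 'd) module" where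
  "product_algebra I D = \<lparr>carrier = (\<Pi>\<^sub>E i\<in>I. carrier (D i)),
     mult = (\<lambda>f g. \<lambda>i\<in>I. f i \<otimes>\<^bsub>D i\<^esub> g i), one = (\<lambda>i\<in>I. \<one>\<^bsub>D i\<^esub>),
     zero = (\<lambda>i\<in>I. \<zero>\<^bsub>D i\<^esub>), add = (\<lambda>f g. \<lambda>i\<in>I. f i \<oplus>\<^bsub>D i\<^esub> g i),
     smult = (\<lambda>c f. \<lambda>i\<in>I. c \<odot>\<^bsub>D i\<^esub> f i)\<rparr>"

text \<open>
  The factors are taken with carriers in the type of \<open>A\<close>, which is no restriction since each
  factor of a product embeds into it.
\<close>

definition product_of_division_algebras :: "('k, 'c) ring_scheme \<Rightarrow> ('k, 'a) module \<Rightarrow> bool" where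
  "product_of_division_algebras K A \<longleftrightarrow> assoc_algebra K A \<and>
     (\<exists>(n::nat) (D :: nat \<Rightarrow> ('k, 'a) module).
        (\<forall>i<n. division_algebra K (D i) \<and> fin_dim K (D i)) \<and>
        (\<exists>\<phi> \<in> ring_iso A (product_algebra {..<n} D).
           \<forall>c\<in>carrier K. \<forall>a\<in>carrier A. \<phi> (c \<odot>\<^bsub>A\<^esub> a) = c \<odot>\<^bsub>product_algebra {..<n} D\<^esub> \<phi> a))"

definition symmetrising :: "('k, 'c) ring_scheme \<Rightarrow> ('k, 'a) module \<Rightarrow> ('a \<Rightarrow> 'k) \<Rightarrow> bool" where
  "symmetrising K A \<sigma> \<longleftrightarrow> \<sigma> \<in> linear_forms K A \<and>
     (\<forall>a\<in>carrier A. \<forall>b\<in>carrier A. \<sigma> (a \<otimes>\<^bsub>A\<^esub> b) = \<sigma> (b \<otimes>\<^bsub>A\<^esub> a)) \<and>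
     (\<forall>a\<in>carrier A. (\<forall>b\<in>carrier A. \<sigma> (a \<otimes>\<^bsub>A\<^esub> b) = \<zero>\<^bsub>K\<^esub>) \<longrightarrow> a = \<zero>\<^bsub>A\<^esub>)"

definition right_submodule :: "('k, 'c) ring_scheme \<Rightarrow> ('k, 'b) module
    \<Rightarrow> ('k, 'b, 'x, 'z) rmodule_scheme \<Rightarrow> 'x set \<Rightarrow> bool" where
  "right_submodule K B X U \<longleftrightarrow> submodule U K X \<and> (\<forall>u\<in>U. \<forall>b\<in>carrier B. u \<triangleleft>\<^bsub>X\<^esub> b \<in> U)"

definition indecomposable :: "('k, 'c) ring_scheme \<Rightarrow> ('k, 'b) module
    \<Rightarrow> ('k, 'b, 'x, 'z) rmodule_scheme \<Rightarrow> bool" where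
  "indecomposable K B X \<longleftrightarrow> carrier X \<noteq> {\<zero>\<^bsub>X\<^esub>} \<and>
     (\<forall>U W. right_submodule K B X U \<and> right_submodule K B X W \<and>
        U \<inter> W = {\<zero>\<^bsub>X\<^esub>} \<and> U <+>\<^bsub>X\<^esub> W = carrier X \<longrightarrow> U = {\<zero>\<^bsub>X\<^esub>} \<or> W = {\<zero>\<^bsub>X\<^esub>})"

text \<open>
  Every finite dimensional module is isomorphic to one with underlying space \<open>K\<^sup>n\<close>, hence to one
  with carrier in \<open>nat \<Rightarrow> 'k\<close>.
\<close>

definition representation_finite :: "('k, 'c) ring_scheme \<Rightarrow> ('k, 'b) module \<Rightarrow> bool" where
  "representation_finite K B \<longleftrightarrow>
     (\<exists>\<F> :: ('k, 'b, nat \<Rightarrow> 'k) rmodule set. finite \<F> \<and>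
        (\<forall>X :: ('k, 'b, nat \<Rightarrow> 'k) rmodule.
           right_module K B X \<and> fin_dim K X \<and> indecomposable K B X \<longrightarrow>
           (\<exists>Y\<in>\<F>. rmod_iso B X Y \<noteq> {})))"

definition jacobson_radical :: "('k, 'c) ring_scheme \<Rightarrow> ('k, 'b) module \<Rightarrow> 'b set" where
  "jacobson_radical K B = carrier B \<inter>
     \<Inter>{U. right_submodule K B (regular B) U \<and> U \<noteq> carrier B \<and>
          (\<forall>W. right_submodule K B (regular B) W \<and> U \<subseteq> W \<longrightarrow> W = U \<or> W = carrier B)}"

definition basic_algebra :: "('k, 'c) ring_scheme \<Rightarrow> ('k, 'b) module \<Rightarrow> bool" where
  "basic_algebra K B \<longleftrightarrow> product_of_division_algebras K (quotient B (jacobson_radical K B))"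

definition free_rmodule :: "('k, 'b) module \<Rightarrow> 's set \<Rightarrow> ('k, 'b, 's \<Rightarrow> 'b) rmodule" where
  "free_rmodule B S = \<lparr>carrier = {f. (\<forall>s\<in>S. f s \<in> carrier B) \<and> (\<forall>s. s \<notin> S \<longrightarrow> f s = \<zero>\<^bsub>B\<^esub>) \<and>
       finite {s. f s \<noteq> \<zero>\<^bsub>B\<^esub>}},
     mult = undefined, one = undefined, zero = (\<lambda>s. \<zero>\<^bsub>B\<^esub>),
     add = (\<lambda>f g s. f s \<oplus>\<^bsub>B\<^esub> g s), smult = (\<lambda>c f s. c \<odot>\<^bsub>B\<^esub> f s),
     ract = (\<lambda>f b s. f s \<otimes>\<^bsub>B\<^esub> b)\<rparr>"

text \<open>
  Projective: a direct summand of a free module.  Index sets in the type of \<open>P\<close> suffice, since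
  the free module on \<open>carrier P\<close> surjects onto \<open>P\<close>.
\<close>

definition projective_rmodule :: "('k, 'b) module \<Rightarrow> ('k, 'b, 'x, 'z) rmodule_scheme \<Rightarrow> bool" where
  "projective_rmodule B P \<longleftrightarrow>
     (\<exists>S :: 'x set. \<exists>\<iota> \<in> rmod_hom B P (free_rmodule B S). \<exists>\<pi> \<in> rmod_hom B (free_rmodule B S) P.
        \<forall>x\<in>carrier P. \<pi> (\<iota> x) = x)"

definition hereditary_algebra :: "('k, 'c) ring_scheme \<Rightarrow> ('k, 'b) module \<Rightarrow> bool" where
  "hereditary_algebra K B \<longleftrightarrow>
     (\<forall>U. right_submodule K B (regular B) U \<longrightarrow> projective_rmodule B ((regular B)\<lparr>carrier := U\<rparr>))"

section \<open>Preprojective algebras\<close>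

definition right_lift :: "('k, 'a) module \<Rightarrow> ('k, 'a, 'a, 'm) bimodule \<Rightarrow> ('a \<Rightarrow> 'k)
    \<Rightarrow> ('m \<Rightarrow> 'k) \<Rightarrow> 'm \<Rightarrow> 'a" where
  "right_lift A M \<sigma> \<mu> =
     (THE f. f \<in> rmod_hom A M (regular A) \<and> (\<forall>m\<in>carrier M. \<sigma> (f m) = \<mu> m))"

definition left_lift :: "('k, 'a) module \<Rightarrow> ('k, 'a, 'a, 'm) bimodule \<Rightarrow> ('a \<Rightarrow> 'k)
    \<Rightarrow> ('m \<Rightarrow> 'k) \<Rightarrow> 'm \<Rightarrow> 'a" where
  "left_lift A M \<sigma> \<mu> =
     (THE f. f \<in> lmod_hom A M (regular A) \<and> (\<forall>m\<in>carrier M. \<sigma> (f m) = \<mu> m))"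

text \<open>
  The elements \<open>\<rho> = \<Sum> m\<^sub>i \<otimes> \<mu>\<^sub>i\<close> and \<open>\<ell> = \<Sum> \<nu>\<^sub>j \<otimes> n\<^sub>j\<close> are given by the lists
  \<open>rs\<close> of the pairs \<open>(m\<^sub>i, \<mu>\<^sub>i)\<close> and \<open>ls\<close> of the pairs \<open>(\<nu>\<^sub>j, n\<^sub>j)\<close>.
\<close>

definition dual_bases :: "('k, 'c) ring_scheme \<Rightarrow> ('k, 'a) module \<Rightarrow> ('k, 'a, 'a, 'm) bimodule
    \<Rightarrow> ('a \<Rightarrow> 'k) \<Rightarrow> ('m \<times> ('m \<Rightarrow> 'k)) list \<Rightarrow> (('m \<Rightarrow> 'k) \<times> 'm) list \<Rightarrow> bool" where
  "dual_bases K A M \<sigma> rs ls \<longleftrightarrow>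
     set rs \<subseteq> carrier M \<times> carrier (dual K M) \<and> set ls \<subseteq> carrier (dual K M) \<times> carrier M \<and>
     (\<forall>m\<in>carrier M.
        m = lsum M (map (\<lambda>(m', \<mu>). m' \<triangleleft>\<^bsub>M\<^esub> right_lift A M \<sigma> \<mu> m) rs) \<and>
        m = lsum M (map (\<lambda>(\<nu>, n). left_lift A M \<sigma> \<nu> m \<triangleright>\<^bsub>M\<^esub> n) ls))"

definition double_bimodule :: "('k, 'c) ring_scheme \<Rightarrow> ('k, 'a, 'a, 'm) bimodule
    \<Rightarrow> ('k, 'a, 'a, 'm \<times> ('m \<Rightarrow> 'k)) bimodule" where
  "double_bimodule K M = bimodule_sum M (dual K M)"

definition inj_M :: "('k, 'c) ring_scheme \<Rightarrow> ('k, 'a, 'a, 'm) bimodule \<Rightarrow> 'm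
    \<Rightarrow> 'm \<times> ('m \<Rightarrow> 'k)" where
  "inj_M K M m = (m, \<zero>\<^bsub>dual K M\<^esub>)"

definition inj_D :: "('k, 'a, 'a, 'm) bimodule \<Rightarrow> ('m \<Rightarrow> 'k) \<Rightarrow> 'm \<times> ('m \<Rightarrow> 'k)" where
  "inj_D M \<mu> = (\<zero>\<^bsub>M\<^esub>, \<mu>)"

definition double_tensor_algebra :: "('k, 'c) ring_scheme \<Rightarrow> ('k, 'a) module
    \<Rightarrow> ('k, 'a, 'a, 'm) bimodule
    \<Rightarrow> ('k, (('a, 'm \<times> ('m \<Rightarrow> 'k)) tword \<Rightarrow> 'k) set) module" where
  "double_tensor_algebra K A M = tensor_algebra K A (double_bimodule K M)"

definition rho_minus_ell :: "('k, 'c) ring_scheme \<Rightarrow> ('k, 'a) module \<Rightarrow> ('k, 'a, 'a, 'm) bimodule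
    \<Rightarrow> ('m \<times> ('m \<Rightarrow> 'k)) list \<Rightarrow> (('m \<Rightarrow> 'k) \<times> 'm) list
    \<Rightarrow> (('a, 'm \<times> ('m \<Rightarrow> 'k)) tword \<Rightarrow> 'k) set" where
  "rho_minus_ell K A M rs ls =
    (let T = double_tensor_algebra K A M; g = tgen K A (double_bimodule K M) in
       lsum T (map (\<lambda>(m, \<mu>). g (inj_M K M m) \<otimes>\<^bsub>T\<^esub> g (inj_D M \<mu>)) rs) \<ominus>\<^bsub>T\<^esub>
       lsum T (map (\<lambda>(\<nu>, n). g (inj_D M \<nu>) \<otimes>\<^bsub>T\<^esub> g (inj_M K M n)) ls))"

definition prep_ideal :: "('k, 'c) ring_scheme \<Rightarrow> ('k, 'a) module \<Rightarrow> ('k, 'a, 'a, 'm) bimodule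
    \<Rightarrow> ('m \<times> ('m \<Rightarrow> 'k)) list \<Rightarrow> (('m \<Rightarrow> 'k) \<times> 'm) list
    \<Rightarrow> (('a, 'm \<times> ('m \<Rightarrow> 'k)) tword \<Rightarrow> 'k) set set" where
  "prep_ideal K A M rs ls = Idl\<^bsub>double_tensor_algebra K A M\<^esub> {rho_minus_ell K A M rs ls}"

type_synonym ('k, 'a, 'm) prep_elt = "(('a, 'm \<times> ('m \<Rightarrow> 'k)) tword \<Rightarrow> 'k) set set"

definition preprojective :: "('k, 'c) ring_scheme \<Rightarrow> ('k, 'a) module \<Rightarrow> ('k, 'a, 'a, 'm) bimodule
    \<Rightarrow> ('m \<times> ('m \<Rightarrow> 'k)) list \<Rightarrow> (('m \<Rightarrow> 'k) \<times> 'm) list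
    \<Rightarrow> ('k, ('k, 'a, 'm) prep_elt) module" where
  "preprojective K A M rs ls = quotient (double_tensor_algebra K A M) (prep_ideal K A M rs ls)"

text \<open>The canonical maps from \<open>A\<close> and from \<open>M \<oplus> DM\<close> to the preprojective algebra.\<close>

definition prep_scalar :: "('k, 'c) ring_scheme \<Rightarrow> ('k, 'a) module \<Rightarrow> ('k, 'a, 'a, 'm) bimodule
    \<Rightarrow> ('m \<times> ('m \<Rightarrow> 'k)) list \<Rightarrow> (('m \<Rightarrow> 'k) \<times> 'm) list
    \<Rightarrow> 'a \<Rightarrow> ('k, 'a, 'm) prep_elt" where
  "prep_scalar K A M rs ls a =
     prep_ideal K A M rs ls +>\<^bsub>double_tensor_algebra K A M\<^esub> tscalar K A (double_bimodule K M) a"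

definition prep_gen :: "('k, 'c) ring_scheme \<Rightarrow> ('k, 'a) module \<Rightarrow> ('k, 'a, 'a, 'm) bimodule
    \<Rightarrow> ('m \<times> ('m \<Rightarrow> 'k)) list \<Rightarrow> (('m \<Rightarrow> 'k) \<times> 'm) list
    \<Rightarrow> 'm \<times> ('m \<Rightarrow> 'k) \<Rightarrow> ('k, 'a, 'm) prep_elt" where
  "prep_gen K A M rs ls v =
     prep_ideal K A M rs ls +>\<^bsub>double_tensor_algebra K A M\<^esub> tgen K A (double_bimodule K M) v"

section \<open>The standard presentation and the two functors\<close>

text \<open>\<open>\<Pi>\<close> as an \<open>A\<close>-\<open>\<Pi>\<close>-bimodule, and a right \<open>\<Pi>\<close>-module as a right \<open>A\<close>-module.\<close>

definition prep_bimodule :: "('k, 'c) ring_scheme \<Rightarrow> ('k, 'a) module \<Rightarrow> ('k, 'a, 'a, 'm) bimodule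
    \<Rightarrow> ('m \<times> ('m \<Rightarrow> 'k)) list \<Rightarrow> (('m \<Rightarrow> 'k) \<times> 'm) list
    \<Rightarrow> ('k, 'a, ('k, 'a, 'm) prep_elt, ('k, 'a, 'm) prep_elt) bimodule" where
  "prep_bimodule K A M rs ls =
     restrict_left (prep_scalar K A M rs ls) (regular (preprojective K A M rs ls))"

definition restrict_to_A :: "('k, 'c) ring_scheme \<Rightarrow> ('k, 'a) module \<Rightarrow> ('k, 'a, 'a, 'm) bimodule
    \<Rightarrow> ('m \<times> ('m \<Rightarrow> 'k)) list \<Rightarrow> (('m \<Rightarrow> 'k) \<times> 'm) list
    \<Rightarrow> ('k, ('k, 'a, 'm) prep_elt, 'x) rmodule \<Rightarrow> ('k, 'a, 'x) rmodule" where
  "restrict_to_A K A M rs ls X = restrict_right (prep_scalar K A M rs ls) X"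

text \<open>The terms \<open>X \<otimes>\<^sub>A \<Pi>\<close> and \<open>X \<otimes>\<^sub>A (M \<oplus> DM) \<otimes>\<^sub>A \<Pi>\<close>.\<close>

definition pres_src where
  "pres_src K A M rs ls X =
     tensor K A (restrict_to_A K A M rs ls X) (prep_bimodule K A M rs ls)"

definition pres_tgt where
  "pres_tgt K A M rs ls X =
     tensor K A (tensor K A (restrict_to_A K A M rs ls X) (double_bimodule K M)) (prep_bimodule K A M rs ls)"

text \<open>
  The right \<open>\<Pi>\<close>-linear map \<open>X \<otimes>\<^sub>A \<Pi> \<rightarrow> X \<otimes>\<^sub>A (M \<oplus> DM) \<otimes>\<^sub>A \<Pi>\<close>, determined by its values on the
  elements \<open>x \<otimes> 1\<close>.  Below \<open>t x v p\<close> is \<open>x \<otimes> v \<otimes> p\<close>.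
\<close>

definition pres_map :: "('k, 'c) ring_scheme \<Rightarrow> ('k, 'a) module \<Rightarrow> ('k, 'a, 'a, 'm) bimodule
    \<Rightarrow> ('m \<times> ('m \<Rightarrow> 'k)) list \<Rightarrow> (('m \<Rightarrow> 'k) \<times> 'm) list
    \<Rightarrow> ('k, ('k, 'a, 'm) prep_elt, 'x) rmodule
    \<Rightarrow> ('x \<times> ('k, 'a, 'm) prep_elt \<Rightarrow> 'k) set
    \<Rightarrow> (('x \<times> 'm \<times> ('m \<Rightarrow> 'k) \<Rightarrow> 'k) set \<times> ('k, 'a, 'm) prep_elt \<Rightarrow> 'k) set" where
  "pres_map K A M rs ls X =
    (let P = preprojective K A M rs ls; PB = prep_bimodule K A M rs ls;
         XA = restrict_to_A K A M rs ls X; V = double_bimodule K M;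
         g = prep_gen K A M rs ls; S = pres_src K A M rs ls X; Y = pres_tgt K A M rs ls X;
         t = (\<lambda>x v p. pure_tensor K A (tensor K A XA V) PB (pure_tensor K A XA V x v) p);
         i = inj_M K M; j = inj_D M
     in THE d. d \<in> rmod_hom P S Y \<and>
       (\<forall>x\<in>carrier X. d (pure_tensor K A XA PB x \<one>\<^bsub>P\<^esub>) =
          lsum Y (map (\<lambda>(m, \<mu>). t (x \<triangleleft>\<^bsub>X\<^esub> g (i m)) (j \<mu>) \<one>\<^bsub>P\<^esub> \<oplus>\<^bsub>Y\<^esub> t x (i m) (g (j \<mu>))) rs) \<ominus>\<^bsub>Y\<^esub>
          lsum Y (map (\<lambda>(\<nu>, n). t (x \<triangleleft>\<^bsub>X\<^esub> g (j \<nu>)) (i n) \<one>\<^bsub>P\<^esub> \<oplus>\<^bsub>Y\<^esub> t x (j \<nu>) (g (i n))) ls)))"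

definition third_syzygy :: "('k, 'c) ring_scheme \<Rightarrow> ('k, 'a) module \<Rightarrow> ('k, 'a, 'a, 'm) bimodule
    \<Rightarrow> ('m \<times> ('m \<Rightarrow> 'k)) list \<Rightarrow> (('m \<Rightarrow> 'k) \<times> 'm) list
    \<Rightarrow> ('k, ('k, 'a, 'm) prep_elt, 'x) rmodule
    \<Rightarrow> ('k, ('k, 'a, 'm) prep_elt, ('x \<times> ('k, 'a, 'm) prep_elt \<Rightarrow> 'k) set) rmodule" where
  "third_syzygy K A M rs ls X = (pres_src K A M rs ls X)
     \<lparr>carrier := {t \<in> carrier (pres_src K A M rs ls X).
        pres_map K A M rs ls X t = \<zero>\<^bsub>pres_tgt K A M rs ls X\<^esub>}\<rparr>"

text \<open>The restriction of \<open>f \<otimes> \<Pi>\<close> to the kernels.\<close>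

definition third_syzygy_map where
  "third_syzygy_map K A M rs ls X Y f =
     restrict (tensor_map K A (restrict_to_A K A M rs ls X) (prep_bimodule K A M rs ls)
         (restrict_to_A K A M rs ls Y) (prep_bimodule K A M rs ls) f (\<lambda>p. p))
       (carrier (third_syzygy K A M rs ls X))"

definition inverse_nakayama :: "('k, 'c) ring_scheme \<Rightarrow> ('k, 'p) module \<Rightarrow> ('k, 'p, 'x) rmodule
    \<Rightarrow> ('k, 'p, ('p \<Rightarrow> 'k) \<Rightarrow> 'x) rmodule" where
  "inverse_nakayama K P X = hom_module P (dual K (regular P)) X"

definition inverse_nakayama_map :: "('k, 'c) ring_scheme \<Rightarrow> ('k, 'p) module
    \<Rightarrow> ('k, 'p, 'x) rmodule \<Rightarrow> ('k, 'p, 'x) rmodule \<Rightarrow> ('x \<Rightarrow> 'x)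
    \<Rightarrow> (('p \<Rightarrow> 'k) \<Rightarrow> 'x) \<Rightarrow> ('p \<Rightarrow> 'k) \<Rightarrow> 'x" where
  "inverse_nakayama_map K P X Y f =
     (\<lambda>h\<in>carrier (inverse_nakayama K P X). compose (carrier (dual K (regular P))) f h)"

text \<open>
  Natural isomorphism of two functors, given by their object parts \<open>F\<close>, \<open>G\<close> and morphism parts
  \<open>F\<^sub>m\<close>, \<open>G\<^sub>m\<close>, on the category of all right \<open>B\<close>-modules with carrier in the type \<open>'x\<close>.
\<close>

definition naturally_isomorphic :: "('k, 'c) ring_scheme \<Rightarrow> ('k, 'b) module
    \<Rightarrow> (('k, 'b, 'x) rmodule \<Rightarrow> ('k, 'b, 'y) rmodule)
    \<Rightarrow> (('k, 'b, 'x) rmodule \<Rightarrow> ('k, 'b, 'x) rmodule \<Rightarrow> ('x \<Rightarrow> 'x) \<Rightarrow> 'y \<Rightarrow> 'y)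
    \<Rightarrow> (('k, 'b, 'x) rmodule \<Rightarrow> ('k, 'b, 'z) rmodule)
    \<Rightarrow> (('k, 'b, 'x) rmodule \<Rightarrow> ('k, 'b, 'x) rmodule \<Rightarrow> ('x \<Rightarrow> 'x) \<Rightarrow> 'z \<Rightarrow> 'z) \<Rightarrow> bool" where
  "naturally_isomorphic K B F F\<^sub>m G G\<^sub>m \<longleftrightarrow>
     (\<exists>\<eta> :: ('k, 'b, 'x) rmodule \<Rightarrow> 'y \<Rightarrow> 'z.
        (\<forall>X. right_module K B X \<longrightarrow> \<eta> X \<in> rmod_iso B (F X) (G X)) \<and>
        (\<forall>X Y f. right_module K B X \<and> right_module K B Y \<and> f \<in> rmod_hom B X Y \<longrightarrow>
           (\<forall>t\<in>carrier (F X). \<eta> Y (F\<^sub>m X Y f t) = G\<^sub>m X Y f (\<eta> X t))))"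

end

theory Submission
  imports Defs
begin

text \<open>
 The proof has two parts: the finite dimension of \<open>\<Pi>\<close>, and the identification of the third syzygy
 for a finite dimensional \<open>\<Pi>\<close>.  Representation-finiteness of \<open>\<Lambda>\<close> enters in the first part.

 As a right \<open>\<Lambda>\<close>-module \<open>\<Pi>\<close> is the sum of its parts \<open>G n\<close> of degree \<open>n\<close> in \<open>DM\<close>, and \<open>G n\<close> is
 \<open>\<tau>\<^sup>-\<^sup>n \<Lambda>\<close>.  There are no nonzero maps from \<open>G m\<close> to \<open>G n\<close> for \<open>m > n\<close> (\<open>G_hom_zero\<close>).  This goes by
 induction on \<open>n\<close>, in two steps that together are the Auslander-Reiten formula: if there are no
 nonzero maps from \<open>X\<close> to \<open>G n\<close>, then every extension of \<open>G (n + 1)\<close> by \<open>X\<close> splits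
 (\<open>hom_zero_imp_surjective\<close>, \<open>derivation_inner_Suc\<close>), and if every extension of \<open>Z\<close> by \<open>G n\<close>
 splits, then there are no nonzero maps from \<open>G (n + 1)\<close> to \<open>Z\<close> (\<open>inner_imp_hom_zero\<close>).  If all
 \<open>G n\<close> were nonzero, then, as there are finitely many indecomposables, two of them would have a
 common direct summand, and this gives a nonzero map between them in the forbidden direction.
 So \<open>G n = 0\<close> for large \<open>n\<close>, and as each \<open>G n\<close> is finite dimensional, so is \<open>\<Pi>\<close>.

 Now let \<open>\<Pi>\<close> be finite dimensional.  For \<open>\<phi> \<in> D\<Pi>\<close> let \<open>al \<phi> : \<Pi> \<rightarrow> A\<close> be the left \<open>A\<close>-linear map with
 \<open>\<sigma> \<circ> al \<phi> = \<phi>\<close>, and \<open>ev \<phi> : X \<otimes>\<^sub>A \<Pi> \<rightarrow> X\<close> the map \<open>x \<otimes> p \<mapsto> x (al \<phi> p)\<close>.  As \<open>\<Pi>\<close> has a dual basis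
 over the semisimple algebra \<open>A\<close>, an element \<open>t\<close> of \<open>X \<otimes>\<^sub>A \<Pi>\<close> is the same thing as the \<open>A\<close>-linear
 map \<open>\<phi> \<mapsto> ev \<phi> t\<close> from \<open>D\<Pi>\<close> to \<open>X\<close>.  In the same way the elements of \<open>X \<otimes>\<^sub>A (M \<oplus> DM) \<otimes>\<^sub>A \<Pi>\<close> are
 determined by double contractions with forms on \<open>\<Pi>\<close> and elements of \<open>M\<close> and \<open>DM\<close>.  The
 double contraction of the image of \<open>t\<close> under the left hand map is, up to sign, the difference
 \<open>ev \<phi> t \<cdot> \<gamma> - ev (\<phi> \<gamma>) t\<close> for \<open>\<gamma>\<close> in \<open>M\<close> or \<open>DM\<close> (\<open>cc_dterm\<close>, \<open>pres_map\<close>).  So \<open>t\<close> is in the kernel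
 if and only if \<open>\<phi> \<mapsto> ev \<phi> t\<close> is \<open>\<Pi>\<close>-linear (\<open>kernel_iff\<close>), and \<open>t \<mapsto> (\<phi> \<mapsto> ev \<phi> t)\<close> is an isomorphism of
 the kernel with \<open>Hom\<^sub>\<Pi>(D\<Pi>, X)\<close>, which is visibly natural in \<open>X\<close>.
\<close>

section \<open>Vector spaces\<close>

text \<open>
 The underlying set, and subscripted forms of the operations, of an algebra, space or module.
\<close>

abbreviation (input) carrier_bars ("|_|") where "|V| \<equiv> carrier V"
abbreviation (input) add_in ("_ \<oplus>\<^sub>_ _" [65, 1000, 66] 65) where "x \<oplus>\<^sub>X y \<equiv> add X x y"
abbreviation (input) minus_in ("_ \<ominus>\<^sub>_ _" [65, 1000, 66] 65) where "x \<ominus>\<^sub>X y \<equiv> a_minus X x y"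
abbreviation (input) uminus_in ("\<ominus>\<^sub>_ _" [1000, 81] 80) where "\<ominus>\<^sub>X x \<equiv> a_inv X x"
abbreviation (input) mult_in ("_ \<otimes>\<^sub>_ _" [70, 1000, 71] 70) where "x \<otimes>\<^sub>X y \<equiv> mult X x y"
abbreviation (input) smult_in ("_ \<odot>\<^sub>_ _" [70, 1000, 71] 70) where "c \<odot>\<^sub>X y \<equiv> smult X c y"
abbreviation (input) zero_in ("\<zero>\<^sub>_" [1000] 1000) where "\<zero>\<^sub>X \<equiv> zero X"
abbreviation (input) one_in ("\<one>\<^sub>_" [1000] 1000) where "\<one>\<^sub>X \<equiv> one X"
abbreviation (input) ract_in ("_ \<lhd>\<^sub>_ _" [70, 1000, 71] 70) where "x \<lhd>\<^sub>X b \<equiv> ract X x b"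
abbreviation (input) ract_in' ("_ \<lhd>\<^bsub>_\<^esub> _" [70, 0, 71] 70) where "x \<lhd>\<^bsub>X\<^esub> b \<equiv> ract X x b"
abbreviation (input) lact_in' ("_ \<rhd>\<^bsub>_\<^esub> _" [71, 0, 70] 70) where "a \<rhd>\<^bsub>X\<^esub> x \<equiv> lact X a x"
abbreviation (input) lact_in ("_ \<rhd>\<^sub>_ _" [71, 1000, 70] 70) where "a \<rhd>\<^sub>X x \<equiv> lact X a x"

locale kfield =
 fixes K :: "('k, 'c) ring_scheme" (structure)
 assumes field_K: "field K"

sublocale kfield \<subseteq> K?: field K
 by (rule field_K)

context kfield
begin

abbreviation vspace :: "('k, 'v, 'z) module_scheme \<Rightarrow> bool" where
 "vspace V \<equiv> module K V"

abbreviation sub :: "'v set \<Rightarrow> ('k, 'v, 'z) module_scheme \<Rightarrow> bool" where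
 "sub W V \<equiv> submodule W K V"

lemma vs_abelian_group: "vspace V ==> abelian_group V"
 by (simp add: module_def)

context
 fixes V :: "('k, 'v, 'z) module_scheme"
 assumes V: "module K V"
begin

interpretation V: module K V by (rule V)

lemma vs_simps [simp]:
 "x \<in> |V| ==> y \<in> |V| ==> x \<oplus>\<^sub>V y \<in> |V|"
 "\<zero>\<^sub>V \<in> |V|"
 "c \<in> |K| ==> x \<in> |V| ==> c \<odot>\<^sub>V x \<in> |V|"
 "x \<in> |V| ==> \<ominus>\<^sub>V x \<in> |V|"
 "x \<in> |V| ==> y \<in> |V| ==> x \<ominus>\<^sub>V y \<in> |V|"
 "x \<in> |V| ==> x \<oplus>\<^sub>V \<zero>\<^sub>V = x"
 "x \<in> |V| ==> \<zero>\<^sub>V \<oplus>\<^sub>V x = x"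
 "x \<in> |V| ==> x \<ominus>\<^sub>V \<zero>\<^sub>V = x"
 "x \<in> |V| ==> x \<ominus>\<^sub>V x = \<zero>\<^sub>V"
 "x \<in> |V| ==> \<one> \<odot>\<^sub>V x = x"
 "x \<in> |V| ==> \<zero> \<odot>\<^sub>V x = \<zero>\<^sub>V"
 "c \<in> |K| ==> c \<odot>\<^sub>V \<zero>\<^sub>V = \<zero>\<^sub>V"
 by (auto simp: a_minus_def V.M.r_neg)

lemma vs_ac:
 assumes "x \<in> |V|" "y \<in> |V|"
 shows "x \<oplus>\<^sub>V y = y \<oplus>\<^sub>V x"
  and "z \<in> |V| ==> (x \<oplus>\<^sub>V y) \<oplus>\<^sub>V z = x \<oplus>\<^sub>V (y \<oplus>\<^sub>V z)"
  and "z \<in> |V| ==> x \<oplus>\<^sub>V (y \<oplus>\<^sub>V z) = y \<oplus>\<^sub>V (x \<oplus>\<^sub>V z)"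
 using assms by (auto simp: V.M.a_ac)

lemma vs_smult:
 assumes "c \<in> |K|" "x \<in> |V|"
 shows "y \<in> |V| ==> c \<odot>\<^sub>V (x \<oplus>\<^sub>V y) = c \<odot>\<^sub>V x \<oplus>\<^sub>V c \<odot>\<^sub>V y"
  and "d \<in> |K| ==> (c \<oplus> d) \<odot>\<^sub>V x = c \<odot>\<^sub>V x \<oplus>\<^sub>V d \<odot>\<^sub>V x"
  and "d \<in> |K| ==> (c \<otimes> d) \<odot>\<^sub>V x = c \<odot>\<^sub>V (d \<odot>\<^sub>V x)"
  and "(\<ominus> c) \<odot>\<^sub>V x = \<ominus>\<^sub>V (c \<odot>\<^sub>V x)"
  and "c \<odot>\<^sub>V (\<ominus>\<^sub>V x) = \<ominus>\<^sub>V (c \<odot>\<^sub>V x)"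
 using assms by (auto simp: V.smult_r_distr V.smult_l_distr V.smult_assoc1 V.smult_l_minus V.smult_r_minus)

lemma vs_minus_iff:
 assumes "x \<in> |V|" "y \<in> |V|" "z \<in> |V|"
 shows "x \<ominus>\<^sub>V y = z \<longleftrightarrow> x = z \<oplus>\<^sub>V y"
 using assms unfolding a_minus_def
 by (metis V.M.a_assoc V.M.a_inv_closed V.M.l_neg V.M.r_neg V.M.r_zero)

lemma vs_add_cancel:
 assumes "x \<in> |V|" "y \<in> |V|" "z \<in> |V|"
 shows "x \<oplus>\<^sub>V z = y \<oplus>\<^sub>V z \<longleftrightarrow> x = y" and "z \<oplus>\<^sub>V x = z \<oplus>\<^sub>V y \<longleftrightarrow> x = y"
 using assms by auto

lemma vs_inv_smult: "x \<in> |V| ==> \<ominus>\<^sub>V x = (\<ominus> \<one>) \<odot>\<^sub>V x"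
 by (simp add: vs_smult)

lemma subI:
 assumes "W \<subseteq> |V|" "\<zero>\<^sub>V \<in> W"
  and "\<And>x y. x \<in> W ==> y \<in> W ==> x \<oplus>\<^sub>V y \<in> W"
  and "\<And>c x. c \<in> |K| ==> x \<in> W ==> c \<odot>\<^sub>V x \<in> W"
 shows "sub W V"
proof (rule V.submoduleI)
 fix a assume "a \<in> W"
 then show "\<ominus>\<^sub>V a \<in> W" using assms(1,4) by (auto simp: vs_inv_smult)
qed (use assms in auto)

end

lemma vs_minus_zero_iff:
 "vspace V ==> x \<in> |V| ==> y \<in> |V| ==> x \<ominus>\<^sub>V y = \<zero>\<^sub>V \<longleftrightarrow> x = y"
 by (simp add: vs_minus_iff)

lemma vs_minus_add_cancel:
 assumes "vspace V" "x \<in> |V|" "y \<in> |V|"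
 shows "(x \<ominus>\<^sub>V y) \<oplus>\<^sub>V y = x" and "y \<oplus>\<^sub>V (x \<ominus>\<^sub>V y) = x"
proof -
 show *: "(x \<ominus>\<^sub>V y) \<oplus>\<^sub>V y = x" using vs_minus_iff[OF assms, of "x \<ominus>\<^sub>V y"] assms by simp
 show "y \<oplus>\<^sub>V (x \<ominus>\<^sub>V y) = x" using * assms by (simp add: vs_ac(1))
qed

lemma vs_minus_add_distrib:
 assumes "vspace V" "x \<in> |V|" "y \<in> |V|" "x' \<in> |V|" "y' \<in> |V|"
 shows "(x \<oplus>\<^sub>V x') \<ominus>\<^sub>V (y \<oplus>\<^sub>V y') = (x \<ominus>\<^sub>V y) \<oplus>\<^sub>V (x' \<ominus>\<^sub>V y')"
proof -
 have "(x \<oplus>\<^sub>V x') = (x \<ominus>\<^sub>V y) \<oplus>\<^sub>V (x' \<ominus>\<^sub>V y') \<oplus>\<^sub>V (y \<oplus>\<^sub>V y')"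
 proof -
  have "(x \<ominus>\<^sub>V y) \<oplus>\<^sub>V (x' \<ominus>\<^sub>V y') \<oplus>\<^sub>V (y \<oplus>\<^sub>V y')
   = ((x \<ominus>\<^sub>V y) \<oplus>\<^sub>V y) \<oplus>\<^sub>V ((x' \<ominus>\<^sub>V y') \<oplus>\<^sub>V y')"
   using assms by (simp add: vs_ac)
  then show ?thesis using assms by (simp only: vs_minus_add_cancel)
 qed
 then show ?thesis using assms by (simp add: vs_minus_iff)
qed

lemma vs_smult_minus:
 assumes "vspace V" "c \<in> |K|" "x \<in> |V|" "y \<in> |V|"
 shows "c \<odot>\<^sub>V (x \<ominus>\<^sub>V y) = c \<odot>\<^sub>V x \<ominus>\<^sub>V c \<odot>\<^sub>V y"
 using assms by (simp add: a_minus_def vs_smult)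

lemma vsI:
 assumes "\<And>x y. x \<in> |V| ==> y \<in> |V| ==> x \<oplus>\<^sub>V y \<in> |V|"
  and "\<zero>\<^sub>V \<in> |V|"
  and "\<And>x y z. x \<in> |V| ==> y \<in> |V| ==> z \<in> |V|
   ==> (x \<oplus>\<^sub>V y) \<oplus>\<^sub>V z = x \<oplus>\<^sub>V (y \<oplus>\<^sub>V z)"
  and "\<And>x y. x \<in> |V| ==> y \<in> |V| ==> x \<oplus>\<^sub>V y = y \<oplus>\<^sub>V x"
  and "\<And>x. x \<in> |V| ==> \<zero>\<^sub>V \<oplus>\<^sub>V x = x"
  and "\<And>c x. c \<in> |K| ==> x \<in> |V| ==> c \<odot>\<^sub>V x \<in> |V|"
  and "\<And>c d x. c \<in> |K| ==> d \<in> |K| ==> x \<in> |V|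
   ==> (c \<oplus> d) \<odot>\<^sub>V x = c \<odot>\<^sub>V x \<oplus>\<^sub>V d \<odot>\<^sub>V x"
  and "\<And>c x y. c \<in> |K| ==> x \<in> |V| ==> y \<in> |V|
   ==> c \<odot>\<^sub>V (x \<oplus>\<^sub>V y) = c \<odot>\<^sub>V x \<oplus>\<^sub>V c \<odot>\<^sub>V y"
  and "\<And>c d x. c \<in> |K| ==> d \<in> |K| ==> x \<in> |V|
   ==> (c \<otimes> d) \<odot>\<^sub>V x = c \<odot>\<^sub>V (d \<odot>\<^sub>V x)"
  and "\<And>x. x \<in> |V| ==> \<one> \<odot>\<^sub>V x = x"
  and "\<And>x. x \<in> |V| ==> \<zero> \<odot>\<^sub>V x = \<zero>\<^sub>V"
 shows "vspace V"
proof (rule moduleI)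
 show "cring K" by (rule K.is_cring)
 show "abelian_group V"
 proof (rule abelian_groupI)
  fix x assume x: "x \<in> |V|"
  have "(\<ominus> \<one>) \<odot>\<^sub>V x \<oplus>\<^sub>V x = (\<ominus> \<one>) \<odot>\<^sub>V x \<oplus>\<^sub>V \<one> \<odot>\<^sub>V x" using assms(10) x by simp
  also have "\<dots> = (\<ominus> \<one> \<oplus> \<one>) \<odot>\<^sub>V x" using assms(7) x by simp
  also have "\<dots> = \<zero>\<^sub>V" using assms(11) x by (simp add: K.l_neg)
  finally show "\<exists>y\<in>|V|. y \<oplus>\<^sub>V x = \<zero>\<^sub>V" using assms(6) x by blast
 qed (use assms in auto)
qed (use assms in auto)

text \<open>
 Every space below is the image of a known one under an operation preserving map (a quotient, a
 copy, a subspace), so that the axioms need only be pushed forward.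
\<close>

lemma vs_image:
 assumes V: "vspace V" and img: "|U| = q ` |V|"
  and add: "\<And>x y. x \<in> |V| ==> y \<in> |V| ==> q x \<oplus>\<^sub>U q y = q (x \<oplus>\<^sub>V y)"
  and smult: "\<And>c x. c \<in> |K| ==> x \<in> |V| ==> c \<odot>\<^sub>U q x = q (c \<odot>\<^sub>V x)"
  and zero: "\<zero>\<^sub>U = q \<zero>\<^sub>V"
 shows "vspace U"
proof (rule vsI)
 fix x y assume "x \<in> |U|" "y \<in> |U|"
 then obtain x' y' where "x' \<in> |V|" "y' \<in> |V|" "x = q x'" "y = q y'"
  unfolding img by blast
 then show "x \<oplus>\<^sub>U y = y \<oplus>\<^sub>U x" using vs_ac(1)[OF V, of x' y'] by (simp add: add)
qed (use V in \<open>auto simp: img add smult zero vs_ac(2) vs_smult\<close>)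

text \<open>A set of functions is a space if it is closed under the pointwise operations, as the laws hold at each point.\<close>

lemma pointwise_vs:
 assumes V: "vspace V"
  and val: "\<And>f s. f \<in> |U| ==> s \<in> S ==> f s \<in> |V|"
  and cl: "\<And>f g. f \<in> |U| ==> g \<in> |U| ==> f \<oplus>\<^sub>U g \<in> |U|" "\<zero>\<^sub>U \<in> |U|"
   "\<And>c f. c \<in> |K| ==> f \<in> |U| ==> c \<odot>\<^sub>U f \<in> |U|"
  and ops: "\<And>f g s. s \<in> S ==> (f \<oplus>\<^sub>U g) s = f s \<oplus>\<^sub>V g s" "\<And>s. s \<in> S ==> \<zero>\<^sub>U s = \<zero>\<^sub>V"
   "\<And>c f s. s \<in> S ==> (c \<odot>\<^sub>U f) s = c \<odot>\<^sub>V f s"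
  and eq: "\<And>f g. f \<in> |U| ==> g \<in> |U| ==> (\<And>s. s \<in> S ==> f s = g s) ==> f = g"
 shows "vspace U"
 by (rule vsI; (rule cl | rule eq)?; (simp add: cl ops val V vs_ac[OF V] vs_smult[OF V])?)

subsection \<open>Subspaces and spans\<close>

lemma subD:
 assumes "sub W V" "vspace V"
 shows "W \<subseteq> |V|" "x \<in> W ==> x \<in> |V|" "\<zero>\<^sub>V \<in> W"
  "x \<in> W ==> y \<in> W ==> x \<oplus>\<^sub>V y \<in> W"
  "c \<in> |K| ==> x \<in> W ==> c \<odot>\<^sub>V x \<in> W"
  "x \<in> W ==> y \<in> W ==> x \<ominus>\<^sub>V y \<in> W"
  "x \<in> W ==> \<ominus>\<^sub>V x \<in> W"
proof -
 interpret V: module K V by fact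
 note * = V.submoduleE[OF assms(1)]
 show "W \<subseteq> |V|" by (rule *(1))
 then show "x \<in> W ==> x \<in> |V|" by auto
 show "\<zero>\<^sub>V \<in> W"
 proof -
  obtain w where w: "w \<in> W" using *(2) by auto
  then have "w \<oplus>\<^sub>V \<ominus>\<^sub>V w \<in> W" using *(3,5) by simp
  moreover have "w \<in> |V|" using w *(1) by auto
  ultimately show ?thesis by (simp add: V.M.r_neg)
 qed
 show "x \<in> W ==> y \<in> W ==> x \<oplus>\<^sub>V y \<in> W" by (rule *(5))
 show "c \<in> |K| ==> x \<in> W ==> c \<odot>\<^sub>V x \<in> W" by (rule *(4))
 show "x \<in> W ==> \<ominus>\<^sub>V x \<in> W" by (rule *(3))
 show "x \<in> W ==> y \<in> W ==> x \<ominus>\<^sub>V y \<in> W" unfolding a_minus_def using *(3,5) by simp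
qed

lemma sub_carrier: "vspace V ==> sub |V| V"
 by (rule subI) auto

lemma sub_zero: "vspace V ==> sub {\<zero>\<^sub>V} V"
 by (rule subI) auto

lemma vs_sub: "vspace V ==> sub W V ==> vspace (V\<lparr>carrier := W\<rparr>)"
 by (rule vsI) (auto simp: subD vs_ac vs_smult)

lemma kspan_sub: "vspace V ==> S \<subseteq> |V| ==> sub (kspan K V S) V"
 unfolding kspan_def
 by (rule subI) (auto simp: subD dest: sub_carrier)

lemma kspan_superset: "S \<subseteq> kspan K V S"
 unfolding kspan_def by auto

lemma kspan_least: "sub W V ==> S \<subseteq> W ==> kspan K V S \<subseteq> W"
 unfolding kspan_def by auto

lemma kspan_mono: "vspace V ==> T \<subseteq> |V| ==> S \<subseteq> T ==> kspan K V S \<subseteq> kspan K V T"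
 using kspan_superset[of T V] by (intro kspan_least[OF kspan_sub]) auto

lemma kspan_carrier: "vspace V ==> S \<subseteq> |V| ==> kspan K V S \<subseteq> |V|"
 by (rule kspan_least[OF sub_carrier])

lemma kspan_induct [consumes 3, case_names base zero add smult]:
 assumes "v \<in> kspan K V S" "vspace V" "S \<subseteq> |V|"
  and "\<And>s. s \<in> S ==> Q s" and "Q \<zero>\<^sub>V"
  and "\<And>x y. x \<in> |V| ==> y \<in> |V| ==> Q x ==> Q y ==> Q (x \<oplus>\<^sub>V y)"
  and "\<And>c x. c \<in> |K| ==> x \<in> |V| ==> Q x ==> Q (c \<odot>\<^sub>V x)"
 shows "Q v"
proof -
 have "sub {x \<in> |V|. Q x} V" by (rule subI) (use assms in auto)
 then have "kspan K V S \<subseteq> {x \<in> |V|. Q x}" by (rule kspan_least) (use assms in auto)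
 then show ?thesis using assms(1) by auto
qed

lemma kspan_empty: "vspace V ==> kspan K V {} = {\<zero>\<^sub>V}"
 using kspan_least[OF sub_zero, of V "{}"] subD(3)[OF kspan_sub, of V "{}"] by auto

lemma kspan_insert:
 assumes V: "vspace V" and s: "s \<in> |V|" and S: "S \<subseteq> |V|" and v: "v \<in> kspan K V (insert s S)"
 obtains c u where "c \<in> |K|" "u \<in> kspan K V S" "v = c \<odot>\<^sub>V s \<oplus>\<^sub>V u"
proof -
 note sp = kspan_sub[OF V S] kspan_carrier[OF V S]
 have u: "u \<in> kspan K V S ==> u \<in> |V|" for u using sp by auto
 have sS: "insert s S \<subseteq> |V|" using s S by auto
 have "\<exists>c\<in>|K|. \<exists>u\<in>kspan K V S. v = c \<odot>\<^sub>V s \<oplus>\<^sub>V u"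
  using v V sS
 proof (induction rule: kspan_induct)
  case (base t)
  show ?case
  proof (cases "t = s")
   case True
   then show ?thesis using V s subD(3)[OF sp(1) V]
    by (intro bexI[of _ "\<one>"] bexI[of _ "\<zero>\<^sub>V"]) auto
  next
   case False
   then have "t \<in> kspan K V S" using base kspan_superset[of S V] by auto
   then show ?thesis using V s u by (intro bexI[of _ "\<zero>"] bexI[of _ t]) auto
  qed
 next
  case zero
  show ?case using V s subD(3)[OF sp(1) V] by (intro bexI[of _ "\<zero>"] bexI[of _ "\<zero>\<^sub>V"]) auto
 next
  case (add x y)
  then obtain c u c' u' where *: "c \<in> |K|" "u \<in> kspan K V S" "x = c \<odot>\<^sub>V s \<oplus>\<^sub>V u"
   "c' \<in> |K|" "u' \<in> kspan K V S" "y = c' \<odot>\<^sub>V s \<oplus>\<^sub>V u'" by auto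
  then show ?case using V s u subD(4)[OF sp(1) V]
   by (intro bexI[of _ "c \<oplus> c'"] bexI[of _ "u \<oplus>\<^sub>V u'"]) (auto simp: vs_smult vs_ac)
 next
  case (smult d x)
  then obtain c u where *: "c \<in> |K|" "u \<in> kspan K V S" "x = c \<odot>\<^sub>V s \<oplus>\<^sub>V u" by auto
  then show ?case using V s u smult(1) subD(5)[OF sp(1) V]
   by (intro bexI[of _ "d \<otimes> c"] bexI[of _ "d \<odot>\<^sub>V u"]) (auto simp: vs_smult)
 qed
 then show ?thesis using that by auto
qed

subsection \<open>Linear maps\<close>

definition klin :: "('k, 'v, 'y) module_scheme \<Rightarrow> ('k, 'w, 'z) module_scheme \<Rightarrow> ('v \<Rightarrow> 'w) \<Rightarrow> bool"
 where "klin V W f \<longleftrightarrow> vspace V \<and> vspace W \<and> (\<forall>x\<in>|V|. f x \<in> |W| ) \<and>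
  (\<forall>x\<in>|V|. \<forall>y\<in>|V|. f (x \<oplus>\<^sub>V y) = f x \<oplus>\<^sub>W f y) \<and>
  (\<forall>c\<in>|K|. \<forall>x\<in>|V|. f (c \<odot>\<^sub>V x) = c \<odot>\<^sub>W f x)"

lemma klinI:
 assumes "vspace V" "vspace W" "\<And>x. x \<in> |V| ==> f x \<in> |W|"
  and "\<And>x y. x \<in> |V| ==> y \<in> |V| ==> f (x \<oplus>\<^sub>V y) = f x \<oplus>\<^sub>W f y"
  and "\<And>c x. c \<in> |K| ==> x \<in> |V| ==> f (c \<odot>\<^sub>V x) = c \<odot>\<^sub>W f x"
 shows "klin V W f"
 using assms unfolding klin_def by auto

lemma klinD:
 assumes "klin V W f"
 shows "vspace V" "vspace W" "x \<in> |V| ==> f x \<in> |W|"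
  "x \<in> |V| ==> y \<in> |V| ==> f (x \<oplus>\<^sub>V y) = f x \<oplus>\<^sub>W f y"
  "c \<in> |K| ==> x \<in> |V| ==> f (c \<odot>\<^sub>V x) = c \<odot>\<^sub>W f x"
  "f \<zero>\<^sub>V = \<zero>\<^sub>W"
  "x \<in> |V| ==> f (\<ominus>\<^sub>V x) = \<ominus>\<^sub>W f x"
  "x \<in> |V| ==> y \<in> |V| ==> f (x \<ominus>\<^sub>V y) = f x \<ominus>\<^sub>W f y"
proof -
 note d = assms[unfolded klin_def]
 show V: "vspace V" and W: "vspace W" using d by auto
 show c: "\<And>x. x \<in> |V| ==> f x \<in> |W|" using d by auto
 show a: "\<And>x y. x \<in> |V| ==> y \<in> |V| ==> f (x \<oplus>\<^sub>V y) = f x \<oplus>\<^sub>W f y" using d by auto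
 show s: "\<And>c x. c \<in> |K| ==> x \<in> |V| ==> f (c \<odot>\<^sub>V x) = c \<odot>\<^sub>W f x" using d by auto
 show "f \<zero>\<^sub>V = \<zero>\<^sub>W" using s[of "\<zero>" "\<zero>\<^sub>V"] V W c[of "\<zero>\<^sub>V"] by simp
 show n: "\<And>x. x \<in> |V| ==> f (\<ominus>\<^sub>V x) = \<ominus>\<^sub>W f x"
  using s V W c by (simp add: vs_inv_smult)
 show "x \<in> |V| ==> y \<in> |V| ==> f (x \<ominus>\<^sub>V y) = f x \<ominus>\<^sub>W f y"
  using V by (simp add: a_minus_def a n)
qed

lemma klin_comp: "klin V W f ==> klin W U g ==> klin V U (\<lambda>x. g (f x))"
 unfolding klin_def by auto

lemma klin_id: "vspace V ==> klin V V (\<lambda>x. x)"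
 unfolding klin_def by auto

lemma klin_zero: "vspace V ==> vspace W ==> klin V W (\<lambda>x. \<zero>\<^sub>W)"
 unfolding klin_def by auto

lemma klin_add: "klin V W f ==> klin V W g ==> klin V W (\<lambda>x. f x \<oplus>\<^sub>W g x)"
 by (rule klinI) (auto simp: klinD klinD(1,2)[of V W f] vs_ac vs_smult)

lemma klin_smult: "klin V W f ==> c \<in> |K| ==> klin V W (\<lambda>x. c \<odot>\<^sub>W f x)"
 by (rule klinI)
  (auto simp: klinD klinD(1,2)[of V W f] vs_smult(1) vs_smult(3)[symmetric] K.m_comm)

lemma klin_minus: "klin V W f ==> klin V W g ==> klin V W (\<lambda>x. f x \<ominus>\<^sub>W g x)"
 by (rule klinI) (auto simp: klinD klinD(1,2)[of V W f] vs_minus_add_distrib vs_smult_minus)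

lemma klin_kernel_sub: "klin V W f ==> sub {x \<in> |V|. f x = \<zero>\<^sub>W} V"
 by (rule subI) (auto simp: klinD klinD(1,2)[of V W f])

lemma klin_preimage_sub: "klin V W f ==> sub U W ==> sub {x \<in> |V|. f x \<in> U} V"
 by (rule subI) (auto simp: klinD subD klinD(1,2)[of V W f])

lemma klin_image_sub: "klin V W f ==> sub U V ==> sub (f ` U) W"
proof (rule subI)
 assume f: "klin V W f" and U: "sub U V"
 note V = klinD(1)[OF f]
 show "vspace W" "f ` U \<subseteq> |W|" using f subD[OF U V] by (auto simp: klinD)
 show "\<zero>\<^sub>W \<in> f ` U" using klinD(6)[OF f] subD(3)[OF U V] by (metis imageI)
 show "x \<oplus>\<^sub>W y \<in> f ` U" if "x \<in> f ` U" "y \<in> f ` U" for x y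
 proof -
  from that(1) obtain u where "u \<in> U" "x = f u" ..
  moreover from that(2) obtain u' where "u' \<in> U" "y = f u'" ..
  ultimately show ?thesis using subD(2,4)[OF U V] klinD(4)[OF f, of u u'] by (metis imageI)
 qed
 show "c \<odot>\<^sub>W x \<in> f ` U" if "c \<in> |K|" "x \<in> f ` U" for c x
 proof -
  from that(2) obtain u where "u \<in> U" "x = f u" ..
  then show ?thesis using subD(2,5)[OF U V] klinD(5)[OF f that(1), of u] that(1)
   by (metis imageI)
 qed
qed

lemma klin_eq_on_span:
 assumes "klin V W f" "klin V W g" "S \<subseteq> |V|" "\<And>s. s \<in> S ==> f s = g s" "v \<in> kspan K V S"
 shows "f v = g v"
 using assms(5) klinD(1)[OF assms(1)] assms(3)
 by (induction rule: kspan_induct)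
  (use assms in \<open>auto simp: klinD(3-6)[OF assms(1)] klinD(3-6)[OF assms(2)]\<close>)

lemma kspan_image:
 assumes f: "klin V W f" and S: "S \<subseteq> |V|"
 shows "f ` kspan K V S = kspan K W (f ` S)"
proof
 note V = klinD(1)[OF f] and W = klinD(2)[OF f]
 have fS: "f ` S \<subseteq> |W|" using f S by (auto simp: klinD)
 show "f ` kspan K V S \<subseteq> kspan K W (f ` S)"
 proof -
  have "sub {x \<in> |V|. f x \<in> kspan K W (f ` S)} V"
   by (rule klin_preimage_sub[OF f kspan_sub[OF W fS]])
  then have "kspan K V S \<subseteq> {x \<in> |V|. f x \<in> kspan K W (f ` S)}"
   by (rule kspan_least) (use S kspan_superset[of "f ` S" W] in auto)
  then show ?thesis by auto
 qed
 show "kspan K W (f ` S) \<subseteq> f ` kspan K V S"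
  by (rule kspan_least[OF klin_image_sub[OF f kspan_sub[OF V S]]])
   (use kspan_superset[of S V] in auto)
qed

subsection \<open>Finite dimension\<close>

text \<open>
 Steinitz exchange for a single vector: an element \<open>s\<close> with nonzero coefficient in an
 expression of \<open>p\<close> can be replaced by \<open>p\<close>.
\<close>

lemma kspan_exchange:
 assumes V: "vspace V" and "finite S" "S \<subseteq> |V|" "p \<in> kspan K V S" "p \<noteq> \<zero>\<^sub>V"
 shows "\<exists>s\<in>S. s \<in> kspan K V (insert p (S - {s}))"
 using assms(2-5)
proof (induction S rule: finite_induct)
 case empty
 then show ?case using kspan_empty[OF V] by auto
next
 case (insert s S)
 have s: "s \<in> |V|" and S: "S \<subseteq> |V|" using insert.prems by auto
 obtain c u where cu: "c \<in> |K|" "u \<in> kspan K V S" "p = c \<odot>\<^sub>V s \<oplus>\<^sub>V u"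
  using kspan_insert[OF V s S insert.prems(2)] by blast
 have u: "u \<in> |V|" using cu(2) kspan_carrier[OF V S] by auto
 have p: "p \<in> |V|" using cu s u V by simp
 show ?case
 proof (cases "c = \<zero>")
  case True
  then have "p = u" using cu u s V by simp
  then obtain t where t: "t \<in> S" "t \<in> kspan K V (insert p (S - {t}))"
   using insert.IH[OF S] cu(2) insert.prems(3) by blast
  have "kspan K V (insert p (S - {t})) \<subseteq> kspan K V (insert p (insert s S - {t}))"
   by (rule kspan_mono[OF V]) (use p s S in auto)
  then show ?thesis using t by blast
 next
  case False
  then have c: "inv c \<in> |K|" "inv c \<otimes> c = \<one>" using cu(1) K.field_Units by auto
  let ?S = "insert p (insert s S - {s})"
  have i: "?S \<subseteq> |V|" "S \<subseteq> ?S" using p S insert.hyps by auto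
  note sp = kspan_sub[OF V i(1)]
  have "p \<ominus>\<^sub>V u = c \<odot>\<^sub>V s" using vs_minus_iff[OF V p u, of "c \<odot>\<^sub>V s"] cu s V by simp
  then have "s = inv c \<odot>\<^sub>V (p \<ominus>\<^sub>V u)" using c cu(1) s V by (simp add: vs_smult(3)[symmetric])
  moreover have "p \<in> kspan K V ?S" "u \<in> kspan K V ?S"
   using kspan_superset[of ?S V] kspan_mono[OF V i] cu(2) by auto
  ultimately have "s \<in> kspan K V ?S" using subD(5)[OF sp V c(1) subD(6)[OF sp V]] by simp
  then show ?thesis by blast
 qed
qed

text \<open>
 Counting generators replaces dimensions: a linear map that kills a nonzero vector saves at least
 one generator of its image.
\<close>

definition spanned :: "('k, 'v, 'z) module_scheme \<Rightarrow> nat \<Rightarrow> bool" where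
 "spanned V n \<longleftrightarrow> (\<exists>S. finite S \<and> card S = n \<and> S \<subseteq> |V| \<and> kspan K V S = |V| )"

lemma fin_dim_spanned: "fin_dim K V \<longleftrightarrow> (\<exists>n. spanned V n)"
 unfolding fin_dim_def spanned_def by auto

lemma spanned_image_drop:
 assumes f: "klin V W f" and "spanned V n" "f ` |V| = |W|"
  and p: "p \<in> |V|" "p \<noteq> \<zero>\<^sub>V" "f p = \<zero>\<^sub>W"
 shows "\<exists>m<n. spanned W m"
proof -
 note V = klinD(1)[OF f] and W = klinD(2)[OF f]
 obtain S where S: "finite S" "card S = n" "S \<subseteq> |V|" "kspan K V S = |V|"
  using assms(2) unfolding spanned_def by auto
 obtain s where s: "s \<in> S" "s \<in> kspan K V (insert p (S - {s}))"
  using kspan_exchange[OF V S(1,3), of p] S(4) p by blast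
 let ?T = "f ` (S - {s})"
 have T: "?T \<subseteq> |W|" using S(3) klinD(3)[OF f] by auto
 note sp = kspan_sub[OF W T]
 have "f ` kspan K V (insert p (S - {s})) = kspan K W (f ` insert p (S - {s}))"
  by (rule kspan_image[OF f]) (use p S in auto)
 also have "\<dots> \<subseteq> kspan K W ?T"
  by (rule kspan_least[OF sp]) (use kspan_superset[of ?T W] p(3) subD(3)[OF sp W] in auto)
 finally have "f s \<in> kspan K W ?T" using s(2) by blast
 then have "f ` S \<subseteq> kspan K W ?T" using kspan_superset[of ?T W] by blast
 then have "|W| \<subseteq> kspan K W ?T"
  using kspan_least[OF sp, of "f ` S"] kspan_image[OF f S(3)] S(4) assms(3) by simp
 then have "kspan K W ?T = |W|" using kspan_carrier[OF W T] by blast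
 moreover have "card ?T < n" using S(1,2) s(1) card_image_le[of "S - {s}" f] card_Diff1_less[OF S(1) s(1)] by simp
 ultimately show ?thesis unfolding spanned_def using S(1) T
  by (intro exI[of _ "card ?T"] conjI exI[of _ ?T]) auto
qed

lemma fin_dim_image:
 assumes f: "klin V W f" and "fin_dim K V" "f ` |V| = |W|"
 shows "fin_dim K W"
proof -
 obtain S where S: "finite S" "S \<subseteq> |V|" "kspan K V S = |V|"
  using assms(2) unfolding fin_dim_def by auto
 then show ?thesis unfolding fin_dim_def
  using kspan_image[OF f S(2)] assms(3) klinD(3)[OF f]
  by (intro exI[of _ "f ` S"]) auto
qed

text \<open>\<open>K\<close> as a vector space over itself makes linear forms a case of linear maps.\<close>

definition Kv :: "('k, 'k) module" where
 "Kv = \<lparr>carrier = |K|, mult = mult K, one = one K, zero = zero K, add = add K, smult = mult K\<rparr>"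

lemma Kv_simps [simp]: "|Kv| = |K|" "zero Kv = zero K" "add Kv = add K" "smult Kv = mult K"
 by (simp_all add: Kv_def)

lemma Kv_vs [simp]: "vspace Kv"
 by (rule vsI) (simp_all add: K.a_ac K.l_distr K.r_distr K.m_assoc)

lemma lsum_Kv [simp]: "lsum Kv = lsum K"
 by (simp add: lsum_def fun_eq_iff)

subsection \<open>Linear forms\<close>

lemma formD:
 assumes "\<phi> \<in> linear_forms K V"
 shows "x \<in> |V| ==> \<phi> x \<in> |K|"
  "x \<in> |V| ==> y \<in> |V| ==> \<phi> (x \<oplus>\<^sub>V y) = \<phi> x \<oplus> \<phi> y"
  "c \<in> |K| ==> x \<in> |V| ==> \<phi> (c \<odot>\<^sub>V x) = c \<otimes> \<phi> x"
  "\<phi> \<in> extensional |V|"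
  "x \<notin> |V| ==> \<phi> x = undefined"
 using assms unfolding linear_forms_def by (auto simp: PiE_def extensional_def)

lemma form_zero: "\<phi> \<in> linear_forms K V ==> vspace V ==> \<phi> \<zero>\<^sub>V = \<zero>"
 using formD(3)[of \<phi> V "\<zero>" "\<zero>\<^sub>V"] formD(1)[of \<phi> V "\<zero>\<^sub>V"] by simp

lemma form_minus:
 assumes "\<phi> \<in> linear_forms K V" "vspace V" "x \<in> |V|" "y \<in> |V|"
 shows "\<phi> (x \<ominus>\<^sub>V y) = \<phi> x \<ominus> \<phi> y"
proof -
 have "\<phi> (\<ominus>\<^sub>V y) = (\<ominus> \<one>) \<otimes> \<phi> y" using assms by (simp add: vs_inv_smult formD)
 then show ?thesis using assms by (simp add: a_minus_def formD K.l_minus)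
qed

lemma formI:
 assumes "\<And>x. x \<in> |V| ==> f x \<in> |K|"
  "\<And>x y. x \<in> |V| ==> y \<in> |V| ==> f (x \<oplus>\<^sub>V y) = f x \<oplus> f y"
  "\<And>c x. c \<in> |K| ==> x \<in> |V| ==> f (c \<odot>\<^sub>V x) = c \<otimes> f x" "vspace V"
 shows "restrict f |V| \<in> linear_forms K V"
 using assms unfolding linear_forms_def by auto

lemma form_comp:
 "klin V W f ==> \<phi> \<in> linear_forms K W ==> (\<lambda>x\<in>|V|. \<phi> (f x)) \<in> linear_forms K V"
 by (rule formI) (auto simp: klinD formD klinD(1)[of V W f])

text \<open>
 A subspace that contains \<open>W\<close> and is maximal among those that avoid \<open>v\<close> is a complement of the
 line through \<open>v\<close>.
\<close>

lemma separating_form: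
 assumes V: "vspace V" and W: "sub W V" and v: "v \<in> |V|" "v \<notin> W"
 obtains \<phi> where "\<phi> \<in> linear_forms K V" "\<And>w. w \<in> W ==> \<phi> w = \<zero>" "\<phi> v = \<one>"
proof -
 define \<A> where "\<A> = {H. sub H V \<and> W \<subseteq> H \<and> v \<notin> H}"
 have "\<exists>H\<in>\<A>. \<forall>X\<in>\<A>. H \<subseteq> X \<longrightarrow> X = H"
 proof (rule subset_Zorn_nonempty)
  show "\<A> \<noteq> {}" using W v unfolding \<A>_def by auto
  fix \<C> assume C: "\<C> \<noteq> {}" "subset.chain \<A> \<C>"
  have sub: "sub H V" "W \<subseteq> H" "v \<notin> H" if "H \<in> \<C>" for H
   using C that unfolding \<A>_def subset.chain_def by auto
  obtain H0 where H0: "H0 \<in> \<C>" using C by auto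
  have "sub (\<Union>\<C>) V"
  proof (rule subI[OF V])
   show "\<Union>\<C> \<subseteq> |V|" using sub(1) subD(1)[OF _ V] by blast
   show "\<zero>\<^sub>V \<in> \<Union>\<C>" using H0 sub(1) subD(3)[OF _ V] by blast
   show "c \<odot>\<^sub>V x \<in> \<Union>\<C>" if "c \<in> |K|" "x \<in> \<Union>\<C>" for c x
    using that sub(1) subD(5)[OF _ V] by blast
   show "x \<oplus>\<^sub>V y \<in> \<Union>\<C>" if xy: "x \<in> \<Union>\<C>" "y \<in> \<Union>\<C>" for x y
   proof -
    obtain X Y where XY: "X \<in> \<C>" "x \<in> X" "Y \<in> \<C>" "y \<in> Y" using xy by auto
    then have "X \<subseteq> Y \<or> Y \<subseteq> X" using C(2) unfolding subset.chain_def by auto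
    then show ?thesis
    proof
     assume "X \<subseteq> Y"
     then show ?thesis using XY sub(1)[of Y] subD(4)[OF _ V, of Y x y] by auto
    next
     assume "Y \<subseteq> X"
     then show ?thesis using XY sub(1)[of X] subD(4)[OF _ V, of X x y] by auto
    qed
   qed
  qed
  then show "\<Union>\<C> \<in> \<A>" using H0 sub unfolding \<A>_def by auto
 qed
 then obtain H where H: "sub H V" "W \<subseteq> H" "v \<notin> H"
  and max: "\<And>X. sub X V ==> W \<subseteq> X ==> v \<notin> X ==> H \<subseteq> X ==> X = H" unfolding \<A>_def by auto
 note h = subD[OF H(1) V]
 have K_unit: "inv c \<in> |K|" "inv c \<otimes> c = \<one>" if "c \<in> |K|" "c \<noteq> \<zero>" for c
  using that K.field_Units by auto
 \<comment> \<open>the multiple of \<open>v\<close> that is congruent to \<open>u\<close> modulo the hyperplane \<open>H\<close>\<close>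
 have ex: "\<exists>c\<in>|K|. c \<odot>\<^sub>V v \<ominus>\<^sub>V u \<in> H" if u: "u \<in> |V|" for u
 proof (cases "u \<in> H")
  case True
  then show ?thesis using h(6)[OF h(3) True] V v(1) by (intro bexI[of _ "\<zero>"]) simp_all
 next
  case False
  let ?X = "kspan K V (insert u H)"
  have i: "insert u H \<subseteq> |V|" "H \<subseteq> kspan K V (insert u H)" "u \<in> ?X"
   using u h(1) kspan_superset[of "insert u H" V] by auto
  have "v \<in> ?X" using max[OF kspan_sub[OF V i(1)] _ _ i(2)] i(2,3) H(2) False by blast
  then obtain c w where c: "c \<in> |K|" "w \<in> kspan K V H" "v = c \<odot>\<^sub>V u \<oplus>\<^sub>V w"
   by (rule kspan_insert[OF V u h(1)])
  have w: "w \<in> H" using kspan_least[OF H(1) subset_refl] c(2) by blast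
  then have "c \<noteq> \<zero>" using c(3) H(3) u V h(2)[OF w] by auto
  note c' = K_unit[OF c(1) this]
  have "v \<ominus>\<^sub>V c \<odot>\<^sub>V u \<in> H"
   using vs_minus_iff[OF V v(1), of "c \<odot>\<^sub>V u" w] w c u V h(2)[OF w] vs_ac(1)[OF V h(2)[OF w], of "c \<odot>\<^sub>V u"] by simp
  from h(5)[OF c'(1) this] have "inv c \<odot>\<^sub>V v \<ominus>\<^sub>V u \<in> H"
   using V v(1) u c(1) c' by (simp add: vs_smult_minus vs_smult(3)[symmetric])
  then show ?thesis using c'(1) by blast
 qed
 define \<phi> where "\<phi> = (\<lambda>u. THE c. c \<in> |K| \<and> c \<odot>\<^sub>V v \<ominus>\<^sub>V u \<in> H)"
 have phi: "\<phi> u = c" if u: "u \<in> |V|" and c: "c \<in> |K|" "c \<odot>\<^sub>V v \<ominus>\<^sub>V u \<in> H" for u c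
  unfolding \<phi>_def
 proof (rule the_equality)
  fix d assume d: "d \<in> |K| \<and> d \<odot>\<^sub>V v \<ominus>\<^sub>V u \<in> H"
  have cd: "c = (c \<ominus> d) \<oplus> d" using c(1) d by (simp add: a_minus_def K.a_assoc K.l_neg)
  have "c \<odot>\<^sub>V v = (c \<ominus> d) \<odot>\<^sub>V v \<oplus>\<^sub>V d \<odot>\<^sub>V v"
   using vs_smult(2)[OF V, of "c \<ominus> d" v d] v(1) c(1) d cd by simp
  then have "c \<odot>\<^sub>V v \<ominus>\<^sub>V u = (c \<ominus> d) \<odot>\<^sub>V v \<oplus>\<^sub>V (d \<odot>\<^sub>V v \<ominus>\<^sub>V u)"
   using V v(1) u c(1) d by (simp add: a_minus_def vs_ac(2))
  then have "(c \<odot>\<^sub>V v \<ominus>\<^sub>V u) \<ominus>\<^sub>V (d \<odot>\<^sub>V v \<ominus>\<^sub>V u) = (c \<ominus> d) \<odot>\<^sub>V v"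
   using V v(1) u c(1) d by (simp add: vs_minus_iff)
  then have m: "(c \<ominus> d) \<odot>\<^sub>V v \<in> H" using h(6)[OF c(2)] d by metis
  have "c \<ominus> d = \<zero>"
  proof (rule ccontr)
   assume n: "c \<ominus> d \<noteq> \<zero>"
   have "c \<ominus> d \<in> |K|" using c(1) d by simp
   note i = K_unit[OF this n] and this
   then show False using h(5)[OF i(1) m] V v(1) H(3) by (simp add: vs_smult(3)[symmetric])
  qed
  then show "d = c" using cd d by simp
 qed (use c in blast)
 have lin: "restrict \<phi> |V| \<in> linear_forms K V"
 proof (rule formI[OF _ _ _ V])
  fix x assume x: "x \<in> |V|"
  then obtain c where c: "c \<in> |K|" "c \<odot>\<^sub>V v \<ominus>\<^sub>V x \<in> H" using ex by blast
  show "\<phi> x \<in> |K|" using phi[OF x c] c by simp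
  show "\<phi> (d \<odot>\<^sub>V x) = d \<otimes> \<phi> x" if d: "d \<in> |K|" for d
   unfolding phi[OF x c] by (rule phi) (use h(5)[OF d c(2)] V v(1) x c(1) d in \<open>simp_all add: vs_smult_minus vs_smult(3)\<close>)
  fix y assume y: "y \<in> |V|"
  then obtain d where d: "d \<in> |K|" "d \<odot>\<^sub>V v \<ominus>\<^sub>V y \<in> H" using ex by blast
  show "\<phi> (x \<oplus>\<^sub>V y) = \<phi> x \<oplus> \<phi> y" unfolding phi[OF x c] phi[OF y d]
   by (rule phi) (use h(4)[OF c(2) d(2)] V v(1) x y c(1) d(1) in \<open>simp_all add: vs_smult(2) vs_minus_add_distrib\<close>)
 qed
 show ?thesis
 proof (rule that[OF lin])
  show "restrict \<phi> |V| w = \<zero>" if "w \<in> W" for w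
  proof -
   have w: "w \<in> H" "w \<in> |V|" using H(2) h(1) that by auto
   show ?thesis using phi[OF w(2), of "\<zero>"] h(6)[OF h(3) w(1)] w(2) V v(1) by simp
  qed
  show "restrict \<phi> |V| v = \<one>" using phi[OF v(1), of "\<one>"] h(3) V v(1) by simp
 qed
qed

lemma form_nonzero:
 assumes "vspace V" "v \<in> |V|" "v \<noteq> \<zero>\<^sub>V"
 obtains \<phi> where "\<phi> \<in> linear_forms K V" "\<phi> v = \<one>"
 using separating_form[OF assms(1) sub_zero[OF assms(1)] assms(2)] assms(3) by auto

lemma forms_separate:
 assumes "vspace V" "u \<in> |V|" "v \<in> |V|" "\<And>\<phi>. \<phi> \<in> linear_forms K V ==> \<phi> u = \<phi> v"
 shows "u = v"
proof (rule ccontr)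
 assume "u \<noteq> v"
 then have "u \<ominus>\<^sub>V v \<noteq> \<zero>\<^sub>V" using assms by (simp add: vs_minus_zero_iff)
 then obtain \<phi> where \<phi>: "\<phi> \<in> linear_forms K V" "\<phi> (u \<ominus>\<^sub>V v) = \<one>"
  using form_nonzero[of V "u \<ominus>\<^sub>V v"] assms by auto
 have "\<phi> (u \<ominus>\<^sub>V v) = \<phi> v \<ominus> \<phi> v" using assms(4)[OF \<phi>(1)] form_minus[OF \<phi>(1) assms(1-3)] by simp
 also have "\<dots> = \<zero>" using formD(1)[OF \<phi>(1) assms(3)] by (simp add: a_minus_def K.r_neg)
 finally show False using \<phi>(2) by simp
qed

subsection \<open>Sums over lists\<close>

lemma lsum_simps [simp]: "lsum V [] = \<zero>\<^sub>V" "lsum V (x # xs) = x \<oplus>\<^sub>V lsum V xs"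
 by (auto simp: lsum_def)

lemma lsum_in_sub: "sub W V ==> vspace V ==> set xs \<subseteq> W ==> lsum V xs \<in> W"
 by (induction xs) (auto simp: subD)

lemma lsum_closed [simp]: "vspace V ==> set xs \<subseteq> |V| ==> lsum V xs \<in> |V|"
 by (induction xs) auto

lemma lsum_map_closed: "vspace V ==> (\<And>x. x \<in> set xs ==> f x \<in> |V| ) ==> lsum V (map f xs) \<in> |V|"
 by (induction xs) auto

lemma lsum_klin:
 "klin V W f ==> (\<And>x. x \<in> set xs ==> g x \<in> |V| )
  ==> f (lsum V (map g xs)) = lsum W (map (\<lambda>x. f (g x)) xs)"
proof (induction xs)
 case (Cons x xs)
 then show ?case
  using klinD(4)[OF Cons.prems(1), of "g x" "lsum V (map g xs)"] klinD(1)[OF Cons.prems(1)]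
  by (simp add: lsum_map_closed)
qed (simp add: klinD)

lemma lsum_cong: "(\<And>x. x \<in> set xs ==> f x = g x) ==> lsum V (map f xs) = lsum V (map g xs)"
 by (induction xs) auto

lemma lsum_add:
 assumes "vspace V" "\<And>x. x \<in> set xs ==> f x \<in> |V|" "\<And>x. x \<in> set xs ==> g x \<in> |V|"
 shows "lsum V (map (\<lambda>x. f x \<oplus>\<^sub>V g x) xs) = lsum V (map f xs) \<oplus>\<^sub>V lsum V (map g xs)"
 using assms(2,3)
proof (induction xs)
 case (Cons x xs)
 have *: "f x \<in> |V|" "g x \<in> |V|" "lsum V (map f xs) \<in> |V|" "lsum V (map g xs) \<in> |V|"
  using Cons.prems assms(1) by (auto intro: lsum_map_closed)
 have "lsum V (map (\<lambda>x. f x \<oplus>\<^sub>V g x) xs) = lsum V (map f xs) \<oplus>\<^sub>V lsum V (map g xs)"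
  by (rule Cons.IH) (use Cons.prems in auto)
 then show ?case using * assms(1) by (simp add: vs_ac)
qed (use assms in simp)

lemma lsum_zero: "vspace V ==> (\<And>x. x \<in> set xs ==> f x = \<zero>\<^sub>V) ==> lsum V (map f xs) = \<zero>\<^sub>V"
 by (induction xs) auto

lemma klin_lsum:
 "vspace V ==> vspace W ==> (\<And>x. x \<in> set xs ==> klin V W (f x)) ==> klin V W (\<lambda>v. lsum W (map (\<lambda>x. f x v) xs))"
 by (induction xs) (auto intro!: klin_zero klin_add)

subsection \<open>Coordinates\<close>

text \<open>
 A finite spanning set is turned into a basis with its coordinate forms, one vector at a time:
 a new vector outside the span has a form that vanishes on the span, and projecting along it corrects
 the coordinates found before.
\<close>

lemma fin_dim_coordinates:
 assumes V: "vspace V" and fd: "fin_dim K V"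
 obtains bs where "set bs \<subseteq> |V| \<times> linear_forms K V"
  "\<And>v. v \<in> |V| ==> v = lsum V (map (\<lambda>(b, \<phi>). \<phi> v \<odot>\<^sub>V b) bs)"
proof -
 have "\<exists>bs. set bs \<subseteq> |V| \<times> linear_forms K V \<and>
   (\<forall>v\<in>kspan K V S. v = lsum V (map (\<lambda>(b, \<phi>). \<phi> v \<odot>\<^sub>V b) bs))" if "finite S" "S \<subseteq> |V|" for S
  using that
 proof (induction S rule: finite_induct)
  case empty
  then show ?case by (intro exI[of _ "[]"]) (simp add: kspan_empty[OF V])
 next
  case (insert s S)
  then have s: "s \<in> |V|" and S: "S \<subseteq> |V|" by auto
  obtain bs where bs: "set bs \<subseteq> |V| \<times> linear_forms K V"
   "\<And>v. v \<in> kspan K V S ==> v = lsum V (map (\<lambda>(b, \<phi>). \<phi> v \<odot>\<^sub>V b) bs)" using insert.IH[OF S] by blast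
  note sp = kspan_sub[OF V S]
  show ?case
  proof (cases "s \<in> kspan K V S")
   case True
   then have "kspan K V (insert s S) \<subseteq> kspan K V S" using kspan_superset[of S V] by (intro kspan_least[OF sp]) simp
   then show ?thesis using bs by blast
  next
   case False
   obtain \<phi> where \<phi>: "\<phi> \<in> linear_forms K V" "\<And>w. w \<in> kspan K V S ==> \<phi> w = \<zero>" "\<phi> s = \<one>"
    by (rule separating_form[OF V sp s False]) (rule that)
   \<comment> \<open>the projection along \<open>s\<close>, which fixes the span of \<open>S\<close>\<close>
   define \<pi> where "\<pi> = (\<lambda>x. x \<ominus>\<^sub>V \<phi> x \<odot>\<^sub>V s)"
   have pi: "klin V V \<pi>" unfolding \<pi>_def
    by (rule klin_minus[OF klin_id[OF V]], rule klinI) (use V s \<phi> in \<open>simp_all add: formD vs_smult\<close>)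
   define bs' where "bs' = (s, \<phi>) # map (\<lambda>(b, \<psi>). (b, \<lambda>x\<in>|V|. \<psi> (\<pi> x))) bs"
   have "set bs' \<subseteq> |V| \<times> linear_forms K V"
    using bs(1) s \<phi>(1) form_comp[OF pi] unfolding bs'_def by (auto; blast)
   moreover have "v = lsum V (map (\<lambda>(b, \<phi>). \<phi> v \<odot>\<^sub>V b) bs')" if v: "v \<in> kspan K V (insert s S)" for v
   proof -
    obtain c u where cu: "c \<in> |K|" "u \<in> kspan K V S" "v = c \<odot>\<^sub>V s \<oplus>\<^sub>V u"
     by (rule kspan_insert[OF V s S v])
    have u: "u \<in> |V|" by (rule subD(2)[OF sp V cu(2)])
    have vV: "v \<in> |V|" and \<phi>v: "\<phi> v = c" using cu(1,3) u s V \<phi> \<phi>(2)[OF cu(2)] by (simp_all add: formD(2,3))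
    have "\<pi> v = u" unfolding \<pi>_def \<phi>v using vs_minus_iff[OF V vV, of "c \<odot>\<^sub>V s" u] cu(1,3) u s V by (simp add: vs_ac(1))
    moreover have "lsum V (map (\<lambda>(b, \<phi>). \<phi> v \<odot>\<^sub>V b) bs') = c \<odot>\<^sub>V s \<oplus>\<^sub>V lsum V (map (\<lambda>(b, \<phi>). \<phi> (\<pi> v) \<odot>\<^sub>V b) bs)"
     unfolding bs'_def by (simp add: \<phi>v vV comp_def case_prod_beta')
    ultimately show ?thesis using bs(2)[OF cu(2)] cu(3) by simp
   qed
   ultimately show ?thesis by blast
  qed
 qed
 then show ?thesis using that fd unfolding fin_dim_def by metis
qed

end

context kfield
begin

section \<open>Quotients, free spaces and tensor products\<close>

subsection \<open>Quotient spaces and quotient algebras\<close>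

lemma quot_carrier: "|quotient V W| = (\<lambda>v. W +>\<^bsub>V\<^esub> v) ` |V|"
 by (auto simp: quotient_def A_RCOSETS_def')

context
 fixes V :: "('k, 'v, 'z) module_scheme" and W
 assumes V: "vspace V" and W: "sub W V"
begin

interpretation S: abelian_subgroup W V
 by (rule abelian_subgroupI3[OF additive_subgroup.intro[OF submodule.axioms(1)[OF W]] vs_abelian_group[OF V]])

lemma quot_eq:
 assumes "u \<in> |V|" "v \<in> |V|"
 shows "W +>\<^bsub>V\<^esub> u = W +>\<^bsub>V\<^esub> v \<longleftrightarrow> u \<ominus>\<^sub>V v \<in> W"
 using S.a_rcos_module[OF assms(2,1)] S.a_repr_independence'[OF _ assms(2)] S.a_rcos_self[OF assms(1)]
 unfolding a_minus_def by metis

lemma quot_eq_zero: "u \<in> |V| ==> W +>\<^bsub>V\<^esub> u = W \<longleftrightarrow> u \<in> W"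
 using quot_eq[of u "\<zero>\<^sub>V"] abelian_group.a_coset_add_zero[OF vs_abelian_group[OF V], of W]
 by (simp add: subD[OF W V] V)

lemma quot_add:
 "u \<in> |V| ==> v \<in> |V|
  ==> (W +>\<^bsub>V\<^esub> u) \<oplus>\<^bsub>quotient V W\<^esub> (W +>\<^bsub>V\<^esub> v) = W +>\<^bsub>V\<^esub> (u \<oplus>\<^sub>V v)"
 using S.a_rcos_sum by (simp add: quotient_def)

lemma quot_self: "u \<in> |V| ==> u \<in> W +>\<^bsub>V\<^esub> u"
 by (rule S.a_rcos_self)

lemma quot_mem:
 assumes u: "u \<in> |V|" and x: "x \<in> W +>\<^bsub>V\<^esub> u"
 shows "x \<in> |V|" "x \<ominus>\<^sub>V u \<in> W"
proof -
 show xV: "x \<in> |V|" using S.a_elemrcos_carrier[OF u x] .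
 show "x \<ominus>\<^sub>V u \<in> W" using S.a_rcos_module[OF u xV] x by (simp add: a_minus_def)
qed

end

lemma quot_smult:
 assumes V: "vspace V" and W: "sub W V" and c: "c \<in> |K|" and u: "u \<in> |V|"
 shows "c \<odot>\<^bsub>quotient V W\<^esub> (W +>\<^bsub>V\<^esub> u) = W +>\<^bsub>V\<^esub> (c \<odot>\<^sub>V u)"
proof -
 have "W +>\<^bsub>V\<^esub> (c \<odot>\<^sub>V x) = W +>\<^bsub>V\<^esub> (c \<odot>\<^sub>V u)" if x: "x \<in> W +>\<^bsub>V\<^esub> u" for x
  using quot_mem[OF V W u x] V c u subD(5)[OF W V, of c "x \<ominus>\<^sub>V u"]
  by (simp add: quot_eq[OF V W] vs_smult_minus)
 then have "(\<Union>x\<in>W +>\<^bsub>V\<^esub> u. W +>\<^bsub>V\<^esub> (c \<odot>\<^sub>V x)) = (\<Union>x\<in>W +>\<^bsub>V\<^esub> u. W +>\<^bsub>V\<^esub> (c \<odot>\<^sub>V u))"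
  by (intro SUP_cong refl)
 also have "\<dots> = W +>\<^bsub>V\<^esub> (c \<odot>\<^sub>V u)" using quot_self[OF V W u] by (intro SUP_const) blast
 finally show ?thesis unfolding quotient_def by (simp only: module.simps)
qed

lemma quot_zero: "\<zero>\<^bsub>quotient V W\<^esub> = W"
 by (simp add: quotient_def)

lemma quot_zero': "vspace V ==> sub W V ==> \<zero>\<^bsub>quotient V W\<^esub> = W +>\<^bsub>V\<^esub> \<zero>\<^sub>V"
 using quot_eq_zero[of V W "\<zero>\<^sub>V"] by (simp add: quot_zero subD)

lemma quot_vs: "vspace V ==> sub W V ==> vspace (quotient V W)"
 by (rule vs_image[where q = "\<lambda>v. W +>\<^bsub>V\<^esub> v"])
  (auto simp: quot_carrier quot_add quot_smult quot_zero')

lemma quot_klin: "vspace V ==> sub W V ==> klin V (quotient V W) (\<lambda>v. W +>\<^bsub>V\<^esub> v)"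
 by (rule klinI) (auto simp: quot_carrier quot_add quot_smult quot_vs)

lemma quot_lift:
 assumes V: "vspace V" and W: "sub W V" and f: "klin V U f" and z: "\<And>w. w \<in> W ==> f w = \<zero>\<^sub>U"
 obtains h where "klin (quotient V W) U h" "\<And>v. v \<in> |V| ==> h (W +>\<^bsub>V\<^esub> v) = f v"
proof -
 define h where "h = (\<lambda>C. f (SOME v. v \<in> |V| \<and> C = W +>\<^bsub>V\<^esub> v))"
 have h: "h (W +>\<^bsub>V\<^esub> v) = f v" if v: "v \<in> |V|" for v
 proof -
  define u where "u = (SOME u. u \<in> |V| \<and> W +>\<^bsub>V\<^esub> v = W +>\<^bsub>V\<^esub> u)"
  have u: "u \<in> |V| \<and> W +>\<^bsub>V\<^esub> v = W +>\<^bsub>V\<^esub> u" unfolding u_def by (rule someI[of _ v]) (use v in auto)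
  then have "f (v \<ominus>\<^sub>V u) = \<zero>\<^sub>U" using z quot_eq[OF V W v] by blast
  then have "f v = f u"
   using u v klinD(8)[OF f v] klinD(3)[OF f] klinD(2)[OF f] by (simp add: vs_minus_zero_iff)
  then show ?thesis unfolding h_def u_def by simp
 qed
 have "klin (quotient V W) U h"
 proof (rule klinI)
  fix x y assume "x \<in> |quotient V W|" "y \<in> |quotient V W|"
  then obtain u v where "u \<in> |V|" "v \<in> |V|" "x = W +>\<^bsub>V\<^esub> u" "y = W +>\<^bsub>V\<^esub> v"
   unfolding quot_carrier by blast
  then show "h (x \<oplus>\<^bsub>quotient V W\<^esub> y) = h x \<oplus>\<^sub>U h y"
   using V W f by (simp add: quot_add h klinD)
 qed (use V W f in \<open>auto simp: quot_vs quot_carrier quot_smult h klinD\<close>)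
 then show ?thesis using that h by blast
qed

lemma algI:
 assumes "vspace B" "\<And>x y. x \<in> |B| ==> y \<in> |B| ==> x \<otimes>\<^sub>B y \<in> |B|"
  and "\<one>\<^sub>B \<in> |B|"
  and "\<And>x y z. x \<in> |B| ==> y \<in> |B| ==> z \<in> |B|
   ==> (x \<otimes>\<^sub>B y) \<otimes>\<^sub>B z = x \<otimes>\<^sub>B (y \<otimes>\<^sub>B z)"
  and "\<And>x. x \<in> |B| ==> \<one>\<^sub>B \<otimes>\<^sub>B x = x" "\<And>x. x \<in> |B| ==> x \<otimes>\<^sub>B \<one>\<^sub>B = x"
  and "\<And>x y z. x \<in> |B| ==> y \<in> |B| ==> z \<in> |B|
   ==> (x \<oplus>\<^sub>B y) \<otimes>\<^sub>B z = x \<otimes>\<^sub>B z \<oplus>\<^sub>B y \<otimes>\<^sub>B z"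
  and "\<And>x y z. x \<in> |B| ==> y \<in> |B| ==> z \<in> |B|
   ==> z \<otimes>\<^sub>B (x \<oplus>\<^sub>B y) = z \<otimes>\<^sub>B x \<oplus>\<^sub>B z \<otimes>\<^sub>B y"
  and "\<And>c x y. c \<in> |K| ==> x \<in> |B| ==> y \<in> |B|
   ==> (c \<odot>\<^sub>B x) \<otimes>\<^sub>B y = c \<odot>\<^sub>B (x \<otimes>\<^sub>B y)"
  and "\<And>c x y. c \<in> |K| ==> x \<in> |B| ==> y \<in> |B|
   ==> x \<otimes>\<^sub>B (c \<odot>\<^sub>B y) = c \<odot>\<^sub>B (x \<otimes>\<^sub>B y)"
 shows "assoc_algebra K B"
 by (intro assoc_algebra.intro assoc_algebra_axioms.intro ringI monoidI vs_abelian_group) (use assms in auto)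

lemma algD:
 assumes "assoc_algebra K B"
 shows "vspace B" "\<one>\<^sub>B \<in> |B|" "x \<in> |B| ==> y \<in> |B| ==> x \<otimes>\<^sub>B y \<in> |B|"
  "x \<in> |B| ==> y \<in> |B| ==> z \<in> |B|
   ==> (x \<otimes>\<^sub>B y) \<otimes>\<^sub>B z = x \<otimes>\<^sub>B (y \<otimes>\<^sub>B z)"
  "x \<in> |B| ==> \<one>\<^sub>B \<otimes>\<^sub>B x = x" "x \<in> |B| ==> x \<otimes>\<^sub>B \<one>\<^sub>B = x"
  "x \<in> |B| ==> y \<in> |B| ==> z \<in> |B|
   ==> (x \<oplus>\<^sub>B y) \<otimes>\<^sub>B z = x \<otimes>\<^sub>B z \<oplus>\<^sub>B y \<otimes>\<^sub>B z"
  "x \<in> |B| ==> y \<in> |B| ==> z \<in> |B|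
   ==> z \<otimes>\<^sub>B (x \<oplus>\<^sub>B y) = z \<otimes>\<^sub>B x \<oplus>\<^sub>B z \<otimes>\<^sub>B y"
  "c \<in> |K| ==> x \<in> |B| ==> y \<in> |B|
   ==> (c \<odot>\<^sub>B x) \<otimes>\<^sub>B y = c \<odot>\<^sub>B (x \<otimes>\<^sub>B y)"
  "c \<in> |K| ==> x \<in> |B| ==> y \<in> |B|
   ==> x \<otimes>\<^sub>B (c \<odot>\<^sub>B y) = c \<odot>\<^sub>B (x \<otimes>\<^sub>B y)"
  "ring B"
  "x \<in> |B| ==> \<zero>\<^sub>B \<otimes>\<^sub>B x = \<zero>\<^sub>B" "x \<in> |B| ==> x \<otimes>\<^sub>B \<zero>\<^sub>B = \<zero>\<^sub>B"
proof -
 interpret B: assoc_algebra K B by fact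
 show "vspace B" by (rule B.module_axioms)
 show "ring B" by (rule B.A.ring_axioms)
qed (use assoc_algebra.smult_mult_left[OF assms] assoc_algebra.smult_mult_right[OF assms]
   assoc_algebra.axioms(2)[OF assms] in \<open>auto simp: ring.ring_simprules ring.is_monoid
    monoid.m_closed monoid.m_assoc\<close>)

text \<open>
 The multiplication of \<open>F\<close> is only assumed to be bilinear; associativity and the unit laws need
 to hold in the quotient.
\<close>

lemma quot_algebra:
 assumes F: "vspace F" and W: "sub W F"
  and cl: "\<And>x y. x \<in> |F| ==> y \<in> |F| ==> x \<otimes>\<^sub>F y \<in> |F|"
  and l: "\<And>y. y \<in> |F| ==> klin F F (\<lambda>x. x \<otimes>\<^sub>F y)"
  and r: "\<And>x. x \<in> |F| ==> klin F F (\<lambda>y. x \<otimes>\<^sub>F y)"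
  and Wl: "\<And>x w. x \<in> |F| ==> w \<in> W ==> x \<otimes>\<^sub>F w \<in> W"
  and Wr: "\<And>x w. x \<in> |F| ==> w \<in> W ==> w \<otimes>\<^sub>F x \<in> W"
  and assoc: "\<And>x y z. x \<in> |F| ==> y \<in> |F| ==> z \<in> |F|
   ==> (x \<otimes>\<^sub>F y) \<otimes>\<^sub>F z \<ominus>\<^sub>F x \<otimes>\<^sub>F (y \<otimes>\<^sub>F z) \<in> W"
  and one: "\<one>\<^sub>F \<in> |F|" "\<And>x. x \<in> |F| ==> \<one>\<^sub>F \<otimes>\<^sub>F x \<ominus>\<^sub>F x \<in> W"
   "\<And>x. x \<in> |F| ==> x \<otimes>\<^sub>F \<one>\<^sub>F \<ominus>\<^sub>F x \<in> W"
 shows "assoc_algebra K (quotient F W)"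
  and "\<And>u v. u \<in> |F| ==> v \<in> |F|
   ==> (W +>\<^bsub>F\<^esub> u) \<otimes>\<^bsub>quotient F W\<^esub> (W +>\<^bsub>F\<^esub> v) = W +>\<^bsub>F\<^esub> (u \<otimes>\<^sub>F v)"
  and "\<one>\<^bsub>quotient F W\<^esub> = W +>\<^bsub>F\<^esub> \<one>\<^sub>F"
proof -
 let ?q = "\<lambda>v. W +>\<^bsub>F\<^esub> v" and ?Q = "quotient F W"
 show m: "?q u \<otimes>\<^sub>?Q ?q v = ?q (u \<otimes>\<^sub>F v)" if uv: "u \<in> |F|" "v \<in> |F|" for u v
 proof -
  have *: "?q (a \<otimes>\<^sub>F b) = ?q (u \<otimes>\<^sub>F v)" if ab: "a \<in> ?q u" "b \<in> ?q v" for a b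
  proof -
   note a = quot_mem[OF F W uv(1) ab(1)] and b = quot_mem[OF F W uv(2) ab(2)]
   have "?q (a \<otimes>\<^sub>F b) = ?q (u \<otimes>\<^sub>F b)"
    using Wr[OF b(1) a(2)] klinD(8)[OF l[OF b(1)] a(1) uv(1)] a b uv cl by (simp add: quot_eq[OF F W])
   also have "\<dots> = ?q (u \<otimes>\<^sub>F v)"
    using Wl[OF uv(1) b(2)] klinD(8)[OF r[OF uv(1)] b(1) uv(2)] b uv cl by (simp add: quot_eq[OF F W])
   finally show ?thesis .
  qed
  have "(\<Union>a\<in>?q u. \<Union>b\<in>?q v. ?q (a \<otimes>\<^sub>F b)) = (\<Union>a\<in>?q u. \<Union>b\<in>?q v. ?q (u \<otimes>\<^sub>F v))"
   by (intro SUP_cong refl) (rule *)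
  also have "\<dots> = ?q (u \<otimes>\<^sub>F v)" using quot_self[OF F W uv(1)] quot_self[OF F W uv(2)] by auto
  finally show ?thesis by (simp add: quotient_def rcoset_mult_def)
 qed
 show o: "\<one>\<^sub>?Q = ?q \<one>\<^sub>F" by (simp add: quotient_def)
 have Q: "vspace ?Q" by (rule quot_vs[OF F W])
 note L = klinD(4,5)[OF l] and R = klinD(4,5)[OF r]
 show "assoc_algebra K ?Q"
 proof (rule algI[OF Q])
  fix x y z assume "x \<in> |?Q|" "y \<in> |?Q|" "z \<in> |?Q|"
  then obtain u v w where u: "u \<in> |F|" "v \<in> |F|" "w \<in> |F|"
   "x = ?q u" "y = ?q v" "z = ?q w" unfolding quot_carrier by blast
  have "?q ((u \<otimes>\<^sub>F v) \<otimes>\<^sub>F w) = ?q (u \<otimes>\<^sub>F (v \<otimes>\<^sub>F w))"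
   using assoc[OF u(1-3)] u by (subst quot_eq[OF F W]) (auto simp: cl)
  then show "(x \<otimes>\<^sub>?Q y) \<otimes>\<^sub>?Q z = x \<otimes>\<^sub>?Q (y \<otimes>\<^sub>?Q z)" using u by (simp add: m cl)
  show "(x \<oplus>\<^sub>?Q y) \<otimes>\<^sub>?Q z = x \<otimes>\<^sub>?Q z \<oplus>\<^sub>?Q y \<otimes>\<^sub>?Q z"
   "z \<otimes>\<^sub>?Q (x \<oplus>\<^sub>?Q y) = z \<otimes>\<^sub>?Q x \<oplus>\<^sub>?Q z \<otimes>\<^sub>?Q y"
   using u F by (simp_all add: m cl quot_add[OF F W] L R)
 next
  fix x assume "x \<in> |?Q|"
  then obtain u where u: "u \<in> |F|" "x = ?q u" unfolding quot_carrier by blast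
  have "?q (\<one>\<^sub>F \<otimes>\<^sub>F u) = ?q u" "?q (u \<otimes>\<^sub>F \<one>\<^sub>F) = ?q u"
   using one u by (auto simp: cl quot_eq[OF F W])
  then show "\<one>\<^sub>?Q \<otimes>\<^sub>?Q x = x" "x \<otimes>\<^sub>?Q \<one>\<^sub>?Q = x" using u one(1) by (simp_all add: m o)
 next
  fix c x y assume c: "c \<in> |K|" and "x \<in> |?Q|" "y \<in> |?Q|"
  then obtain u v where u: "u \<in> |F|" "v \<in> |F|" "x = ?q u" "y = ?q v"
   unfolding quot_carrier by blast
  then show "(c \<odot>\<^sub>?Q x) \<otimes>\<^sub>?Q y = c \<odot>\<^sub>?Q (x \<otimes>\<^sub>?Q y)"
   "x \<otimes>\<^sub>?Q (c \<odot>\<^sub>?Q y) = c \<odot>\<^sub>?Q (x \<otimes>\<^sub>?Q y)"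
   using F c by (simp_all add: m cl quot_smult[OF F W] L R)
 next
  show "\<one>\<^sub>?Q \<in> |?Q|" using one(1) by (auto simp: o quot_carrier)
 next
  fix x y assume "x \<in> |?Q|" "y \<in> |?Q|"
  then show "x \<otimes>\<^sub>?Q y \<in> |?Q|" unfolding quot_carrier using m cl by auto
 qed
qed

subsection \<open>Free spaces\<close>

lemma free_in_K: "f \<in> |free_space K S| ==> f s \<in> |K|"
 unfolding free_space_def by (cases "s \<in> S") auto

lemma free_vs: "vspace (free_space K (S :: 's set))"
proof (rule pointwise_vs[OF Kv_vs, where S = UNIV])
 fix f g assume fg: "f \<in> |free_space K S|" "g \<in> |free_space K S|"
 have "{s. f s \<oplus> g s \<noteq> \<zero>} \<subseteq> {s. f s \<noteq> \<zero>} \<union> {s. g s \<noteq> \<zero>}" by auto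
 then have "finite {s. f s \<oplus> g s \<noteq> \<zero>}"
  using fg unfolding free_space_def by (simp add: finite_subset[OF _ finite_UnI])
 then show "f \<oplus>\<^bsub>free_space K S\<^esub> g \<in> |free_space K S|"
  using fg unfolding free_space_def by auto
next
 fix c f assume c: "c \<in> |K|" and f: "f \<in> |free_space K S|"
 have "{s. c \<otimes> f s \<noteq> \<zero>} \<subseteq> {s. f s \<noteq> \<zero>}" using c by auto
 then have "finite {s. c \<otimes> f s \<noteq> \<zero>}" using f unfolding free_space_def by (simp add: finite_subset)
 then show "c \<odot>\<^bsub>free_space K S\<^esub> f \<in> |free_space K S|" using c f unfolding free_space_def by auto
next
 show "f = g" if "\<And>s. s \<in> UNIV ==> f s = g s" for f g :: "'s \<Rightarrow> 'k" using that by (intro ext) simp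
qed (simp_all add: free_in_K, simp_all add: free_space_def Kv_simps)

lemma unit_vec_closed [simp]: "s \<in> S ==> unit_vec K s \<in> |free_space K S|"
 by (auto simp: free_space_def unit_vec_def)

lemma free_span: "kspan K (free_space K S) (unit_vec K ` S) = |free_space K S|"
proof
 let ?F = "free_space K S"
 have uv: "unit_vec K ` S \<subseteq> |?F|" by auto
 show "kspan K ?F (unit_vec K ` S) \<subseteq> |?F|" by (rule kspan_carrier[OF free_vs uv])
 note sp = kspan_sub[OF free_vs uv]
 have "f \<in> kspan K ?F (unit_vec K ` S)" if "finite T" "f \<in> |?F|" "{s. f s \<noteq> \<zero>} \<subseteq> T" for f T
  using that
 proof (induction T arbitrary: f)
  case empty
  then have "f = \<zero>\<^sub>?F" by (auto simp: free_space_def)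
  then show ?case using subD(3)[OF sp free_vs] by simp
 next
  case (insert t T)
  show ?case
  proof (cases "t \<in> S")
   case True
   define g where "g = f(t := \<zero>)"
   have g: "g \<in> |?F|" using insert.prems(1) unfolding g_def free_space_def
    by (auto elim!: finite_subset[rotated])
   have "{s. g s \<noteq> \<zero>} \<subseteq> T" using insert.prems(2) unfolding g_def by auto
   then have "g \<in> kspan K ?F (unit_vec K ` S)" using insert.IH g by blast
   moreover have "f t \<odot>\<^sub>?F unit_vec K t \<in> kspan K ?F (unit_vec K ` S)"
    by (rule subD(5)[OF sp free_vs free_in_K[OF insert.prems(1)]])
     (use True kspan_superset[of "unit_vec K ` S" ?F] in auto)
   moreover have "f = f t \<odot>\<^sub>?F unit_vec K t \<oplus>\<^sub>?F g"
    using free_in_K[OF insert.prems(1)] unfolding g_def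
    by (auto simp: free_space_def unit_vec_def)
   ultimately show ?thesis using subD(4)[OF sp free_vs] by metis
  next
   case False
   then have "f t = \<zero>" using insert.prems(1) by (auto simp: free_space_def)
   then have "{s. f s \<noteq> \<zero>} \<subseteq> T" using insert.prems(2) by auto
   then show ?thesis using insert.IH insert.prems(1) by blast
  qed
 qed
 then show "|?F| \<subseteq> kspan K ?F (unit_vec K ` S)" by (auto simp: free_space_def)
qed

lemma free_ext:
 assumes U: "vspace U" and u: "\<And>s. s \<in> S ==> u s \<in> |U|"
 obtains h where "klin (free_space K S) U h" "\<And>s. s \<in> S ==> h (unit_vec K s) = u s"
proof -
 interpret U: module K U by fact
 define h where "h = (\<lambda>f. finsum U (\<lambda>s. f s \<odot>\<^sub>U u s) {s. f s \<noteq> \<zero>})"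
 let ?F = "free_space K S"
 have supp: "{s. f s \<noteq> \<zero>} \<subseteq> S" "finite {s. f s \<noteq> \<zero>}" if "f \<in> |?F|" for f
  using that unfolding free_space_def by auto
 have cl: "f s \<odot>\<^sub>U u s \<in> |U|" if "f \<in> |?F|" "s \<in> S" for f s
  using u[OF that(2)] free_in_K[OF that(1)] U by simp
 have sup: "h f = finsum U (\<lambda>s. f s \<odot>\<^sub>U u s) T"
  if f: "f \<in> |?F|" and T: "finite T" "T \<subseteq> S" "{s. f s \<noteq> \<zero>} \<subseteq> T" for f T
  unfolding h_def
  by (rule U.M.add.finprod_mono_neutral_cong_left) (use that cl u in \<open>auto simp: subset_iff\<close>)
 have "klin ?F U h"
 proof (rule klinI[OF free_vs U])
  fix f assume f: "f \<in> |?F|"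
  show "h f \<in> |U|" unfolding h_def
   by (rule U.M.finsum_closed) (use cl[OF f] supp[OF f] in auto)
  show "h (c \<odot>\<^sub>?F f) = c \<odot>\<^sub>U h f" if c: "c \<in> |K|" for c
  proof -
   let ?T = "{s. f s \<noteq> \<zero>}"
   have cf: "c \<odot>\<^sub>?F f \<in> |?F|" using vs_simps(3)[OF free_vs c f] .
   have ap: "(c \<odot>\<^sub>?F f) s = c \<otimes> f s" for s by (simp add: free_space_def)
   have "h (c \<odot>\<^sub>?F f) = finsum U (\<lambda>s. (c \<odot>\<^sub>?F f) s \<odot>\<^sub>U u s) ?T"
    by (rule sup[OF cf]) (use supp[OF f] c in \<open>auto simp: ap\<close>)
   also have "\<dots> = finsum U (\<lambda>s. c \<odot>\<^sub>U (f s \<odot>\<^sub>U u s)) ?T"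
    by (rule U.M.finsum_cong')
     (use supp[OF f] c u free_in_K[OF f] U in \<open>auto simp: ap vs_smult(3) subset_iff\<close>)
   also have "\<dots> = c \<odot>\<^sub>U h f" unfolding h_def
    by (rule U.finsum_smult_ldistr[symmetric]) (use supp[OF f] cl[OF f] c in auto)
   finally show ?thesis .
  qed
  fix g assume g: "g \<in> |?F|"
  let ?T = "{s. f s \<noteq> \<zero>} \<union> {s. g s \<noteq> \<zero>}"
  have T: "finite ?T" "?T \<subseteq> S" using supp f g by auto
  have fg: "f \<oplus>\<^sub>?F g \<in> |?F|" using vs_simps(1)[OF free_vs f g] .
  have ap: "(f \<oplus>\<^sub>?F g) s = f s \<oplus> g s" for s by (simp add: free_space_def)
  have "h (f \<oplus>\<^sub>?F g) = finsum U (\<lambda>s. (f \<oplus>\<^sub>?F g) s \<odot>\<^sub>U u s) ?T"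
   by (rule sup[OF fg T]) (auto simp: ap)
  also have "\<dots> = finsum U (\<lambda>s. f s \<odot>\<^sub>U u s \<oplus>\<^sub>U g s \<odot>\<^sub>U u s) ?T"
   by (rule U.M.finsum_cong')
    (use T u free_in_K[OF f] free_in_K[OF g] U in \<open>auto simp: ap vs_smult(2) subset_iff\<close>)
  also have "\<dots> = finsum U (\<lambda>s. f s \<odot>\<^sub>U u s) ?T \<oplus>\<^sub>U finsum U (\<lambda>s. g s \<odot>\<^sub>U u s) ?T"
   by (rule U.M.finsum_addf) (use T cl f g in \<open>auto simp: subset_iff\<close>)
  also have "\<dots> = h f \<oplus>\<^sub>U h g" using sup[OF f T] sup[OF g T] by auto
  finally show "h (f \<oplus>\<^sub>?F g) = h f \<oplus>\<^sub>U h g" .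
 qed
 moreover have "h (unit_vec K s) = u s" if s: "s \<in> S" for s
 proof -
  have "h (unit_vec K s) = finsum U (\<lambda>t. unit_vec K s t \<odot>\<^sub>U u t) {s}"
   by (rule sup[OF unit_vec_closed[OF s]]) (use s in \<open>auto simp: unit_vec_def\<close>)
  also have "\<dots> = u s" using u[OF s] by (simp add: unit_vec_def)
  finally show ?thesis .
 qed
 ultimately show ?thesis using that by blast
qed

subsection \<open>Modules over algebras\<close>

lemma rmodI:
 assumes "assoc_algebra K B" "vspace X"
  and "\<And>x b. x \<in> |X| ==> b \<in> |B| ==> x \<lhd>\<^sub>X b \<in> |X|"
  and "\<And>x y b. x \<in> |X| ==> y \<in> |X| ==> b \<in> |B|
   ==> (x \<oplus>\<^sub>X y) \<lhd>\<^sub>X b = x \<lhd>\<^sub>X b \<oplus>\<^sub>X y \<lhd>\<^sub>X b"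
  and "\<And>x b b'. x \<in> |X| ==> b \<in> |B| ==> b' \<in> |B|
   ==> x \<lhd>\<^sub>X (b \<oplus>\<^sub>B b') = x \<lhd>\<^sub>X b \<oplus>\<^sub>X x \<lhd>\<^sub>X b'"
  and "\<And>x b b'. x \<in> |X| ==> b \<in> |B| ==> b' \<in> |B|
   ==> x \<lhd>\<^sub>X (b \<otimes>\<^sub>B b') = (x \<lhd>\<^sub>X b) \<lhd>\<^sub>X b'"
  and "\<And>x. x \<in> |X| ==> x \<lhd>\<^sub>X \<one>\<^sub>B = x"
  and "\<And>c x b. c \<in> |K| ==> x \<in> |X| ==> b \<in> |B|
   ==> (c \<odot>\<^sub>X x) \<lhd>\<^sub>X b = c \<odot>\<^sub>X (x \<lhd>\<^sub>X b)"
  and "\<And>c x b. c \<in> |K| ==> x \<in> |X| ==> b \<in> |B|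
   ==> x \<lhd>\<^sub>X (c \<odot>\<^sub>B b) = c \<odot>\<^sub>X (x \<lhd>\<^sub>X b)"
 shows "right_module K B X"
 by (intro right_module.intro right_module_axioms.intro) (use assms in auto)

lemma rmodD:
 assumes "right_module K B X"
 shows "assoc_algebra K B" "vspace X" "x \<in> |X| ==> b \<in> |B| ==> x \<lhd>\<^sub>X b \<in> |X|"
  "x \<in> |X| ==> y \<in> |X| ==> b \<in> |B|
   ==> (x \<oplus>\<^sub>X y) \<lhd>\<^sub>X b = x \<lhd>\<^sub>X b \<oplus>\<^sub>X y \<lhd>\<^sub>X b"
  "x \<in> |X| ==> b \<in> |B| ==> b' \<in> |B|
   ==> x \<lhd>\<^sub>X (b \<oplus>\<^sub>B b') = x \<lhd>\<^sub>X b \<oplus>\<^sub>X x \<lhd>\<^sub>X b'"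
  "x \<in> |X| ==> b \<in> |B| ==> b' \<in> |B|
   ==> x \<lhd>\<^sub>X (b \<otimes>\<^sub>B b') = (x \<lhd>\<^sub>X b) \<lhd>\<^sub>X b'"
  "x \<in> |X| ==> x \<lhd>\<^sub>X \<one>\<^sub>B = x"
  "c \<in> |K| ==> x \<in> |X| ==> b \<in> |B|
   ==> (c \<odot>\<^sub>X x) \<lhd>\<^sub>X b = c \<odot>\<^sub>X (x \<lhd>\<^sub>X b)"
  "c \<in> |K| ==> x \<in> |X| ==> b \<in> |B|
   ==> x \<lhd>\<^sub>X (c \<odot>\<^sub>B b) = c \<odot>\<^sub>X (x \<lhd>\<^sub>X b)"
proof -
 interpret X: right_module K B X by fact
 show "assoc_algebra K B" by (rule X.assoc_algebra_axioms)
 show "vspace X" by (rule X.N.module_axioms)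
qed (use right_module.ract_closed[OF assms] right_module.ract_add_left[OF assms]
 right_module.ract_add_right[OF assms] right_module.ract_assoc[OF assms] right_module.ract_one[OF assms]
 right_module.ract_smult_left[OF assms] right_module.ract_smult_right[OF assms] in auto)

lemma rmod_klin:
 assumes "right_module K B X"
 shows "b \<in> |B| ==> klin X X (\<lambda>x. x \<lhd>\<^sub>X b)"
  and "x \<in> |X| ==> klin B X (\<lambda>b. x \<lhd>\<^sub>X b)"
 by (rule klinI; simp add: rmodD[OF assms] algD(1)[OF rmodD(1)[OF assms]])+

lemma alg_klin:
 assumes "assoc_algebra K B" "b \<in> |B|"
 shows "klin B B (\<lambda>x. x \<otimes>\<^sub>B b)" "klin B B (\<lambda>x. b \<otimes>\<^sub>B x)"
 by (rule klinI; use assms in \<open>simp add: algD\<close>)+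

lemma rmod_sub:
 assumes X: "right_module K B X" and U: "sub U X" "\<And>u b. u \<in> U ==> b \<in> |B| ==> u \<lhd>\<^sub>X b \<in> U"
 shows "right_module K B (X\<lparr>carrier := U\<rparr>)"
 by (rule rmodI[OF rmodD(1)[OF X] vs_sub[OF rmodD(2)[OF X] U(1)]])
  (use U subD(2)[OF U(1) rmodD(2)[OF X]] in \<open>auto simp: rmodD[OF X]\<close>)

text \<open>
 As for vector spaces, the module axioms are pushed forward along a surjection.
\<close>

lemma rmod_image:
 assumes X: "right_module K B X" and img: "|U| = q ` |X|"
  and add: "\<And>x y. x \<in> |X| ==> y \<in> |X| ==> q x \<oplus>\<^sub>U q y = q (x \<oplus>\<^sub>X y)"
  and smult: "\<And>c x. c \<in> |K| ==> x \<in> |X| ==> c \<odot>\<^sub>U q x = q (c \<odot>\<^sub>X x)"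
  and zero: "\<zero>\<^sub>U = q \<zero>\<^sub>X"
  and ract: "\<And>x b. x \<in> |X| ==> b \<in> |B| ==> q x \<lhd>\<^sub>U b = q (x \<lhd>\<^sub>X b)"
 shows "right_module K B U"
proof -
 note X' = rmodD[OF X] algD[OF rmodD(1)[OF X]]
 show ?thesis
  by (rule rmodI[OF X'(1) vs_image[OF X'(2) img add smult zero]])
   (auto simp: img X' add smult ract)
qed

lemma bimodD:
 assumes "bimodule K A B N"
 shows "right_module K B N" "assoc_algebra K A" "vspace N"
  "a \<in> |A| ==> n \<in> |N| ==> a \<rhd>\<^sub>N n \<in> |N|"
  "a \<in> |A| ==> n \<in> |N| ==> n' \<in> |N|
   ==> a \<rhd>\<^sub>N (n \<oplus>\<^sub>N n') = (a \<rhd>\<^sub>N n) \<oplus>\<^sub>N (a \<rhd>\<^sub>N n')"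
  "a \<in> |A| ==> a' \<in> |A| ==> n \<in> |N|
   ==> (a \<oplus>\<^sub>A a') \<rhd>\<^sub>N n = (a \<rhd>\<^sub>N n) \<oplus>\<^sub>N (a' \<rhd>\<^sub>N n)"
  "a \<in> |A| ==> a' \<in> |A| ==> n \<in> |N|
   ==> (a \<otimes>\<^sub>A a') \<rhd>\<^sub>N n = a \<rhd>\<^sub>N (a' \<rhd>\<^sub>N n)"
  "n \<in> |N| ==> \<one>\<^sub>A \<rhd>\<^sub>N n = n"
  "c \<in> |K| ==> a \<in> |A| ==> n \<in> |N|
   ==> (c \<odot>\<^sub>A a) \<rhd>\<^sub>N n = c \<odot>\<^sub>N (a \<rhd>\<^sub>N n)"
  "c \<in> |K| ==> a \<in> |A| ==> n \<in> |N|
   ==> a \<rhd>\<^sub>N (c \<odot>\<^sub>N n) = c \<odot>\<^sub>N (a \<rhd>\<^sub>N n)"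
  "a \<in> |A| ==> n \<in> |N| ==> b \<in> |B|
   ==> (a \<rhd>\<^sub>N n) \<lhd>\<^sub>N b = a \<rhd>\<^sub>N (n \<lhd>\<^sub>N b)"
proof -
 interpret N: bimodule K A B N by fact
 show r: "right_module K B N" by (rule N.right_module_axioms)
 show "assoc_algebra K A" by (rule N.A.assoc_algebra_axioms)
 show "vspace N" by (rule rmodD(2)[OF r])
qed (use bimodule.lact_closed[OF assms] bimodule.lact_add_right[OF assms] bimodule.lact_add_left[OF assms]
 bimodule.lact_assoc[OF assms] bimodule.lact_one[OF assms] bimodule.lact_smult_left[OF assms]
 bimodule.lact_smult_right[OF assms] bimodule.lact_ract[OF assms] in auto)

lemma bimodI:
 assumes "right_module K B N" "assoc_algebra K A"
  "\<And>a n. a \<in> |A| ==> n \<in> |N| ==> a \<rhd>\<^sub>N n \<in> |N|"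
  "\<And>a n n'. a \<in> |A| ==> n \<in> |N| ==> n' \<in> |N|
   ==> a \<rhd>\<^sub>N (n \<oplus>\<^sub>N n') = (a \<rhd>\<^sub>N n) \<oplus>\<^sub>N (a \<rhd>\<^sub>N n')"
  "\<And>a a' n. a \<in> |A| ==> a' \<in> |A| ==> n \<in> |N|
   ==> (a \<oplus>\<^sub>A a') \<rhd>\<^sub>N n = (a \<rhd>\<^sub>N n) \<oplus>\<^sub>N (a' \<rhd>\<^sub>N n)"
  "\<And>a a' n. a \<in> |A| ==> a' \<in> |A| ==> n \<in> |N|
   ==> (a \<otimes>\<^sub>A a') \<rhd>\<^sub>N n = a \<rhd>\<^sub>N (a' \<rhd>\<^sub>N n)"
  "\<And>n. n \<in> |N| ==> \<one>\<^sub>A \<rhd>\<^sub>N n = n"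
  "\<And>c a n. c \<in> |K| ==> a \<in> |A| ==> n \<in> |N|
   ==> (c \<odot>\<^sub>A a) \<rhd>\<^sub>N n = c \<odot>\<^sub>N (a \<rhd>\<^sub>N n)"
  "\<And>c a n. c \<in> |K| ==> a \<in> |A| ==> n \<in> |N|
   ==> a \<rhd>\<^sub>N (c \<odot>\<^sub>N n) = c \<odot>\<^sub>N (a \<rhd>\<^sub>N n)"
  "\<And>a n b. a \<in> |A| ==> n \<in> |N| ==> b \<in> |B|
   ==> (a \<rhd>\<^sub>N n) \<lhd>\<^sub>N b = a \<rhd>\<^sub>N (n \<lhd>\<^sub>N b)"
 shows "bimodule K A B N"
 by (intro bimodule.intro bimodule_axioms.intro) (use assms in auto)

subsection \<open>Tensor products\<close>

definition balanced :: "('k, 'a) module \<Rightarrow> ('k, 'a, 'x) rmodule \<Rightarrow> ('k, 'a, 'b, 'n) bimodule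
  \<Rightarrow> ('k, 'u, 'z) module_scheme \<Rightarrow> ('x \<Rightarrow> 'n \<Rightarrow> 'u) \<Rightarrow> bool" where
 "balanced A X N U \<beta> \<longleftrightarrow> (\<forall>n\<in>|N|. klin X U (\<lambda>x. \<beta> x n)) \<and> (\<forall>x\<in>|X|. klin N U (\<beta> x)) \<and>
   (\<forall>x\<in>|X|. \<forall>a\<in>|A|. \<forall>n\<in>|N|. \<beta> (x \<lhd>\<^sub>X a) n = \<beta> x (a \<rhd>\<^sub>N n))"

lemma balancedD:
 assumes "balanced A X N U \<beta>"
 shows "n \<in> |N| ==> klin X U (\<lambda>x. \<beta> x n)" "x \<in> |X| ==> klin N U (\<beta> x)"
  "x \<in> |X| ==> a \<in> |A| ==> n \<in> |N| ==> \<beta> (x \<lhd>\<^sub>X a) n = \<beta> x (a \<rhd>\<^sub>N n)"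
 using assms unfolding balanced_def by auto

context
 fixes A :: "('k, 'a) module" and X :: "('k, 'a, 'x) rmodule" and N :: "('k, 'a, 'b, 'n) bimodule"
  and B :: "('k, 'b, 'z) module_scheme"
 assumes X: "right_module K A X" and N: "bimodule K A B N"
begin

abbreviation (input) FXN where "FXN \<equiv> free_space K ( |X| \<times> |N| )"
abbreviation (input) TXN where "TXN \<equiv> tensor_space K A X N"
abbreviation (input) XN where "XN \<equiv> tensor K A X N"
abbreviation (input) pXN where "pXN \<equiv> pure_tensor K A X N"

lemma tensor_rels_subset: "tensor_rels K A X N \<subseteq> |FXN|"
proof -
 note s = rmodD[OF X] bimodD[OF N]
 show ?thesis unfolding tensor_rels_def Let_def using s free_vs[of "|X| \<times> |N|"] by auto
qed

lemma tensor_null_sub: "sub (tensor_null K A X N) FXN"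
 unfolding tensor_null_def by (rule kspan_sub[OF free_vs tensor_rels_subset])

lemma tensor_space_vs: "vspace TXN"
 unfolding tensor_space_def by (rule quot_vs[OF free_vs tensor_null_sub])

lemma tensor_sels:
 "|XN| = |TXN|"
 "add XN = add TXN"
 "zero XN = zero TXN"
 "smult XN = smult TXN"
 "ract XN = (\<lambda>t b. tensor_map K A X N X N (\<lambda>x. x) (\<lambda>n. n \<lhd>\<^sub>N b) t)"
 by (simp_all add: tensor_def module.extend_def rmodule.fields_def)

lemma tensor_vs: "vspace XN"
 by (rule vs_image[OF tensor_space_vs, where q = "\<lambda>x. x"]) (simp_all add: tensor_sels)

lemma klin_tensor:
 "klin XN U h \<longleftrightarrow> klin TXN U h"
 "klin U' XN h' \<longleftrightarrow> klin U' TXN h'"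
 by (simp_all add: klin_def tensor_vs tensor_space_vs tensor_sels)

text \<open>
 Each clause of the bilinearity of \<open>x \<otimes> n\<close> is one family of generators of the relations.
\<close>

lemma balanced_pure: "balanced A X N XN pXN"
proof -
 let ?q = "\<lambda>u. tensor_null K A X N +>\<^bsub>FXN\<^esub> u" and ?e = "unit_vec K"
 note s = rmodD[OF X] bimodD[OF N] and F = free_vs[of "|X| \<times> |N|"]
 note k = klinD(3-5)[OF quot_klin[OF F tensor_null_sub], folded tensor_space_def]
 have e: "?q u = ?q v" if "u \<ominus>\<^bsub>FXN\<^esub> v \<in> tensor_rels K A X N" "u \<in> |FXN|" "v \<in> |FXN|" for u v
  unfolding quot_eq[OF F tensor_null_sub that(2,3)] unfolding tensor_null_def
  using that(1) kspan_superset[of "tensor_rels K A X N" FXN] by blast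
 note rels = tensor_rels_def[of K A X N, unfolded Let_def]
 have "?q (?e (x \<oplus>\<^sub>X x', n)) = ?q (?e (x, n) \<oplus>\<^bsub>FXN\<^esub> ?e (x', n))"
  if "x \<in> |X|" "x' \<in> |X|" "n \<in> |N|" for x x' n
  by (rule e) (use that in \<open>unfold rels, blast, simp_all add: s F\<close>)
 moreover have "?q (?e (x, n \<oplus>\<^sub>N n')) = ?q (?e (x, n) \<oplus>\<^bsub>FXN\<^esub> ?e (x, n'))"
  if "x \<in> |X|" "n' \<in> |N|" "n \<in> |N|" for x n n'
  by (rule e) (use that in \<open>unfold rels, blast, simp_all add: s F\<close>)
 moreover have "?q (?e (c \<odot>\<^sub>X x, n)) = ?q (c \<odot>\<^bsub>FXN\<^esub> ?e (x, n))" "?q (?e (x, c \<odot>\<^sub>N n)) = ?q (c \<odot>\<^bsub>FXN\<^esub> ?e (x, n))"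
  if "x \<in> |X|" "c \<in> |K|" "n \<in> |N|" for x c n
  by (rule e, use that in \<open>unfold rels, blast, simp_all add: s F\<close>)+
 moreover have "?q (?e (x \<lhd>\<^sub>X a, n)) = ?q (?e (x, a \<rhd>\<^sub>N n))"
  if "x \<in> |X|" "a \<in> |A|" "n \<in> |N|" for x a n
  by (rule e) (use that in \<open>unfold rels, blast, simp_all add: s F\<close>)
 ultimately show ?thesis unfolding balanced_def klin_tensor pure_tensor_def
  by (auto intro!: klinI simp: s tensor_space_vs k)
qed

lemma tensor_span:
 "kspan K XN {pXN x n | x n. x \<in> |X| \<and> n \<in> |N|}
  = |XN|"
proof -
 let ?S = "|X| \<times> |N|"
 let ?q = "\<lambda>v. tensor_null K A X N +>\<^bsub>FXN\<^esub> v"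
 have q: "klin FXN XN ?q"
  unfolding klin_tensor unfolding tensor_space_def by (rule quot_klin[OF free_vs tensor_null_sub])
 have "?q ` kspan K FXN (unit_vec K ` ?S) = kspan K XN (?q ` unit_vec K ` ?S)"
  by (rule kspan_image[OF q]) auto
 moreover have "?q ` unit_vec K ` ?S = {pXN x n | x n. x \<in> |X| \<and> n \<in> |N|}"
  by (auto simp: pure_tensor_def image_iff)
 moreover have "?q ` |FXN| = |XN|"
  unfolding tensor_sels tensor_space_def quot_carrier ..
 ultimately show ?thesis unfolding free_span by simp
qed

lemma tensor_induct [consumes 1, case_names pure add smult]:
 assumes "t \<in> |XN|"
  and "\<And>x n. x \<in> |X| ==> n \<in> |N| ==> Q (pXN x n)"
  and "\<And>s t. s \<in> |XN| ==> t \<in> |XN| ==> Q s ==> Q t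
   ==> Q (s \<oplus>\<^bsub>XN\<^esub> t)"
  and "\<And>c t. c \<in> |K| ==> t \<in> |XN| ==> Q t ==> Q (c \<odot>\<^bsub>XN\<^esub> t)"
 shows "Q t"
proof -
 have p: "{pXN x n | x n. x \<in> |X| \<and> n \<in> |N|} \<subseteq> |XN|"
  using klinD(3)[OF balancedD(2)[OF balanced_pure]] by auto
 have z: "\<zero>\<^bsub>XN\<^esub> = \<zero> \<odot>\<^bsub>XN\<^esub> pXN \<zero>\<^sub>X \<zero>\<^sub>N"
  using klinD(3)[OF balancedD(2)[OF balanced_pure]] rmodD(2)[OF X] bimodD(3)[OF N] tensor_vs
  by simp
 have t: "t \<in> kspan K XN {pXN x n | x n. x \<in> |X| \<and> n \<in> |N|}"
  using assms(1) tensor_span by simp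
 have zQ: "Q \<zero>\<^bsub>XN\<^esub>" unfolding z
  by (rule assms(4)[OF _ _ assms(2)])
   (use klinD(3)[OF balancedD(2)[OF balanced_pure]] rmodD(2)[OF X] bimodD(3)[OF N] in auto)
 show ?thesis using t tensor_vs p
  by (induction rule: kspan_induct) (use assms(2-4) zQ in auto)
qed

lemma tensor_eqI:
 assumes "klin XN U f" "klin XN U g"
  and "\<And>x n. x \<in> |X| ==> n \<in> |N| ==> f (pXN x n) = g (pXN x n)"
  and "t \<in> |XN|"
 shows "f t = g t"
 using assms(4) by (induction rule: tensor_induct) (simp_all add: assms klinD[OF assms(1)] klinD[OF assms(2)])

lemma tensor_lift:
 assumes U: "vspace U" and b: "balanced A X N U \<beta>"
 obtains h where "klin XN U h"
  "\<And>x n. x \<in> |X| ==> n \<in> |N| ==> h (pXN x n) = \<beta> x n"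
proof -
 let ?S = "|X| \<times> |N|"
 note s = rmodD[OF X] bimodD[OF N]
 have cl: "\<beta> x n \<in> |U|" if "x \<in> |X|" "n \<in> |N|" for x n
  using klinD(3)[OF balancedD(2)[OF b]] that by auto
 obtain g where g: "klin FXN U g" "\<And>s. s \<in> ?S ==> g (unit_vec K s) = \<beta> (fst s) (snd s)"
  by (rule free_ext[OF U, of ?S "\<lambda>s. \<beta> (fst s) (snd s)"]) (use cl in auto)
 note gs = klinD[OF g(1)] and F = free_vs[of ?S]
 have "g w = \<zero>\<^sub>U" if w: "w \<in> tensor_null K A X N" for w
 proof -
  have "tensor_rels K A X N \<subseteq> {x \<in> |FXN|. g x = \<zero>\<^sub>U}"
  proof
   fix r assume r: "r \<in> tensor_rels K A X N"
   have "g r = \<zero>\<^sub>U"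
    using r U F unfolding tensor_rels_def Let_def
    by (auto simp: gs g(2) s klinD[OF balancedD(1)[OF b]] klinD[OF balancedD(2)[OF b]] cl
      balancedD(3)[OF b])
   then show "r \<in> {x \<in> |FXN|. g x = \<zero>\<^sub>U}" using tensor_rels_subset r by auto
  qed
  then have "tensor_null K A X N \<subseteq> {x \<in> |FXN|. g x = \<zero>\<^sub>U}"
   unfolding tensor_null_def by (rule kspan_least[OF klin_kernel_sub[OF g(1)]])
  then show ?thesis using w by auto
 qed
 then obtain h where h: "klin TXN U h"
  "\<And>v. v \<in> |FXN| ==> h (tensor_null K A X N +>\<^bsub>FXN\<^esub> v) = g v"
  using quot_lift[OF free_vs tensor_null_sub g(1)] unfolding tensor_space_def by blast
 show ?thesis
  by (rule that[of h]) (use h g(2) in \<open>auto simp: klin_tensor pure_tensor_def\<close>)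
qed

end

text \<open>
 The map \<open>f \<otimes> g\<close> is given by a definite description; the universal property gives a
 candidate, and pure tensors show that it is the only one.
\<close>

lemma tensor_map_props:
 assumes X: "right_module K A X" and N: "bimodule K A B N"
  and X': "right_module K A X'" and N': "bimodule K A B' N'"
  and f: "klin X X' f" "\<And>x a. x \<in> |X| ==> a \<in> |A| ==> f (x \<lhd>\<^sub>X a) = f x \<lhd>\<^sub>X' a"
  and g: "klin N N' g" "\<And>n a. n \<in> |N| ==> a \<in> |A| ==> g (a \<rhd>\<^sub>N n) = a \<rhd>\<^sub>N' g n"
 shows "klin (tensor K A X N) (tensor K A X' N') (tensor_map K A X N X' N' f g)"
  and "\<And>x n. x \<in> |X| ==> n \<in> |N|
   ==> tensor_map K A X N X' N' f g (pure_tensor K A X N x n) = pure_tensor K A X' N' (f x) (g n)"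
proof -
 note bp = balanced_pure[OF X' N']
 note kt = klin_tensor[OF X N] klin_tensor[OF X' N']
 have "balanced A X N (tensor K A X' N') (\<lambda>x n. pure_tensor K A X' N' (f x) (g n))"
  unfolding balanced_def
  using klin_comp[OF f(1) balancedD(1)[OF bp]] klin_comp[OF g(1) balancedD(2)[OF bp]]
   klinD(3)[OF f(1)] klinD(3)[OF g(1)] balancedD(3)[OF bp] f(2) g(2) by auto
 then obtain h where h: "klin (tensor K A X N) (tensor K A X' N') h"
  "\<And>x n. x \<in> |X| ==> n \<in> |N| ==> h (pure_tensor K A X N x n) = pure_tensor K A X' N' (f x) (g n)"
  using tensor_lift[OF X N tensor_vs[OF X' N']] by blast
 define h' where "h' = restrict h |tensor_space K A X N|"
 have pc: "pure_tensor K A X N x n \<in> |tensor_space K A X N|"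
  if "x \<in> |X|" "n \<in> |N|" for x n
  using klinD(3)[OF balancedD(2)[OF balanced_pure[OF X N]]] that by (simp add: tensor_sels[OF X N])
 let ?Q = "\<lambda>h. h \<in> lin_maps K (tensor_space K A X N) (tensor_space K A X' N') \<and>
    (\<forall>x\<in>|X|. \<forall>n\<in>|N|.
      h (pure_tensor K A X N x n) = pure_tensor K A X' N' (f x) (g n))"
 note ts = tensor_space_vs[OF X N] tensor_space_vs[OF X' N']
 have hs: "klin (tensor_space K A X N) (tensor_space K A X' N') h" using h(1) unfolding kt .
 have h': "?Q h'"
  using klinD[OF hs] h(2) pc ts unfolding lin_maps_def h'_def by auto
 have lk: "klin (tensor_space K A X N) (tensor_space K A X' N') u"
  if "u \<in> lin_maps K (tensor_space K A X N) (tensor_space K A X' N')" for u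
  using that ts unfolding klin_def lin_maps_def by auto
 have eq: "tensor_map K A X N X' N' f g = h'"
  unfolding tensor_map_def
 proof (rule the_equality)
  show "?Q h'" by (rule h')
  fix u assume u: "?Q u"
  show "u = h'"
  proof (rule extensionalityI)
   show "u \<in> extensional |tensor_space K A X N|"
    using u unfolding lin_maps_def by (auto simp: PiE_def)
   show "h' \<in> extensional |tensor_space K A X N|" unfolding h'_def by simp
   fix t assume t: "t \<in> |tensor_space K A X N|"
   show "u t = h' t"
    by (rule tensor_eqI[OF X N, of "tensor K A X' N'"])
     (use lk[of u] lk[of h'] u h' t in \<open>auto simp: kt tensor_sels[OF X N]\<close>)
  qed
 qed
 show "klin (tensor K A X N) (tensor K A X' N') (tensor_map K A X N X' N' f g)"
  unfolding eq kt by (rule lk) (use h' in blast)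
 show "\<And>x n. x \<in> |X| ==> n \<in> |N|
   ==> tensor_map K A X N X' N' f g (pure_tensor K A X N x n) = pure_tensor K A X' N' (f x) (g n)"
  unfolding eq using h' by blast
qed

lemma tensor_right_module:
 assumes X: "right_module K A X" and N: "bimodule K A B N"
 shows "right_module K B (tensor K A X N)"
  and "\<And>x n b. x \<in> |X| ==> n \<in> |N| ==> b \<in> |B|
   ==> pure_tensor K A X N x n \<lhd>\<^bsub>tensor K A X N\<^esub> b = pure_tensor K A X N x (n \<lhd>\<^sub>N b)"
proof -
 let ?T = "tensor K A X N" and ?p = "pure_tensor K A X N"
 note s = rmodD[OF X] bimodD[OF N] rmodD[OF bimodD(1)[OF N]] and B = rmodD(1)[OF bimodD(1)[OF N]]
 note T = tensor_vs[OF X N]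
 have props: "klin ?T ?T (\<lambda>t. t \<lhd>\<^sub>?T b)"
  "\<And>x n. x \<in> |X| ==> n \<in> |N| ==> ?p x n \<lhd>\<^sub>?T b = ?p x (n \<lhd>\<^sub>N b)"
  if b: "b \<in> |B|" for b
  unfolding tensor_sels(5)[OF X N]
  by (rule tensor_map_props[OF X N X N]; use b s rmod_klin(1)[OF bimodD(1)[OF N]] in \<open>simp add: klin_id\<close>)+
 then show "\<And>x n b. x \<in> |X| ==> n \<in> |N| ==> b \<in> |B| ==> ?p x n \<lhd>\<^sub>?T b = ?p x (n \<lhd>\<^sub>N b)" by blast
 note bp = klinD[OF balancedD(2)[OF balanced_pure[OF X N]]]
 show "right_module K B ?T"
 proof (rule rmodI[OF B T])
  fix t b b' assume t: "t \<in> |?T|" and b: "b \<in> |B|" "b' \<in> |B|"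
  note tb = props(1)[OF b(1)] props(1)[OF b(2)]
  show "t \<lhd>\<^sub>?T (b \<oplus>\<^sub>B b') = t \<lhd>\<^sub>?T b \<oplus>\<^sub>?T t \<lhd>\<^sub>?T b'"
   by (rule tensor_eqI[OF X N props(1) klin_add[OF tb]])
    (use b t B in \<open>simp_all add: props(2) bp s algD\<close>)
  show "t \<lhd>\<^sub>?T (b \<otimes>\<^sub>B b') = (t \<lhd>\<^sub>?T b) \<lhd>\<^sub>?T b'"
   by (rule tensor_eqI[OF X N props(1) klin_comp[OF tb]])
    (use b t B in \<open>simp_all add: props(2) bp s algD\<close>)
 next
  fix t assume t: "t \<in> |?T|"
  show "t \<lhd>\<^sub>?T \<one>\<^sub>B = t"
   by (rule tensor_eqI[OF X N props(1) klin_id[OF T]]) (use t B in \<open>simp_all add: props(2) s algD\<close>)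
 next
  fix c t b assume *: "c \<in> |K|" "t \<in> |?T|" "b \<in> |B|"
  show "t \<lhd>\<^sub>?T (c \<odot>\<^sub>B b) = c \<odot>\<^sub>?T (t \<lhd>\<^sub>?T b)"
   by (rule tensor_eqI[OF X N props(1) klin_smult[OF props(1)[OF *(3)] *(1)]])
    (use B * in \<open>simp_all add: props(2) bp s algD\<close>)
 qed (simp_all add: klinD[OF props(1)])
qed

end

context kfield
begin

section \<open>Duality\<close>

subsection \<open>Dual spaces and dual bimodules\<close>

lemma form_klin: "\<phi> \<in> linear_forms K V ==> vspace V ==> klin V Kv \<phi>"
 by (rule klinI) (simp_all add: formD)

lemma klin_form: "klin V Kv f ==> restrict f |V| \<in> linear_forms K V"
 by (rule formI) (use klinD[of V Kv f] in simp_all)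

lemma klin_form': "klin V Kv f ==> f \<in> extensional |V| ==> f \<in> linear_forms K V"
 using klin_form[of V f] by (simp add: extensional_restrict)

lemma klin_cong:
 assumes "klin V W f" "\<And>x. x \<in> |V| ==> g x = f x"
 shows "klin V W g"
 using assms unfolding klin_def by simp

lemma form_eqI:
 assumes "\<phi> \<in> linear_forms K V" "\<psi> \<in> linear_forms K V" "\<And>v. v \<in> |V| ==> \<phi> v = \<psi> v"
 shows "\<phi> = \<psi>"
 by (rule extensionalityI[OF formD(4)[OF assms(1)] formD(4)[OF assms(2)] assms(3)])

lemma dual_sels:
 "|dual K N| = linear_forms K N" "zero (dual K N) = (\<lambda>n\<in>|N|. \<zero>)"
 "n \<in> |N| ==> \<zero>\<^bsub>dual K N\<^esub> n = \<zero>"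
 "n \<in> |N| ==> (\<phi> \<oplus>\<^bsub>dual K N\<^esub> \<psi>) n = \<phi> n \<oplus> \<psi> n"
 "n \<in> |N| ==> (c \<odot>\<^bsub>dual K N\<^esub> \<phi>) n = c \<otimes> \<phi> n"
 "n \<in> |N| ==> (\<phi> \<lhd>\<^bsub>dual K N\<^esub> a) n = \<phi> (a \<rhd>\<^sub>N n)"
 "n \<in> |N| ==> (b \<rhd>\<^bsub>dual K N\<^esub> \<phi>) n = \<phi> (n \<lhd>\<^sub>N b)"
 by (simp_all add: dual_def)

lemma dual_ext:
 "\<zero>\<^bsub>dual K N\<^esub> \<in> extensional |N|" "\<phi> \<oplus>\<^bsub>dual K N\<^esub> \<psi> \<in> extensional |N|"
 "c \<odot>\<^bsub>dual K N\<^esub> \<phi> \<in> extensional |N|" "\<phi> \<lhd>\<^bsub>dual K N\<^esub> a \<in> extensional |N|"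
 "b \<rhd>\<^bsub>dual K N\<^esub> \<phi> \<in> extensional |N|"
 by (simp_all add: dual_def)

lemma dual_closed:
 assumes N: "vspace N"
 shows "\<zero>\<^bsub>dual K N\<^esub> \<in> linear_forms K N"
  and "\<phi> \<in> linear_forms K N ==> \<psi> \<in> linear_forms K N ==> \<phi> \<oplus>\<^bsub>dual K N\<^esub> \<psi> \<in> linear_forms K N"
  and "c \<in> |K| ==> \<phi> \<in> linear_forms K N ==> c \<odot>\<^bsub>dual K N\<^esub> \<phi> \<in> linear_forms K N"
proof -
 show "\<zero>\<^bsub>dual K N\<^esub> \<in> linear_forms K N"
  by (rule klin_form'[OF klin_cong[OF klin_zero[OF N Kv_vs]]]) (simp_all add: dual_sels dual_ext)
 show "\<phi> \<oplus>\<^bsub>dual K N\<^esub> \<psi> \<in> linear_forms K N" if "\<phi> \<in> linear_forms K N" "\<psi> \<in> linear_forms K N"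
  by (rule klin_form'[OF klin_cong[OF klin_add[OF form_klin[OF that(1) N] form_klin[OF that(2) N]]]])
   (simp_all add: dual_sels dual_ext)
 show "c \<odot>\<^bsub>dual K N\<^esub> \<phi> \<in> linear_forms K N" if "c \<in> |K|" "\<phi> \<in> linear_forms K N"
  by (rule klin_form'[OF klin_cong[OF klin_smult[OF form_klin[OF that(2) N] that(1)]]])
   (simp_all add: dual_sels dual_ext)
qed

lemma dual_vs:
 assumes N: "vspace N"
 shows "vspace (dual K N)"
proof -
 note c = dual_closed[OF N]
 show ?thesis
  by (rule vsI; unfold dual_sels(1); (intro form_eqI[of _ N] c; assumption?)?)
   (simp_all add: dual_sels formD K.a_ac K.l_distr K.r_distr K.m_assoc dual_closed[OF N])
qed

lemma dual_bimodule:
 assumes N: "bimodule K A B N"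
 shows "bimodule K B A (dual K N)"
proof -
 note s = bimodD[OF N] rmodD[OF bimodD(1)[OF N]]
 note r = rmod_klin(1)[OF s(1)]
 have l: "klin N N (\<lambda>n. a \<rhd>\<^sub>N n)" if "a \<in> |A|" for a
  by (rule klinI) (use that s in simp_all)
 have rc: "\<phi> \<lhd>\<^bsub>dual K N\<^esub> a \<in> linear_forms K N" if "\<phi> \<in> linear_forms K N" "a \<in> |A|" for \<phi> a
  by (rule klin_form'[OF klin_cong[OF klin_comp[OF l[OF that(2)] form_klin[OF that(1) s(3)]]]])
   (simp_all add: dual_sels dual_ext)
 have lc: "b \<rhd>\<^bsub>dual K N\<^esub> \<phi> \<in> linear_forms K N" if "\<phi> \<in> linear_forms K N" "b \<in> |B|" for \<phi> b
  by (rule klin_form'[OF klin_cong[OF klin_comp[OF r[OF that(2)] form_klin[OF that(1) s(3)]]]])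
   (simp_all add: dual_sels dual_ext)
 note c = dual_closed[OF s(3)] rc lc
 have R: "right_module K A (dual K N)"
  by (rule rmodI[OF s(2) dual_vs[OF s(3)]]; unfold dual_sels(1); (intro form_eqI[of _ N] c; assumption?)?)
   (simp_all add: dual_sels formD s c algD[OF s(2)])
 show ?thesis
  by (rule bimodI[OF R rmodD(1)[OF s(1)]]; unfold dual_sels(1); (intro form_eqI[of _ N] c; assumption?)?)
   (simp_all add: dual_sels formD s c algD[OF rmodD(1)[OF s(1)]])
qed

lemma regular_sels [simp]: "|regular B| = |B|" "add (regular B) = add B" "zero (regular B) = zero B"
 "smult (regular B) = smult B" "x \<lhd>\<^bsub>regular B\<^esub> y = x \<otimes>\<^sub>B y" "x \<rhd>\<^bsub>regular B\<^esub> y = x \<otimes>\<^sub>B y"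
 by (simp_all add: regular_def)

lemma regular_bimodule:
 assumes B: "assoc_algebra K B"
 shows "bimodule K B B (regular B)"
proof (rule bimodI)
 have "vspace (regular B)" by (rule vs_image[OF algD(1)[OF B], where q = "\<lambda>x. x"]) simp_all
 then show "right_module K B (regular B)" by (rule rmodI[OF B]) (simp_all add: algD[OF B])
qed (simp_all add: algD[OF B] B)

lemma lsum_dual:
 assumes "vspace N" "n \<in> |N|" "\<And>x. x \<in> set xs ==> f x \<in> linear_forms K N"
 shows "lsum (dual K N) (map f xs) n = lsum K (map (\<lambda>x. f x n) xs)"
 using assms(3) by (induction xs) (simp_all add: dual_sels assms)

text \<open>A finite dimensional space is reflexive.\<close>

lemma double_dual:
 assumes N: "vspace N" and fd: "fin_dim K N" and F: "klin (dual K N) Kv F"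
 obtains v where "v \<in> |N|" "\<And>\<phi>. \<phi> \<in> linear_forms K N ==> F \<phi> = \<phi> v"
proof -
 let ?D = "dual K N"
 note D = dual_vs[OF N]
 obtain bs where bs: "set bs \<subseteq> |N| \<times> linear_forms K N"
  "\<And>v. v \<in> |N| ==> v = lsum N (map (\<lambda>(b, \<phi>). \<phi> v \<odot>\<^sub>N b) bs)"
  using fin_dim_coordinates[OF N fd] by blast
 have b: "fst p \<in> |N|" "snd p \<in> |?D|" if "p \<in> set bs" for p using bs(1) that by (auto simp: dual_sels)
 note b' = b(2)[unfolded dual_sels(1)]
 have Fb: "F (snd p) \<in> |K|" if "p \<in> set bs" for p using klinD(3)[OF F b(2)[OF that]] by simp
 define v where "v = lsum N (map (\<lambda>p. F (snd p) \<odot>\<^sub>N fst p) bs)"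
 show ?thesis
 proof (rule that[of v])
  show "v \<in> |N|" unfolding v_def by (rule lsum_map_closed[OF N]) (simp add: N Fb b)
  fix \<phi> assume \<phi>: "\<phi> \<in> linear_forms K N"
  note k = form_klin[OF \<phi> N] and f = formD[OF \<phi>]
  have c: "\<phi> (fst p) \<odot>\<^sub>?D snd p \<in> |?D|" if "p \<in> set bs" for p using D f(1) b that by simp
  have "\<phi> = lsum ?D (map (\<lambda>p. \<phi> (fst p) \<odot>\<^sub>?D snd p) bs)"
  proof (rule form_eqI[OF \<phi>])
   show "lsum ?D (map (\<lambda>p. \<phi> (fst p) \<odot>\<^sub>?D snd p) bs) \<in> linear_forms K N"
    using lsum_map_closed[OF D c] by (simp only: dual_sels(1))
   fix n assume n: "n \<in> |N|"
   have "\<phi> n = \<phi> (lsum N (map (\<lambda>p. snd p n \<odot>\<^sub>N fst p) bs))" using bs(2)[OF n] by (simp only: case_prod_beta')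
   also have "\<dots> = lsum Kv (map (\<lambda>p. \<phi> (snd p n \<odot>\<^sub>N fst p)) bs)"
    by (rule lsum_klin[OF k]) (simp add: N b formD(1)[OF b'] n)
   also have "\<dots> = lsum K (map (\<lambda>p. (\<phi> (fst p) \<odot>\<^sub>?D snd p) n) bs)"
    unfolding lsum_Kv by (rule lsum_cong) (simp add: f b formD(1)[OF b'] n dual_sels K.m_comm)
   also have "\<dots> = lsum ?D (map (\<lambda>p. \<phi> (fst p) \<odot>\<^sub>?D snd p) bs) n"
    by (rule lsum_dual[OF N n, symmetric]) (use c in \<open>simp add: dual_sels(1)\<close>)
   finally show "\<phi> n = lsum ?D (map (\<lambda>p. \<phi> (fst p) \<odot>\<^sub>?D snd p) bs) n" .
  qed
  then have "F \<phi> = F (lsum ?D (map (\<lambda>p. \<phi> (fst p) \<odot>\<^sub>?D snd p) bs))" by (rule arg_cong)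
  also have "\<dots> = lsum Kv (map (\<lambda>p. F (\<phi> (fst p) \<odot>\<^sub>?D snd p)) bs)" by (rule lsum_klin[OF F c])
  also have "\<dots> = lsum Kv (map (\<lambda>p. \<phi> (F (snd p) \<odot>\<^sub>N fst p)) bs)"
   by (rule lsum_cong) (simp add: klinD(5)[OF F] f b Fb K.m_comm)
  also have "\<dots> = \<phi> v" unfolding v_def by (rule lsum_klin[OF k, symmetric]) (simp add: N Fb b)
  finally show "F \<phi> = \<phi> v" .
 qed
qed

end

subsection \<open>Symmetric algebras\<close>

locale symmetric_algebra = kfield K
 for K :: "('k, 'c) ring_scheme" (structure) +
 fixes A :: "('k, 'a) module" and \<sigma> :: "'a \<Rightarrow> 'k"
 assumes A_alg: "assoc_algebra K A" and A_fd: "fin_dim K A" and \<sigma>_sym: "symmetrising K A \<sigma>"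
begin

lemmas A_simps [simp] = algD(1-3,5,6)[OF A_alg]
lemmas A_assoc = algD(4)[OF A_alg]

lemma \<sigma>_form: "\<sigma> \<in> linear_forms K A"
 using \<sigma>_sym by (simp add: symmetrising_def)

lemma \<sigma>_klin: "klin A Kv \<sigma>"
 by (rule form_klin[OF \<sigma>_form A_simps(1)])

lemma \<sigma>_comm: "a \<in> |A| ==> b \<in> |A| ==> \<sigma> (a \<otimes>\<^sub>A b) = \<sigma> (b \<otimes>\<^sub>A a)"
 using \<sigma>_sym by (simp add: symmetrising_def)

lemma \<sigma>_closed [simp]: "a \<in> |A| ==> \<sigma> a \<in> |K|"
 using \<sigma>_form by (simp add: formD)

lemma \<sigma>_eqI:
 assumes "b \<in> |A|" "c \<in> |A|" "\<And>a. a \<in> |A| ==> \<sigma> (b \<otimes>\<^sub>A a) = \<sigma> (c \<otimes>\<^sub>A a)"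
 shows "b = c"
proof -
 have "\<sigma> ((b \<ominus>\<^sub>A c) \<otimes>\<^sub>A a) = \<zero>" if "a \<in> |A|" for a
 proof -
  have "(b \<ominus>\<^sub>A c) \<otimes>\<^sub>A a = b \<otimes>\<^sub>A a \<ominus>\<^sub>A c \<otimes>\<^sub>A a"
   using klinD(8)[OF alg_klin(1)[OF A_alg that] assms(1,2)] .
  then have "\<sigma> ((b \<ominus>\<^sub>A c) \<otimes>\<^sub>A a) = \<sigma> (b \<otimes>\<^sub>A a) \<ominus>\<^bsub>Kv\<^esub> \<sigma> (c \<otimes>\<^sub>A a)"
   using assms(1,2) that by (simp add: klinD(8)[OF \<sigma>_klin])
  also have "\<dots> = \<zero>" using assms that vs_minus_zero_iff[OF Kv_vs] by simp
  finally show ?thesis .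
 qed
 then have "b \<ominus>\<^sub>A c = \<zero>\<^sub>A" using \<sigma>_sym assms(1,2) unfolding symmetrising_def by simp
 then show ?thesis using assms(1,2) by (simp add: vs_minus_zero_iff)
qed

text \<open>
 The element that represents a linear form on \<open>A\<close> through \<open>\<sigma>\<close>.  It exists because the forms
 \<open>\<sigma>(b -)\<close> have no common zero: a linear form on \<open>DA\<close> that kills all of them is the evaluation
 at some \<open>v\<close> with \<open>\<sigma>(b v) = 0\<close> for all \<open>b\<close>.
\<close>

definition rep :: "('a \<Rightarrow> 'k) \<Rightarrow> 'a" where
 "rep \<psi> = (THE b. b \<in> |A| \<and> (\<forall>a\<in>|A|. \<sigma> (b \<otimes>\<^sub>A a) = \<psi> a))"

lemma rep_unique:
 "b \<in> |A| ==> (\<And>a. a \<in> |A| ==> \<sigma> (b \<otimes>\<^sub>A a) = \<psi> a) ==> rep \<psi> = b"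
 unfolding rep_def by (rule the_equality) (auto intro!: \<sigma>_eqI)

lemma rep_exists:
 assumes "klin A Kv \<psi>"
 shows "\<exists>b\<in>|A|. \<forall>a\<in>|A|. \<sigma> (b \<otimes>\<^sub>A a) = \<psi> a"
proof (rule ccontr)
 let ?D = "dual K (regular A)" and ?R = "\<lambda>b. \<lambda>a\<in>|A|. \<sigma> (b \<otimes>\<^sub>A a)" and ?\<psi> = "restrict \<psi> |A|"
 note rv = bimodD(3)[OF regular_bimodule[OF A_alg]]
 note D = dual_vs[OF rv]
 have Dc: "|?D| = linear_forms K A" by (simp add: dual_sels linear_forms_def)
 have fd: "fin_dim K (regular A)"
  by (rule fin_dim_image[OF _ A_fd, of _ "\<lambda>x. x"]) (simp_all add: klin_def rv)
 have R: "?R b \<in> |?D|" if "b \<in> |A|" for b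
  unfolding Dc by (rule klin_form[OF klin_comp[OF alg_klin(2)[OF A_alg that] \<sigma>_klin]])
 have Rk: "klin A ?D ?R"
 proof (rule klinI[OF A_simps(1) D R])
  show "?R (x \<oplus>\<^sub>A y) = ?R x \<oplus>\<^sub>?D ?R y" if "x \<in> |A|" "y \<in> |A|" for x y
   using that by (auto simp: dual_def algD(7)[OF A_alg] formD[OF \<sigma>_form])
  show "?R (c \<odot>\<^sub>A x) = c \<odot>\<^sub>?D ?R x" if "c \<in> |K|" "x \<in> |A|" for c x
   using that by (auto simp: dual_def algD(9)[OF A_alg] formD[OF \<sigma>_form])
 qed
 assume no: "\<not> ?thesis"
 have psi: "?\<psi> \<in> |?D|" unfolding Dc by (rule klin_form[OF assms])
 have "?\<psi> \<notin> ?R ` |A|"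
 proof
  assume "?\<psi> \<in> ?R ` |A|"
  then obtain b where b: "b \<in> |A|" "?\<psi> = ?R b" by blast
  have "\<sigma> (b \<otimes>\<^sub>A a) = \<psi> a" if "a \<in> |A|" for a using fun_cong[OF b(2), of a] that by simp
  then show False using no b(1) by blast
 qed
 then obtain \<Phi> where \<Phi>: "\<Phi> \<in> linear_forms K ?D" "\<And>w. w \<in> ?R ` |A| ==> \<Phi> w = \<zero>" "\<Phi> ?\<psi> = \<one>"
  using separating_form[OF D klin_image_sub[OF Rk sub_carrier[OF A_simps(1)]] psi] by blast
 obtain v where v: "v \<in> |regular A|" "\<And>\<phi>. \<phi> \<in> linear_forms K (regular A) ==> \<Phi> \<phi> = \<phi> v"
  by (rule double_dual[OF rv fd form_klin[OF \<Phi>(1) D]]) (rule that)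
 note v = v(1)[simplified] v(2)[folded dual_sels(1)]
 have "\<sigma> (v \<otimes>\<^sub>A b) = \<zero>" if b: "b \<in> |A|" for b
  using \<Phi>(2)[of "?R b"] v(2)[OF R[OF b]] b v(1) \<sigma>_comm[OF b v(1)] by simp
 then have "v = \<zero>\<^sub>A" using \<sigma>_sym v(1) unfolding symmetrising_def by simp
 then show False using klinD(6)[OF assms] v(1) v(2)[OF psi] \<Phi>(3) by simp
qed

lemma rep:
 assumes "klin A Kv \<psi>"
 shows "rep \<psi> \<in> |A|" "a \<in> |A| ==> \<sigma> (rep \<psi> \<otimes>\<^sub>A a) = \<psi> a"
  "a \<in> |A| ==> \<sigma> (a \<otimes>\<^sub>A rep \<psi>) = \<psi> a" "\<sigma> (rep \<psi>) = \<psi> \<one>\<^sub>A"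
proof -
 obtain b where b: "b \<in> |A|" "\<And>a. a \<in> |A| ==> \<sigma> (b \<otimes>\<^sub>A a) = \<psi> a"
  using rep_exists[OF assms] by blast
 have *: "rep \<psi> = b" by (rule rep_unique[OF b])
 show "rep \<psi> \<in> |A|" using b * by simp
 show 1: "\<And>a. a \<in> |A| ==> \<sigma> (rep \<psi> \<otimes>\<^sub>A a) = \<psi> a" using b * by simp
 show "a \<in> |A| ==> \<sigma> (a \<otimes>\<^sub>A rep \<psi>) = \<psi> a" using 1 b(1) * \<sigma>_comm by simp
 show "\<sigma> (rep \<psi>) = \<psi> \<one>\<^sub>A" using 1[of "\<one>\<^sub>A"] b(1) * by simp
qed

lemma rep_cong: "(\<And>a. a \<in> |A| ==> \<psi> a = \<psi>' a) ==> rep \<psi> = rep \<psi>'"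
 unfolding rep_def by (rule arg_cong[of _ _ The]) auto

lemma rep_ops:
 assumes "klin A Kv \<psi>"
 shows "klin A Kv \<psi>' ==> rep (\<lambda>a. \<psi> a \<oplus> \<psi>' a) = rep \<psi> \<oplus>\<^sub>A rep \<psi>'"
  and "c \<in> |K| ==> rep (\<lambda>a. c \<otimes> \<psi> a) = c \<odot>\<^sub>A rep \<psi>"
  and "b \<in> |A| ==> rep (\<lambda>a. \<psi> (b \<otimes>\<^sub>A a)) = rep \<psi> \<otimes>\<^sub>A b"
  and "b \<in> |A| ==> rep (\<lambda>a. \<psi> (a \<otimes>\<^sub>A b)) = b \<otimes>\<^sub>A rep \<psi>"
proof -
 note r = rep[OF assms] and \<sigma> = formD[OF \<sigma>_form]
 show "rep (\<lambda>a. \<psi> a \<oplus> \<psi>' a) = rep \<psi> \<oplus>\<^sub>A rep \<psi>'" if "klin A Kv \<psi>'"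
  by (rule rep_unique) (simp_all add: r rep[OF that] algD(7)[OF A_alg] \<sigma>)
 show "c \<in> |K| ==> rep (\<lambda>a. c \<otimes> \<psi> a) = c \<odot>\<^sub>A rep \<psi>"
  by (rule rep_unique) (simp_all add: r algD(9)[OF A_alg] \<sigma>)
 show "b \<in> |A| ==> rep (\<lambda>a. \<psi> (b \<otimes>\<^sub>A a)) = rep \<psi> \<otimes>\<^sub>A b"
  by (rule rep_unique) (simp_all add: r A_assoc)
 show "rep (\<lambda>a. \<psi> (a \<otimes>\<^sub>A b)) = b \<otimes>\<^sub>A rep \<psi>" if b: "b \<in> |A|"
 proof (rule rep_unique)
  fix a assume a: "a \<in> |A|"
  have "\<sigma> ((b \<otimes>\<^sub>A rep \<psi>) \<otimes>\<^sub>A a) = \<sigma> (b \<otimes>\<^sub>A (rep \<psi> \<otimes>\<^sub>A a))" using a b r(1) by (simp add: A_assoc)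
  also have "\<dots> = \<sigma> ((rep \<psi> \<otimes>\<^sub>A a) \<otimes>\<^sub>A b)" using a b r(1) by (intro \<sigma>_comm) simp_all
  also have "\<dots> = \<psi> (a \<otimes>\<^sub>A b)" using a b r by (simp add: A_assoc)
  finally show "\<sigma> ((b \<otimes>\<^sub>A rep \<psi>) \<otimes>\<^sub>A a) = \<psi> (a \<otimes>\<^sub>A b)" .
 qed (use b r in simp)
qed

text \<open>
 The unique right (left) \<open>A\<close>-linear map to \<open>A\<close> whose composite with \<open>\<sigma>\<close> is a given form.
\<close>

definition rlift :: "('k, 'a, 'x, 'z) rmodule_scheme \<Rightarrow> ('x \<Rightarrow> 'k) \<Rightarrow> 'x \<Rightarrow> 'a" where
 "rlift X \<phi> x = rep (\<lambda>a. \<phi> (x \<lhd>\<^sub>X a))"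

definition llift :: "('k, 'a, 'b, 'n) bimodule \<Rightarrow> ('n \<Rightarrow> 'k) \<Rightarrow> 'n \<Rightarrow> 'a" where
 "llift N \<phi> n = rep (\<lambda>a. \<phi> (a \<rhd>\<^sub>N n))"

lemma rlift:
 assumes X: "right_module K A X" and \<phi>: "klin X Kv \<phi>"
 shows "klin X A (rlift X \<phi>)" "x \<in> |X| ==> rlift X \<phi> x \<in> |A|"
  "x \<in> |X| ==> a \<in> |A| ==> rlift X \<phi> (x \<lhd>\<^sub>X a) = rlift X \<phi> x \<otimes>\<^sub>A a"
  "x \<in> |X| ==> \<sigma> (rlift X \<phi> x) = \<phi> x"
  "x \<in> |X| ==> a \<in> |A| ==> \<sigma> (rlift X \<phi> x \<otimes>\<^sub>A a) = \<phi> (x \<lhd>\<^sub>X a)"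
  "x \<in> |X| ==> a \<in> |A| ==> \<sigma> (a \<otimes>\<^sub>A rlift X \<phi> x) = \<phi> (x \<lhd>\<^sub>X a)"
proof -
 note s = rmodD[OF X] and k = klin_comp[OF rmod_klin(2)[OF X] \<phi>] and p = klinD[OF \<phi>]
 show c: "\<And>x. x \<in> |X| ==> rlift X \<phi> x \<in> |A|" unfolding rlift_def by (rule rep(1)[OF k])
 show "x \<in> |X| ==> a \<in> |A| ==> rlift X \<phi> (x \<lhd>\<^sub>X a) = rlift X \<phi> x \<otimes>\<^sub>A a"
  unfolding rlift_def rep_ops(3)[OF k, symmetric] by (rule rep_cong) (simp add: s)
 show "x \<in> |X| ==> \<sigma> (rlift X \<phi> x) = \<phi> x" unfolding rlift_def by (simp add: rep(4)[OF k] s)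
 show "x \<in> |X| ==> a \<in> |A| ==> \<sigma> (rlift X \<phi> x \<otimes>\<^sub>A a) = \<phi> (x \<lhd>\<^sub>X a)"
  "x \<in> |X| ==> a \<in> |A| ==> \<sigma> (a \<otimes>\<^sub>A rlift X \<phi> x) = \<phi> (x \<lhd>\<^sub>X a)"
  unfolding rlift_def by (simp_all add: rep[OF k])
 show "klin X A (rlift X \<phi>)"
 proof (rule klinI[OF s(2) A_simps(1) c])
  fix x y assume xy: "x \<in> |X|" "y \<in> |X|"
  show "rlift X \<phi> (x \<oplus>\<^sub>X y) = rlift X \<phi> x \<oplus>\<^sub>A rlift X \<phi> y"
   unfolding rlift_def rep_ops(1)[OF k[OF xy(1)] k[OF xy(2)], symmetric]
   by (rule rep_cong) (use xy s p in simp)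
 next
  fix c x assume cx: "c \<in> |K|" "x \<in> |X|"
  show "rlift X \<phi> (c \<odot>\<^sub>X x) = c \<odot>\<^sub>A rlift X \<phi> x"
   unfolding rlift_def rep_ops(2)[OF k[OF cx(2)] cx(1), symmetric]
   by (rule rep_cong) (use cx s p in simp)
 qed
qed

text \<open>Left modules over \<open>A\<close> are right modules over the opposite algebra.\<close>

definition opp :: "('k, 'a) module" where
 "opp = A\<lparr>mult := \<lambda>a b. b \<otimes>\<^sub>A a\<rparr>"

definition flip :: "('k, 'a, 'b, 'n) bimodule \<Rightarrow> ('k, 'a, 'n) rmodule" where
 "flip N = \<lparr>carrier = |N|, mult = mult N, one = one N, zero = zero N, add = add N,
   smult = smult N, ract = (\<lambda>n a. a \<rhd>\<^sub>N n)\<rparr>"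

lemma opp_sels [simp]: "|opp| = |A|" "one opp = one A" "add opp = add A" "zero opp = zero A"
 "smult opp = smult A" "a \<otimes>\<^bsub>opp\<^esub> b = b \<otimes>\<^sub>A a"
 by (simp_all add: opp_def)

lemma flip_sels [simp]: "|flip N| = |N|" "add (flip N) = add N" "zero (flip N) = zero N"
 "smult (flip N) = smult N" "n \<lhd>\<^bsub>flip N\<^esub> a = a \<rhd>\<^sub>N n"
 by (simp_all add: flip_def)

lemma opp_vs: "vspace opp"
 by (rule vs_image[OF A_simps(1), where q = "\<lambda>x. x"]) simp_all

lemma opp_alg: "assoc_algebra K opp"
 by (rule algI[OF opp_vs]) (simp_all add: A_assoc algD(7-10)[OF A_alg])

lemma klin_opp: "klin V opp f \<longleftrightarrow> klin V A f" "klin opp W g \<longleftrightarrow> klin A W g"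
 by (simp_all add: klin_def opp_vs)

lemma opp_symmetric: "symmetric_algebra K opp \<sigma>"
proof -
 have "kspan K opp S = kspan K A S" for S
  unfolding kspan_def submodule_def submodule_axioms_def subgroup_def by simp
 then have "fin_dim K opp" using A_fd unfolding fin_dim_def by simp
 moreover have "symmetrising K opp \<sigma>"
  using \<sigma>_sym \<sigma>_comm unfolding symmetrising_def linear_forms_def by simp
 ultimately show ?thesis
  by (intro symmetric_algebra.intro symmetric_algebra_axioms.intro opp_alg kfield_axioms) auto
qed

lemma flip_rmod:
 assumes N: "bimodule K A B N"
 shows "right_module K opp (flip N)"
 by (rule rmodI[OF opp_alg vs_image[OF bimodD(3)[OF N], where q = "\<lambda>x. x"]])
  (simp_all add: bimodD[OF N])

lemma opp_rep: "symmetric_algebra.rep opp \<sigma> = rep"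
proof -
 interpret o: symmetric_algebra K opp \<sigma> by (rule opp_symmetric)
 have *: "(b \<in> |A| \<and> (\<forall>a\<in>|A|. \<sigma> (a \<otimes>\<^sub>A b) = \<psi> a))
  \<longleftrightarrow> (b \<in> |A| \<and> (\<forall>a\<in>|A|. \<sigma> (b \<otimes>\<^sub>A a) = \<psi> a))" for b \<psi>
  using \<sigma>_comm by auto
 show ?thesis unfolding o.rep_def rep_def opp_sels * ..
qed

lemma llift:
 assumes N: "bimodule K A B N" and \<phi>: "klin N Kv \<phi>"
 shows "klin N A (llift N \<phi>)" "n \<in> |N| ==> llift N \<phi> n \<in> |A|"
  "n \<in> |N| ==> a \<in> |A| ==> llift N \<phi> (a \<rhd>\<^sub>N n) = a \<otimes>\<^sub>A llift N \<phi> n"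
  "n \<in> |N| ==> \<sigma> (llift N \<phi> n) = \<phi> n"
  "n \<in> |N| ==> a \<in> |A| ==> \<sigma> (a \<otimes>\<^sub>A llift N \<phi> n) = \<phi> (a \<rhd>\<^sub>N n)"
  "n \<in> |N| ==> a \<in> |A| ==> \<sigma> (llift N \<phi> n \<otimes>\<^sub>A a) = \<phi> (a \<rhd>\<^sub>N n)"
proof -
 interpret o: symmetric_algebra K opp \<sigma> by (rule opp_symmetric)
 have eq: "o.rlift (flip N) \<phi> = llift N \<phi>"
  by (rule ext) (simp add: o.rlift_def llift_def opp_rep)
 have fv: "vspace (flip N)" by (rule rmodD(2)[OF flip_rmod[OF N]])
 have kf: "klin (flip N) W f \<longleftrightarrow> klin N W f" for W :: "('k, 'w, 'z) module_scheme" and f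
  using fv bimodD(3)[OF N] by (simp add: klin_def)
 note r = o.rlift[OF flip_rmod[OF N], of \<phi>, unfolded eq kf klin_opp opp_sels flip_sels, OF \<phi>]
 show "klin N A (llift N \<phi>)" "n \<in> |N| ==> llift N \<phi> n \<in> |A|"
  "n \<in> |N| ==> a \<in> |A| ==> llift N \<phi> (a \<rhd>\<^sub>N n) = a \<otimes>\<^sub>A llift N \<phi> n"
  "n \<in> |N| ==> \<sigma> (llift N \<phi> n) = \<phi> n"
  "n \<in> |N| ==> a \<in> |A| ==> \<sigma> (a \<otimes>\<^sub>A llift N \<phi> n) = \<phi> (a \<rhd>\<^sub>N n)"
  "n \<in> |N| ==> a \<in> |A| ==> \<sigma> (llift N \<phi> n \<otimes>\<^sub>A a) = \<phi> (a \<rhd>\<^sub>N n)"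
  using r by auto
qed

end

subsection \<open>Dual bases over a von Neumann regular symmetric algebra\<close>

locale frobenius_algebra = symmetric_algebra K A \<sigma>
 for K :: "('k, 'c) ring_scheme" (structure) and A :: "('k, 'a) module" and \<sigma> +
 assumes regular_A: "a \<in> |A| ==> \<exists>u\<in>|A|. (a \<otimes>\<^sub>A u) \<otimes>\<^sub>A a = a"
begin

definition rlin :: "('k, 'a, 'x, 'z) rmodule_scheme \<Rightarrow> ('x \<Rightarrow> 'a) \<Rightarrow> bool" where
 "rlin X \<xi> \<longleftrightarrow> klin X A \<xi> \<and> (\<forall>x\<in>|X|. \<forall>a\<in>|A|. \<xi> (x \<lhd>\<^sub>X a) = \<xi> x \<otimes>\<^sub>A a)"

lemma rlinD:
 assumes "rlin X \<xi>"
 shows "klin X A \<xi>" "x \<in> |X| ==> \<xi> x \<in> |A|"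
  "x \<in> |X| ==> a \<in> |A| ==> \<xi> (x \<lhd>\<^sub>X a) = \<xi> x \<otimes>\<^sub>A a"
 using assms klinD(3)[of X A \<xi>] unfolding rlin_def by auto

text \<open>
 A nonzero \<open>p\<close> is seen by some form, hence \<open>a = f(p) \<noteq> 0\<close> for a right \<open>A\<close>-linear \<open>f\<close>.  With
 \<open>a u a = a\<close> the idempotent \<open>e = u a\<close> satisfies \<open>e = u f(p)\<close>, and \<open>p' = p e\<close>, \<open>f' = u f\<close>
 with \<open>f'(p') = e\<close> split off the summand \<open>p' A\<close>.
\<close>

lemma split_off:
 assumes X: "right_module K A X" and p: "p \<in> |X|" "p \<noteq> \<zero>\<^sub>X"
 obtains q \<xi> where "q \<in> |X|" "q \<noteq> \<zero>\<^sub>X" "rlin X \<xi>" "q \<lhd>\<^sub>X \<xi> q = q"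
  "\<And>x. x \<in> |X| ==> \<xi> q \<otimes>\<^sub>A \<xi> x = \<xi> x"
proof -
 note s = rmodD[OF X]
 obtain \<phi> where \<phi>: "\<phi> \<in> linear_forms K X" "\<phi> p = \<one>" using form_nonzero[OF s(2) p] by auto
 note f = rlift[OF X form_klin[OF \<phi>(1) s(2)]]
 define f where "f = rlift X \<phi>"
 note f = f[folded f_def]
 obtain u where u: "u \<in> |A|" "(f p \<otimes>\<^sub>A u) \<otimes>\<^sub>A f p = f p" using regular_A[OF f(2)[OF p(1)]] by auto
 have fp: "f p \<in> |A|" by (rule f(2)[OF p(1)])
 define e where "e = u \<otimes>\<^sub>A f p"
 have e: "e \<in> |A|" "e \<otimes>\<^sub>A e = e" "f p \<otimes>\<^sub>A e = f p"
  using u fp unfolding e_def by (simp_all add: A_assoc)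
 have e0: "e \<noteq> \<zero>\<^sub>A"
 proof
  assume "e = \<zero>\<^sub>A"
  then have "f p = \<zero>\<^sub>A" using e(3) fp algD(13)[OF A_alg] by simp
  then have "\<phi> p = \<zero>" using f(4)[OF p(1)] klinD(6)[OF \<sigma>_klin] by simp
  then show False using \<phi>(2) by simp
 qed
 define \<xi> where "\<xi> = (\<lambda>x. e \<otimes>\<^sub>A (u \<otimes>\<^sub>A f x))"
 define q where "q = p \<lhd>\<^sub>X e"
 have q: "q \<in> |X|" unfolding q_def using p e s by simp
 have xq: "\<xi> q = e" unfolding \<xi>_def q_def using p e u fp f(3) by (simp add: e_def[symmetric])
 have xi: "rlin X \<xi>" unfolding rlin_def \<xi>_def
  using klin_comp[OF klin_comp[OF f(1) alg_klin(2)[OF A_alg u(1)]] alg_klin(2)[OF A_alg e(1)]]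
   u e f by (simp add: A_assoc)
 show ?thesis
 proof (rule that[OF q _ xi])
  show "q \<noteq> \<zero>\<^sub>X" using xq e0 klinD(6)[OF rlinD(1)[OF xi]] by auto
  show "q \<lhd>\<^sub>X \<xi> q = q" unfolding xq unfolding q_def using s(6)[OF p(1) e(1) e(1)] e(2) by simp
  fix x assume x: "x \<in> |X|"
  show "\<xi> q \<otimes>\<^sub>A \<xi> x = \<xi> x" unfolding xq unfolding \<xi>_def
   using e u f(2)[OF x] A_assoc[of e e "u \<otimes>\<^sub>A f x"] by simp
 qed
qed

text \<open>
 Splitting off summands \<open>p' A\<close> until nothing is left; the number of generators drops by
 \<open>spanned_image_drop\<close>.
\<close>

lemma dual_basis_spanned:
 "spanned X n ==> right_module K A X ==> \<exists>bs. set bs \<subseteq> |X| \<times> Collect (rlin X) \<and>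
   (\<forall>x\<in>|X|. x = lsum X (map (\<lambda>(b, \<xi>). b \<lhd>\<^sub>X \<xi> x) bs))"
 proof (induction n arbitrary: X rule: less_induct)
  case (less n)
  note X = less.prems(2)
  note s = rmodD[OF X]
  show ?case
  proof (cases "|X| = {\<zero>\<^sub>X}")
   case True
   then show ?thesis by (intro exI[of _ "[]"]) auto
  next
   case False
   then obtain p where p: "p \<in> |X|" "p \<noteq> \<zero>\<^sub>X" using vs_simps(2)[OF s(2)] by blast
   obtain q \<xi> where q: "q \<in> |X|" "q \<noteq> \<zero>\<^sub>X" "rlin X \<xi>" "q \<lhd>\<^sub>X \<xi> q = q"
    and qx: "\<And>x. x \<in> |X| ==> \<xi> q \<otimes>\<^sub>A \<xi> x = \<xi> x" using split_off[OF X p] by metis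
   note \<xi> = rlinD[OF q(3)]
   define U where "U = X\<lparr>carrier := {x \<in> |X|. \<xi> x = \<zero>\<^sub>A}\<rparr>"
   define \<pi> where "\<pi> = (\<lambda>x. x \<ominus>\<^sub>X q \<lhd>\<^sub>X \<xi> x)"
   have U: "right_module K A U" unfolding U_def
    by (rule rmod_sub[OF X klin_kernel_sub[OF \<xi>(1)]]) (simp add: s \<xi>(3) algD(12)[OF A_alg])
   have "klin X X \<pi>" unfolding \<pi>_def
    by (rule klin_minus[OF klin_id[OF s(2)] klin_comp[OF \<xi>(1) rmod_klin(2)[OF X q(1)]]])
   moreover have "\<xi> (\<pi> x) = \<zero>\<^sub>A" if "x \<in> |X|" for x
    unfolding \<pi>_def using that q(1) \<xi> qx s klinD(8)[OF \<xi>(1), of x "q \<lhd>\<^sub>X \<xi> x"] by simp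
   ultimately have pi: "klin X U \<pi>"
    using rmodD(2)[OF U] unfolding klin_def U_def by auto
   have surj: "\<pi> ` |X| = |U|"
   proof
    show "\<pi> ` |X| \<subseteq> |U|" using pi by (auto simp: klinD)
    show "|U| \<subseteq> \<pi> ` |X|"
    proof
     fix x assume x: "x \<in> |U|"
     then have "\<pi> x = x" using q(1) s klinD(6)[OF rmod_klin(2)[OF X q(1)]] unfolding U_def \<pi>_def by simp
     then show "x \<in> \<pi> ` |X|" using x unfolding U_def by force
    qed
   qed
   have "\<pi> q = \<zero>\<^sub>U" using q s unfolding \<pi>_def U_def by simp
   then obtain m where "m < n" "spanned U m"
    using spanned_image_drop[OF pi less.prems(1) surj q(1,2)] by auto
   then obtain bs where bs: "set bs \<subseteq> |U| \<times> Collect (rlin U)"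
    "\<And>v. v \<in> |U| ==> v = lsum U (map (\<lambda>(b, \<xi>). b \<lhd>\<^sub>U \<xi> v) bs)"
    using less.IH U by blast
   define bs' where "bs' = (q, \<xi>) # map (\<lambda>(b, \<psi>). (b, \<lambda>x. \<psi> (\<pi> x))) bs"
   have pr: "\<pi> (x \<lhd>\<^sub>X a) = \<pi> x \<lhd>\<^sub>U a" if "x \<in> |X|" "a \<in> |A|" for x a
    unfolding \<pi>_def U_def using that q(1) s \<xi> klinD(8)[OF rmod_klin(1)[OF X that(2)]] by simp
   have "rlin X (\<lambda>x. \<psi> (\<pi> x))" if "rlin U \<psi>" for \<psi>
    unfolding rlin_def using klin_comp[OF pi rlinD(1)[OF that]] rlinD(3)[OF that] pr klinD(3)[OF pi] by simp
   then have 1: "set bs' \<subseteq> |X| \<times> Collect (rlin X)"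
    using bs(1) q unfolding bs'_def U_def by (auto; blast)
   have 2: "v = lsum X (map (\<lambda>(b, \<xi>). b \<lhd>\<^sub>X \<xi> v) bs')" if v: "v \<in> |X|" for v
   proof -
    have piv: "\<pi> v \<in> |U|" using pi v by (simp add: klinD)
    have "\<pi> v = lsum U (map (\<lambda>(b, \<xi>). b \<lhd>\<^sub>U \<xi> (\<pi> v)) bs)" by (rule bs(2)[OF piv])
    also have "\<dots> = lsum X (map (\<lambda>(b, \<psi>). b \<lhd>\<^sub>X \<psi> (\<pi> v)) bs)" unfolding U_def lsum_def by simp
    also have "\<dots> = lsum X (map (\<lambda>(b, \<xi>). b \<lhd>\<^sub>X \<xi> v) (tl bs'))"
     unfolding bs'_def list.sel map_map using v by (intro arg_cong[of _ _ "lsum X"]) auto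
    finally have "lsum X (map (\<lambda>(b, \<xi>). b \<lhd>\<^sub>X \<xi> v) (tl bs')) = \<pi> v" by simp
    then have "lsum X (map (\<lambda>(b, \<xi>). b \<lhd>\<^sub>X \<xi> v) bs') = q \<lhd>\<^sub>X \<xi> v \<oplus>\<^sub>X \<pi> v"
     unfolding bs'_def by simp
    also have "\<dots> = v" unfolding \<pi>_def using v q(1) \<xi> s by (simp add: vs_minus_add_cancel)
    finally show ?thesis by simp
   qed
   show ?thesis using 1 2 by blast
  qed
 qed

lemma dual_basis:
 assumes X: "right_module K A X" and fd: "fin_dim K X"
 obtains bs where "set bs \<subseteq> |X| \<times> Collect (rlin X)"
  "\<And>x. x \<in> |X| ==> x = lsum X (map (\<lambda>(b, \<xi>). b \<lhd>\<^sub>X \<xi> x) bs)"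
proof -
 obtain n where "spanned X n" using fd unfolding fin_dim_spanned ..
 from dual_basis_spanned[OF this X] show ?thesis using that by blast
qed

lemma opp_frobenius: "frobenius_algebra K opp \<sigma>"
proof -
 interpret o: symmetric_algebra K opp \<sigma> by (rule opp_symmetric)
 show ?thesis
 proof
  fix a assume "a \<in> |opp|"
  then show "\<exists>u\<in>|opp|. (a \<otimes>\<^bsub>opp\<^esub> u) \<otimes>\<^bsub>opp\<^esub> a = a"
   using regular_A[of a] by (auto simp: A_assoc)
 qed
qed

definition llin :: "('k, 'a, 'b, 'x) bimodule \<Rightarrow> ('x \<Rightarrow> 'a) \<Rightarrow> bool" where
 "llin N \<xi> \<longleftrightarrow> klin N A \<xi> \<and> (\<forall>x\<in>|N|. \<forall>a\<in>|A|. \<xi> (a \<rhd>\<^sub>N x) = a \<otimes>\<^sub>A \<xi> x)"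

lemma llinD:
 assumes "llin X \<xi>"
 shows "klin X A \<xi>" "x \<in> |X| ==> \<xi> x \<in> |A|"
  "x \<in> |X| ==> a \<in> |A| ==> \<xi> (a \<rhd>\<^sub>X x) = a \<otimes>\<^sub>A \<xi> x"
 using assms klinD(3)[of X A \<xi>] unfolding llin_def by auto

text \<open>
 The statement for right modules, over the opposite algebra.
\<close>

lemma left_dual_basis:
 assumes N: "bimodule K A B N" and fd: "fin_dim K N"
 obtains bs where "set bs \<subseteq> |N| \<times> Collect (llin N)"
  "\<And>x. x \<in> |N| ==> x = lsum N (map (\<lambda>(b, \<xi>). \<xi> x \<rhd>\<^sub>N b) bs)"
proof -
 interpret o: frobenius_algebra K opp \<sigma> by (rule opp_frobenius)
 have fv: "vspace (flip N)" by (rule rmodD(2)[OF flip_rmod[OF N]])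
 have fd': "fin_dim K (flip N)"
  by (rule fin_dim_image[where f = "\<lambda>x. x", OF _ fd]) (use fv bimodD(3)[OF N] in \<open>simp_all add: klin_def\<close>)
 have ll: "o.rlin (flip N) = llin N"
  by (rule ext) (use fv bimodD(3)[OF N] in \<open>simp add: o.rlin_def llin_def klin_def opp_vs\<close>)
 have ls: "lsum (flip N) = lsum N" by (simp add: lsum_def fun_eq_iff)
 obtain bs where bs: "set bs \<subseteq> |flip N| \<times> Collect (o.rlin (flip N))"
  "\<And>x. x \<in> |flip N| ==> x = lsum (flip N) (map (\<lambda>(b, \<xi>). b \<lhd>\<^bsub>flip N\<^esub> \<xi> x) bs)"
  using o.dual_basis[OF flip_rmod[OF N] fd'] by blast
 show ?thesis by (rule that[of bs]) (use bs in \<open>simp_all add: ll ls\<close>)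
qed

end

context kfield
begin

section \<open>Bimodule maps and the Auslander-Reiten formula\<close>

text \<open>An \<open>A\<close>-linear map \<open>X \<otimes>\<^sub>A V \<rightarrow> Z\<close>, for an \<open>A\<close>-bimodule \<open>V\<close>.\<close>

definition blin :: "('k, 'a) module \<Rightarrow> ('k, 'a, 'a, 'v) bimodule \<Rightarrow> ('k, 'a, 'x, 's) rmodule_scheme
  \<Rightarrow> ('k, 'a, 'z, 't) rmodule_scheme \<Rightarrow> ('x \<Rightarrow> 'v \<Rightarrow> 'z) \<Rightarrow> bool" where
 "blin A V X Z h \<longleftrightarrow> (\<forall>v\<in>|V|. klin X Z (\<lambda>x. h x v)) \<and> (\<forall>x\<in>|X|. klin V Z (h x)) \<and>
   (\<forall>x\<in>|X|. \<forall>a\<in>|A|. \<forall>v\<in>|V|. h (x \<lhd>\<^sub>X a) v = h x (a \<rhd>\<^sub>V v)) \<and>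
   (\<forall>x\<in>|X|. \<forall>a\<in>|A|. \<forall>v\<in>|V|. h x v \<lhd>\<^sub>Z a = h x (v \<lhd>\<^sub>V a))"

lemma blinD:
 assumes "blin A V X Z h"
 shows "v \<in> |V| ==> klin X Z (\<lambda>x. h x v)" "x \<in> |X| ==> klin V Z (h x)"
  "x \<in> |X| ==> a \<in> |A| ==> v \<in> |V| ==> h (x \<lhd>\<^sub>X a) v = h x (a \<rhd>\<^sub>V v)"
  "x \<in> |X| ==> a \<in> |A| ==> v \<in> |V| ==> h x v \<lhd>\<^sub>Z a = h x (v \<lhd>\<^sub>V a)"
  "x \<in> |X| ==> v \<in> |V| ==> h x v \<in> |Z|"
 using assms klinD(3)[of V Z "h x" v] unfolding blin_def by auto

lemma blinI:
 assumes "\<And>v. v \<in> |V| ==> klin X Z (\<lambda>x. h x v)" "\<And>x. x \<in> |X| ==> klin V Z (h x)"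
  "\<And>x a v. x \<in> |X| ==> a \<in> |A| ==> v \<in> |V| ==> h (x \<lhd>\<^sub>X a) v = h x (a \<rhd>\<^sub>V v)"
  "\<And>x a v. x \<in> |X| ==> a \<in> |A| ==> v \<in> |V| ==> h x v \<lhd>\<^sub>Z a = h x (v \<lhd>\<^sub>V a)"
 shows "blin A V X Z h"
 using assms unfolding blin_def by auto

lemma blin_zero:
 assumes "vspace X" "right_module K A Z" "bimodule K A A V"
 shows "blin A V X Z (\<lambda>x v. \<zero>\<^sub>Z)"
 by (rule blinI)
  (use assms bimodD(3)[OF assms(3)] klinD(6)[OF rmod_klin(1)[OF assms(2)]] rmodD(2)[OF assms(2)]
   in \<open>auto intro: klin_zero\<close>)

lemma blin_add:
 assumes h: "blin A V X Z h" "blin A V X Z h'" and Z: "right_module K A Z"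
 shows "blin A V X Z (\<lambda>x v. h x v \<oplus>\<^sub>Z h' x v)"
 by (rule blinI) (use klin_add[OF blinD(1)[OF h(1)] blinD(1)[OF h(2)]]
  klin_add[OF blinD(2)[OF h(1)] blinD(2)[OF h(2)]] rmodD[OF Z] blinD(3-5)[OF h(1)] blinD(3-5)[OF h(2)]
  in simp_all)

lemma blin_smult:
 assumes h: "blin A V X Z h" and c: "c \<in> |K|" and Z: "right_module K A Z"
 shows "blin A V X Z (\<lambda>x v. c \<odot>\<^sub>Z h x v)"
 by (rule blinI) (use klin_smult[OF blinD(1)[OF h] c] klin_smult[OF blinD(2)[OF h] c]
  rmodD[OF Z] blinD(3-5)[OF h] c in simp_all)

text \<open>Right \<open>A\<close>-linear maps, and maps of representations of a bimodule.\<close>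

definition alin :: "('k, 'a) module \<Rightarrow> ('k, 'a, 'x, 's) rmodule_scheme
  \<Rightarrow> ('k, 'a, 'z, 't) rmodule_scheme \<Rightarrow> ('x \<Rightarrow> 'z) \<Rightarrow> bool" where
 "alin A X Z f \<longleftrightarrow> klin X Z f \<and> (\<forall>x\<in>|X|. \<forall>a\<in>|A|. f (x \<lhd>\<^sub>X a) = f x \<lhd>\<^sub>Z a)"

lemma alinD:
 assumes "alin A X Z f"
 shows "klin X Z f" "x \<in> |X| ==> f x \<in> |Z|"
  "x \<in> |X| ==> a \<in> |A| ==> f (x \<lhd>\<^sub>X a) = f x \<lhd>\<^sub>Z a"
 using assms klinD(3)[of X Z f] unfolding alin_def by auto

lemma blin_alin: "blin A V X Z h ==> alin A Z U f ==> blin A V X U (\<lambda>x v. f (h x v))"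
 by (rule blinI) (auto intro: klin_comp blinD alinD simp: blinD(3-5) alinD(3)[symmetric])

text \<open>
 Transposing two dual bases means exchanging two finite sums.
\<close>

lemma lsum_swap:
 assumes "vspace V" "\<And>x y. x \<in> set xs ==> y \<in> set ys ==> f x y \<in> |V|"
 shows "lsum V (map (\<lambda>x. lsum V (map (f x) ys)) xs) = lsum V (map (\<lambda>y. lsum V (map (\<lambda>x. f x y) xs)) ys)"
 using assms(2)
proof (induction xs)
 case Nil
 then show ?case using assms(1) by (simp add: lsum_zero)
next
 case (Cons x xs)
 have "lsum V (map (\<lambda>x. lsum V (map (f x) ys)) xs) = lsum V (map (\<lambda>y. lsum V (map (\<lambda>x. f x y) xs)) ys)"
  by (rule Cons.IH) (use Cons.prems in auto)
 then show ?case
  using lsum_add[OF assms(1), of ys "f x" "\<lambda>y. lsum V (map (\<lambda>x. f x y) xs)"] Cons.prems assms(1)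
  by (simp add: lsum_map_closed)
qed

end

locale dualised_bimodule = frobenius_algebra K A \<sigma>
 for K :: "('k, 'c) ring_scheme" (structure) and A :: "('k, 'a) module" and \<sigma> +
 fixes M :: "('k, 'a, 'a, 'm) bimodule"
  and rs :: "('m \<times> ('m \<Rightarrow> 'k)) list" and ls :: "(('m \<Rightarrow> 'k) \<times> 'm) list"
 assumes M_bimodule: "bimodule K A A M" and dual_bases: "dual_bases K A M \<sigma> rs ls"
begin

abbreviation DM where "DM \<equiv> dual K M"

lemma DM_bimodule: "bimodule K A A DM"
 by (rule dual_bimodule[OF M_bimodule])

lemmas M_simps [simp] = bimodD(3,4)[OF M_bimodule] rmodD(3)[OF bimodD(1)[OF M_bimodule]]
lemmas M_rules = bimodD(5-11)[OF M_bimodule] rmodD(4-9)[OF bimodD(1)[OF M_bimodule]]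
lemmas DM_simps [simp] = bimodD(3,4)[OF DM_bimodule] rmodD(3)[OF bimodD(1)[OF DM_bimodule]]

lemma DM_klin: "\<mu> \<in> |DM| ==> klin M Kv \<mu>"
 by (rule form_klin) (simp_all add: dual_sels)

lemma M_mult_klin: "a \<in> |A| ==> klin M M (\<lambda>m. a \<rhd>\<^sub>M m)" "a \<in> |A| ==> klin M M (\<lambda>m. m \<lhd>\<^sub>M a)"
 "m \<in> |M| ==> klin A M (\<lambda>a. a \<rhd>\<^sub>M m)" "m \<in> |M| ==> klin A M (\<lambda>a. m \<lhd>\<^sub>M a)"
 by (rule klinI; simp add: M_rules)+

abbreviation rt where "rt \<equiv> rlift M"
abbreviation lt where "lt \<equiv> llift M"

lemmas M_rmod = bimodD(1)[OF M_bimodule]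

lemma rt:
 assumes "\<mu> \<in> |DM|"
 shows "klin M A (rt \<mu>)" "m \<in> |M| ==> rt \<mu> m \<in> |A|"
  "m \<in> |M| ==> a \<in> |A| ==> rt \<mu> (m \<lhd>\<^sub>M a) = rt \<mu> m \<otimes>\<^sub>A a"
  "m \<in> |M| ==> \<sigma> (rt \<mu> m) = \<mu> m"
  "m \<in> |M| ==> a \<in> |A| ==> \<sigma> (rt \<mu> m \<otimes>\<^sub>A a) = \<mu> (m \<lhd>\<^sub>M a)"
  "m \<in> |M| ==> a \<in> |A| ==> \<sigma> (a \<otimes>\<^sub>A rt \<mu> m) = \<mu> (m \<lhd>\<^sub>M a)"
  "m \<in> |M| ==> a \<in> |A| ==> rt (\<mu> \<lhd>\<^bsub>DM\<^esub> a) m = rt \<mu> (a \<rhd>\<^sub>M m)"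
  "m \<in> |M| ==> a \<in> |A| ==> rt (a \<rhd>\<^bsub>DM\<^esub> \<mu>) m = a \<otimes>\<^sub>A rt \<mu> m"
proof -
 note k = DM_klin[OF assms]
 show "klin M A (rt \<mu>)" "m \<in> |M| ==> rt \<mu> m \<in> |A|"
  "m \<in> |M| ==> a \<in> |A| ==> rt \<mu> (m \<lhd>\<^sub>M a) = rt \<mu> m \<otimes>\<^sub>A a"
  "m \<in> |M| ==> \<sigma> (rt \<mu> m) = \<mu> m"
  "m \<in> |M| ==> a \<in> |A| ==> \<sigma> (rt \<mu> m \<otimes>\<^sub>A a) = \<mu> (m \<lhd>\<^sub>M a)"
  "m \<in> |M| ==> a \<in> |A| ==> \<sigma> (a \<otimes>\<^sub>A rt \<mu> m) = \<mu> (m \<lhd>\<^sub>M a)"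
  using rlift[OF M_rmod k] by auto
 show "rt (\<mu> \<lhd>\<^bsub>DM\<^esub> a) m = rt \<mu> (a \<rhd>\<^sub>M m)" if "m \<in> |M|" "a \<in> |A|"
  unfolding rlift_def by (rule rep_cong) (use that in \<open>simp add: dual_sels M_rules\<close>)
 show "rt (a \<rhd>\<^bsub>DM\<^esub> \<mu>) m = a \<otimes>\<^sub>A rt \<mu> m" if "m \<in> |M|" "a \<in> |A|"
  unfolding rlift_def rep_ops(4)[OF klin_comp[OF M_mult_klin(4)[OF that(1)] k] that(2), symmetric]
  by (rule rep_cong) (use that in \<open>simp add: dual_sels M_rules\<close>)
qed

lemma lt:
 assumes "\<mu> \<in> |DM|"
 shows "klin M A (lt \<mu>)" "m \<in> |M| ==> lt \<mu> m \<in> |A|"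
  "m \<in> |M| ==> a \<in> |A| ==> lt \<mu> (a \<rhd>\<^sub>M m) = a \<otimes>\<^sub>A lt \<mu> m"
  "m \<in> |M| ==> \<sigma> (lt \<mu> m) = \<mu> m"
  "m \<in> |M| ==> a \<in> |A| ==> \<sigma> (a \<otimes>\<^sub>A lt \<mu> m) = \<mu> (a \<rhd>\<^sub>M m)"
  "m \<in> |M| ==> a \<in> |A| ==> \<sigma> (lt \<mu> m \<otimes>\<^sub>A a) = \<mu> (a \<rhd>\<^sub>M m)"
  "m \<in> |M| ==> a \<in> |A| ==> lt (\<mu> \<lhd>\<^bsub>DM\<^esub> a) m = lt \<mu> m \<otimes>\<^sub>A a"
  "m \<in> |M| ==> a \<in> |A| ==> lt (a \<rhd>\<^bsub>DM\<^esub> \<mu>) m = lt \<mu> (m \<lhd>\<^sub>M a)"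
proof -
 note k = DM_klin[OF assms]
 show "klin M A (lt \<mu>)" "m \<in> |M| ==> lt \<mu> m \<in> |A|"
  "m \<in> |M| ==> a \<in> |A| ==> lt \<mu> (a \<rhd>\<^sub>M m) = a \<otimes>\<^sub>A lt \<mu> m"
  "m \<in> |M| ==> \<sigma> (lt \<mu> m) = \<mu> m"
  "m \<in> |M| ==> a \<in> |A| ==> \<sigma> (a \<otimes>\<^sub>A lt \<mu> m) = \<mu> (a \<rhd>\<^sub>M m)"
  "m \<in> |M| ==> a \<in> |A| ==> \<sigma> (lt \<mu> m \<otimes>\<^sub>A a) = \<mu> (a \<rhd>\<^sub>M m)"
  using llift[OF M_bimodule k] by auto
 show "lt (a \<rhd>\<^bsub>DM\<^esub> \<mu>) m = lt \<mu> (m \<lhd>\<^sub>M a)" if "m \<in> |M|" "a \<in> |A|"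
  unfolding llift_def by (rule rep_cong) (use that in \<open>simp add: dual_sels M_rules\<close>)
 show "lt (\<mu> \<lhd>\<^bsub>DM\<^esub> a) m = lt \<mu> m \<otimes>\<^sub>A a" if "m \<in> |M|" "a \<in> |A|"
  unfolding llift_def rep_ops(3)[OF klin_comp[OF M_mult_klin(3)[OF that(1)] k] that(2), symmetric]
  by (rule rep_cong) (use that in \<open>simp add: dual_sels M_rules\<close>)
qed

lemma rt_klin: "m \<in> |M| ==> klin DM A (\<lambda>\<mu>. rt \<mu> m)"
proof (rule klinI)
 assume m: "m \<in> |M|"
 note k = klin_comp[OF M_mult_klin(4)[OF m] DM_klin]
 fix \<mu> assume \<mu>: "\<mu> \<in> |DM|"
 show "rt \<mu> m \<in> |A|" using rt(2)[OF \<mu> m] .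
 show "rt (\<mu> \<oplus>\<^bsub>DM\<^esub> \<nu>) m = rt \<mu> m \<oplus>\<^sub>A rt \<nu> m" if "\<nu> \<in> |DM|" for \<nu>
  unfolding rlift_def rep_ops(1)[OF k[OF \<mu>] k[OF that], symmetric]
  by (rule rep_cong) (use m in \<open>simp add: dual_sels\<close>)
 show "rt (c \<odot>\<^bsub>DM\<^esub> \<mu>) m = c \<odot>\<^sub>A rt \<mu> m" if "c \<in> |K|" for c
  unfolding rlift_def rep_ops(2)[OF k[OF \<mu>] that, symmetric]
  by (rule rep_cong) (use m in \<open>simp add: dual_sels\<close>)
qed simp_all

lemma lt_klin: "m \<in> |M| ==> klin DM A (\<lambda>\<mu>. lt \<mu> m)"
proof (rule klinI)
 assume m: "m \<in> |M|"
 note k = klin_comp[OF M_mult_klin(3)[OF m] DM_klin]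
 fix \<mu> assume \<mu>: "\<mu> \<in> |DM|"
 show "lt \<mu> m \<in> |A|" using lt(2)[OF \<mu> m] .
 show "lt (\<mu> \<oplus>\<^bsub>DM\<^esub> \<nu>) m = lt \<mu> m \<oplus>\<^sub>A lt \<nu> m" if "\<nu> \<in> |DM|" for \<nu>
  unfolding llift_def rep_ops(1)[OF k[OF \<mu>] k[OF that], symmetric]
  by (rule rep_cong) (use m in \<open>simp add: dual_sels\<close>)
 show "lt (c \<odot>\<^bsub>DM\<^esub> \<mu>) m = c \<odot>\<^sub>A lt \<mu> m" if "c \<in> |K|" for c
  unfolding llift_def rep_ops(2)[OF k[OF \<mu>] that, symmetric]
  by (rule rep_cong) (use m in \<open>simp add: dual_sels\<close>)
qed simp_all

lemma right_lift_eq: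
 assumes \<mu>: "\<mu> \<in> |DM|" and m: "m \<in> |M|"
 shows "right_lift A M \<sigma> \<mu> m = rt \<mu> m"
proof -
 let ?Q = "\<lambda>f. f \<in> rmod_hom A M (regular A) \<and> (\<forall>m\<in>|M|. \<sigma> (f m) = \<mu> m)"
 have "?Q (restrict (rt \<mu>) |M| )"
  by (simp add: rmod_hom_def regular_def rt[OF \<mu>] klinD(4)[OF rt(1)[OF \<mu>]] Pi_iff)
 moreover have "f = restrict (rt \<mu>) |M|" if f: "?Q f" for f
 proof (rule extensionalityI[of _ "|M|"])
  show "f \<in> extensional |M|" using f by (auto simp: rmod_hom_def PiE_def)
  fix x assume x: "x \<in> |M|"
  have "rt \<mu> x = f x" unfolding rlift_def
  proof (rule rep_unique)
   show "f x \<in> |A|" using f x by (auto simp: rmod_hom_def regular_def PiE_def)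
   fix a assume a: "a \<in> |A|"
   have "f (x \<lhd>\<^sub>M a) = f x \<otimes>\<^sub>A a" using f x a by (auto simp: rmod_hom_def regular_def)
   then show "\<sigma> (f x \<otimes>\<^sub>A a) = \<mu> (x \<lhd>\<^sub>M a)" using f x a by (metis M_simps(3))
  qed
  then show "f x = restrict (rt \<mu>) |M| x" using x by simp
 qed simp
 ultimately have "right_lift A M \<sigma> \<mu> = restrict (rt \<mu>) |M|"
  unfolding right_lift_def by (intro the_equality) blast+
 then show ?thesis using m by simp
qed

lemma left_lift_eq:
 assumes \<mu>: "\<mu> \<in> |DM|" and m: "m \<in> |M|"
 shows "left_lift A M \<sigma> \<mu> m = lt \<mu> m"
proof -
 let ?Q = "\<lambda>f. f \<in> lmod_hom A M (regular A) \<and> (\<forall>m\<in>|M|. \<sigma> (f m) = \<mu> m)"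
 have "?Q (restrict (lt \<mu>) |M| )"
  by (simp add: lmod_hom_def regular_def lt[OF \<mu>] klinD(4)[OF lt(1)[OF \<mu>]] Pi_iff)
 moreover have "f = restrict (lt \<mu>) |M|" if f: "?Q f" for f
 proof (rule extensionalityI[of _ "|M|"])
  show "f \<in> extensional |M|" using f by (auto simp: lmod_hom_def PiE_def)
  fix x assume x: "x \<in> |M|"
  have "lt \<mu> x = f x" unfolding llift_def
  proof (rule rep_unique)
   show fx: "f x \<in> |A|" using f x by (auto simp: lmod_hom_def regular_def PiE_def)
   fix a assume a: "a \<in> |A|"
   have "f (a \<rhd>\<^sub>M x) = a \<otimes>\<^sub>A f x" using f x a by (auto simp: lmod_hom_def regular_def)
   then have "\<sigma> (a \<otimes>\<^sub>A f x) = \<mu> (a \<rhd>\<^sub>M x)" using f x a by (metis M_simps(2))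
   then show "\<sigma> (f x \<otimes>\<^sub>A a) = \<mu> (a \<rhd>\<^sub>M x)" using \<sigma>_comm[OF a fx] by simp
  qed
  then show "f x = restrict (lt \<mu>) |M| x" using x by simp
 qed simp
 ultimately have "left_lift A M \<sigma> \<mu> = restrict (lt \<mu>) |M|"
  unfolding left_lift_def by (intro the_equality) blast+
 then show ?thesis using m by simp
qed

lemma rs_mem [simp]: "p \<in> set rs ==> fst p \<in> |M|" "p \<in> set rs ==> snd p \<in> |DM|"
 using dual_bases unfolding dual_bases_def by auto

lemma ls_mem [simp]: "q \<in> set ls ==> fst q \<in> |DM|" "q \<in> set ls ==> snd q \<in> |M|"
 using dual_bases unfolding dual_bases_def by auto

lemma basis_rs: "m \<in> |M| ==> lsum M (map (\<lambda>p. fst p \<lhd>\<^sub>M rt (snd p) m) rs) = m"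
proof -
 assume m: "m \<in> |M|"
 have "m = lsum M (map (\<lambda>(m', \<mu>). m' \<lhd>\<^sub>M right_lift A M \<sigma> \<mu> m) rs)"
  using dual_bases m unfolding dual_bases_def by blast
 also have "\<dots> = lsum M (map (\<lambda>p. fst p \<lhd>\<^sub>M rt (snd p) m) rs)"
  by (rule lsum_cong) (use m in \<open>simp add: case_prod_beta right_lift_eq\<close>)
 finally show ?thesis by simp
qed

lemma basis_ls: "m \<in> |M| ==> lsum M (map (\<lambda>q. lt (fst q) m \<rhd>\<^sub>M snd q) ls) = m"
proof -
 assume m: "m \<in> |M|"
 have "m = lsum M (map (\<lambda>(\<nu>, n). left_lift A M \<sigma> \<nu> m \<rhd>\<^sub>M n) ls)"
  using dual_bases m unfolding dual_bases_def by blast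
 also have "\<dots> = lsum M (map (\<lambda>q. lt (fst q) m \<rhd>\<^sub>M snd q) ls)"
  by (rule lsum_cong) (use m in \<open>simp add: case_prod_beta left_lift_eq\<close>)
 finally show ?thesis by simp
qed

lemma lsum_DM:
 "m \<in> |M| ==> (\<And>x. x \<in> set xs ==> f x \<in> |DM| )
  ==> lsum DM (map f xs) m = lsum K (map (\<lambda>x. f x m) xs)"
 by (rule lsum_dual) (simp_all add: dual_sels)

lemma DM_eqI: "\<mu> \<in> |DM| ==> \<nu> \<in> |DM| ==> (\<And>m. m \<in> |M| ==> \<mu> m = \<nu> m) ==> \<mu> = \<nu>"
 by (rule form_eqI[of _ M]) (simp_all add: dual_sels)

text \<open>Transposing the two dual bases of \<open>M\<close> gives dual bases of \<open>DM\<close>.\<close>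

lemma dual_basis_rs:
 assumes \<mu>: "\<mu> \<in> |DM|"
 shows "lsum DM (map (\<lambda>p. rt \<mu> (fst p) \<rhd>\<^bsub>DM\<^esub> snd p) rs) = \<mu>"
proof (rule DM_eqI[OF _ \<mu>])
 show "lsum DM (map (\<lambda>p. rt \<mu> (fst p) \<rhd>\<^bsub>DM\<^esub> snd p) rs) \<in> |DM|"
  by (rule lsum_map_closed) (simp_all add: rt[OF \<mu>])
 fix m assume m: "m \<in> |M|"
 have "lsum DM (map (\<lambda>p. rt \<mu> (fst p) \<rhd>\<^bsub>DM\<^esub> snd p) rs) m = lsum K (map (\<lambda>p. (rt \<mu> (fst p) \<rhd>\<^bsub>DM\<^esub> snd p) m) rs)"
  by (rule lsum_DM[OF m]) (simp add: rt[OF \<mu>])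
 also have "\<dots> = lsum K (map (\<lambda>p. \<sigma> (rt \<mu> (fst p \<lhd>\<^sub>M rt (snd p) m))) rs)"
 proof (rule lsum_cong)
  fix p assume p: "p \<in> set rs"
  have "(rt \<mu> (fst p) \<rhd>\<^bsub>DM\<^esub> snd p) m = \<sigma> (rt (snd p) m \<otimes>\<^sub>A rt \<mu> (fst p))"
   using rt(5)[OF rs_mem(2)[OF p] m rt(2)[OF \<mu> rs_mem(1)[OF p]]] m by (simp add: dual_sels)
  also have "\<dots> = \<sigma> (rt \<mu> (fst p) \<otimes>\<^sub>A rt (snd p) m)"
   by (rule \<sigma>_comm) (use p m in \<open>simp_all add: rt(2)[of "snd p"] rt(2)[OF \<mu>]\<close>)
  also have "\<dots> = \<sigma> (rt \<mu> (fst p \<lhd>\<^sub>M rt (snd p) m))"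
   using p m by (simp add: rt(3)[OF \<mu>] rt(2)[of "snd p"])
  finally show "(rt \<mu> (fst p) \<rhd>\<^bsub>DM\<^esub> snd p) m = \<sigma> (rt \<mu> (fst p \<lhd>\<^sub>M rt (snd p) m))" .
 qed
 also have "\<dots> = \<sigma> (rt \<mu> (lsum M (map (\<lambda>p. fst p \<lhd>\<^sub>M rt (snd p) m) rs)))"
  using lsum_klin[OF klin_comp[OF rt(1)[OF \<mu>] \<sigma>_klin], of rs "\<lambda>p. fst p \<lhd>\<^sub>M rt (snd p) m"] m
  by (simp add: rt(2))
 also have "\<dots> = \<mu> m" using m by (simp add: basis_rs rt(4)[OF \<mu>])
 finally show "lsum DM (map (\<lambda>p. rt \<mu> (fst p) \<rhd>\<^bsub>DM\<^esub> snd p) rs) m = \<mu> m" .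
qed

lemma dual_basis_ls:
 assumes \<mu>: "\<mu> \<in> |DM|"
 shows "lsum DM (map (\<lambda>q. fst q \<lhd>\<^bsub>DM\<^esub> lt \<mu> (snd q)) ls) = \<mu>"
proof (rule DM_eqI[OF _ \<mu>])
 show "lsum DM (map (\<lambda>q. fst q \<lhd>\<^bsub>DM\<^esub> lt \<mu> (snd q)) ls) \<in> |DM|"
  by (rule lsum_map_closed) (simp_all add: lt[OF \<mu>])
 fix m assume m: "m \<in> |M|"
 have "lsum DM (map (\<lambda>q. fst q \<lhd>\<^bsub>DM\<^esub> lt \<mu> (snd q)) ls) m = lsum K (map (\<lambda>q. (fst q \<lhd>\<^bsub>DM\<^esub> lt \<mu> (snd q)) m) ls)"
  by (rule lsum_DM[OF m]) (simp add: lt[OF \<mu>])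
 also have "\<dots> = lsum K (map (\<lambda>q. \<sigma> (lt \<mu> (lt (fst q) m \<rhd>\<^sub>M snd q))) ls)"
 proof (rule lsum_cong)
  fix q assume q: "q \<in> set ls"
  have "(fst q \<lhd>\<^bsub>DM\<^esub> lt \<mu> (snd q)) m = \<sigma> (lt \<mu> (snd q) \<otimes>\<^sub>A lt (fst q) m)"
   using lt(5)[OF ls_mem(1)[OF q] m lt(2)[OF \<mu> ls_mem(2)[OF q]]] m by (simp add: dual_sels)
  also have "\<dots> = \<sigma> (lt (fst q) m \<otimes>\<^sub>A lt \<mu> (snd q))"
   by (rule \<sigma>_comm) (use q m in \<open>simp_all add: lt(2)[of "fst q"] lt(2)[OF \<mu>]\<close>)
  also have "\<dots> = \<sigma> (lt \<mu> (lt (fst q) m \<rhd>\<^sub>M snd q))"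
   using q m by (simp add: lt(3)[OF \<mu>] lt(2)[of "fst q"])
  finally show "(fst q \<lhd>\<^bsub>DM\<^esub> lt \<mu> (snd q)) m = \<sigma> (lt \<mu> (lt (fst q) m \<rhd>\<^sub>M snd q))" .
 qed
 also have "\<dots> = \<sigma> (lt \<mu> (lsum M (map (\<lambda>q. lt (fst q) m \<rhd>\<^sub>M snd q) ls)))"
  using lsum_klin[OF klin_comp[OF lt(1)[OF \<mu>] \<sigma>_klin], of ls "\<lambda>q. lt (fst q) m \<rhd>\<^sub>M snd q"] m
  by (simp add: lt(2))
 also have "\<dots> = \<mu> m" using m by (simp add: basis_ls lt(4)[OF \<mu>])
 finally show "lsum DM (map (\<lambda>q. fst q \<lhd>\<^bsub>DM\<^esub> lt \<mu> (snd q)) ls) m = \<mu> m" .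
qed

end

context kfield
begin

subsection \<open>The space of linear maps\<close>

lemma alin_cong: "alin A X Z f ==> (\<And>x. x \<in> |X| ==> g x = f x) ==> right_module K A X ==> alin A X Z g"
 unfolding alin_def by (auto intro: klin_cong simp: rmodD(3))

lemma alin_zero: "right_module K A X ==> right_module K A Z ==> alin A X Z (\<lambda>x. \<zero>\<^sub>Z)"
 unfolding alin_def using klinD(6)[OF rmod_klin(1), symmetric, of A Z] by (auto intro: klin_zero rmodD(2))

lemma alin_add:
 assumes Z: "right_module K A Z" and f: "alin A X Z f" and g: "alin A X Z g"
 shows "alin A X Z (\<lambda>x. f x \<oplus>\<^sub>Z g x)"
 unfolding alin_def using klin_add[OF alinD(1)[OF f] alinD(1)[OF g]]
 by (simp add: rmodD(4)[OF Z] alinD[OF f] alinD[OF g])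

lemma alin_smult:
 assumes Z: "right_module K A Z" and f: "alin A X Z f" and c: "c \<in> |K|"
 shows "alin A X Z (\<lambda>x. c \<odot>\<^sub>Z f x)"
 unfolding alin_def using klin_smult[OF alinD(1)[OF f] c]
 by (simp add: rmodD(8)[OF Z] alinD[OF f] c)

definition alin_space :: "('k, 'a) module \<Rightarrow> ('k, 'a, 'x, 's) rmodule_scheme
  \<Rightarrow> ('k, 'a, 'z, 't) rmodule_scheme \<Rightarrow> ('k, 'x \<Rightarrow> 'z) module" where
 "alin_space A X Z = \<lparr>carrier = {f \<in> extensional |X|. alin A X Z f}, mult = undefined,
   one = undefined, zero = (\<lambda>x\<in>|X|. \<zero>\<^sub>Z), add = (\<lambda>f g. \<lambda>x\<in>|X|. f x \<oplus>\<^sub>Z g x),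
   smult = (\<lambda>c f. \<lambda>x\<in>|X|. c \<odot>\<^sub>Z f x)\<rparr>"

lemma alin_space_sels:
 "f \<in> |alin_space A X Z| \<longleftrightarrow> f \<in> extensional |X| \<and> alin A X Z f"
 "x \<in> |X| ==> \<zero>\<^bsub>alin_space A X Z\<^esub> x = \<zero>\<^sub>Z"
 "x \<in> |X| ==> (f \<oplus>\<^bsub>alin_space A X Z\<^esub> g) x = f x \<oplus>\<^sub>Z g x"
 "x \<in> |X| ==> (c \<odot>\<^bsub>alin_space A X Z\<^esub> f) x = c \<odot>\<^sub>Z f x"
 "\<zero>\<^bsub>alin_space A X Z\<^esub> \<in> extensional |X|" "f \<oplus>\<^bsub>alin_space A X Z\<^esub> g \<in> extensional |X|"
 "c \<odot>\<^bsub>alin_space A X Z\<^esub> f \<in> extensional |X|"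
 by (simp_all add: alin_space_def)

lemma alin_space_eqI:
 "f \<in> |alin_space A X Z| ==> g \<in> |alin_space A X Z| ==> (\<And>x. x \<in> |X| ==> f x = g x) ==> f = g"
 unfolding alin_space_sels(1) by (blast intro: extensionalityI)

lemma alin_space_vs:
 assumes X: "right_module K A X" and Z: "right_module K A Z"
 shows "vspace (alin_space A X Z)"
proof (rule pointwise_vs[OF rmodD(2)[OF Z], where S = "|X|"])
 show "f x \<in> |Z|" if "f \<in> |alin_space A X Z|" "x \<in> |X|" for f x
  using that alinD(2)[of A X Z f x] by (simp add: alin_space_sels)
 show "f \<oplus>\<^bsub>alin_space A X Z\<^esub> g \<in> |alin_space A X Z|"
  if "f \<in> |alin_space A X Z|" "g \<in> |alin_space A X Z|" for f g
  using that alin_cong[OF alin_add[OF Z, of X f g] _ X] by (simp add: alin_space_sels)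
 show "\<zero>\<^bsub>alin_space A X Z\<^esub> \<in> |alin_space A X Z|"
  using alin_cong[OF alin_zero[OF X Z] _ X] by (simp add: alin_space_sels)
 show "c \<odot>\<^bsub>alin_space A X Z\<^esub> f \<in> |alin_space A X Z|" if "c \<in> |K|" "f \<in> |alin_space A X Z|" for c f
  using that alin_cong[OF alin_smult[OF Z, of X f c] _ X] by (simp add: alin_space_sels)
qed (simp_all add: alin_space_sels, rule alin_space_eqI, simp_all add: alin_space_sels)

lemma alin_space_eval:
 "right_module K A X ==> right_module K A Z ==> x \<in> |X| ==> klin (alin_space A X Z) Z (\<lambda>f. f x)"
 by (rule klinI) (auto simp: alin_space_vs alin_space_sels rmodD(2) intro: alinD(2))

end

context dualised_bimodule
begin

subsection \<open>Vanishing of homomorphisms\<close>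

lemma rlift_rlin:
 assumes X: "right_module K A X" and \<phi>: "klin X Kv \<phi>"
 shows "rlin X (rlift X \<phi>)"
 unfolding rlin_def using rlift(1,3)[OF X \<phi>] by blast

lemma rlin_separate:
 assumes Y: "right_module K A Y" and y: "u \<in> |Y|" "v \<in> |Y|" "\<And>\<xi>. rlin Y \<xi> ==> \<sigma> (\<xi> u) = \<sigma> (\<xi> v)"
 shows "u = v"
proof (rule forms_separate[OF rmodD(2)[OF Y] y(1,2)])
 fix \<phi> assume "\<phi> \<in> linear_forms K Y"
 then have \<phi>: "klin Y Kv \<phi>" by (rule form_klin[OF _ rmodD(2)[OF Y]])
 show "\<phi> u = \<phi> v" using y(3)[OF rlift_rlin[OF Y \<phi>]] rlift(4)[OF Y \<phi>] y(1,2) by simp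
qed

lemma rlin_basis:
 assumes "right_module K A Y" "fin_dim K Y"
 obtains bs where "\<And>k. k \<in> set bs ==> fst k \<in> |Y|" "\<And>k. k \<in> set bs ==> rlin Y (snd k)"
  "\<And>y. y \<in> |Y| ==> lsum Y (map (\<lambda>k. fst k \<lhd>\<^sub>Y snd k y) bs) = y"
proof -
 obtain bs where bs: "set bs \<subseteq> |Y| \<times> Collect (rlin Y)"
  "\<And>y. y \<in> |Y| ==> y = lsum Y (map (\<lambda>(b, \<xi>). b \<lhd>\<^sub>Y \<xi> y) bs)" using dual_basis[OF assms] by blast
 show ?thesis by (rule that[of bs]) (use bs(1) bs(2)[symmetric] in \<open>auto simp: case_prod_beta'\<close>)
qed

text \<open>
 Expand \<open>a m\<close> in the dual basis of \<open>M\<close>, and move the coefficients around with \<open>\<sigma>(a b) = \<sigma>(b a)\<close>.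
\<close>

lemma contract_rs:
 assumes Y: "right_module K A Y" and \<xi>: "rlin Y \<xi>" and act: "blin A M Y Y act"
  and y: "y \<in> |Y|" and m: "m \<in> |M|"
 shows "lsum A (map (\<lambda>p. lt (snd p) (m \<lhd>\<^sub>M \<xi> (act y (fst p)))) rs)
  = rlift Y (\<lambda>y. \<sigma> (\<xi> (act y m))) y"
proof -
 note l = rlinD[OF \<xi>]
 let ?s = "\<lambda>p. lt (snd p) (m \<lhd>\<^sub>M \<xi> (act y (fst p)))"
 have ay: "act y (fst p) \<in> |Y|" if "p \<in> set rs" for p using blinD(5)[OF act y] that by simp
 have c: "?s p \<in> |A|" if "p \<in> set rs" for p using that by (simp add: lt(2) m l(2) ay)
 show ?thesis unfolding rlift_def
 proof (rule rep_unique[symmetric])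
  show "lsum A (map ?s rs) \<in> |A|" by (rule lsum_map_closed) (simp_all add: c)
  fix a assume a: "a \<in> |A|"
  have am: "a \<rhd>\<^sub>M m \<in> |M|" using a m by simp
  note k = klin_comp[OF klin_comp[OF blinD(2)[OF act y] l(1)] \<sigma>_klin]
  have "\<sigma> (lsum A (map ?s rs) \<otimes>\<^sub>A a) = lsum Kv (map (\<lambda>p. \<sigma> (?s p \<otimes>\<^sub>A a)) rs)"
   by (rule lsum_klin[OF klin_comp[OF alg_klin(1)[OF A_alg a] \<sigma>_klin] c])
  also have "\<dots> = lsum Kv (map (\<lambda>p. \<sigma> (\<xi> (act y (fst p \<lhd>\<^sub>M rt (snd p) (a \<rhd>\<^sub>M m))))) rs)"
  proof (rule lsum_cong)
   fix p assume p: "p \<in> set rs"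
   let ?b = "\<xi> (act y (fst p))" and ?c = "rt (snd p) (a \<rhd>\<^sub>M m)"
   have b: "?b \<in> |A|" by (rule l(2)[OF ay[OF p]])
   have c: "?c \<in> |A|" using rt(2)[OF rs_mem(2)[OF p] am] .
   have "\<sigma> (?s p \<otimes>\<^sub>A a) = snd p (a \<rhd>\<^sub>M (m \<lhd>\<^sub>M ?b))" by (rule lt(6)) (use p m b a in simp_all)
   also have "\<dots> = \<sigma> (?c \<otimes>\<^sub>A ?b)" using rt(5)[OF rs_mem(2)[OF p] am b] a m b by (simp add: M_rules)
   also have "\<dots> = \<sigma> (\<xi> (act y (fst p \<lhd>\<^sub>M ?c)))"
    using \<sigma>_comm[OF b c] l(3)[OF ay[OF p] c] blinD(4)[OF act y c] p by simp
   finally show "\<sigma> (?s p \<otimes>\<^sub>A a) = \<sigma> (\<xi> (act y (fst p \<lhd>\<^sub>M ?c)))" .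
  qed
  also have "\<dots> = \<sigma> (\<xi> (act y (lsum M (map (\<lambda>p. fst p \<lhd>\<^sub>M rt (snd p) (a \<rhd>\<^sub>M m)) rs))))"
   by (rule lsum_klin[OF k, symmetric]) (simp add: rt(2) am)
  also have "\<dots> = \<sigma> (\<xi> (act (y \<lhd>\<^sub>Y a) m))" using blinD(3)[OF act y a m] by (simp add: basis_rs am)
  finally show "\<sigma> (lsum A (map ?s rs) \<otimes>\<^sub>A a) = \<sigma> (\<xi> (act (y \<lhd>\<^sub>Y a) m))" .
 qed
qed

text \<open>
 If \<open>Hom\<^sub>\<Lambda>(X, Y) = 0\<close> then the map \<open>h \<mapsto> \<Sum> h(y m\<^sub>i, \<mu>\<^sub>i) - \<Sum> h(y, \<nu>\<^sub>j) n\<^sub>j\<close> onto \<open>Hom\<^sub>A(Y, X)\<close> is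
 surjective.  Otherwise some functional \<open>L\<close> on \<open>Hom\<^sub>A(Y, X)\<close> kills its image.  Any functional is of
 the form \<open>L(x \<xi>) = \<sigma>(\<xi>(f(x)))\<close> on the maps \<open>x \<xi> : y \<mapsto> x \<xi>(y)\<close> of rank one, for an \<open>A\<close>-linear \<open>f : X \<rightarrow> Y\<close>,
 and \<open>L\<close> kills the image if and only if \<open>f\<close> is \<open>\<Lambda>\<close>-linear.
\<close>

lemma hom_zero_imp_surjective:
 fixes X :: "('k, 'a, 'x) rmodule" and Y :: "('k, 'a, 'y) rmodule"
 assumes X: "right_module K A X" and Y: "right_module K A Y" and fd: "fin_dim K Y"
  and aX: "blin A M X X aX" and aY: "blin A M Y Y aY"
  and hom0: "\<And>f x. alin A X Y f ==> (\<And>x m. x \<in> |X| ==> m \<in> |M| ==> f (aX x m) = aY (f x) m) ==>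
   x \<in> |X| ==> f x = \<zero>\<^sub>Y"
  and c: "alin A Y X c"
 obtains h where "blin A DM Y X h"
  "\<And>y. y \<in> |Y| ==> lsum X (map (\<lambda>p. h (aY y (fst p)) (snd p)) rs)
   = lsum X (map (\<lambda>q. aX (h y (fst q)) (snd q)) ls) \<oplus>\<^sub>X c y"
proof -
 let ?H = "alin_space A Y X" and ?R = "\<lambda>h y. lsum X (map (\<lambda>p. h (aY y (fst p)) (snd p)) rs)"
  and ?L = "\<lambda>h y. lsum X (map (\<lambda>q. aX (h y (fst q)) (snd q)) ls)"
 note H = alin_space_vs[OF Y X] and Xv = rmodD(2)[OF X] and Yv = rmodD(2)[OF Y]
 note sX = rmodD(3)[OF X] and sY = rmodD(3)[OF Y]
 have eval: "(f \<ominus>\<^sub>?H g) y = f y \<ominus>\<^sub>X g y"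
  if "f \<in> |?H|" "g \<in> |?H|" "y \<in> |Y|" for f g y
  using klinD(8)[OF alin_space_eval[OF Y X that(3)] that(1,2)] .
 \<comment> \<open>\<open>W\<close> is the image of the map, as the set of the \<open>c\<close> for which the equation has a solution \<open>h\<close>\<close>
 define good where "good = (\<lambda>h c. blin A DM Y X h \<and> (\<forall>y\<in>|Y|. ?R h y = ?L h y \<oplus>\<^sub>X c y))"
 define W where "W = {c \<in> |?H|. \<exists>h. good h c}"
 have cl1: "h (aY y (fst p)) (snd p) \<in> |X|" if "blin A DM Y X h" "y \<in> |Y|" "p \<in> set rs" for h y p
  using blinD(5)[OF that(1)] blinD(5)[OF aY that(2)] that(3) by simp
 have cl2: "aX (h y (fst q)) (snd q) \<in> |X|" if "blin A DM Y X h" "y \<in> |Y|" "q \<in> set ls" for h y q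
  using blinD(5)[OF aX] blinD(5)[OF that(1,2)] that(3) by simp
 have cH: "c y \<in> |X|" if "c \<in> |?H|" "y \<in> |Y|" for c y
  using that alinD(2)[of A Y X c y] unfolding alin_space_sels by blast
 have Wsub: "sub W ?H"
 proof (rule subI[OF H])
  show "W \<subseteq> |?H|" unfolding W_def by auto
  have "good (\<lambda>y \<mu>. \<zero>\<^sub>X) \<zero>\<^sub>?H" unfolding good_def
   using Xv by (intro conjI blin_zero[OF Yv X DM_bimodule] ballI)
    (simp add: alin_space_sels lsum_zero klinD(6)[OF blinD(1)[OF aX]])
  then show "\<zero>\<^sub>?H \<in> W" unfolding W_def using vs_simps(2)[OF H] by blast
 next
  fix c c' assume "c \<in> W" "c' \<in> W"
  then obtain h h' where *: "c \<in> |?H|" "c' \<in> |?H|" "good h c" "good h' c'" unfolding W_def by auto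
  note b = *(3,4)[unfolded good_def, THEN conjunct1] and e = *(3,4)[unfolded good_def, THEN conjunct2, rule_format]
  have "good (\<lambda>y \<mu>. h y \<mu> \<oplus>\<^sub>X h' y \<mu>) (c \<oplus>\<^sub>?H c')" unfolding good_def
  proof (intro conjI blin_add[OF b X] ballI)
   fix y assume y: "y \<in> |Y|"
   have S: "?L h y \<in> |X|" "?L h' y \<in> |X|" using Xv cl2[OF b(1) y] cl2[OF b(2) y] by (simp_all add: lsum_map_closed)
   have "?R (\<lambda>y \<mu>. h y \<mu> \<oplus>\<^sub>X h' y \<mu>) y = (?L h y \<oplus>\<^sub>X c y) \<oplus>\<^sub>X (?L h' y \<oplus>\<^sub>X c' y)"
    using Xv e y cl1[OF b(1) y] cl1[OF b(2) y] by (simp add: lsum_add)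
   moreover have "?L (\<lambda>y \<mu>. h y \<mu> \<oplus>\<^sub>X h' y \<mu>) y = ?L h y \<oplus>\<^sub>X ?L h' y"
    by (subst lsum_add[OF Xv, of ls "\<lambda>q. aX (h y (fst q)) (snd q)", symmetric], (simp add: cl2 b y)+, rule lsum_cong)
     (simp add: klinD(4)[OF blinD(1)[OF aX]] blinD(5)[OF b(1) y] blinD(5)[OF b(2) y])
   ultimately show "?R (\<lambda>y \<mu>. h y \<mu> \<oplus>\<^sub>X h' y \<mu>) y
    = ?L (\<lambda>y \<mu>. h y \<mu> \<oplus>\<^sub>X h' y \<mu>) y \<oplus>\<^sub>X (c \<oplus>\<^sub>?H c') y"
    using S y cH[OF *(1) y] cH[OF *(2) y] Xv by (simp add: alin_space_sels vs_ac)
  qed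
  then show "c \<oplus>\<^sub>?H c' \<in> W" unfolding W_def using vs_simps(1)[OF H *(1,2)] by blast
 next
  fix d c assume d: "d \<in> |K|" and "c \<in> W"
  then obtain h where *: "c \<in> |?H|" "good h c" unfolding W_def by auto
  note b = *(2)[unfolded good_def, THEN conjunct1] and e = *(2)[unfolded good_def, THEN conjunct2, rule_format]
  have "good (\<lambda>y \<mu>. d \<odot>\<^sub>X h y \<mu>) (d \<odot>\<^sub>?H c)" unfolding good_def
  proof (intro conjI blin_smult[OF b d X] ballI)
   fix y assume y: "y \<in> |Y|"
   note k = klin_smult[OF klin_id[OF Xv] d]
   have "?R (\<lambda>y \<mu>. d \<odot>\<^sub>X h y \<mu>) y = d \<odot>\<^sub>X ?R h y" by (rule lsum_klin[OF k cl1[OF b y], symmetric])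
   also have "\<dots> = d \<odot>\<^sub>X ?L h y \<oplus>\<^sub>X (d \<odot>\<^sub>?H c) y"
    unfolding e[OF y] alin_space_sels(4)[OF y]
    by (rule klinD(4)[OF k lsum_map_closed[OF Xv cl2[OF b y]] cH[OF *(1) y]])
   also have "d \<odot>\<^sub>X ?L h y = lsum X (map (\<lambda>q. d \<odot>\<^sub>X aX (h y (fst q)) (snd q)) ls)"
    by (rule lsum_klin[OF k cl2[OF b y]])
   also have "\<dots> = ?L (\<lambda>y \<mu>. d \<odot>\<^sub>X h y \<mu>) y"
    by (rule lsum_cong) (simp add: klinD(5)[OF blinD(1)[OF aX]] blinD(5)[OF b y] d)
   finally show "?R (\<lambda>y \<mu>. d \<odot>\<^sub>X h y \<mu>) y = ?L (\<lambda>y \<mu>. d \<odot>\<^sub>X h y \<mu>) y \<oplus>\<^sub>X (d \<odot>\<^sub>?H c) y" .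
  qed
  then show "d \<odot>\<^sub>?H c \<in> W" unfolding W_def using vs_simps(3)[OF H d *(1)] by blast
 qed
 define c0 where "c0 = restrict c |Y|"
 have ca: "alin A Y X c0" by (rule alin_cong[OF c _ Y]) (simp add: c0_def)
 have c0: "c0 \<in> |?H|" unfolding alin_space_sels using ca by (simp add: c0_def)
 have "c0 \<in> W"
 proof (rule ccontr)
  assume "c0 \<notin> W"
  then obtain L where L: "L \<in> linear_forms K ?H" "\<And>w. w \<in> W ==> L w = \<zero>" "L c0 = \<one>"
   using separating_form[OF H Wsub c0] by blast
  note Lk = form_klin[OF L(1) H]
  obtain bs where bs: "\<And>k. k \<in> set bs ==> fst k \<in> |Y|" "\<And>k. k \<in> set bs ==> rlin Y (snd k)"
   "\<And>y. y \<in> |Y| ==> lsum Y (map (\<lambda>k. fst k \<lhd>\<^sub>Y snd k y) bs) = y" by (rule rlin_basis[OF Y fd]) (rule that)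
  note xi = rlinD[OF bs(2)]
  \<comment> \<open>the maps of rank one, which span by the dual basis\<close>
  define rk where "rk = (\<lambda>x \<xi>. \<lambda>y\<in>|Y|. x \<lhd>\<^sub>X \<xi> y)"
  have rk_app: "rk x \<xi> y = x \<lhd>\<^sub>X \<xi> y" if "y \<in> |Y|" for x \<xi> y using that by (simp add: rk_def)
  have rk: "rk x \<xi> \<in> |?H|" if x: "x \<in> |X|" and \<xi>: "rlin Y \<xi>" for x \<xi>
  proof -
   have "alin A Y X (\<lambda>y. x \<lhd>\<^sub>X \<xi> y)" unfolding alin_def
    using klin_comp[OF rlinD(1)[OF \<xi>] rmod_klin(2)[OF X x]] rlinD[OF \<xi>] x by (simp add: rmodD(6)[OF X])
   from alin_cong[OF this _ Y] show ?thesis by (simp add: alin_space_sels rk_def)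
  qed
  have rk_klin: "klin X ?H (\<lambda>x. rk x \<xi>)" if \<xi>: "rlin Y \<xi>" for \<xi>
  proof (rule klinI[OF Xv H rk[OF _ \<xi>]])
   show "rk (x \<oplus>\<^sub>X x') \<xi> = rk x \<xi> \<oplus>\<^sub>?H rk x' \<xi>" if "x \<in> |X|" "x' \<in> |X|" for x x'
    by (rule alin_space_eqI[of _ A Y X])
     (use that H Xv rk[OF _ \<xi>] rlinD(2)[OF \<xi>] in \<open>simp_all add: alin_space_sels(3) rk_app rmodD(4)[OF X]\<close>)
   show "rk (d \<odot>\<^sub>X x) \<xi> = d \<odot>\<^sub>?H rk x \<xi>" if "d \<in> |K|" "x \<in> |X|" for d x
    by (rule alin_space_eqI[of _ A Y X])
     (use that H Xv rk[OF _ \<xi>] rlinD(2)[OF \<xi>] in \<open>simp_all add: alin_space_sels(4) rk_app rmodD(8)[OF X]\<close>)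
  qed
  have expand: "g = lsum ?H (map (\<lambda>k. rk (g (fst k)) (snd k)) bs)" if g: "g \<in> |?H|" for g
  proof (rule alin_space_eqI[OF g lsum_map_closed[OF H rk[OF cH[OF g bs(1)] bs(2)]]])
   fix y assume y: "y \<in> |Y|"
   have ga: "alin A Y X g" using g by (simp add: alin_space_sels)
   have "g y = g (lsum Y (map (\<lambda>k. fst k \<lhd>\<^sub>Y snd k y) bs))" using bs(3)[OF y] by simp
   also have "\<dots> = lsum X (map (\<lambda>k. g (fst k \<lhd>\<^sub>Y snd k y)) bs)"
    by (rule lsum_klin[OF alinD(1)[OF ga]]) (simp add: sY bs xi(2) y)
   also have "\<dots> = lsum X (map (\<lambda>k. rk (g (fst k)) (snd k) y) bs)"
    by (rule lsum_cong) (simp add: rk_app y alinD(3)[OF ga] bs xi(2))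
   also have "\<dots> = lsum ?H (map (\<lambda>k. rk (g (fst k)) (snd k)) bs) y"
    by (rule lsum_klin[OF alin_space_eval[OF Y X y] rk[OF cH[OF g bs(1)] bs(2)], symmetric])
   finally show "g y = lsum ?H (map (\<lambda>k. rk (g (fst k)) (snd k)) bs) y" .
  qed
  \<comment> \<open>the components of the map \<open>f\<close> that represents \<open>L\<close>\<close>
  define \<phi> where "\<phi> = (\<lambda>(k :: 'y \<times> ('y \<Rightarrow> 'a)) x. L (rk x (snd k)))"
  have \<phi>: "klin X Kv (\<phi> k)" if "k \<in> set bs" for k unfolding \<phi>_def by (rule klin_comp[OF rk_klin[OF bs(2)[OF that]] Lk])
  note r = rlift[OF X \<phi>]
  define f where "f = (\<lambda>x. lsum Y (map (\<lambda>k. fst k \<lhd>\<^sub>Y rlift X (\<phi> k) x) bs))"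
  have fk: "klin X Y f" unfolding f_def
   by (rule klin_lsum[OF Xv Yv]) (rule klin_comp[OF r(1) rmod_klin(2)[OF Y bs(1)]])
  have f_alin: "alin A X Y f" unfolding alin_def
  proof (intro conjI ballI fk)
   fix x a assume x: "x \<in> |X|" and a: "a \<in> |A|"
   have "f x \<lhd>\<^sub>Y a = lsum Y (map (\<lambda>k. (fst k \<lhd>\<^sub>Y rlift X (\<phi> k) x) \<lhd>\<^sub>Y a) bs)"
    unfolding f_def by (rule lsum_klin[OF rmod_klin(1)[OF Y a]]) (simp add: sY bs(1) r(2) x)
   also have "\<dots> = f (x \<lhd>\<^sub>X a)" unfolding f_def
    by (rule lsum_cong) (simp add: r(2,3) x a bs(1) rmodD(6)[OF Y])
   finally show "f (x \<lhd>\<^sub>X a) = f x \<lhd>\<^sub>Y a" by simp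
  qed
  have Lf: "L (rk x \<xi>) = \<sigma> (\<xi> (f x))" if x: "x \<in> |X|" and \<xi>: "rlin Y \<xi>" for x \<xi>
  proof -
   note l = rlinD[OF \<xi>]
   have "L (rk x \<xi>) = L (lsum ?H (map (\<lambda>k. rk (rk x \<xi> (fst k)) (snd k)) bs))" using expand[OF rk[OF that]] by simp
   also have "\<dots> = lsum Kv (map (\<lambda>k. L (rk (rk x \<xi> (fst k)) (snd k))) bs)"
    by (rule lsum_klin[OF Lk]) (rule rk[OF cH[OF rk[OF that] bs(1)] bs(2)])
   also have "\<dots> = lsum Kv (map (\<lambda>k. \<sigma> (\<xi> (fst k \<lhd>\<^sub>Y rlift X (\<phi> k) x))) bs)"
    by (rule lsum_cong) (simp add: rk_app bs(1) l r(2)[OF _ x] r(6)[OF _ x], simp add: \<phi>_def)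
   also have "\<dots> = \<sigma> (\<xi> (f x))" unfolding f_def
    by (rule lsum_klin[OF klin_comp[OF l(1) \<sigma>_klin], symmetric]) (simp add: sY bs(1) r(2) x)
   finally show ?thesis .
  qed
  have "f (aX x m) = aY (f x) m" if x: "x \<in> |X|" and m: "m \<in> |M|" for x m
  proof (rule rlin_separate[OF Y])
   have fx: "f x \<in> |Y|" and axm: "aX x m \<in> |X|" using klinD(3)[OF fk x] blinD(5)[OF aX x m] by simp_all
   then show "f (aX x m) \<in> |Y|" "aY (f x) m \<in> |Y|" using klinD(3)[OF fk] blinD(5)[OF aY _ m] by simp_all
   fix \<xi> assume \<xi>: "rlin Y \<xi>"
   note l = rlinD[OF \<xi>]
   define \<xi>' where "\<xi>' = rlift Y (\<lambda>y. \<sigma> (\<xi> (aY y m)))"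
   have k': "klin Y Kv (\<lambda>y. \<sigma> (\<xi> (aY y m)))" by (rule klin_comp[OF klin_comp[OF blinD(1)[OF aY m] l(1)] \<sigma>_klin])
   have \<xi>': "rlin Y \<xi>'" unfolding \<xi>'_def by (rule rlift_rlin[OF Y k'])
   \<comment> \<open>a choice of \<open>h\<close> of rank one, on which \<open>L\<close> compares \<open>f(x m)\<close> with \<open>f(x) m\<close>\<close>
   define h where "h = (\<lambda>y \<mu>. x \<lhd>\<^sub>X lt \<mu> (m \<lhd>\<^sub>M \<xi> y))"
   have h: "blin A DM Y X h" unfolding h_def
   proof (rule blinI)
    fix \<mu> assume "\<mu> \<in> |DM|"
    then show "klin Y X (\<lambda>y. x \<lhd>\<^sub>X lt \<mu> (m \<lhd>\<^sub>M \<xi> y))"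
     by (intro klin_comp[OF klin_comp[OF klin_comp[OF l(1) M_mult_klin(4)[OF m]] lt(1)] rmod_klin(2)[OF X x]])
   next
    fix y assume y: "y \<in> |Y|"
    then have mb: "m \<lhd>\<^sub>M \<xi> y \<in> |M|" using m l(2) by simp
    show "klin DM X (\<lambda>\<mu>. x \<lhd>\<^sub>X lt \<mu> (m \<lhd>\<^sub>M \<xi> y))"
     by (rule klin_comp[OF lt_klin[OF mb] rmod_klin(2)[OF X x]])
    fix a \<mu> assume a: "a \<in> |A|" and \<mu>: "\<mu> \<in> |DM|"
    show "x \<lhd>\<^sub>X lt \<mu> (m \<lhd>\<^sub>M \<xi> (y \<lhd>\<^sub>Y a)) = x \<lhd>\<^sub>X lt (a \<rhd>\<^bsub>DM\<^esub> \<mu>) (m \<lhd>\<^sub>M \<xi> y)"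
     using y a m l(2)[OF y] by (simp add: l(3) lt(8)[OF \<mu> mb a] M_rules)
    show "x \<lhd>\<^sub>X lt \<mu> (m \<lhd>\<^sub>M \<xi> y) \<lhd>\<^sub>X a = x \<lhd>\<^sub>X lt (\<mu> \<lhd>\<^bsub>DM\<^esub> a) (m \<lhd>\<^sub>M \<xi> y)"
     using x a lt(2)[OF \<mu> mb] by (simp add: lt(7)[OF \<mu> mb a] rmodD(6)[OF X])
   qed
   let ?u = "rk x \<xi>'" and ?v = "rk (aX x m) \<xi>"
   note uv = rk[OF x \<xi>'] rk[OF axm \<xi>]
   have "good h (?u \<ominus>\<^sub>?H ?v)" unfolding good_def
   proof (intro conjI h ballI)
    fix y assume y: "y \<in> |Y|"
    have mb: "m \<lhd>\<^sub>M \<xi> y \<in> |M|" using m l(2)[OF y] by simp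
    have "?R h y = x \<lhd>\<^sub>X lsum A (map (\<lambda>p. lt (snd p) (m \<lhd>\<^sub>M \<xi> (aY y (fst p)))) rs)"
     unfolding h_def by (rule lsum_klin[OF rmod_klin(2)[OF X x], symmetric])
      (simp add: lt(2) m l(2) blinD(5)[OF aY y])
    then have 1: "?R h y = ?u y" unfolding contract_rs[OF Y \<xi> aY y m] by (simp add: rk_app y \<xi>'_def)
    have "?L h y = lsum X (map (\<lambda>q. aX x (lt (fst q) (m \<lhd>\<^sub>M \<xi> y) \<rhd>\<^sub>M snd q)) ls)"
     unfolding h_def by (rule lsum_cong) (simp add: blinD(3)[OF aX x] lt(2) mb)
    also have "\<dots> = aX x (lsum M (map (\<lambda>q. lt (fst q) (m \<lhd>\<^sub>M \<xi> y) \<rhd>\<^sub>M snd q) ls))"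
     by (rule lsum_klin[OF blinD(2)[OF aX x], symmetric]) (simp add: lt(2) mb)
    also have "\<dots> = ?v y" using y mb blinD(4)[OF aX x l(2)[OF y] m] by (simp add: basis_ls rk_app)
    finally have 2: "?L h y = ?v y" .
    show "?R h y = ?L h y \<oplus>\<^sub>X (?u \<ominus>\<^sub>?H ?v) y"
     unfolding 1 2 eval[OF uv y] using cH[OF uv(1) y] cH[OF uv(2) y] Xv by (simp add: vs_minus_add_cancel)
   qed
   then have "?u \<ominus>\<^sub>?H ?v \<in> W" unfolding W_def using vs_simps(5)[OF H uv] by blast
   then have "L ?u \<ominus>\<^bsub>Kv\<^esub> L ?v = \<zero>" using L(2) klinD(8)[OF Lk uv] by simp
   then have "L ?u = L ?v" using klinD(3)[OF Lk uv(1)] klinD(3)[OF Lk uv(2)] vs_minus_zero_iff[OF Kv_vs, of "L ?u" "L ?v"] by simp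
   then show "\<sigma> (\<xi> (f (aX x m))) = \<sigma> (\<xi> (aY (f x) m))"
    using Lf[OF axm \<xi>] Lf[OF x \<xi>'] rlift(4)[OF Y k' fx] by (simp add: \<xi>'_def)
  qed
  then have f0: "f x = \<zero>\<^sub>Y" if "x \<in> |X|" for x using hom0[OF f_alin _ that] by blast
  have "L c0 = L (lsum ?H (map (\<lambda>k. rk (c0 (fst k)) (snd k)) bs))" using expand[OF c0] by simp
  also have "\<dots> = lsum Kv (map (\<lambda>k. L (rk (c0 (fst k)) (snd k))) bs)"
   by (rule lsum_klin[OF Lk]) (rule rk[OF cH[OF c0 bs(1)] bs(2)])
  also have "\<dots> = \<zero>\<^bsub>Kv\<^esub>"
   by (rule lsum_zero[OF Kv_vs])
    (use klinD(6)[OF \<sigma>_klin] klinD(6)[OF xi(1)] in \<open>simp add: Lf[OF cH[OF c0 bs(1)] bs(2)] f0[OF cH[OF c0 bs(1)]]\<close>)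
  finally show False using L(3) by simp
 qed
 then obtain h where h: "good h c0" unfolding W_def by blast
 show ?thesis by (rule that[of h]) (use h in \<open>simp_all add: good_def c0_def\<close>)
qed

end

context dualised_bimodule
begin

text \<open>
 For a right \<open>A\<close>-module \<open>X\<close> with dual basis \<open>(x\<^sub>k, \<xi>\<^sub>k)\<close>, the trace of an endomorphism \<open>g\<close> is
 \<open>\<Sum> \<sigma>(\<xi>\<^sub>k(g x\<^sub>k))\<close>.  The two endomorphisms \<open>x \<mapsto> \<Sum> t(x m\<^sub>i, \<mu>\<^sub>i)\<close> and \<open>x \<mapsto> \<Sum> t(x, \<nu>\<^sub>j) n\<^sub>j\<close> that belong to an
 action of \<open>M\<close> and to a map \<open>t : X \<otimes> DM \<rightarrow> X\<close> have the same trace: both are the contraction of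
 \<open>t\<close> with the action.
\<close>

lemma trace_symmetric:
 fixes X :: "('k, 'a, 'x) rmodule"
 assumes X: "right_module K A X" and aX: "blin A M X X aX" and t: "blin A DM X X t"
  and bs: "\<And>k. k \<in> set bs ==> fst k \<in> |X|" "\<And>k. k \<in> set bs ==> rlin X (snd k)"
   "\<And>x. x \<in> |X| ==> lsum X (map (\<lambda>k. fst k \<lhd>\<^sub>X snd k x) bs) = x"
 shows "lsum K (map (\<lambda>k. \<sigma> (snd k (lsum X (map (\<lambda>p. t (aX (fst k) (fst p)) (snd p)) rs)))) bs)
  = lsum K (map (\<lambda>l. \<sigma> (snd l (lsum X (map (\<lambda>q. aX (t (fst l) (fst q)) (snd q)) ls)))) bs)"
proof -
 note Xv = rmodD(2)[OF X] and xi = rlinD[OF bs(2)]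
 define \<mu> where "\<mu> = (\<lambda>(k :: 'x \<times> ('x \<Rightarrow> 'a)) (l :: 'x \<times> ('x \<Rightarrow> 'a)). \<lambda>m\<in>|M|. \<sigma> (snd l (aX (fst k) m)))"
 have tr: "klin X Kv (\<lambda>x. \<sigma> (snd k x))" if "k \<in> set bs" for k
  by (rule klin_comp[OF xi(1)[OF that] \<sigma>_klin])
 have mu: "\<mu> k l \<in> |DM|" if "k \<in> set bs" "l \<in> set bs" for k l
  unfolding \<mu>_def dual_sels(1) by (rule klin_form[OF klin_comp[OF blinD(2)[OF aX bs(1)[OF that(1)]] tr[OF that(2)]]])
 have axm: "aX (fst k) m \<in> |X|" if "k \<in> set bs" "m \<in> |M|" for k m
  by (rule blinD(5)[OF aX bs(1)[OF that(1)] that(2)])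
 have rmu: "rt (\<mu> k l) m = snd l (aX (fst k) m)" if "k \<in> set bs" "l \<in> set bs" "m \<in> |M|" for k l m
  unfolding rlift_def
 proof (rule rep_unique)
  show "snd l (aX (fst k) m) \<in> |A|" by (rule xi(2)[OF that(2) axm[OF that(1,3)]])
  fix a assume a: "a \<in> |A|"
  show "\<sigma> (snd l (aX (fst k) m) \<otimes>\<^sub>A a) = \<mu> k l (m \<lhd>\<^sub>M a)"
   using that a xi(3)[OF that(2) axm[OF that(1,3)] a] blinD(4)[OF aX bs(1)[OF that(1)] a that(3)]
   by (simp add: \<mu>_def)
 qed
 let ?a = "\<lambda>k l p. snd l (aX (fst k) (fst p)) \<rhd>\<^bsub>DM\<^esub> snd p"
  and ?c = "\<lambda>k l q. \<sigma> (snd k (t (fst l) (fst q \<lhd>\<^bsub>DM\<^esub> lt (\<mu> k l) (snd q))))"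
 \<comment> \<open>the common value of both traces is \<open>\<Sum> T k l\<close>\<close>
 define T where "T = (\<lambda>k l. \<sigma> (snd k (t (fst l) (\<mu> k l))))"
 have T: "T k l \<in> |K|" if "k \<in> set bs" "l \<in> set bs" for k l
  unfolding T_def using klinD(3)[OF tr[OF that(1)]] blinD(5)[OF t bs(1)[OF that(2)] mu[OF that]] by simp
 have "\<sigma> (snd k (lsum X (map (\<lambda>p. t (aX (fst k) (fst p)) (snd p)) rs))) = lsum K (map (T k) bs)"
  if k: "k \<in> set bs" for k
 proof -
  have tc: "t (fst l) (?a k l p) \<in> |X|" if "p \<in> set rs" "l \<in> set bs" for p l
   using that blinD(5)[OF t bs(1)] xi(2)[OF that(2) axm[OF k]] by simp
  have "lsum X (map (\<lambda>p. t (aX (fst k) (fst p)) (snd p)) rs)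
   = lsum X (map (\<lambda>p. lsum X (map (\<lambda>l. t (fst l) (?a k l p)) bs)) rs)"
  proof (rule lsum_cong)
   fix p assume p: "p \<in> set rs"
   have ak: "aX (fst k) (fst p) \<in> |X|" using axm[OF k] p by simp
   have "t (aX (fst k) (fst p)) (snd p)
    = t (lsum X (map (\<lambda>l. fst l \<lhd>\<^sub>X snd l (aX (fst k) (fst p))) bs)) (snd p)" using bs(3)[OF ak] by simp
   also have "\<dots> = lsum X (map (\<lambda>l. t (fst l \<lhd>\<^sub>X snd l (aX (fst k) (fst p))) (snd p)) bs)"
    by (rule lsum_klin[OF blinD(1)[OF t]]) (use p in \<open>simp_all add: rmodD(3)[OF X] bs xi(2) ak\<close>)
   also have "\<dots> = lsum X (map (\<lambda>l. t (fst l) (?a k l p)) bs)"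
    by (rule lsum_cong) (use p in \<open>simp add: blinD(3)[OF t] bs xi(2) ak\<close>)
   finally show "t (aX (fst k) (fst p)) (snd p)
    = lsum X (map (\<lambda>l. t (fst l) (?a k l p)) bs)" .
  qed
  also have "\<dots> = lsum X (map (\<lambda>l. lsum X (map (\<lambda>p. t (fst l) (?a k l p)) rs)) bs)"
   by (rule lsum_swap[OF Xv]) (rule tc)
  also have "\<dots> = lsum X (map (\<lambda>l. t (fst l) (\<mu> k l)) bs)"
  proof (rule lsum_cong)
   fix l assume l: "l \<in> set bs"
   have "lsum X (map (\<lambda>p. t (fst l) (?a k l p)) rs)
    = t (fst l) (lsum DM (map (?a k l) rs))"
    by (rule lsum_klin[OF blinD(2)[OF t bs(1)[OF l]], symmetric]) (simp add: xi(2)[OF l] axm[OF k])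
   also have "lsum DM (map (?a k l) rs)
    = lsum DM (map (\<lambda>p. rt (\<mu> k l) (fst p) \<rhd>\<^bsub>DM\<^esub> snd p) rs)"
    by (rule lsum_cong) (simp add: rmu k l)
   finally show "lsum X (map (\<lambda>p. t (fst l) (?a k l p)) rs) = t (fst l) (\<mu> k l)"
    by (simp add: dual_basis_rs mu k l)
  qed
  finally show ?thesis
   using lsum_klin[OF tr[OF k], of bs "\<lambda>l. t (fst l) (\<mu> k l)"] blinD(5)[OF t bs(1) mu[OF k]]
   by (simp add: T_def)
 qed
 then have 1: "lsum K (map (\<lambda>k. \<sigma> (snd k (lsum X (map (\<lambda>p. t (aX (fst k) (fst p)) (snd p)) rs)))) bs)
  = lsum K (map (\<lambda>k. lsum K (map (T k) bs)) bs)" by (intro lsum_cong)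
 have "\<sigma> (snd l (lsum X (map (\<lambda>q. aX (t (fst l) (fst q)) (snd q)) ls))) = lsum K (map (\<lambda>k. T k l) bs)"
  if l: "l \<in> set bs" for l
 proof -
  have tl: "t (fst l) \<nu> \<in> |X|" if "\<nu> \<in> |DM|" for \<nu> by (rule blinD(5)[OF t bs(1)[OF l] that])
  have atl: "aX (t (fst l) (fst q)) (snd q) \<in> |X|" if "q \<in> set ls" for q
   by (rule blinD(5)[OF aX]) (use that tl in simp_all)
  have lmu: "lt (\<mu> k l) n \<in> |A|" if "k \<in> set bs" "n \<in> |M|" for k n by (rule lt(2)[OF mu[OF that(1) l] that(2)])
  have "\<sigma> (snd l (lsum X (map (\<lambda>q. aX (t (fst l) (fst q)) (snd q)) ls)))
   = lsum Kv (map (\<lambda>q. \<sigma> (snd l (aX (t (fst l) (fst q)) (snd q)))) ls)"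
   by (rule lsum_klin[OF tr[OF l]]) (rule atl)
  also have "\<dots> = lsum Kv (map (\<lambda>q. lsum Kv (map (\<lambda>k. ?c k l q) bs)) ls)"
  proof (rule lsum_cong)
   fix q assume q: "q \<in> set ls"
   note n = ls_mem(2)[OF q] and \<nu> = ls_mem(1)[OF q]
   let ?z = "t (fst l) (fst q)"
   have "\<sigma> (snd l (aX ?z (snd q))) = \<sigma> (snd l (aX (lsum X (map (\<lambda>k. fst k \<lhd>\<^sub>X snd k ?z) bs)) (snd q)))"
    using bs(3)[OF tl[OF \<nu>]] by simp
   also have "\<dots> = lsum Kv (map (\<lambda>k. \<sigma> (snd l (aX (fst k \<lhd>\<^sub>X snd k ?z) (snd q)))) bs)"
    by (rule lsum_klin[OF klin_comp[OF blinD(1)[OF aX n] tr[OF l]]])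
     (simp add: rmodD(3)[OF X] bs xi(2)[OF _ tl[OF \<nu>]])
   also have "\<dots> = lsum Kv (map (\<lambda>k. ?c k l q) bs)"
   proof (rule lsum_cong)
    fix k assume k: "k \<in> set bs"
    let ?b = "snd k ?z"
    have b: "?b \<in> |A|" by (rule xi(2)[OF k tl[OF \<nu>]])
    have "\<sigma> (snd l (aX (fst k \<lhd>\<^sub>X ?b) (snd q))) = \<mu> k l (?b \<rhd>\<^sub>M snd q)"
     using blinD(3)[OF aX bs(1)[OF k] b n] b n by (simp add: \<mu>_def)
    also have "\<dots> = \<sigma> (?b \<otimes>\<^sub>A lt (\<mu> k l) (snd q))" using lt(5)[OF mu[OF k l] n b] by simp
    also have "\<dots> = \<sigma> (snd k (?z \<lhd>\<^sub>X lt (\<mu> k l) (snd q)))"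
     using xi(3)[OF k tl[OF \<nu>] lmu[OF k n]] by simp
    also have "\<dots> = ?c k l q"
     using blinD(4)[OF t bs(1)[OF l] lmu[OF k n] \<nu>] by simp
    finally show "\<sigma> (snd l (aX (fst k \<lhd>\<^sub>X ?b) (snd q)))
     = ?c k l q" .
   qed
   finally show "\<sigma> (snd l (aX ?z (snd q)))
    = lsum Kv (map (\<lambda>k. ?c k l q) bs)" .
  qed
  also have "\<dots> = lsum Kv (map (\<lambda>k. lsum Kv (map (?c k l) ls)) bs)"
   by (rule lsum_swap[OF Kv_vs])
    (simp add: xi(2) tl lmu)
  also have "\<dots> = lsum Kv (map (\<lambda>k. T k l) bs)"
  proof (rule lsum_cong)
   fix k assume k: "k \<in> set bs"
   have "lsum Kv (map (?c k l) ls)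
    = \<sigma> (snd k (t (fst l) (lsum DM (map (\<lambda>q. fst q \<lhd>\<^bsub>DM\<^esub> lt (\<mu> k l) (snd q)) ls))))"
    by (rule lsum_klin[OF klin_comp[OF blinD(2)[OF t bs(1)[OF l]] tr[OF k]], symmetric]) (simp add: lmu k)
   then show "lsum Kv (map (?c k l) ls) = T k l"
    by (simp add: dual_basis_ls mu k l T_def)
  qed
  finally show ?thesis by simp
 qed
 then have 2: "lsum K (map (\<lambda>l. \<sigma> (snd l (lsum X (map (\<lambda>q. aX (t (fst l) (fst q)) (snd q)) ls)))) bs)
  = lsum K (map (\<lambda>l. lsum K (map (\<lambda>k. T k l) bs)) bs)" by (intro lsum_cong)
 have "lsum Kv (map (\<lambda>k. lsum Kv (map (T k) bs)) bs) = lsum Kv (map (\<lambda>l. lsum Kv (map (\<lambda>k. T k l) bs)) bs)"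
  by (rule lsum_swap[OF Kv_vs]) (simp add: T)
 then show ?thesis using 1 2 by simp
qed

text \<open>
 Let \<open>\<theta>\<close> be a map to \<open>Z\<close> that is compatible with the relation \<open>\<rho> = \<ell>\<close>.  To show that
 \<open>\<eta>(\<theta>(x\<^sub>0, \<mu>\<^sub>0)) = 0\<close> for a form \<open>\<eta>\<close>, take the derivation \<open>D(z, m) = x\<^sub>0 \<mu>\<^sub>0(\<eta>(z) m)\<close>, with forms read as
 \<open>A\<close>-linear maps.  It is inner, by some \<open>u : Z \<rightarrow> X\<close>.  Then \<open>t = u \<circ> \<theta>\<close> gives two endomorphisms of \<open>X\<close>
 of the same trace, whose difference is \<open>x \<mapsto> x\<^sub>0 \<zeta>(x)\<close>, of trace \<open>\<sigma>(\<zeta>(x\<^sub>0)) = \<eta>(\<theta>(x\<^sub>0, \<mu>\<^sub>0))\<close>.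
\<close>

lemma inner_imp_hom_zero:
 fixes X :: "('k, 'a, 'x) rmodule" and Z :: "('k, 'a, 'z) rmodule"
 assumes X: "right_module K A X" and Z: "right_module K A Z" and fd: "fin_dim K X"
  and aX: "blin A M X X aX" and aZ: "blin A M Z Z aZ"
  and inner: "\<And>D. blin A M Z X D ==> \<exists>u. alin A Z X u \<and>
   (\<forall>z\<in>|Z|. \<forall>m\<in>|M|. u (aZ z m) = aX (u z) m \<oplus>\<^sub>X D z m)"
  and \<theta>: "blin A DM X Z \<theta>"
  and rel: "\<And>x. x \<in> |X| ==> lsum Z (map (\<lambda>p. \<theta> (aX x (fst p)) (snd p)) rs)
   = lsum Z (map (\<lambda>q. aZ (\<theta> x (fst q)) (snd q)) ls)"
  and x0: "x0 \<in> |X|" and \<mu>0: "\<mu>0 \<in> |DM|"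
 shows "\<theta> x0 \<mu>0 = \<zero>\<^sub>Z"
proof (rule forms_separate)
 note Xv = rmodD(2)[OF X] and Zv = rmodD(2)[OF Z]
 show "vspace Z" "\<theta> x0 \<mu>0 \<in> |Z|" "\<zero>\<^sub>Z \<in> |Z|" using Zv blinD(5)[OF \<theta> x0 \<mu>0] by simp_all
 fix \<eta> assume \<eta>: "\<eta> \<in> linear_forms K Z"
 note l = rlift[OF Z form_klin[OF \<eta> Zv]]
 define D where "D = (\<lambda>z m. x0 \<lhd>\<^sub>X rt \<mu>0 (rlift Z \<eta> z \<rhd>\<^sub>M m))"
 note r = rt[OF \<mu>0]
 have D: "blin A M Z X D" unfolding D_def
 proof (rule blinI)
  fix m assume "m \<in> |M|"
  then show "klin Z X (\<lambda>z. x0 \<lhd>\<^sub>X rt \<mu>0 (rlift Z \<eta> z \<rhd>\<^sub>M m))"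
   by (intro klin_comp[OF klin_comp[OF klin_comp[OF l(1) M_mult_klin(3)] r(1)] rmod_klin(2)[OF X x0]])
 next
  fix z assume z: "z \<in> |Z|"
  show "klin M X (\<lambda>m. x0 \<lhd>\<^sub>X rt \<mu>0 (rlift Z \<eta> z \<rhd>\<^sub>M m))"
   by (rule klin_comp[OF klin_comp[OF M_mult_klin(1)[OF l(2)[OF z]] r(1)] rmod_klin(2)[OF X x0]])
  fix a m assume a: "a \<in> |A|" and m: "m \<in> |M|"
  show "x0 \<lhd>\<^sub>X rt \<mu>0 (rlift Z \<eta> (z \<lhd>\<^sub>Z a) \<rhd>\<^sub>M m) = x0 \<lhd>\<^sub>X rt \<mu>0 (rlift Z \<eta> z \<rhd>\<^sub>M (a \<rhd>\<^sub>M m))"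
   using z a m l(2)[OF z] by (simp add: l(3) M_rules)
  show "x0 \<lhd>\<^sub>X rt \<mu>0 (rlift Z \<eta> z \<rhd>\<^sub>M m) \<lhd>\<^sub>X a = x0 \<lhd>\<^sub>X rt \<mu>0 (rlift Z \<eta> z \<rhd>\<^sub>M (m \<lhd>\<^sub>M a))"
  proof -
   have zm: "rlift Z \<eta> z \<rhd>\<^sub>M m \<in> |M|" using l(2)[OF z] m by simp
   have "rlift Z \<eta> z \<rhd>\<^sub>M (m \<lhd>\<^sub>M a) = (rlift Z \<eta> z \<rhd>\<^sub>M m) \<lhd>\<^sub>M a" using l(2)[OF z] m a by (simp add: M_rules)
   then show ?thesis using r(3)[OF zm a] rmodD(6)[OF X x0 r(2)[OF zm] a] by simp
  qed
 qed
 then obtain u where u: "alin A Z X u"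
  "\<And>z m. z \<in> |Z| ==> m \<in> |M| ==> u (aZ z m) = aX (u z) m \<oplus>\<^sub>X D z m" using inner by blast
 obtain bs where bs_mem: "\<And>k. k \<in> set bs ==> fst k \<in> |X|" "\<And>k. k \<in> set bs ==> rlin X (snd k)"
  and bs_sum: "\<And>x. x \<in> |X| ==> lsum X (map (\<lambda>k. fst k \<lhd>\<^sub>X snd k x) bs) = x"
  by (rule rlin_basis[OF X fd]) (rule that)
 note xi = rlinD[OF bs_mem(2)]
 have tr: "klin X Kv (\<lambda>x. \<sigma> (snd k x))" if "k \<in> set bs" for k
  by (rule klin_comp[OF xi(1)[OF that] \<sigma>_klin])
 define t where "t = (\<lambda>x \<mu>. u (\<theta> x \<mu>))"
 have t: "blin A DM X X t" unfolding t_def by (rule blin_alin[OF \<theta> u(1)])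
 define g1 where "g1 = (\<lambda>x. lsum X (map (\<lambda>p. t (aX x (fst p)) (snd p)) rs))"
 define g2 where "g2 = (\<lambda>x. lsum X (map (\<lambda>q. aX (t x (fst q)) (snd q)) ls))"
 define \<zeta> where "\<zeta> = (\<lambda>x. lsum A (map (\<lambda>q. rt \<mu>0 (rlift Z \<eta> (\<theta> x (fst q)) \<rhd>\<^sub>M snd q)) ls))"
 have th: "\<theta> x (fst q) \<in> |Z|" if "x \<in> |X|" "q \<in> set ls" for x q
  using blinD(5)[OF \<theta> that(1)] that(2) by simp
 have zq: "rt \<mu>0 (rlift Z \<eta> (\<theta> x (fst q)) \<rhd>\<^sub>M snd q) \<in> |A|" if "x \<in> |X|" "q \<in> set ls" for x q
  using that by (simp add: r(2) l(2) th)
 \<comment> \<open>\<open>\<zeta>(y)\<close> represents the form \<open>b \<mapsto> \<eta>(\<theta>(y, b \<mu>\<^sub>0))\<close>, because \<open>b \<mu>\<^sub>0\<close> is recovered from \<open>\<nu>\<^sub>j\<close> and \<open>n\<^sub>j\<close>\<close>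
 have \<psi>: "klin A Kv (\<lambda>b. \<eta> (\<theta> y (b \<rhd>\<^bsub>DM\<^esub> \<mu>0)))" if y: "y \<in> |X|" for y
 proof -
  have "klin A DM (\<lambda>b. b \<rhd>\<^bsub>DM\<^esub> \<mu>0)"
   by (rule klinI) (use \<mu>0 in \<open>simp_all add: bimodD(6,9)[OF DM_bimodule]\<close>)
  then show ?thesis by (rule klin_comp[OF _ klin_comp[OF blinD(2)[OF \<theta> y] form_klin[OF \<eta> Zv]]])
 qed
 have zeta_rep: "\<zeta> y = rep (\<lambda>b. \<eta> (\<theta> y (b \<rhd>\<^bsub>DM\<^esub> \<mu>0)))" if y: "y \<in> |X|" for y
 proof (rule rep_unique[symmetric])
  show "\<zeta> y \<in> |A|" unfolding \<zeta>_def by (rule lsum_map_closed) (simp_all add: zq y)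
  fix b assume b: "b \<in> |A|"
  have \<mu>b: "b \<rhd>\<^bsub>DM\<^esub> \<mu>0 \<in> |DM|" using b \<mu>0 by simp
  have k: "klin A Kv (\<lambda>c. \<sigma> (c \<otimes>\<^sub>A b))" by (rule klin_comp[OF alg_klin(1)[OF A_alg b] \<sigma>_klin])
  have "\<sigma> (\<zeta> y \<otimes>\<^sub>A b)
   = lsum Kv (map (\<lambda>q. \<sigma> (rt \<mu>0 (rlift Z \<eta> (\<theta> y (fst q)) \<rhd>\<^sub>M snd q) \<otimes>\<^sub>A b)) ls)"
   unfolding \<zeta>_def by (rule lsum_klin[OF k]) (simp add: zq y)
  also have "\<dots> = lsum Kv (map (\<lambda>q. \<eta> (\<theta> y (fst q \<lhd>\<^bsub>DM\<^esub> lt (b \<rhd>\<^bsub>DM\<^esub> \<mu>0) (snd q)))) ls)"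
  proof (rule lsum_cong)
   fix q assume q: "q \<in> set ls"
   note n = ls_mem(2)[OF q] and \<nu> = ls_mem(1)[OF q]
   let ?e = "rlift Z \<eta> (\<theta> y (fst q))"
   have e: "?e \<in> |A|" by (rule l(2)[OF th[OF y q]])
   have c: "lt (b \<rhd>\<^bsub>DM\<^esub> \<mu>0) (snd q) \<in> |A|" by (rule lt(2)[OF \<mu>b n])
   have "\<sigma> (rt \<mu>0 (?e \<rhd>\<^sub>M snd q) \<otimes>\<^sub>A b) = \<mu>0 ((?e \<rhd>\<^sub>M snd q) \<lhd>\<^sub>M b)" by (rule r(5)) (use e n b in simp_all)
   also have "\<dots> = (b \<rhd>\<^bsub>DM\<^esub> \<mu>0) (?e \<rhd>\<^sub>M snd q)" using e n by (simp add: dual_sels)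
   also have "\<dots> = \<sigma> (?e \<otimes>\<^sub>A lt (b \<rhd>\<^bsub>DM\<^esub> \<mu>0) (snd q))" using lt(5)[OF \<mu>b n e] by simp
   also have "\<dots> = \<eta> (\<theta> y (fst q) \<lhd>\<^sub>Z lt (b \<rhd>\<^bsub>DM\<^esub> \<mu>0) (snd q))" by (rule l(5)[OF th[OF y q] c])
   also have "\<dots> = \<eta> (\<theta> y (fst q \<lhd>\<^bsub>DM\<^esub> lt (b \<rhd>\<^bsub>DM\<^esub> \<mu>0) (snd q)))" using blinD(4)[OF \<theta> y c \<nu>] by simp
   finally show "\<sigma> (rt \<mu>0 (?e \<rhd>\<^sub>M snd q) \<otimes>\<^sub>A b) = \<eta> (\<theta> y (fst q \<lhd>\<^bsub>DM\<^esub> lt (b \<rhd>\<^bsub>DM\<^esub> \<mu>0) (snd q)))" .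
  qed
  also have "\<dots> = \<eta> (\<theta> y (lsum DM (map (\<lambda>q. fst q \<lhd>\<^bsub>DM\<^esub> lt (b \<rhd>\<^bsub>DM\<^esub> \<mu>0) (snd q)) ls)))"
   by (rule lsum_klin[OF klin_comp[OF blinD(2)[OF \<theta> y] form_klin[OF \<eta> Zv]], symmetric]) (simp add: lt(2)[OF \<mu>b])
  finally show "\<sigma> (\<zeta> y \<otimes>\<^sub>A b) = \<eta> (\<theta> y (b \<rhd>\<^bsub>DM\<^esub> \<mu>0))" using dual_basis_ls[OF \<mu>b] by simp
 qed
 have zeta: "rlin X \<zeta>" unfolding rlin_def
 proof (intro conjI ballI)
  show "klin X A \<zeta>" unfolding \<zeta>_def
  proof (intro klin_lsum Xv A_simps(1))
   fix q assume q: "q \<in> set ls"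
   show "klin X A (\<lambda>x. rt \<mu>0 (rlift Z \<eta> (\<theta> x (fst q)) \<rhd>\<^sub>M snd q))"
    by (rule klin_comp[OF klin_comp[OF klin_comp[OF blinD(1)[OF \<theta>] l(1)] M_mult_klin(3)] r(1)]) (use q in simp_all)
  qed
  fix x a assume x: "x \<in> |X|" and a: "a \<in> |A|"
  have xa: "x \<lhd>\<^sub>X a \<in> |X|" using x a rmodD(3)[OF X] by simp
  show "\<zeta> (x \<lhd>\<^sub>X a) = \<zeta> x \<otimes>\<^sub>A a"
   unfolding zeta_rep[OF x] zeta_rep[OF xa] rep_ops(3)[OF \<psi>[OF x] a, symmetric]
   by (rule rep_cong) (use x a \<mu>0 in \<open>simp add: blinD(3)[OF \<theta>] bimodD(7)[OF DM_bimodule]\<close>)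
 qed
 note ze = rlinD[OF zeta]
 have g: "g1 x = g2 x \<oplus>\<^sub>X x0 \<lhd>\<^sub>X \<zeta> x" if x: "x \<in> |X|" for x
 proof -
  have "g1 x = u (lsum Z (map (\<lambda>p. \<theta> (aX x (fst p)) (snd p)) rs))" unfolding g1_def t_def
   by (rule lsum_klin[OF alinD(1)[OF u(1)], symmetric]) (simp add: blinD(5)[OF \<theta>] blinD(5)[OF aX x])
  also have "\<dots> = u (lsum Z (map (\<lambda>q. aZ (\<theta> x (fst q)) (snd q)) ls))" using rel[OF x] by simp
  also have "\<dots> = lsum X (map (\<lambda>q. u (aZ (\<theta> x (fst q)) (snd q))) ls)"
   by (rule lsum_klin[OF alinD(1)[OF u(1)]]) (simp add: blinD(5)[OF aZ] th[OF x])
  also have "\<dots> = lsum X (map (\<lambda>q. aX (t x (fst q)) (snd q) \<oplus>\<^sub>X D (\<theta> x (fst q)) (snd q)) ls)"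
   by (rule lsum_cong) (simp add: u(2) th[OF x] t_def)
  also have "\<dots> = g2 x \<oplus>\<^sub>X lsum X (map (\<lambda>q. D (\<theta> x (fst q)) (snd q)) ls)" unfolding g2_def
   by (rule lsum_add[OF Xv]) (simp_all add: blinD(5)[OF aX] blinD(5)[OF t x] blinD(5)[OF D] th[OF x])
  also have "lsum X (map (\<lambda>q. D (\<theta> x (fst q)) (snd q)) ls) = x0 \<lhd>\<^sub>X \<zeta> x" unfolding D_def \<zeta>_def
   by (rule lsum_klin[OF rmod_klin(2)[OF X x0], symmetric]) (rule zq[OF x])
  finally show ?thesis .
 qed
 have g2c: "g2 x \<in> |X|" if "x \<in> |X|" for x unfolding g2_def
  by (rule lsum_map_closed[OF Xv]) (simp add: blinD(5)[OF aX] blinD(5)[OF t that])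
 have x0z: "x0 \<lhd>\<^sub>X \<zeta> x \<in> |X|" if "x \<in> |X|" for x using that x0 ze(2) rmodD(3)[OF X] by simp
 let ?T = "\<lambda>g. lsum Kv (map (\<lambda>k. \<sigma> (snd k (g (fst k)))) bs)"
 have "?T g1 = lsum Kv (map (\<lambda>k. \<sigma> (snd k (g2 (fst k))) \<oplus>\<^bsub>Kv\<^esub> \<sigma> (snd k (x0 \<lhd>\<^sub>X \<zeta> (fst k)))) bs)"
  by (rule lsum_cong) (simp add: g bs_mem klinD(4)[OF tr, simplified] g2c x0z)
 also have "\<dots> = ?T g2 \<oplus>\<^bsub>Kv\<^esub> ?T (\<lambda>x. x0 \<lhd>\<^sub>X \<zeta> x)"
  by (rule lsum_add[OF Kv_vs]) (simp_all add: klinD(3)[OF tr, simplified] g2c x0z bs_mem)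
 finally have sum: "?T g1 = ?T g2 \<oplus>\<^bsub>Kv\<^esub> ?T (\<lambda>x. x0 \<lhd>\<^sub>X \<zeta> x)" .
 have e: "?T g1 = ?T g2" using trace_symmetric[OF X aX t bs_mem bs_sum] unfolding g1_def g2_def by simp
 have Tc: "?T g2 \<in> |Kv|" "?T (\<lambda>x. x0 \<lhd>\<^sub>X \<zeta> x) \<in> |Kv|"
  by (rule lsum_map_closed[OF Kv_vs]; simp add: klinD(3)[OF tr, simplified] g2c x0z bs_mem)+
 have "?T g2 \<oplus>\<^bsub>Kv\<^esub> ?T (\<lambda>x. x0 \<lhd>\<^sub>X \<zeta> x) = ?T g2 \<oplus>\<^bsub>Kv\<^esub> \<zero>\<^bsub>Kv\<^esub>"
  by (rule trans[OF sum[symmetric] trans[OF e vs_simps(6)[OF Kv_vs Tc(1), symmetric]]])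
 then have "?T (\<lambda>x. x0 \<lhd>\<^sub>X \<zeta> x) = \<zero>\<^bsub>Kv\<^esub>"
  by (rule vs_add_cancel(2)[OF Kv_vs Tc(2) vs_simps(2)[OF Kv_vs] Tc(1), THEN iffD1])
 moreover have "?T (\<lambda>x. x0 \<lhd>\<^sub>X \<zeta> x) = lsum Kv (map (\<lambda>k. \<sigma> (\<zeta> (fst k \<lhd>\<^sub>X snd k x0))) bs)"
 proof (rule lsum_cong)
  fix k assume k: "k \<in> set bs"
  have c: "snd k x0 \<in> |A|" "\<zeta> (fst k) \<in> |A|" using xi(2)[OF k x0] ze(2)[OF bs_mem(1)[OF k]] by auto
  show "\<sigma> (snd k (x0 \<lhd>\<^sub>X \<zeta> (fst k))) = \<sigma> (\<zeta> (fst k \<lhd>\<^sub>X snd k x0))"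
   using xi(3)[OF k x0 c(2)] ze(3)[OF bs_mem(1)[OF k] c(1)] \<sigma>_comm[OF c] by simp
 qed
 moreover have "\<dots> = \<sigma> (\<zeta> (lsum X (map (\<lambda>k. fst k \<lhd>\<^sub>X snd k x0) bs)))"
  by (rule lsum_klin[OF klin_comp[OF ze(1) \<sigma>_klin], symmetric]) (simp add: rmodD(3)[OF X] bs_mem xi(2) x0)
 ultimately have "\<sigma> (\<zeta> x0) = \<zero>" using bs_sum[OF x0] by simp
 then show "\<eta> (\<theta> x0 \<mu>0) = \<eta> \<zero>\<^sub>Z"
  using rep(4)[OF \<psi>[OF x0]] zeta_rep[OF x0] form_zero[OF \<eta> Zv] \<mu>0 bimodD(8)[OF DM_bimodule] by simp
qed

end

text \<open>
 One computation instead of two, for maps whose linearity takes some work.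
\<close>

lemma (in kfield) klinI':
 assumes V: "vspace V" and W: "vspace W" and c: "\<And>x. x \<in> |V| ==> f x \<in> |W|"
  and l: "\<And>c x y. c \<in> |K| ==> x \<in> |V| ==> y \<in> |V| ==> f (c \<odot>\<^sub>V x \<oplus>\<^sub>V y) = c \<odot>\<^sub>W f x \<oplus>\<^sub>W f y"
 shows "klin V W f"
proof (rule klinI[OF V W c])
 note s = vs_simps[OF V] vs_simps[OF W] c
 have "f \<zero>\<^sub>V = f \<zero>\<^sub>V \<oplus>\<^sub>W f \<zero>\<^sub>V" using l[of \<one> "\<zero>\<^sub>V" "\<zero>\<^sub>V"] by (simp add: s)
 then have z: "f \<zero>\<^sub>V = \<zero>\<^sub>W" using vs_add_cancel(1)[OF W, of "f \<zero>\<^sub>V" "\<zero>\<^sub>W" "f \<zero>\<^sub>V"] by (simp add: s)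
 show "f (x \<oplus>\<^sub>V y) = f x \<oplus>\<^sub>W f y" if "x \<in> |V|" "y \<in> |V|" for x y
  using l[of \<one> x y] that by (simp add: s)
 show "f (c \<odot>\<^sub>V x) = c \<odot>\<^sub>W f x" if "c \<in> |K|" "x \<in> |V|" for c x
  using l[of c x "\<zero>\<^sub>V"] that by (simp add: s z)
qed

section \<open>Tensor algebras\<close>

locale bimodule_data = kfield K
 for K :: "('k, 'c) ring_scheme" (structure) +
 fixes A :: "('k, 'a) module" and V :: "('k, 'a, 'a, 'v) bimodule"
 assumes V_bimodule: "bimodule K A A V"
begin

lemmas A_alg = bimodD(2)[OF V_bimodule]
lemmas A_simps [simp] = algD(1-3,5,6)[OF A_alg]
lemmas A_rules = algD(4,7-10)[OF A_alg]
lemmas V_rmod = bimodD(1)[OF V_bimodule]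
lemmas V_simps [simp] = bimodD(3,4)[OF V_bimodule] rmodD(3)[OF V_rmod]
lemmas V_rules = bimodD(5-11)[OF V_bimodule] rmodD(4-9)[OF V_rmod]

abbreviation "F \<equiv> tword_algebra K A V"
abbreviation "W \<equiv> twords A V"
abbreviation "mul \<equiv> tword_mult A V"
abbreviation "e \<equiv> unit_vec K"
abbreviation "N \<equiv> tword_null K A V"
abbreviation "T \<equiv> tensor_algebra K A V"
abbreviation "ts \<equiv> tscalar K A V"
abbreviation "tg \<equiv> tgen K A V"

subsection \<open>The algebra of words\<close>

lemma F_sels [simp]: "|F| = |free_space K W|" "add F = add (free_space K W)"
 "zero F = zero (free_space K W)" "smult F = smult (free_space K W)"
 by (simp_all add: tword_algebra_def)

lemma F_vs: "vspace F"
 by (rule vs_image[OF free_vs, where q = "\<lambda>x. x"]) simp_all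

lemma F_klin: "klin F U f \<longleftrightarrow> klin (free_space K W) U f"
 by (simp add: klin_def F_vs free_vs)

lemma F_minus [simp]: "a_minus F = a_minus (free_space K W)"
 by (simp add: a_minus_def a_inv_def fun_eq_iff)

lemma e_F [simp]: "w \<in> W ==> e w \<in> |F|"
 by simp

lemma F_span: "kspan K F (e ` W) = |F|"
proof -
 have "kspan K F S = kspan K (free_space K W) S" for S
  unfolding kspan_def submodule_def submodule_axioms_def subgroup_def by simp
 then show ?thesis using free_span by simp
qed

lemma W_simps [simp]: "Scalar a \<in> W \<longleftrightarrow> a \<in> |A|"
 "Word vs \<in> W \<longleftrightarrow> vs \<noteq> [] \<and> set vs \<subseteq> |V|"
 by (auto simp: twords_def)

lemma W_cases [case_names Scalar Word]:
 assumes "w \<in> W"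
 obtains a where "w = Scalar a" "a \<in> |A|" | vs where "w = Word vs" "vs \<noteq> []" "set vs \<subseteq> |V|"
 using assms by (auto simp: twords_def)

lemma mul_closed [simp]:
 assumes "u \<in> W" "w \<in> W"
 shows "mul u w \<in> W"
 using assms(1)
proof (cases rule: W_cases)
 case u: (Scalar a)
 show ?thesis using assms(2)
 proof (cases rule: W_cases)
  case (Word vs)
  then show ?thesis using u by (cases vs) auto
 qed (use u in simp)
next
 case u: (Word us)
 then obtain x xs where x: "us = xs @ [x]" by (cases us rule: rev_cases) auto
 show ?thesis using assms(2) by (cases rule: W_cases) (use u x in auto)
qed

lemma F_in_K: "f \<in> |F| ==> f w \<in> |K|"
 by (simp add: free_in_K)

lemma F_supp: "f \<in> |F| ==> finite {w. f w \<noteq> \<zero>}" "f \<in> |F| ==> f w \<noteq> \<zero> ==> w \<in> W"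
 by (auto simp: free_space_def)

text \<open>
 The product is a sum over the two supports; any larger finite sets do, so that a common index
 set is at hand for the products of several elements.
\<close>

lemma F_mult_sum:
 assumes f: "f \<in> |F|" and g: "g \<in> |F|"
  and S: "finite S" "{w. f w \<noteq> \<zero>} \<subseteq> S" and S': "finite S'" "{w. g w \<noteq> \<zero>} \<subseteq> S'"
 shows "(f \<otimes>\<^sub>F g) w = (\<Oplus>p\<in>S \<times> S'. if mul (fst p) (snd p) = w then f (fst p) \<otimes> g (snd p) else \<zero>)"
proof -
 have "(f \<otimes>\<^sub>F g) w = (\<Oplus>p\<in>{(u, v). f u \<noteq> \<zero> \<and> g v \<noteq> \<zero> \<and> mul u v = w}. f (fst p) \<otimes> g (snd p))"
  by (simp add: tword_algebra_def)
 also have "\<dots> = (\<Oplus>p\<in>S \<times> S'. if mul (fst p) (snd p) = w then f (fst p) \<otimes> g (snd p) else \<zero>)"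
  by (rule K.add.finprod_mono_neutral_cong_left)
   (use S S' F_in_K[OF f] F_in_K[OF g] in \<open>auto simp: subset_iff\<close>)
 finally show ?thesis .
qed

lemma F_mult_closed:
 assumes f: "f \<in> |F|" and g: "g \<in> |F|"
 shows "f \<otimes>\<^sub>F g \<in> |F|"
proof -
 let ?S = "{w. f w \<noteq> \<zero>}" and ?S' = "{w. g w \<noteq> \<zero>}"
 note s = F_mult_sum[OF f g F_supp(1)[OF f] subset_refl F_supp(1)[OF g] subset_refl]
 have c: "(f \<otimes>\<^sub>F g) w \<in> |K|" for w unfolding s
  by (rule K.finsum_closed) (use F_in_K[OF f] F_in_K[OF g] in auto)
 have z: "(f \<otimes>\<^sub>F g) w = \<zero>" if "w \<notin> (\<lambda>p. mul (fst p) (snd p)) ` (?S \<times> ?S')" for w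
  unfolding s by (rule K.add.finprod_one_eqI) (use that in force)
 have fin: "finite ((\<lambda>p. mul (fst p) (snd p)) ` (?S \<times> ?S'))" using F_supp(1)[OF f] F_supp(1)[OF g] by simp
 have sub: "{w. (f \<otimes>\<^sub>F g) w \<noteq> \<zero>} \<subseteq> (\<lambda>p. mul (fst p) (snd p)) ` (?S \<times> ?S')" using z by blast
 have W: "(\<lambda>p. mul (fst p) (snd p)) ` (?S \<times> ?S') \<subseteq> W" using F_supp(2)[OF f] F_supp(2)[OF g] by auto
 have "(f \<otimes>\<^sub>F g) w = \<zero>" if "w \<notin> W" for w using z W that by blast
 moreover have "finite {w. (f \<otimes>\<^sub>F g) w \<noteq> \<zero>}" by (rule finite_subset[OF sub fin])
 ultimately show ?thesis using c unfolding F_sels free_space_def by simp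
qed

lemma F_mult_klin:
 assumes g: "g \<in> |F|"
 shows "klin F F (\<lambda>f. f \<otimes>\<^sub>F g)" "klin F F (\<lambda>f. g \<otimes>\<^sub>F f)"
proof -
 have *: "(c \<odot>\<^sub>F f \<oplus>\<^sub>F f') \<otimes>\<^sub>F g = c \<odot>\<^sub>F (f \<otimes>\<^sub>F g) \<oplus>\<^sub>F f' \<otimes>\<^sub>F g"
  "g \<otimes>\<^sub>F (c \<odot>\<^sub>F f \<oplus>\<^sub>F f') = c \<odot>\<^sub>F (g \<otimes>\<^sub>F f) \<oplus>\<^sub>F g \<otimes>\<^sub>F f'"
  if c: "c \<in> |K|" and f: "f \<in> |F|" and f': "f' \<in> |F|" for c f f'
 proof -
  let ?S = "{w. f w \<noteq> \<zero>} \<union> {w. f' w \<noteq> \<zero>}" and ?G = "{w. g w \<noteq> \<zero>}"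
  note k = F_in_K[OF f] F_in_K[OF f'] F_in_K[OF g]
  have S: "finite ?S" "{w. f w \<noteq> \<zero>} \<subseteq> ?S" "{w. f' w \<noteq> \<zero>} \<subseteq> ?S" and G: "finite ?G" "?G \<subseteq> ?G"
   using F_supp(1)[OF f] F_supp(1)[OF f'] F_supp(1)[OF g] by auto
  have fc: "c \<odot>\<^sub>F f \<oplus>\<^sub>F f' \<in> |F|" by (intro vs_simps(1,3)[OF F_vs] c f f')
  have pt: "(c \<odot>\<^sub>F x \<oplus>\<^sub>F y) w = c \<otimes> x w \<oplus> y w" for x y w by (simp add: free_space_def)
  have S': "{w. (c \<odot>\<^sub>F f \<oplus>\<^sub>F f') w \<noteq> \<zero>} \<subseteq> ?S" unfolding pt using c by auto
  have sum: "(\<Oplus>p\<in>R. if P p then B (c \<otimes> f (i p) \<oplus> f' (i p)) (g (j p)) else \<zero>)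
   = c \<otimes> (\<Oplus>p\<in>R. if P p then B (f (i p)) (g (j p)) else \<zero>) \<oplus> (\<Oplus>p\<in>R. if P p then B (f' (i p)) (g (j p)) else \<zero>)"
   if R: "finite R" and B: "B = (\<otimes>) \<or> B = (\<lambda>x y. y \<otimes> x)" for R :: "'r set" and P B i j
  proof -
   have b: "B x y \<in> |K|" "B (c \<otimes> x \<oplus> z) y = c \<otimes> B x y \<oplus> B z y"
    if "x \<in> |K|" "y \<in> |K|" "z \<in> |K|" for x y z
    using B that c by (auto simp: K.l_distr K.r_distr K.m_assoc K.m_lcomm)
   let ?t = "\<lambda>f p. if P p then B (f (i p)) (g (j p)) else \<zero>"
   have "(\<Oplus>p\<in>R. ?t (\<lambda>w. c \<otimes> f w \<oplus> f' w) p) = (\<Oplus>p\<in>R. c \<otimes> ?t f p \<oplus> ?t f' p)"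
    by (rule K.finsum_cong') (use c k b in auto)
   also have "\<dots> = (\<Oplus>p\<in>R. c \<otimes> ?t f p) \<oplus> (\<Oplus>p\<in>R. ?t f' p)" by (rule K.finsum_addf) (use c k b in auto)
   also have "(\<Oplus>p\<in>R. c \<otimes> ?t f p) = c \<otimes> (\<Oplus>p\<in>R. ?t f p)"
    by (rule K.finsum_rdistr[symmetric]) (use R c k b(1) in auto)
   finally show ?thesis .
  qed
  show "(c \<odot>\<^sub>F f \<oplus>\<^sub>F f') \<otimes>\<^sub>F g = c \<odot>\<^sub>F (f \<otimes>\<^sub>F g) \<oplus>\<^sub>F f' \<otimes>\<^sub>F g"
   unfolding fun_eq_iff pt F_mult_sum[OF fc g S(1) S' G] F_mult_sum[OF f g S(1,2) G] F_mult_sum[OF f' g S(1,3) G]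
   by (intro allI sum[of _ "(\<otimes>)" _ fst snd]) (use S G in auto)
  show "g \<otimes>\<^sub>F (c \<odot>\<^sub>F f \<oplus>\<^sub>F f') = c \<odot>\<^sub>F (g \<otimes>\<^sub>F f) \<oplus>\<^sub>F g \<otimes>\<^sub>F f'"
   unfolding fun_eq_iff pt F_mult_sum[OF g fc G S(1) S'] F_mult_sum[OF g f G S(1,2)] F_mult_sum[OF g f' G S(1,3)]
   by (intro allI sum[of _ "\<lambda>x y. y \<otimes> x" _ snd fst]) (use S G in auto)
 qed
 show "klin F F (\<lambda>f. f \<otimes>\<^sub>F g)" "klin F F (\<lambda>f. g \<otimes>\<^sub>F f)"
  by (rule klinI'[OF F_vs F_vs]; simp only: * F_mult_closed g)+
qed

lemma e_mult:
 assumes "u \<in> W" "v \<in> W"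
 shows "e u \<otimes>\<^sub>F e v = e (mul u v)"
proof
 fix w
 have "(e u \<otimes>\<^sub>F e v) w = (\<Oplus>p\<in>{u} \<times> {v}. if mul (fst p) (snd p) = w then e u (fst p) \<otimes> e v (snd p) else \<zero>)"
  by (rule F_mult_sum[OF e_F[OF assms(1)] e_F[OF assms(2)]]) (auto simp: unit_vec_def)
 also have "\<dots> = e (mul u v) w" by (simp add: unit_vec_def)
 finally show "(e u \<otimes>\<^sub>F e v) w = e (mul u v) w" .
qed

subsection \<open>The relations form an ideal\<close>

text \<open>
 The relations between words say that \<open>w\<close> is linear in each of its letters, and balanced.
\<close>

definition multilinear :: "('k, 'u, 'z) module_scheme \<Rightarrow> (('a, 'v) tword \<Rightarrow> 'u) \<Rightarrow> bool" where
 "multilinear U g \<longleftrightarrow> klin A U (\<lambda>a. g (Scalar a)) \<and> (\<forall>us vs. set us \<subseteq> |V| \<longrightarrow> set vs \<subseteq> |V| \<longrightarrow>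
   klin V U (\<lambda>v. g (Word (us @ v # vs))) \<and> (\<forall>v\<in>|V|. \<forall>a\<in>|A|. \<forall>v'\<in>|V|.
    g (Word (us @ (v \<lhd>\<^sub>V a) # v' # vs)) = g (Word (us @ v # (a \<rhd>\<^sub>V v') # vs))))"

lemma multilinearD:
 assumes "multilinear U g"
 shows "klin A U (\<lambda>a. g (Scalar a))"
  "set us \<subseteq> |V| ==> set vs \<subseteq> |V| ==> klin V U (\<lambda>v. g (Word (us @ v # vs)))"
  "set us \<subseteq> |V| ==> set vs \<subseteq> |V| ==> v \<in> |V| ==> a \<in> |A| ==> v' \<in> |V|
   ==> g (Word (us @ (v \<lhd>\<^sub>V a) # v' # vs)) = g (Word (us @ v # (a \<rhd>\<^sub>V v') # vs))"
 using assms unfolding multilinear_def by blast+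

lemma multilinear_cong:
 assumes "multilinear U g" "\<And>w. w \<in> W ==> g' w = g w"
 shows "multilinear U g'"
proof -
 note m = multilinearD[OF assms(1)]
 have "klin V U (\<lambda>v. g' (Word (us @ v # vs)))" if "set us \<subseteq> |V|" "set vs \<subseteq> |V|" for us vs
  by (rule klin_cong[OF m(2)[OF that]]) (use that in \<open>simp add: assms(2)\<close>)
 moreover have "klin A U (\<lambda>a. g' (Scalar a))" by (rule klin_cong[OF m(1)]) (simp add: assms(2))
 ultimately show ?thesis unfolding multilinear_def by (simp add: assms(2) m(3))
qed

lemma set_butlast_last: "set vs \<subseteq> |V| ==> vs \<noteq> [] ==> set (butlast vs) \<subseteq> |V| \<and> last vs \<in> |V|"
 by (auto dest: in_set_butlastD)

lemma V_klin:
 "a \<in> |A| ==> klin V V (\<lambda>v. a \<rhd>\<^sub>V v)" "v \<in> |V| ==> klin A V (\<lambda>a. a \<rhd>\<^sub>V v)"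
 by (rule klinI; simp add: V_rules)+

text \<open>
 Multiplication by a word either inserts letters, or changes one letter by a linear map.
\<close>

lemma multilinear_mul:
 assumes g: "multilinear U g" and u: "u \<in> W"
 shows "multilinear U (\<lambda>w. g (mul u w))" "multilinear U (\<lambda>w. g (mul w u))"
proof -
 note m = multilinearD[OF g] and r = rmod_klin[OF V_rmod]
 have L: "multilinear U (\<lambda>w. g (mul u w)) \<and> multilinear U (\<lambda>w. g (mul w u))" using u
 proof (cases rule: W_cases)
  case (Scalar c)
  have "klin V U (\<lambda>v. g (mul u (Word (us @ v # vs)))) \<and> (\<forall>v\<in>|V|. \<forall>a\<in>|A|. \<forall>v'\<in>|V|.
    g (mul u (Word (us @ (v \<lhd>\<^sub>V a) # v' # vs))) = g (mul u (Word (us @ v # (a \<rhd>\<^sub>V v') # vs))))"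
   if "set us \<subseteq> |V|" "set vs \<subseteq> |V|" for us vs
  proof (cases us)
   case Nil
   have "g (Word ((c \<rhd>\<^sub>V (v \<lhd>\<^sub>V a)) # v' # vs)) = g (Word ((c \<rhd>\<^sub>V v) # (a \<rhd>\<^sub>V v') # vs))"
    if "v \<in> |V|" "a \<in> |A|" "v' \<in> |V|" for v a v'
    using that \<open>set vs \<subseteq> _\<close> Scalar m(3)[of "[]" vs "c \<rhd>\<^sub>V v" a v'] by (simp add: V_rules)
   then show ?thesis using that Nil Scalar klin_comp[OF V_klin(1) m(2)[of "[]" vs]] by simp
  next
   case (Cons t us')
   then show ?thesis using that Scalar m(2)[of "(c \<rhd>\<^sub>V t) # us'" vs] m(3)[of "(c \<rhd>\<^sub>V t) # us'" vs] by simp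
  qed
  moreover have "klin V U (\<lambda>v. g (mul (Word (us @ v # vs)) u)) \<and> (\<forall>v\<in>|V|. \<forall>a\<in>|A|. \<forall>v'\<in>|V|.
    g (mul (Word (us @ (v \<lhd>\<^sub>V a) # v' # vs)) u) = g (mul (Word (us @ v # (a \<rhd>\<^sub>V v') # vs)) u))"
   if "set us \<subseteq> |V|" "set vs \<subseteq> |V|" for us vs
  proof (cases "vs = []")
   case True
   then show ?thesis using that Scalar klin_comp[OF r(1) m(2)[of us "[]"]] m(3)[of us "[]" _ _ "_ \<lhd>\<^sub>V c"]
    by (simp add: butlast_append V_rules)
  next
   case False
   then show ?thesis using that Scalar set_butlast_last[of vs] m(2)[of us "butlast vs @ [last vs \<lhd>\<^sub>V c]"]
     m(3)[of us "butlast vs @ [last vs \<lhd>\<^sub>V c]"] by (simp add: butlast_append)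
  qed
  ultimately show ?thesis using Scalar klin_comp[OF alg_klin(1)[OF A_alg] m(1)] klin_comp[OF alg_klin(2)[OF A_alg] m(1)]
   unfolding multilinear_def by simp
 next
  case (Word ws)
  have h: "hd ws \<in> |V|" "set (tl ws) \<subseteq> |V|" using Word by (cases ws; auto)+
  have "klin V U (\<lambda>v. g (Word (us @ v # vs @ ws)))"  "klin V U (\<lambda>v. g (Word (ws @ us @ v # vs)))"
   if "set us \<subseteq> |V|" "set vs \<subseteq> |V|" for us vs
   using that Word m(2)[of us "vs @ ws"] m(2)[of "ws @ us" vs] by simp_all
  moreover have "g (Word (us @ (v \<lhd>\<^sub>V a) # v' # vs @ ws)) = g (Word (us @ v # (a \<rhd>\<^sub>V v') # vs @ ws))"
   "g (Word (ws @ us @ (v \<lhd>\<^sub>V a) # v' # vs)) = g (Word (ws @ us @ v # (a \<rhd>\<^sub>V v') # vs))"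
   if "set us \<subseteq> |V|" "set vs \<subseteq> |V|" "v \<in> |V|" "a \<in> |A|" "v' \<in> |V|" for us vs v a v'
   using that Word m(3)[of us "vs @ ws"] m(3)[of "ws @ us" vs] by simp_all
  moreover have "klin A U (\<lambda>a. g (mul u (Scalar a)))" "klin A U (\<lambda>a. g (mul (Scalar a) u))"
   using Word set_butlast_last[of ws] klin_comp[OF r(2)[of "last ws"] m(2)[of "butlast ws" "[]"]]
    klin_comp[OF V_klin(2)[OF h(1)] m(2)[of "[]" "tl ws"]] h by simp_all
  ultimately show ?thesis using Word unfolding multilinear_def by simp
 qed
 then show "multilinear U (\<lambda>w. g (mul u w))" "multilinear U (\<lambda>w. g (mul w u))" by auto
qed

text \<open>
 Only \<open>(u a) w = u (a w)\<close>, with words \<open>u, w\<close> and a scalar \<open>a\<close> between them, needs that the map is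
 balanced.
\<close>

lemma multilinear_assoc:
 assumes g: "multilinear U g" and W: "u \<in> W" "v \<in> W" "w \<in> W"
 shows "g (mul (mul u v) w) = g (mul u (mul v w))"
 using W(1)
proof (cases rule: W_cases)
 case u: (Scalar a)
 show ?thesis using W(2)
 proof (cases rule: W_cases)
  case v: (Scalar b)
  show ?thesis using W(3)
  proof (cases rule: W_cases)
   case (Word ws)
   then have "hd ws \<in> |V|" by auto
   then show ?thesis using Word u v by (simp add: V_rules)
  qed (use u v in \<open>simp add: A_rules\<close>)
 next
  case v: (Word vs)
  show ?thesis using W(3)
  proof (cases rule: W_cases)
   case (Scalar c)
   then show ?thesis using u v by (cases vs; cases "tl vs = []") (auto simp: V_rules)
  qed (use u v in \<open>cases vs; auto\<close>)
 qed
next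
 case u: (Word us)
 show ?thesis using W(2)
 proof (cases rule: W_cases)
  case v: (Scalar b)
  show ?thesis using W(3)
  proof (cases rule: W_cases)
   case (Scalar c)
   moreover have "last us \<in> |V|" using u by auto
   ultimately show ?thesis using u v by (simp add: V_rules)
  next
   case (Word ws)
   have us: "butlast us @ last us # xs = us @ xs" for xs
    using append_butlast_last_id[OF u(2)] append_assoc[of "butlast us" "[last us]" xs] by simp
   show ?thesis using Word u v set_butlast_last[of us] multilinearD(3)[OF g, of "butlast us" "tl ws" "last us" b "hd ws"]
    by (cases ws) (auto simp: us)
  qed
 next
  case v: (Word vs)
  show ?thesis using W(3) by (cases rule: W_cases) (use u v in \<open>auto simp: butlast_append\<close>)
 qed
qed

lemma rels_F: "tword_rels K A V \<subseteq> |F|"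
 unfolding tword_rels_def Let_def
 by (intro subsetI) (elim UnE CollectE exE conjE, auto intro!: vs_simps(1,3,5)[OF F_vs] e_F simp del: F_sels F_minus)

lemma N_sub: "sub N F"
 unfolding tword_null_def by (rule kspan_sub[OF F_vs rels_F])

text \<open>The generators of the relations are the defects of multilinearity.\<close>

lemma multilinear_kills:
 assumes h: "klin F U h" and m: "multilinear U (\<lambda>w. h (e w))" and r: "r \<in> N"
 shows "h r = \<zero>\<^sub>U"
proof -
 note k = klinD(3-8)[OF h] and U = klinD(2)[OF h] and m = multilinearD[OF m] and c = vs_simps(1,3)[OF F_vs]
 note k' = klinD(4,5)[OF m(1)] klinD(4,5)[OF m(2)]
 have "h r = \<zero>\<^sub>U" if "r \<in> tword_rels K A V" for r
  using that unfolding tword_rels_def Let_def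
  by (elim UnE CollectE exE conjE) (simp_all add: k k' m(3) U c vs_minus_zero_iff del: F_sels F_minus)
 then have "tword_rels K A V \<subseteq> {r \<in> |F|. h r = \<zero>\<^sub>U}" using rels_F by blast
 then have "N \<subseteq> {r \<in> |F|. h r = \<zero>\<^sub>U}"
  unfolding tword_null_def by (rule kspan_least[OF klin_kernel_sub[OF h]])
 then show ?thesis using r by blast
qed

lemma T_eq: "T = quotient F N"
 by (simp add: tensor_algebra_def)

abbreviation "q x \<equiv> N +>\<^bsub>F\<^esub> x"

lemma T_klin: "klin F T (\<lambda>x. q x)"
 unfolding T_eq by (rule quot_klin[OF F_vs N_sub])

lemmas T_vs = klinD(2)[OF T_klin]

lemma q_zero: "x \<in> |F| ==> q x = \<zero>\<^sub>T \<longleftrightarrow> x \<in> N"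
 unfolding T_eq quot_zero by (rule quot_eq_zero[OF F_vs N_sub])

lemma multilinear_q: "multilinear T (\<lambda>w. q (e w))"
proof -
 note k = klinD(3-5)[OF T_klin] and c = vs_simps(1,3)[OF F_vs]
 have eq: "q x = q y" if "x \<ominus>\<^sub>F y \<in> tword_rels K A V" "x \<in> |F|" "y \<in> |F|" for x y
  using that kspan_superset[of "tword_rels K A V" F] quot_eq[OF F_vs N_sub that(2,3)] unfolding tword_null_def by blast
 note rels = tword_rels_def[of K A V, unfolded Let_def]
 have "q (e (Scalar (a \<oplus>\<^sub>A b))) = q (e (Scalar a) \<oplus>\<^sub>F e (Scalar b))" if "a \<in> |A|" "b \<in> |A|" for a b
  by (rule eq) (use that in \<open>unfold rels, blast, simp_all add: c del: F_sels\<close>)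
 moreover have "q (e (Scalar (d \<odot>\<^sub>A a))) = q (d \<odot>\<^sub>F e (Scalar a))" if "d \<in> |K|" "a \<in> |A|" for d a
  by (rule eq) (use that in \<open>unfold rels, blast, simp_all add: c del: F_sels\<close>)
 moreover have "q (e (Word (us @ [v \<oplus>\<^sub>V v'] @ vs))) = q (e (Word (us @ [v] @ vs)) \<oplus>\<^sub>F e (Word (us @ [v'] @ vs)))"
  if "set us \<subseteq> |V|" "v \<in> |V|" "v' \<in> |V|" "set vs \<subseteq> |V|" for us v v' vs
  by (rule eq) (use that in \<open>unfold rels, blast, simp_all add: c del: F_sels\<close>)
 moreover have "q (e (Word (us @ [d \<odot>\<^sub>V v] @ vs))) = q (d \<odot>\<^sub>F e (Word (us @ [v] @ vs)))"
  if "set us \<subseteq> |V|" "d \<in> |K|" "v \<in> |V|" "set vs \<subseteq> |V|" for us d v vs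
  by (rule eq) (use that in \<open>unfold rels, blast, simp_all add: c del: F_sels\<close>)
 moreover have "q (e (Word (us @ [v \<lhd>\<^sub>V a, v'] @ vs))) = q (e (Word (us @ [v, a \<rhd>\<^sub>V v'] @ vs)))"
  if "set us \<subseteq> |V|" "v \<in> |V|" "a \<in> |A|" "v' \<in> |V|" "set vs \<subseteq> |V|" for us v a v' vs
  by (rule eq) (use that in \<open>unfold rels, blast, simp_all add: c del: F_sels\<close>)
 ultimately show ?thesis unfolding multilinear_def
  by (auto intro!: klinI T_vs k(1) e_F simp: k(2,3) simp del: F_sels)
qed

lemma N_ideal:
 assumes x: "x \<in> |F|" and w: "w \<in> N"
 shows "x \<otimes>\<^sub>F w \<in> N" "w \<otimes>\<^sub>F x \<in> N"
proof -
 note R = F_mult_klin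
 have wF: "w \<in> |F|" by (rule subD(2)[OF N_sub F_vs w])
 have eS: "e ` W \<subseteq> |F|" by (auto simp del: F_sels)
 have e: "q (e u \<otimes>\<^sub>F w) = \<zero>\<^sub>T" "q (w \<otimes>\<^sub>F e u) = \<zero>\<^sub>T" if u: "u \<in> W" for u
  by (rule multilinear_kills[OF klin_comp[OF R(2)[OF e_F[OF u]] T_klin] multilinear_cong w]
    multilinear_kills[OF klin_comp[OF R(1)[OF e_F[OF u]] T_klin] multilinear_cong w],
    rule multilinear_mul[OF multilinear_q u], simp add: e_mult u)+
 have "q (x \<otimes>\<^sub>F w) = \<zero>\<^sub>T"
  by (rule klin_eq_on_span[OF klin_comp[OF R(1)[OF wF] T_klin] klin_zero[OF F_vs T_vs] eS])
   (use e x F_span in \<open>auto simp del: F_sels\<close>)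
 then show "x \<otimes>\<^sub>F w \<in> N" using q_zero F_mult_closed[OF x wF] by blast
 have "q (w \<otimes>\<^sub>F x) = \<zero>\<^sub>T"
  by (rule klin_eq_on_span[OF klin_comp[OF R(2)[OF wF] T_klin] klin_zero[OF F_vs T_vs] eS])
   (use e x F_span in \<open>auto simp del: F_sels\<close>)
 then show "w \<otimes>\<^sub>F x \<in> N" using q_zero F_mult_closed[OF wF x] by blast
qed

lemma F_assoc:
 assumes "x \<in> |F|" "y \<in> |F|" "z \<in> |F|"
 shows "(x \<otimes>\<^sub>F y) \<otimes>\<^sub>F z \<ominus>\<^sub>F x \<otimes>\<^sub>F (y \<otimes>\<^sub>F z) \<in> N"
proof -
 note L = F_mult_klin(1) and R = F_mult_klin(2) and c = F_mult_closed and k = klin_comp[OF _ T_klin]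
 have eS: "e ` W \<subseteq> |F|" by (auto simp del: F_sels)
 have 1: "q ((e u \<otimes>\<^sub>F e v) \<otimes>\<^sub>F e w) = q (e u \<otimes>\<^sub>F (e v \<otimes>\<^sub>F e w))" if "u \<in> W" "v \<in> W" "w \<in> W" for u v w
  using multilinear_assoc[OF multilinear_q that] that by (simp add: e_mult)
 have 2: "q ((x \<otimes>\<^sub>F e v) \<otimes>\<^sub>F e w) = q (x \<otimes>\<^sub>F (e v \<otimes>\<^sub>F e w))" if W: "v \<in> W" "w \<in> W" for v w
  by (rule klin_eq_on_span[OF k[OF klin_comp[OF L[OF e_F[OF W(1)]] L[OF e_F[OF W(2)]]]]
     k[OF L[OF c[OF e_F[OF W(1)] e_F[OF W(2)]]]] eS])
   (use 1 W assms(1) F_span in \<open>auto simp del: F_sels\<close>)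
 have 3: "q ((x \<otimes>\<^sub>F y) \<otimes>\<^sub>F e w) = q (x \<otimes>\<^sub>F (y \<otimes>\<^sub>F e w))" if W: "w \<in> W" for w
  by (rule klin_eq_on_span[OF k[OF klin_comp[OF R[OF assms(1)] L[OF e_F[OF W]]]]
     k[OF klin_comp[OF L[OF e_F[OF W]] R[OF assms(1)]]] eS])
   (use 2 W assms(2) F_span in \<open>auto simp del: F_sels\<close>)
 have "q ((x \<otimes>\<^sub>F y) \<otimes>\<^sub>F z) = q (x \<otimes>\<^sub>F (y \<otimes>\<^sub>F z))"
  by (rule klin_eq_on_span[OF k[OF R[OF c[OF assms(1,2)]]] k[OF klin_comp[OF R[OF assms(2)] R[OF assms(1)]]] eS])
   (use 3 assms(3) F_span in \<open>auto simp del: F_sels\<close>)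
 then show ?thesis using quot_eq[OF F_vs N_sub c[OF c[OF assms(1,2)] assms(3)] c[OF assms(1) c[OF assms(2,3)]]] by blast
qed

lemma F_one: "\<one>\<^sub>F = e (Scalar \<one>\<^sub>A)"
 by (simp add: tword_algebra_def)

lemma F_unit:
 assumes "x \<in> |F|"
 shows "\<one>\<^sub>F \<otimes>\<^sub>F x = x" "x \<otimes>\<^sub>F \<one>\<^sub>F = x"
proof -
 have 1: "\<one>\<^sub>F \<in> |F|" unfolding F_one by (rule e_F) simp
 have m: "mul (Scalar \<one>\<^sub>A) w = w \<and> mul w (Scalar \<one>\<^sub>A) = w" if "w \<in> W" for w
  using that
 proof (cases rule: W_cases)
  case (Word vs)
  then have "hd vs \<in> |V|" "last vs \<in> |V|" by auto
  then show ?thesis using Word by (simp add: V_rules)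
 qed simp
 have eS: "e ` W \<subseteq> |F|" by (auto simp del: F_sels)
 show "\<one>\<^sub>F \<otimes>\<^sub>F x = x"
  by (rule klin_eq_on_span[OF F_mult_klin(2)[OF 1] klin_id[OF F_vs] eS])
   (use assms m in \<open>auto simp: F_one e_mult F_span simp del: F_sels\<close>)
 show "x \<otimes>\<^sub>F \<one>\<^sub>F = x"
  by (rule klin_eq_on_span[OF F_mult_klin(1)[OF 1] klin_id[OF F_vs] eS])
   (use assms m in \<open>auto simp: F_one e_mult F_span simp del: F_sels\<close>)
qed

subsection \<open>The tensor algebra and its modules\<close>

lemma T_facts:
 shows T_alg: "assoc_algebra K T"
  and T_mult: "u \<in> |F| ==> v \<in> |F| ==> q u \<otimes>\<^sub>T q v = q (u \<otimes>\<^sub>F v)"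
  and T_one: "\<one>\<^sub>T = q \<one>\<^sub>F"
proof -
 have o: "\<one>\<^sub>F \<in> |F|" unfolding F_one by (rule e_F) simp
 have z: "x \<ominus>\<^sub>F x \<in> N" if "x \<in> |F|" for x
  using vs_simps(9)[OF F_vs that] subD(3)[OF N_sub F_vs] by simp
 have o1: "\<one>\<^sub>F \<otimes>\<^sub>F x \<ominus>\<^sub>F x \<in> N" if "x \<in> |F|" for x unfolding F_unit[OF that] by (rule z[OF that])
 have o2: "x \<otimes>\<^sub>F \<one>\<^sub>F \<ominus>\<^sub>F x \<in> N" if "x \<in> |F|" for x unfolding F_unit[OF that] by (rule z[OF that])
 note * = quot_algebra[OF F_vs N_sub F_mult_closed F_mult_klin N_ideal F_assoc o o1 o2, folded T_eq]
 show "assoc_algebra K T" by (rule *(1))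
 show "u \<in> |F| ==> v \<in> |F| ==> q u \<otimes>\<^sub>T q v = q (u \<otimes>\<^sub>F v)" by (rule *(2))
 show "\<one>\<^sub>T = q \<one>\<^sub>F" by (rule *(3))
qed

lemma q_mul: "u \<in> W ==> w \<in> W ==> q (e u) \<otimes>\<^sub>T q (e w) = q (e (mul u w))"
 using T_mult[OF e_F e_F, of u w] by (simp add: e_mult del: F_sels)

lemma ts_def': "ts a = q (e (Scalar a))"
 by (simp add: tscalar_def)

lemma tg_def': "tg v = q (e (Word [v]))"
 by (simp add: tgen_def)

lemma q_e_T: "w \<in> W ==> q (e w) \<in> |T|"
 by (rule klinD(3)[OF T_klin e_F])

lemma ts:
 "klin A T ts" "a \<in> |A| ==> b \<in> |A| ==> ts (a \<otimes>\<^sub>A b) = ts a \<otimes>\<^sub>T ts b"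
 "ts \<one>\<^sub>A = \<one>\<^sub>T" "a \<in> |A| ==> ts a \<in> |T|"
proof -
 show c: "\<And>a. a \<in> |A| ==> ts a \<in> |T|" unfolding ts_def' by (rule q_e_T) simp
 show "klin A T ts" unfolding ts_def' by (rule multilinearD(1)[OF multilinear_q])
 show "a \<in> |A| ==> b \<in> |A| ==> ts (a \<otimes>\<^sub>A b) = ts a \<otimes>\<^sub>T ts b"
  unfolding ts_def' by (simp add: q_mul)
 show "ts \<one>\<^sub>A = \<one>\<^sub>T" unfolding ts_def' T_one F_one ..
qed

lemma tg:
 "klin V T tg" "v \<in> |V| ==> tg v \<in> |T|"
 "a \<in> |A| ==> v \<in> |V| ==> tg (a \<rhd>\<^sub>V v) = ts a \<otimes>\<^sub>T tg v"
 "a \<in> |A| ==> v \<in> |V| ==> tg (v \<lhd>\<^sub>V a) = tg v \<otimes>\<^sub>T ts a"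
proof -
 show c: "\<And>v. v \<in> |V| ==> tg v \<in> |T|" unfolding tg_def' by (rule q_e_T) simp
 show "klin V T tg" unfolding tg_def' using multilinearD(2)[OF multilinear_q, of "[]" "[]"] by simp
 show "a \<in> |A| ==> v \<in> |V| ==> tg (a \<rhd>\<^sub>V v) = ts a \<otimes>\<^sub>T tg v"
  "a \<in> |A| ==> v \<in> |V| ==> tg (v \<lhd>\<^sub>V a) = tg v \<otimes>\<^sub>T ts a"
  unfolding ts_def' tg_def' by (simp_all add: q_mul)
qed

lemma T_span: "kspan K T ((\<lambda>w. q (e w)) ` W) = |T|"
proof -
 have eS: "e ` W \<subseteq> |F|" by (auto simp del: F_sels)
 have "(\<lambda>x. q x) ` kspan K F (e ` W) = kspan K T ((\<lambda>x. q x) ` e ` W)"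
  by (rule kspan_image[OF T_klin eS])
 then show ?thesis unfolding F_span T_eq quot_carrier image_image by simp
qed

text \<open>
 The tensor algebra is built from scalars by right multiplication with elements of \<open>V\<close>.
\<close>

lemma T_induct [consumes 1, case_names scalar gen add smult]:
 assumes "t \<in> |T|"
  and ts: "\<And>a. a \<in> |A| ==> Q (ts a)"
  and tg: "\<And>t v. t \<in> |T| ==> v \<in> |V| ==> Q t ==> Q (t \<otimes>\<^sub>T tg v)"
  and "\<And>s t. s \<in> |T| ==> t \<in> |T| ==> Q s ==> Q t ==> Q (s \<oplus>\<^sub>T t)"
  and "\<And>c t. c \<in> |K| ==> t \<in> |T| ==> Q t ==> Q (c \<odot>\<^sub>T t)"
 shows "Q t"
proof -
 have w: "Q (q (e w))" if "w \<in> W" for w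
  using that
 proof (cases rule: W_cases)
  case (Scalar a)
  then show ?thesis using ts by (simp add: ts_def')
 next
  case (Word vs)
  have "vs \<noteq> [] ==> set vs \<subseteq> |V| ==> Q (q (e (Word vs)))"
  proof (induction vs rule: rev_induct)
   case (snoc x xs)
   have x: "x \<in> |V|" using snoc.prems by simp
   show ?case
   proof (cases "xs = []")
    case True
    have "Q (ts \<one>\<^sub>A \<otimes>\<^sub>T tg x)" by (rule assms(3)) (use x ts in \<open>simp_all add: ts_def' q_e_T\<close>)
    moreover have "ts \<one>\<^sub>A \<otimes>\<^sub>T tg x = q (e (Word [x]))" using x V_rules(4)[OF x] by (simp add: ts_def' tg_def' q_mul)
    ultimately show ?thesis using True by simp
   next
    case False
    then have xs: "Word xs \<in> W" "Q (q (e (Word xs)))" using snoc by auto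
    have "Q (q (e (Word xs)) \<otimes>\<^sub>T tg x)" by (rule assms(3)[OF q_e_T[OF xs(1)] x xs(2)])
    then show ?thesis using xs(1) x by (simp add: tg_def' q_mul)
   qed
  qed simp
  then show ?thesis using Word by simp
 qed
 have z: "Q \<zero>\<^sub>T" using assms(5)[OF K.zero_closed, of "ts \<one>\<^sub>A"] assms(2)[of "\<one>\<^sub>A"] T_vs by (simp add: ts_def' q_e_T)
 have t: "t \<in> kspan K T ((\<lambda>w. q (e w)) ` W)" using assms(1) T_span by simp
 have S: "(\<lambda>w. q (e w)) ` W \<subseteq> |T|" using q_e_T by auto
 from t T_vs S show ?thesis
  by (induction rule: kspan_induct) (use w z assms(4,5) in auto)
qed

end

text \<open>
 A right \<open>A\<close>-module with an action of \<open>V\<close> is a module over the tensor algebra.  As the type of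
 the algebra changes, so does the record.
\<close>

definition with_ract :: "('k, 'a, 'x) rmodule \<Rightarrow> ('x \<Rightarrow> 'b \<Rightarrow> 'x) \<Rightarrow> ('k, 'b, 'x) rmodule" where
 "with_ract X R = \<lparr>carrier = |X|, mult = mult X, one = one X, zero = zero X, add = add X,
   smult = smult X, ract = R\<rparr>"

lemma with_ract_sels [simp]:
 "|with_ract X R| = |X|" "add (with_ract X R) = add X" "zero (with_ract X R) = zero X"
 "smult (with_ract X R) = smult X" "ract (with_ract X R) = R"
 by (simp_all add: with_ract_def)

lemma (in kfield) with_ract_vs: "vspace (with_ract X R) \<longleftrightarrow> vspace X"
 using vs_image[where q = "\<lambda>x. x" and V = X and U = "with_ract X R"]
  vs_image[where q = "\<lambda>x. x" and U = X and V = "with_ract X R"] by auto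

context bimodule_data
begin

fun word_act :: "('k, 'a, 'x) rmodule \<Rightarrow> ('x \<Rightarrow> 'v \<Rightarrow> 'x) \<Rightarrow> 'x \<Rightarrow> ('a, 'v) tword \<Rightarrow> 'x" where
 "word_act X act x (Scalar a) = x \<lhd>\<^sub>X a"
| "word_act X act x (Word vs) = foldl act x vs"

text \<open>
 A word acts letter by letter, which is multilinear in the word, so that the action factors
 over the relations.
\<close>

lemma tensor_algebra_module:
 assumes X: "right_module K A X" and act: "blin A V X X act"
 obtains R where "right_module K T (with_ract X R)"
  "\<And>x a. x \<in> |X| ==> a \<in> |A| ==> R x (ts a) = x \<lhd>\<^sub>X a"
  "\<And>x v. x \<in> |X| ==> v \<in> |V| ==> R x (tg v) = act x v"
proof -
 note sX = rmodD[OF X]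
 note Xv = sX(2)
 have fold_k: "klin X X (\<lambda>x. foldl act x vs)" if "set vs \<subseteq> |V|" for vs
  using that
 proof (induction vs)
  case (Cons v vs)
  have "klin X X (\<lambda>x. foldl act (act x v) vs)"
   by (rule klin_comp[OF blinD(1)[OF act] Cons.IH]) (use Cons.prems in auto)
  then show ?case by simp
 qed (simp add: klin_id[OF Xv])
 have fold_c: "foldl act x vs \<in> |X|" if "x \<in> |X|" "set vs \<subseteq> |V|" for x vs
  using klinD(3)[OF fold_k[OF that(2)] that(1)] .
 let ?w = "word_act X act"
 have wk: "klin X X (\<lambda>x. ?w x w)" if "w \<in> W" for w
  using that by (cases rule: W_cases) (simp_all add: fold_k rmod_klin(1)[OF X])
 have wc: "?w x w \<in> |X|" if "x \<in> |X|" "w \<in> W" for x w using klinD(3)[OF wk[OF that(2)] that(1)] .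
 have ac: "act x v \<in> |X|" if "x \<in> |X|" "v \<in> |V|" for x v by (rule blinD(5)[OF act that])
 have "\<exists>h. klin T X h \<and> (\<forall>w\<in>W. h (q (e w)) = ?w x w)" if x: "x \<in> |X|" for x
 proof -
  obtain g where g0: "klin (free_space K W) X g" "\<And>w. w \<in> W ==> g (e w) = ?w x w"
   by (rule free_ext[OF Xv, of W "?w x"]) (use wc x in auto)
  have g: "klin F X g" using g0(1) by (simp add: F_klin)
  have "multilinear X (?w x)" unfolding multilinear_def
  proof (intro conjI allI impI ballI)
   fix us vs assume us: "set us \<subseteq> |V|" and vs: "set vs \<subseteq> |V|"
   note f = fold_c[OF x us]
   show "klin V X (\<lambda>v. ?w x (Word (us @ v # vs)))" using klin_comp[OF blinD(2)[OF act f] fold_k[OF vs]] by simp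
   fix v a v' assume "v \<in> |V|" "a \<in> |A|" "v' \<in> |V|"
   then show "?w x (Word (us @ (v \<lhd>\<^sub>V a) # v' # vs)) = ?w x (Word (us @ v # (a \<rhd>\<^sub>V v') # vs))"
    using blinD(3)[OF act ac[OF f]] blinD(4)[OF act f] by simp
  qed (use rmod_klin(2)[OF X x] in simp)
  then have "g r = \<zero>\<^sub>X" if "r \<in> N" for r
   using multilinear_kills[OF g multilinear_cong that] g0(2) by blast
  then obtain h where h: "klin T X h" "\<And>f. f \<in> |F| ==> h (q f) = g f"
   using quot_lift[OF F_vs N_sub g] unfolding T_eq by metis
  have "h (q (e w)) = ?w x w" if "w \<in> W" for w using h(2)[OF e_F[OF that]] g0(2)[OF that] by simp
  then show ?thesis using h(1) by blast
 qed
 then obtain R where R: "\<And>x. x \<in> |X| ==> klin T X (R x)"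
  "\<And>x w. x \<in> |X| ==> w \<in> W ==> R x (q (e w)) = ?w x w" by metis
 let ?S = "(\<lambda>w. q (e w)) ` W"
 have S: "?S \<subseteq> |T|" using q_e_T by auto
 have TS: "t \<in> kspan K T ?S" if "t \<in> |T|" for t using that T_span by simp
 have Rk: "klin X X (\<lambda>x. R x t)" if t: "t \<in> |T|" for t
 proof (rule klinI[OF Xv Xv])
  fix x assume x: "x \<in> |X|"
  show "R x t \<in> |X|" using klinD(3)[OF R(1)[OF x] t] .
  show "R (x \<oplus>\<^sub>X y) t = R x t \<oplus>\<^sub>X R y t" if y: "y \<in> |X|" for y
   by (rule klin_eq_on_span[OF R(1) klin_add[OF R(1)[OF x] R(1)[OF y]] S _ TS[OF t]])
    (use x y Xv in \<open>auto simp: R(2) klinD(4)[OF wk]\<close>)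
  show "R (c \<odot>\<^sub>X x) t = c \<odot>\<^sub>X R x t" if c: "c \<in> |K|" for c
   by (rule klin_eq_on_span[OF R(1) klin_smult[OF R(1)[OF x] c] S _ TS[OF t]])
    (use x c Xv in \<open>auto simp: R(2) klinD(5)[OF wk]\<close>)
 qed
 \<comment> \<open>checked on words, then extended linearly in the second and in the first factor\<close>
 have Rm: "R x (t \<otimes>\<^sub>T t') = R (R x t) t'" if x: "x \<in> |X|" and t: "t \<in> |T|" "t' \<in> |T|" for x t t'
 proof -
  have wm: "?w x (mul u w) = ?w (?w x u) w" if "u \<in> W" "w \<in> W" for u w
   using that(1)
  proof (cases rule: W_cases)
   case u: (Scalar a)
   show ?thesis using that(2)
   proof (cases rule: W_cases)
    case (Word vs)
    then show ?thesis using u blinD(3)[OF act x] by (cases vs) auto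
   qed (use u x in \<open>simp add: sX\<close>)
  next
   case u: (Word us)
   show ?thesis using that(2)
   proof (cases rule: W_cases)
    case (Scalar b)
    obtain xs y where y: "us = xs @ [y]" using u(2) by (cases us rule: rev_cases) auto
    then show ?thesis using u Scalar blinD(4)[OF act fold_c[OF x] Scalar(2), of xs y] by simp
   qed (use u in simp)
  qed
  have 1: "R x (q (e u) \<otimes>\<^sub>T q (e w)) = R (R x (q (e u))) (q (e w))" if "u \<in> W" "w \<in> W" for u w
   using that wc[OF x that(1)] x by (simp add: q_mul R(2) wm)
  note al = alg_klin[OF T_alg]
  have 2: "R x (q (e u) \<otimes>\<^sub>T t') = R (R x (q (e u))) t'" if u: "u \<in> W" for u
   by (rule klin_eq_on_span[OF klin_comp[OF al(2)[OF q_e_T[OF u]] R(1)[OF x]] R(1) S _ TS[OF t(2)]])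
    (use 1 u klinD(3)[OF R(1)[OF x] q_e_T[OF u]] in auto)
  show ?thesis
   by (rule klin_eq_on_span[OF klin_comp[OF al(1)[OF t(2)] R(1)[OF x]] klin_comp[OF R(1)[OF x] Rk[OF t(2)]] S _ TS[OF t(1)]])
    (use 2 in auto)
 qed
 have sc: "R x (ts a) = x \<lhd>\<^sub>X a" if "x \<in> |X|" "a \<in> |A|" for x a
  unfolding ts_def' using R(2)[OF that(1), of "Scalar a"] that by simp
 have "right_module K T (with_ract X R)"
 proof (rule rmodI[OF T_alg])
  show "vspace (with_ract X R)" using Xv by (simp add: with_ract_vs)
  fix x assume "x \<in> |with_ract X R|"
  then have x: "x \<in> |X|" by simp
  show "x \<lhd>\<^bsub>with_ract X R\<^esub> \<one>\<^sub>T = x" using sc[OF x A_simps(2)] x by (simp add: ts(3) sX)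
 qed (simp_all add: klinD(3-5)[OF R(1)] klinD(4,5)[OF Rk] Rm)
 then show ?thesis
 proof (rule that[OF _ sc])
  fix x v assume "x \<in> |X|" "v \<in> |V|"
  then show "R x (tg v) = act x v" using R(2)[of x "Word [v]"] by (simp add: tg_def')
 qed
qed

end

section \<open>Preprojective algebras\<close>

context kfield
begin

lemma bimodule_sum_bimodule:
 assumes M: "bimodule K A B M" and N: "bimodule K A B N"
 shows "bimodule K A B (bimodule_sum M N)"
proof -
 note m = bimodD[OF M] rmodD[OF bimodD(1)[OF M]] and n = bimodD[OF N] rmodD[OF bimodD(1)[OF N]]
 note B = rmodD(1)[OF bimodD(1)[OF M]]
 have v: "vspace (bimodule_sum M N)"
 proof (rule vsI)
  show "x \<oplus>\<^bsub>bimodule_sum M N\<^esub> y = y \<oplus>\<^bsub>bimodule_sum M N\<^esub> x"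
   if "x \<in> |bimodule_sum M N|" "y \<in> |bimodule_sum M N|" for x y
   using that m(3) n(3) vs_ac(1)[OF m(3), of "fst x" "fst y"] vs_ac(1)[OF n(3), of "snd x" "snd y"]
   by (auto simp: bimodule_sum_def)
 qed (auto simp: bimodule_sum_def m(3) n(3) vs_ac(2)[OF m(3)] vs_ac(2)[OF n(3)] vs_smult[OF m(3)] vs_smult[OF n(3)])
 have r: "right_module K B (bimodule_sum M N)"
  by (rule rmodI[OF B v]) (auto simp: bimodule_sum_def m n)
 show ?thesis by (rule bimodI[OF r m(2)]) (auto simp: bimodule_sum_def m n)
qed

end

locale preprojective_data = dualised_bimodule K A \<sigma> M rs ls
 for K :: "('k, 'c) ring_scheme" (structure) and A :: "('k, 'a) module" and \<sigma>
  and M :: "('k, 'a, 'a, 'm) bimodule" and rs ls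
begin

abbreviation V where "V \<equiv> double_bimodule K M"
abbreviation iM where "iM \<equiv> inj_M K M"
abbreviation iD where "iD \<equiv> inj_D M"
abbreviation TD where "TD \<equiv> double_tensor_algebra K A M"
abbreviation I where "I \<equiv> prep_ideal K A M rs ls"
abbreviation P where "P \<equiv> preprojective K A M rs ls"
abbreviation ps where "ps \<equiv> prep_scalar K A M rs ls"
abbreviation pg where "pg \<equiv> prep_gen K A M rs ls"
abbreviation pm where "pm \<equiv> \<lambda>m. pg (iM m)"
abbreviation pd where "pd \<equiv> \<lambda>\<mu>. pg (iD \<mu>)"

lemma V_bimodule: "bimodule K A A V"
 unfolding double_bimodule_def by (rule bimodule_sum_bimodule[OF M_bimodule DM_bimodule])

lemma V_sels: "|V| = |M| \<times> |DM|" "\<zero>\<^sub>V = (\<zero>\<^sub>M, \<zero>\<^bsub>DM\<^esub>)"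
 "v \<oplus>\<^sub>V w = (fst v \<oplus>\<^sub>M fst w, snd v \<oplus>\<^bsub>DM\<^esub> snd w)"
 "c \<odot>\<^sub>V v = (c \<odot>\<^sub>M fst v, c \<odot>\<^bsub>DM\<^esub> snd v)" "v \<lhd>\<^sub>V a = (fst v \<lhd>\<^sub>M a, snd v \<lhd>\<^bsub>DM\<^esub> a)"
 "a \<rhd>\<^sub>V v = (a \<rhd>\<^sub>M fst v, a \<rhd>\<^bsub>DM\<^esub> snd v)"
 by (simp_all add: double_bimodule_def bimodule_sum_def case_prod_beta)

sublocale D: bimodule_data K A V
 by (intro bimodule_data.intro bimodule_data_axioms.intro kfield_axioms V_bimodule)

sublocale L: bimodule_data K A M
 by (intro bimodule_data.intro bimodule_data_axioms.intro kfield_axioms M_bimodule)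

lemma TD_eq: "TD = D.T"
 by (simp add: double_tensor_algebra_def)

lemma DM_zero_act: "a \<in> |A| ==> a \<rhd>\<^bsub>DM\<^esub> \<zero>\<^bsub>DM\<^esub> = \<zero>\<^bsub>DM\<^esub>" "a \<in> |A| ==> \<zero>\<^bsub>DM\<^esub> \<lhd>\<^bsub>DM\<^esub> a = \<zero>\<^bsub>DM\<^esub>"
 "a \<in> |A| ==> a \<rhd>\<^sub>M \<zero>\<^sub>M = \<zero>\<^sub>M" "a \<in> |A| ==> \<zero>\<^sub>M \<lhd>\<^sub>M a = \<zero>\<^sub>M"
proof -
 assume a: "a \<in> |A|"
 have k: "klin DM DM (\<lambda>m. a \<rhd>\<^bsub>DM\<^esub> m)"
  by (rule klinI) (use a in \<open>simp_all add: bimodD[OF DM_bimodule]\<close>)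
 show "a \<rhd>\<^bsub>DM\<^esub> \<zero>\<^bsub>DM\<^esub> = \<zero>\<^bsub>DM\<^esub>" by (rule klinD(6)[OF k])
 show "\<zero>\<^bsub>DM\<^esub> \<lhd>\<^bsub>DM\<^esub> a = \<zero>\<^bsub>DM\<^esub>" by (rule klinD(6)[OF rmod_klin(1)[OF bimodD(1)[OF DM_bimodule] a]])
 show "a \<rhd>\<^sub>M \<zero>\<^sub>M = \<zero>\<^sub>M" by (rule klinD(6)[OF M_mult_klin(1)[OF a]])
 show "\<zero>\<^sub>M \<lhd>\<^sub>M a = \<zero>\<^sub>M" by (rule klinD(6)[OF M_mult_klin(2)[OF a]])
qed

lemma iM: "klin M V iM" "m \<in> |M| ==> iM m \<in> |V|"
 "a \<in> |A| ==> m \<in> |M| ==> iM (a \<rhd>\<^sub>M m) = a \<rhd>\<^sub>V iM m"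
 "a \<in> |A| ==> m \<in> |M| ==> iM (m \<lhd>\<^sub>M a) = iM m \<lhd>\<^sub>V a"
proof -
 show "klin M V iM" by (rule klinI) (simp_all add: inj_M_def V_sels bimodD(3)[OF V_bimodule])
qed (simp_all add: inj_M_def V_sels DM_zero_act)

lemma iD: "klin DM V iD" "\<mu> \<in> |DM| ==> iD \<mu> \<in> |V|"
 "a \<in> |A| ==> \<mu> \<in> |DM| ==> iD (a \<rhd>\<^bsub>DM\<^esub> \<mu>) = a \<rhd>\<^sub>V iD \<mu>"
 "a \<in> |A| ==> \<mu> \<in> |DM| ==> iD (\<mu> \<lhd>\<^bsub>DM\<^esub> a) = iD \<mu> \<lhd>\<^sub>V a"
proof -
 show "klin DM V iD" by (rule klinI) (simp_all add: inj_D_def V_sels bimodD(3)[OF V_bimodule])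
qed (simp_all add: inj_D_def V_sels DM_zero_act)

lemma V_split: "v \<in> |V| ==> v = iM (fst v) \<oplus>\<^sub>V iD (snd v)"
 by (auto simp: V_sels inj_M_def inj_D_def)

definition rho where "rho = lsum TD (map (\<lambda>p. D.tg (iM (fst p)) \<otimes>\<^bsub>TD\<^esub> D.tg (iD (snd p))) rs)"
definition ell where "ell = lsum TD (map (\<lambda>q. D.tg (iD (fst q)) \<otimes>\<^bsub>TD\<^esub> D.tg (iM (snd q))) ls)"

lemma rho_minus_ell_eq: "rho_minus_ell K A M rs ls = rho \<ominus>\<^bsub>TD\<^esub> ell"
 by (simp add: rho_minus_ell_def Let_def rho_def ell_def case_prod_beta')

lemmas TD_alg = D.T_alg[folded TD_eq]
lemmas TD_vs = D.T_vs[folded TD_eq]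

lemma rho_ell_TD: "rho \<in> |TD|" "ell \<in> |TD|"
 unfolding rho_def ell_def
 by (rule lsum_map_closed[OF TD_vs]; use D.tg(2)[folded TD_eq] in \<open>simp add: algD(3)[OF TD_alg] iM iD\<close>)+

lemma rel_TD: "rho_minus_ell K A M rs ls \<in> |TD|"
 unfolding rho_minus_ell_eq using rho_ell_TD TD_vs by simp

lemma I_ideal: "ideal I TD"
 unfolding prep_ideal_def using rel_TD by (intro ring.genideal_ideal[OF algD(11)[OF TD_alg]]) simp

lemma I_rel: "rho \<ominus>\<^bsub>TD\<^esub> ell \<in> I"
 unfolding prep_ideal_def rho_minus_ell_eq[symmetric]
 using ring.genideal_self'[OF algD(11)[OF TD_alg] rel_TD] .

lemma I_subset: "ideal J TD ==> rho \<ominus>\<^bsub>TD\<^esub> ell \<in> J ==> I \<subseteq> J"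
 unfolding prep_ideal_def rho_minus_ell_eq[symmetric]
 by (rule ring.genideal_minimal[OF algD(11)[OF TD_alg]]) auto

lemma I_mult:
 assumes "x \<in> |TD|" "i \<in> I"
 shows "x \<otimes>\<^bsub>TD\<^esub> i \<in> I" "i \<otimes>\<^bsub>TD\<^esub> x \<in> I"
 using ideal.I_l_closed[OF I_ideal assms(2,1)] ideal.I_r_closed[OF I_ideal assms(2,1)] .

text \<open>
 An ideal is a subspace because \<open>c x = (c 1) x\<close>.
\<close>

lemma I_sub: "submodule I K TD"
proof (rule subI[OF TD_vs])
 interpret ideal I TD by (rule I_ideal)
 show sub: "I \<subseteq> |TD|" using a_subset .
 show "\<zero>\<^bsub>TD\<^esub> \<in> I" by simp
 show "x \<oplus>\<^bsub>TD\<^esub> y \<in> I" if "x \<in> I" "y \<in> I" for x y using that by simp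
 show "c \<odot>\<^bsub>TD\<^esub> x \<in> I" if c: "c \<in> |K|" and x: "x \<in> I" for c x
 proof -
  have xT: "x \<in> |TD|" using x sub by auto
  have "(c \<odot>\<^bsub>TD\<^esub> \<one>\<^bsub>TD\<^esub>) \<otimes>\<^bsub>TD\<^esub> x = c \<odot>\<^bsub>TD\<^esub> x" using c xT by (simp add: algD[OF TD_alg])
  then show ?thesis using I_mult(1)[of "c \<odot>\<^bsub>TD\<^esub> \<one>\<^bsub>TD\<^esub>" x] c x algD(2)[OF TD_alg] TD_vs by simp
 qed
qed

abbreviation qP where "qP x \<equiv> I +>\<^bsub>TD\<^esub> x"

lemma P_eq: "P = quotient TD I"
 by (simp add: preprojective_def)

lemma P_facts:
 shows P_alg: "assoc_algebra K P"
  and P_mult: "u \<in> |TD| ==> v \<in> |TD| ==> qP u \<otimes>\<^sub>P qP v = qP (u \<otimes>\<^bsub>TD\<^esub> v)"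
  and P_one: "\<one>\<^sub>P = qP \<one>\<^bsub>TD\<^esub>"
proof -
 note t = algD[OF TD_alg]
 have z: "x \<ominus>\<^bsub>TD\<^esub> x \<in> I" if "x \<in> |TD|" for x
  using that TD_vs subD(3)[OF I_sub TD_vs] by simp
 have a: "(x \<otimes>\<^bsub>TD\<^esub> y) \<otimes>\<^bsub>TD\<^esub> w \<ominus>\<^bsub>TD\<^esub> x \<otimes>\<^bsub>TD\<^esub> (y \<otimes>\<^bsub>TD\<^esub> w) \<in> I"
  if "x \<in> |TD|" "y \<in> |TD|" "w \<in> |TD|" for x y w
  unfolding t(4)[OF that] by (rule z) (use that t in simp)
 have o: "\<one>\<^bsub>TD\<^esub> \<otimes>\<^bsub>TD\<^esub> x \<ominus>\<^bsub>TD\<^esub> x \<in> I" "x \<otimes>\<^bsub>TD\<^esub> \<one>\<^bsub>TD\<^esub> \<ominus>\<^bsub>TD\<^esub> x \<in> I" if "x \<in> |TD|" for x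
  unfolding t(5)[OF that] t(6)[OF that] using z[OF that] by auto
 note * = quot_algebra[OF TD_vs I_sub t(3) alg_klin[OF TD_alg] I_mult a t(2) o, folded P_eq]
 show "assoc_algebra K P" by (rule *(1))
 show "u \<in> |TD| ==> v \<in> |TD| ==> qP u \<otimes>\<^sub>P qP v = qP (u \<otimes>\<^bsub>TD\<^esub> v)" by (rule *(2))
 show "\<one>\<^sub>P = qP \<one>\<^bsub>TD\<^esub>" by (rule *(3))
qed

lemmas P_simps [simp] = algD(1-3,5,6)[OF P_alg]
lemmas P_rules = algD(4,7-10)[OF P_alg]

lemma qP_klin: "klin TD P (\<lambda>x. qP x)"
 unfolding P_eq by (rule quot_klin[OF TD_vs I_sub])

lemma ps: "klin A P ps" "a \<in> |A| ==> ps a \<in> |P|" "ps \<one>\<^sub>A = \<one>\<^sub>P"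
 "a \<in> |A| ==> b \<in> |A| ==> ps (a \<otimes>\<^sub>A b) = ps a \<otimes>\<^sub>P ps b"
proof -
 have e: "ps = (\<lambda>a. qP (D.ts a))" by (simp add: prep_scalar_def fun_eq_iff)
 show k: "klin A P ps" unfolding e by (rule klin_comp[OF D.ts(1)[folded TD_eq] qP_klin])
 show "a \<in> |A| ==> ps a \<in> |P|" using klinD(3)[OF k] .
 show "ps \<one>\<^sub>A = \<one>\<^sub>P" unfolding e P_one using D.ts(3) TD_eq by simp
 show "ps (a \<otimes>\<^sub>A b) = ps a \<otimes>\<^sub>P ps b" if "a \<in> |A|" "b \<in> |A|"
  unfolding e using P_mult[of "D.ts a" "D.ts b"] D.ts(2,4)[folded TD_eq] that by simp
qed

lemma pg: "klin V P pg" "v \<in> |V| ==> pg v \<in> |P|"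
 "a \<in> |A| ==> v \<in> |V| ==> pg (a \<rhd>\<^sub>V v) = ps a \<otimes>\<^sub>P pg v"
 "a \<in> |A| ==> v \<in> |V| ==> pg (v \<lhd>\<^sub>V a) = pg v \<otimes>\<^sub>P ps a"
proof -
 have e: "pg = (\<lambda>a. qP (D.tg a))" "ps = (\<lambda>a. qP (D.ts a))" by (simp_all add: prep_gen_def prep_scalar_def fun_eq_iff)
 show k: "klin V P pg" unfolding e by (rule klin_comp[OF D.tg(1)[folded TD_eq] qP_klin])
 show "v \<in> |V| ==> pg v \<in> |P|" using klinD(3)[OF k] .
 show "pg (a \<rhd>\<^sub>V v) = ps a \<otimes>\<^sub>P pg v" "pg (v \<lhd>\<^sub>V a) = pg v \<otimes>\<^sub>P ps a" if "a \<in> |A|" "v \<in> |V|"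
  unfolding e using P_mult[of "D.ts a" "D.tg v"] P_mult[of "D.tg v" "D.ts a"] D.ts(4)[folded TD_eq] D.tg(2-4)[folded TD_eq] that
  by simp_all
qed

lemma pm: "klin M P pm" "m \<in> |M| ==> pm m \<in> |P|"
 "a \<in> |A| ==> m \<in> |M| ==> pm (a \<rhd>\<^sub>M m) = ps a \<otimes>\<^sub>P pm m"
 "a \<in> |A| ==> m \<in> |M| ==> pm (m \<lhd>\<^sub>M a) = pm m \<otimes>\<^sub>P ps a"
 using klin_comp[OF iM(1) pg(1)] by (simp_all add: iM pg)

lemma pd: "klin DM P pd" "\<mu> \<in> |DM| ==> pd \<mu> \<in> |P|"
 "a \<in> |A| ==> \<mu> \<in> |DM| ==> pd (a \<rhd>\<^bsub>DM\<^esub> \<mu>) = ps a \<otimes>\<^sub>P pd \<mu>"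
 "a \<in> |A| ==> \<mu> \<in> |DM| ==> pd (\<mu> \<lhd>\<^bsub>DM\<^esub> a) = pd \<mu> \<otimes>\<^sub>P ps a"
 using klin_comp[OF iD(1) pg(1)] by (simp_all add: iD pg)

lemma pg_split: "v \<in> |V| ==> pg v = pm (fst v) \<oplus>\<^sub>P pd (snd v)"
proof -
 assume v: "v \<in> |V|"
 then have "fst v \<in> |M|" "snd v \<in> |DM|" by (auto simp: V_sels)
 then have "pg (iM (fst v) \<oplus>\<^sub>V iD (snd v)) = pm (fst v) \<oplus>\<^sub>P pd (snd v)"
  by (intro klinD(4)[OF pg(1)] iM iD)
 then show ?thesis using V_split[OF v] by simp
qed

lemma P_rel: "lsum P (map (\<lambda>p. pm (fst p) \<otimes>\<^sub>P pd (snd p)) rs) = lsum P (map (\<lambda>q. pd (fst q) \<otimes>\<^sub>P pm (snd q)) ls)"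
proof -
 note tg = D.tg(2)[folded TD_eq]
 have "qP rho = qP ell" using quot_eq[OF TD_vs I_sub rho_ell_TD] I_rel by simp
 moreover have "qP rho = lsum P (map (\<lambda>p. qP (D.tg (iM (fst p)) \<otimes>\<^bsub>TD\<^esub> D.tg (iD (snd p)))) rs)"
  unfolding rho_def by (rule lsum_klin[OF qP_klin]) (simp add: algD(3)[OF TD_alg] tg iM iD)
 moreover have "\<dots> = lsum P (map (\<lambda>p. pm (fst p) \<otimes>\<^sub>P pd (snd p)) rs)"
  by (rule lsum_cong) (simp add: prep_gen_def P_mult tg iM iD)
 moreover have "qP ell = lsum P (map (\<lambda>q. qP (D.tg (iD (fst q)) \<otimes>\<^bsub>TD\<^esub> D.tg (iM (snd q)))) ls)"
  unfolding ell_def by (rule lsum_klin[OF qP_klin]) (simp add: algD(3)[OF TD_alg] tg iM iD)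
 moreover have "\<dots> = lsum P (map (\<lambda>q. pd (fst q) \<otimes>\<^sub>P pm (snd q)) ls)"
  by (rule lsum_cong) (simp add: prep_gen_def P_mult tg iM iD)
 ultimately show ?thesis by simp
qed

lemma P_induct [consumes 1, case_names scalar M DM add smult]:
 assumes "x \<in> |P|"
  and sc: "\<And>a. a \<in> |A| ==> Q (ps a)"
  and m: "\<And>t m. t \<in> |P| ==> m \<in> |M| ==> Q t ==> Q (t \<otimes>\<^sub>P pm m)"
  and d: "\<And>t \<mu>. t \<in> |P| ==> \<mu> \<in> |DM| ==> Q t ==> Q (t \<otimes>\<^sub>P pd \<mu>)"
  and add: "\<And>s t. s \<in> |P| ==> t \<in> |P| ==> Q s ==> Q t ==> Q (s \<oplus>\<^sub>P t)"
  and smult: "\<And>c t. c \<in> |K| ==> t \<in> |P| ==> Q t ==> Q (c \<odot>\<^sub>P t)"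
 shows "Q x"
proof -
 obtain t where t: "t \<in> |D.T|" "x = qP t" using assms(1) unfolding P_eq quot_carrier TD_eq by blast
 note c = klinD(3)[OF qP_klin, unfolded TD_eq]
 have "Q (I +>\<^bsub>D.T\<^esub> t)" using t(1)
 proof (induction rule: D.T_induct)
  case (scalar a)
  then show ?case using sc[of a] by (simp add: prep_scalar_def TD_eq)
 next
  case (gen t v)
  have mv: "fst v \<in> |M|" "snd v \<in> |DM|" using gen(2) by (auto simp: V_sels)
  have "I +>\<^bsub>D.T\<^esub> (t \<otimes>\<^bsub>D.T\<^esub> D.tg v) = (I +>\<^bsub>D.T\<^esub> t) \<otimes>\<^sub>P pg v"
   using P_mult[of t "D.tg v"] gen D.tg(2) by (simp add: prep_gen_def TD_eq)
  also have "\<dots> = (I +>\<^bsub>D.T\<^esub> t) \<otimes>\<^sub>P pm (fst v) \<oplus>\<^sub>P (I +>\<^bsub>D.T\<^esub> t) \<otimes>\<^sub>P pd (snd v)"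
   using c[OF gen(1)] mv pm(2) pd(2) by (simp add: pg_split[OF gen(2)] P_rules(3))
  finally show ?case using add m d c[OF gen(1)] gen(3) mv pm(2) pd(2) by simp
 next
  case (add s t)
  then show ?case using klinD(4)[OF qP_klin[unfolded TD_eq], of s t] assms(5) c by simp
 next
  case (smult k t)
  then show ?case using klinD(5)[OF qP_klin[unfolded TD_eq], of k t] assms(6) c by simp
 qed
 then show ?thesis using t(2) by (simp add: TD_eq)
qed

text \<open>
 The elements of the tensor algebra that act as zero form an ideal, which contains \<open>\<rho> - \<ell>\<close> if
 the two actions are compatible.
\<close>

lemma preprojective_module:
 assumes X: "right_module K A X" and aM: "blin A M X X aM" and aD: "blin A DM X X aD"
  and rel: "\<And>x. x \<in> |X| ==> lsum X (map (\<lambda>p. aD (aM x (fst p)) (snd p)) rs)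
   = lsum X (map (\<lambda>q. aM (aD x (fst q)) (snd q)) ls)"
 obtains R where "right_module K P (with_ract X R)"
  "\<And>x a. x \<in> |X| ==> a \<in> |A| ==> R x (ps a) = x \<lhd>\<^sub>X a"
  "\<And>x m. x \<in> |X| ==> m \<in> |M| ==> R x (pm m) = aM x m"
  "\<And>x \<mu>. x \<in> |X| ==> \<mu> \<in> |DM| ==> R x (pd \<mu>) = aD x \<mu>"
proof -
 note Xv = rmodD(2)[OF X]
 define act where "act = (\<lambda>x v. aM x (fst v) \<oplus>\<^sub>X aD x (snd v))"
 have fstk: "klin V M fst" and sndk: "klin V DM snd"
  by (rule klinI; auto simp: V_sels bimodD(3)[OF V_bimodule])+
 have act: "blin A V X X act" unfolding act_def
 proof (rule blinI)
  fix v assume "v \<in> |V|"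
  then show "klin X X (\<lambda>x. aM x (fst v) \<oplus>\<^sub>X aD x (snd v))"
   by (intro klin_add blinD(1)[OF aM] blinD(1)[OF aD]) (auto simp: V_sels)
 next
  fix x assume x: "x \<in> |X|"
  show "klin V X (\<lambda>v. aM x (fst v) \<oplus>\<^sub>X aD x (snd v))"
   by (rule klin_add[OF klin_comp[OF fstk blinD(2)[OF aM x]] klin_comp[OF sndk blinD(2)[OF aD x]]])
  fix a v assume a: "a \<in> |A|" and v: "v \<in> |V|"
  then have v': "fst v \<in> |M|" "snd v \<in> |DM|" by (auto simp: V_sels)
  show "aM (x \<lhd>\<^sub>X a) (fst v) \<oplus>\<^sub>X aD (x \<lhd>\<^sub>X a) (snd v) = aM x (fst (a \<rhd>\<^sub>V v)) \<oplus>\<^sub>X aD x (snd (a \<rhd>\<^sub>V v))"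
   using x a v' by (simp add: V_sels blinD(3)[OF aM] blinD(3)[OF aD])
  show "(aM x (fst v) \<oplus>\<^sub>X aD x (snd v)) \<lhd>\<^sub>X a = aM x (fst (v \<lhd>\<^sub>V a)) \<oplus>\<^sub>X aD x (snd (v \<lhd>\<^sub>V a))"
   using x a v' by (simp add: V_sels rmodD(4)[OF X] blinD(5)[OF aM] blinD(5)[OF aD] blinD(4)[OF aM] blinD(4)[OF aD])
 qed
 obtain R where R: "right_module K TD (with_ract X R)"
  "\<And>x a. x \<in> |X| ==> a \<in> |A| ==> R x (D.ts a) = x \<lhd>\<^sub>X a"
  "\<And>x v. x \<in> |X| ==> v \<in> |V| ==> R x (D.tg v) = act x v"
  using D.tensor_algebra_module[OF X act] unfolding TD_eq by blast
 note r = rmodD[OF R(1), simplified] and rk = rmod_klin[OF R(1), simplified]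
 have kX: "klin U (with_ract X R) f \<longleftrightarrow> klin U X f" for U :: "('k, 'u, 'y) module_scheme" and f
  by (simp add: klin_def with_ract_vs)
 have Rk: "klin TD X (R x)" if "x \<in> |X|" for x using rk(2)[OF that] by (simp add: kX)
 have ac0: "act x (iM m) = aM x m" if "x \<in> |X|" "m \<in> |M|" for x m
  using that Xv klinD(6)[OF blinD(2)[OF aD that(1)]] blinD(5)[OF aM] by (simp add: act_def inj_M_def)
 have ac1: "act x (iD \<mu>) = aD x \<mu>" if "x \<in> |X|" "\<mu> \<in> |DM|" for x \<mu>
  using that Xv klinD(6)[OF blinD(2)[OF aM that(1)]] blinD(5)[OF aD] by (simp add: act_def inj_D_def)
 note tg = D.tg(2)[folded TD_eq]
 define J where "J = {t \<in> |TD|. \<forall>x\<in>|X|. R x t = \<zero>\<^sub>X}"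
 have Jsub: "submodule J K TD"
  by (rule subI[OF TD_vs]) (auto simp: J_def TD_vs Xv klinD(4,5,6)[OF Rk])
 have J: "ideal J TD"
 proof (rule idealI[OF algD(11)[OF TD_alg] submodule.axioms(1)[OF Jsub]])
  fix t s assume t: "t \<in> J" and s: "s \<in> |TD|"
  show "s \<otimes>\<^bsub>TD\<^esub> t \<in> J" using t s r(3,6) unfolding J_def by (simp add: algD(3)[OF TD_alg])
  show "t \<otimes>\<^bsub>TD\<^esub> s \<in> J"
   using t s r(6) klinD(6)[OF rk(1)[OF s]] unfolding J_def by (simp add: algD(3)[OF TD_alg])
 qed
 have "rho \<ominus>\<^bsub>TD\<^esub> ell \<in> J"
 proof -
  have "R x (rho \<ominus>\<^bsub>TD\<^esub> ell) = \<zero>\<^sub>X" if x: "x \<in> |X|" for x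
  proof -
   have "R x rho = lsum X (map (\<lambda>p. R x (D.tg (iM (fst p)) \<otimes>\<^bsub>TD\<^esub> D.tg (iD (snd p)))) rs)"
    unfolding rho_def by (rule lsum_klin[OF Rk[OF x]]) (simp add: algD(3)[OF TD_alg] tg iM iD)
   also have "\<dots> = lsum X (map (\<lambda>p. aD (aM x (fst p)) (snd p)) rs)"
    by (rule lsum_cong) (simp add: r(6) x tg iM iD R(3) ac0 ac1 blinD(5)[OF aM])
   also have "\<dots> = lsum X (map (\<lambda>q. aM (aD x (fst q)) (snd q)) ls)" by (rule rel[OF x])
   also have "\<dots> = lsum X (map (\<lambda>q. R x (D.tg (iD (fst q)) \<otimes>\<^bsub>TD\<^esub> D.tg (iM (snd q)))) ls)"
    by (rule lsum_cong) (simp add: r(6) x tg iM iD R(3) ac0 ac1 blinD(5)[OF aD])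
   also have "\<dots> = R x ell" unfolding ell_def
    by (rule lsum_klin[OF Rk[OF x], symmetric]) (simp add: algD(3)[OF TD_alg] tg iM iD)
   finally have e: "R x rho = R x ell" .
   show ?thesis unfolding klinD(8)[OF Rk[OF x] rho_ell_TD] e
    using Xv klinD(3)[OF Rk[OF x] rho_ell_TD(2)] by simp
  qed
  then show ?thesis unfolding J_def using rho_ell_TD TD_vs by simp
 qed
 then have IJ: "I \<subseteq> J" by (rule I_subset[OF J])
 have "\<exists>h. klin P X h \<and> (\<forall>t\<in>|TD|. h (qP t) = R x t)" if x: "x \<in> |X|" for x
 proof (rule quot_lift[OF TD_vs I_sub Rk[OF x]])
  show "R x w = \<zero>\<^sub>X" if "w \<in> I" for w using IJ x that unfolding J_def by blast
  show ?thesis if "klin (quotient TD I) X h" "\<And>v. v \<in> |TD| ==> h (qP v) = R x v" for h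
   using that unfolding P_eq by blast
 qed
 then obtain S where S: "\<And>x. x \<in> |X| ==> klin P X (S x)"
  "\<And>x t. x \<in> |X| ==> t \<in> |TD| ==> S x (qP t) = R x t" by metis
 have Pc: "\<exists>t\<in>|TD|. b = qP t" if "b \<in> |P|" for b
  using that unfolding P_eq quot_carrier by blast
 have mod: "right_module K P (with_ract X S)"
 proof (rule rmodI[OF P_alg], unfold with_ract_sels)
  show "vspace (with_ract X S)" using Xv by (simp add: with_ract_vs)
  fix x b assume x: "x \<in> |X|" and b: "b \<in> |P|"
  obtain t where t: "t \<in> |TD|" "b = qP t" using Pc[OF b] by blast
  show "S x b \<in> |X|" using klinD(3)[OF S(1)[OF x] b] .
  show "S (x \<oplus>\<^sub>X y) b = S x b \<oplus>\<^sub>X S y b" if "y \<in> |X|" for y using that x t Xv by (simp add: S(2) r)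
  show "S (c \<odot>\<^sub>X x) b = c \<odot>\<^sub>X S x b" "S x (c \<odot>\<^sub>P b) = c \<odot>\<^sub>X S x b"
   if "c \<in> |K|" for c using that x t Xv b klinD(5)[OF S(1)[OF x]] by (simp_all add: S(2) r)
  fix b' assume b': "b' \<in> |P|"
  obtain t' where t': "t' \<in> |TD|" "b' = qP t'" using Pc[OF b'] by blast
  show "S x (b \<oplus>\<^sub>P b') = S x b \<oplus>\<^sub>X S x b'" using klinD(4)[OF S(1)[OF x] b b'] .
  show "S x (b \<otimes>\<^sub>P b') = S (S x b) b'" using x t t' by (simp add: P_mult S(2) r algD(3)[OF TD_alg])
 qed (simp add: P_one S(2) r algD(2)[OF TD_alg])
 show ?thesis
 proof (rule that[OF mod])
  fix x a assume "x \<in> |X|" "a \<in> |A|"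
  then show "S x (ps a) = x \<lhd>\<^sub>X a" by (simp add: prep_scalar_def S(2) R(2) D.ts(4)[folded TD_eq])
 next
  fix x m assume "x \<in> |X|" "m \<in> |M|"
  then show "S x (pm m) = aM x m" by (simp add: prep_gen_def S(2) R(3) tg iM ac0)
 next
  fix x \<mu> assume "x \<in> |X|" "\<mu> \<in> |DM|"
  then show "S x (pd \<mu>) = aD x \<mu>" by (simp add: prep_gen_def S(2) R(3) tg iD ac1)
 qed
qed

end

section \<open>Finite dimension of the preprojective algebra\<close>

context kfield
begin

text \<open>Direct sums of modules, to hold extensions.\<close>

definition rprod :: "('k, 'a, 'x, 's) rmodule_scheme \<Rightarrow> ('k, 'a, 'z, 't) rmodule_scheme \<Rightarrow> ('k, 'a, 'x \<times> 'z) rmodule" where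
 "rprod X Z = \<lparr>carrier = |X| \<times> |Z|, mult = undefined, one = undefined,
   zero = (\<zero>\<^sub>X, \<zero>\<^sub>Z), add = (\<lambda>x y. (fst x \<oplus>\<^sub>X fst y, snd x \<oplus>\<^sub>Z snd y)),
   smult = (\<lambda>c x. (c \<odot>\<^sub>X fst x, c \<odot>\<^sub>Z snd x)), ract = (\<lambda>x a. (fst x \<lhd>\<^sub>X a, snd x \<lhd>\<^sub>Z a))\<rparr>"

lemma rprod_sels [simp]: "|rprod X Z| = |X| \<times> |Z|" "\<zero>\<^bsub>rprod X Z\<^esub> = (\<zero>\<^sub>X, \<zero>\<^sub>Z)"
 "x \<oplus>\<^bsub>rprod X Z\<^esub> y = (fst x \<oplus>\<^sub>X fst y, snd x \<oplus>\<^sub>Z snd y)"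
 "c \<odot>\<^bsub>rprod X Z\<^esub> x = (c \<odot>\<^sub>X fst x, c \<odot>\<^sub>Z snd x)" "x \<lhd>\<^bsub>rprod X Z\<^esub> a = (fst x \<lhd>\<^sub>X a, snd x \<lhd>\<^sub>Z a)"
 by (simp_all add: rprod_def)

lemma rprod_rmod:
 assumes X: "right_module K A X" and Z: "right_module K A Z"
 shows "right_module K A (rprod X Z)"
proof -
 note x = rmodD[OF X] and z = rmodD[OF Z]
 have v: "vspace (rprod X Z)"
 proof (rule vsI)
  fix u w assume "u \<in> |rprod X Z|" "w \<in> |rprod X Z|"
  then show "u \<oplus>\<^bsub>rprod X Z\<^esub> w = w \<oplus>\<^bsub>rprod X Z\<^esub> u"
   using vs_ac(1)[OF x(2), of "fst u" "fst w"] vs_ac(1)[OF z(2), of "snd u" "snd w"] by auto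
 qed (auto simp: x(2) z(2) vs_ac(2)[OF x(2)] vs_ac(2)[OF z(2)] vs_smult[OF x(2)] vs_smult[OF z(2)])
 show ?thesis by (rule rmodI[OF x(1) v]) (auto simp: x z)
qed

lemma rprod_klin:
 "right_module K A X ==> right_module K A Z ==> klin U X f ==> klin U Z g ==> klin U (rprod X Z) (\<lambda>u. (f u, g u))"
 using rmodD(2)[OF rprod_rmod] by (intro klinI) (auto simp: klinD klinD(1)[of U X f])

lemma rprod_proj:
 assumes "right_module K A X" "right_module K A Z"
 shows "klin (rprod X Z) X fst" "klin (rprod X Z) Z snd"
 using assms rmodD(2)[OF rprod_rmod[OF assms]] rmodD(2) by (auto intro!: klinI)

end

context dualised_bimodule
begin

text \<open>The element \<open>\<ell>\<close> commutes with \<open>A\<close>.\<close>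

lemma ell_central:
 fixes Y :: "('k, 'a, 'y) rmodule" and Z :: "('k, 'a, 'z) rmodule" and X :: "('k, 'a, 'x) rmodule"
 assumes Y: "right_module K A Y" and Z: "right_module K A Z" and X: "right_module K A X"
  and t: "blin A DM Y Z t" and D: "blin A M Z X D" and y: "y \<in> |Y|" and a: "a \<in> |A|"
 shows "lsum X (map (\<lambda>q. D (t (y \<lhd>\<^sub>Y a) (fst q)) (snd q)) ls)
  = lsum X (map (\<lambda>q. D (t y (fst q)) (snd q)) ls) \<lhd>\<^sub>X a"
proof -
 let ?c = "\<lambda>l q. D (t y (fst l)) (lt (fst q) (snd l \<lhd>\<^sub>M a) \<rhd>\<^sub>M snd q)"
 note Xv = rmodD(2)[OF X]
 have tc: "t y \<nu> \<in> |Z|" if "\<nu> \<in> |DM|" for \<nu> by (rule blinD(5)[OF t y that])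
 have na: "n \<lhd>\<^sub>M a \<in> |M|" if "n \<in> |M|" for n using that a by simp
 have c: "?c l q \<in> |X|" if "q \<in> set ls" "l \<in> set ls" for q l
  using that by (simp add: blinD(5)[OF D] tc lt(2) na)
 have "lsum X (map (\<lambda>q. D (t (y \<lhd>\<^sub>Y a) (fst q)) (snd q)) ls)
  = lsum X (map (\<lambda>q. lsum X (map (\<lambda>l. ?c l q) ls)) ls)"
 proof (rule lsum_cong)
  fix q assume q: "q \<in> set ls"
  note \<nu> = ls_mem(1)[OF q] and n = ls_mem(2)[OF q]
  have a\<nu>: "a \<rhd>\<^bsub>DM\<^esub> fst q \<in> |DM|" using a \<nu> by simp
  have "D (t (y \<lhd>\<^sub>Y a) (fst q)) (snd q) = D (t y (lsum DM (map (\<lambda>l. fst l \<lhd>\<^bsub>DM\<^esub> lt (a \<rhd>\<^bsub>DM\<^esub> fst q) (snd l)) ls))) (snd q)"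
   using blinD(3)[OF t y a \<nu>] dual_basis_ls[OF a\<nu>] by simp
  also have "\<dots> = lsum X (map (\<lambda>l. D (t y (fst l \<lhd>\<^bsub>DM\<^esub> lt (a \<rhd>\<^bsub>DM\<^esub> fst q) (snd l))) (snd q)) ls)"
   by (rule lsum_klin[OF klin_comp[OF blinD(2)[OF t y] blinD(1)[OF D n]]]) (simp add: lt(2)[OF a\<nu>])
  also have "\<dots> = lsum X (map (\<lambda>l. ?c l q) ls)"
  proof (rule lsum_cong)
   fix l assume l: "l \<in> set ls"
   have c: "lt (a \<rhd>\<^bsub>DM\<^esub> fst q) (snd l) \<in> |A|" using lt(2)[OF a\<nu>] l by simp
   show "D (t y (fst l \<lhd>\<^bsub>DM\<^esub> lt (a \<rhd>\<^bsub>DM\<^esub> fst q) (snd l))) (snd q)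
    = ?c l q"
    using blinD(4)[OF t y c ls_mem(1)[OF l]] blinD(3)[OF D tc[OF ls_mem(1)[OF l]] c n]
     lt(8)[OF \<nu> ls_mem(2)[OF l] a] by simp
  qed
  finally show "D (t (y \<lhd>\<^sub>Y a) (fst q)) (snd q)
   = lsum X (map (\<lambda>l. ?c l q) ls)" .
 qed
 also have "\<dots> = lsum X (map (\<lambda>l. lsum X (map (?c l) ls)) ls)"
  by (rule lsum_swap[OF Xv]) (rule c)
 also have "\<dots> = lsum X (map (\<lambda>l. D (t y (fst l)) (snd l) \<lhd>\<^sub>X a) ls)"
 proof (rule lsum_cong)
  fix l assume l: "l \<in> set ls"
  note z = tc[OF ls_mem(1)[OF l]] and n = ls_mem(2)[OF l]
  have "lsum X (map (?c l) ls)
   = D (t y (fst l)) (lsum M (map (\<lambda>q. lt (fst q) (snd l \<lhd>\<^sub>M a) \<rhd>\<^sub>M snd q) ls))"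
   by (rule lsum_klin[OF blinD(2)[OF D z], symmetric]) (simp add: lt(2) na n)
  then show "lsum X (map (?c l) ls)
   = D (t y (fst l)) (snd l) \<lhd>\<^sub>X a" using basis_ls[OF na[OF n]] blinD(4)[OF D z a n] by simp
 qed
 also have "\<dots> = lsum X (map (\<lambda>q. D (t y (fst q)) (snd q)) ls) \<lhd>\<^sub>X a"
  by (rule lsum_klin[OF rmod_klin(1)[OF X a], symmetric]) (simp add: blinD(5)[OF D] tc)
 finally show ?thesis .
qed

end

context preprojective_data
begin

subsection \<open>The homogeneous parts\<close>

text \<open>
 \<open>G n\<close> is the part of degree \<open>n\<close> in \<open>DM\<close>, which is \<open>\<tau>\<^sup>-\<^sup>n \<Lambda>\<close> as a \<open>\<Lambda>\<close>-module.  It is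
 introduced by generators, so that no grading has to be constructed.
\<close>

definition Mspan :: "('k, 'a, 'm) prep_elt set \<Rightarrow> ('k, 'a, 'm) prep_elt set" where
 "Mspan S = \<Inter>{U. submodule U K P \<and> S \<subseteq> U \<and> (\<forall>u\<in>U. \<forall>m\<in>|M|. u \<otimes>\<^sub>P pm m \<in> U)}"

primrec G :: "nat \<Rightarrow> ('k, 'a, 'm) prep_elt set" where
 "G 0 = Mspan (ps ` |A| )"
| "G (Suc n) = Mspan {y \<otimes>\<^sub>P pd \<mu> | y \<mu>. y \<in> G n \<and> \<mu> \<in> |DM|}"

lemma Mspan_sub: "S \<subseteq> |P| ==> submodule (Mspan S) K P"
proof (rule subI[OF P_simps(1)])
 assume S: "S \<subseteq> |P|"
 show "Mspan S \<subseteq> |P|"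
  unfolding Mspan_def by (rule Inter_lower) (use S sub_carrier[OF P_simps(1)] pm(2) in simp)
qed (auto simp: Mspan_def subD[OF _ P_simps(1)])

lemma Mspan_superset: "S \<subseteq> Mspan S"
 unfolding Mspan_def by auto

lemma Mspan_M: "u \<in> Mspan S ==> m \<in> |M| ==> u \<otimes>\<^sub>P pm m \<in> Mspan S"
 unfolding Mspan_def by auto

lemma Mspan_least:
 "submodule U K P ==> S \<subseteq> U ==> (\<And>u m. u \<in> U ==> m \<in> |M| ==> u \<otimes>\<^sub>P pm m \<in> U) ==> Mspan S \<subseteq> U"
 unfolding Mspan_def by auto

lemma Mspan_induct [consumes 2, case_names base M zero add smult]:
 assumes "x \<in> Mspan S" "S \<subseteq> |P|" and "\<And>s. s \<in> S ==> Q s"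
  and "\<And>u m. u \<in> Mspan S ==> m \<in> |M| ==> Q u ==> Q (u \<otimes>\<^sub>P pm m)"
  and "Q \<zero>\<^sub>P" and "\<And>u w. u \<in> Mspan S ==> w \<in> Mspan S ==> Q u ==> Q w ==> Q (u \<oplus>\<^sub>P w)"
  and "\<And>c u. c \<in> |K| ==> u \<in> Mspan S ==> Q u ==> Q (c \<odot>\<^sub>P u)"
 shows "Q x"
proof -
 note s = subD[OF Mspan_sub[OF assms(2)] P_simps(1)]
 have "Mspan S \<subseteq> {u \<in> Mspan S. Q u}"
 proof (rule Mspan_least)
  show "submodule {u \<in> Mspan S. Q u} K P"
   by (rule subI) (use s assms(5-7) in auto)
  show "S \<subseteq> {u \<in> Mspan S. Q u}" using assms(3) Mspan_superset[of S] by blast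
  show "u \<otimes>\<^sub>P pm m \<in> {u \<in> Mspan S. Q u}" if "u \<in> {u \<in> Mspan S. Q u}" "m \<in> |M|" for u m
   using that assms(4)[of u m] Mspan_M[of u S m] by simp
 qed
 then show ?thesis using assms(1) by blast
qed

lemma G_sub: "submodule (G n) K P"
proof (induction n)
 case (Suc n)
 have "{y \<otimes>\<^sub>P pd \<mu> | y \<mu>. y \<in> G n \<and> \<mu> \<in> |DM|} \<subseteq> |P|"
  using subD(2)[OF Suc P_simps(1)] pd(2) by auto
 then show ?case by (simp add: Mspan_sub)
qed (use ps in \<open>auto intro: Mspan_sub\<close>)

lemmas G_D1 = subD[OF G_sub P_simps(1)]

lemma G_gens: "ps ` |A| \<subseteq> |P|"
 "{y \<otimes>\<^sub>P pd \<mu> | y \<mu>. y \<in> G n \<and> \<mu> \<in> |DM|} \<subseteq> |P|"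
 using G_D1(2) pd(2) ps(2) by auto

lemma G_M: "y \<in> G n ==> m \<in> |M| ==> y \<otimes>\<^sub>P pm m \<in> G n"
 by (cases n) (auto intro: Mspan_M)

lemma G_DM: "y \<in> G n ==> \<mu> \<in> |DM| ==> y \<otimes>\<^sub>P pd \<mu> \<in> G (Suc n)"
 unfolding G.simps by (rule subsetD[OF Mspan_superset]) blast

lemma G_zero_gen: "a \<in> |A| ==> ps a \<in> G 0"
 unfolding G.simps by (rule subsetD[OF Mspan_superset]) blast

lemma G_A: "y \<in> G n ==> a \<in> |A| ==> y \<otimes>\<^sub>P ps a \<in> G n"
proof -
 assume y: "y \<in> G n" and a: "a \<in> |A|"
 let ?U = "{u \<in> G n. u \<otimes>\<^sub>P ps a \<in> G n}"
 have U: "submodule ?U K P"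
  by (rule subI[OF P_simps(1)]) (use G_D1(2)[of _ n] a ps(2) G_D1(1)[of n] G_D1(3)[of n] G_D1(4)[of _ n] G_D1(5)[of _ _ n] algD(12)[OF P_alg ps(2)[OF a]] in
    \<open>auto simp: P_rules(2,4) subset_iff simp del: G.simps\<close>)
 have M: "u \<otimes>\<^sub>P pm m \<in> ?U" if "u \<in> ?U" "m \<in> |M|" for u m
 proof -
  have "u \<otimes>\<^sub>P pm m \<otimes>\<^sub>P ps a = u \<otimes>\<^sub>P pm (m \<lhd>\<^sub>M a)"
   using G_D1(2)[of u n] that a by (simp add: P_rules(1) pm ps)
  then show ?thesis using that a G_M[of u n] by simp
 qed
 have "G n \<subseteq> ?U"
 proof (cases n)
  case 0
  have "ps ` |A| \<subseteq> ?U" unfolding 0 using G_zero_gen a ps(4)[symmetric] by (auto simp del: G.simps)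
  from Mspan_least[OF U this M] show ?thesis unfolding 0 by simp
 next
  case (Suc k)
  have "z \<otimes>\<^sub>P pd \<mu> \<otimes>\<^sub>P ps a = z \<otimes>\<^sub>P pd (\<mu> \<lhd>\<^bsub>DM\<^esub> a)" if "z \<in> G k" "\<mu> \<in> |DM|" for z \<mu>
   using G_D1(2)[OF that(1)] that(2) a by (simp add: P_rules(1) pd ps)
  then have "{y \<otimes>\<^sub>P pd \<mu> | y \<mu>. y \<in> G k \<and> \<mu> \<in> |DM|} \<subseteq> ?U"
   unfolding Suc using a by (auto simp: G_DM simp del: G.simps)
  from Mspan_least[OF U this M] show ?thesis unfolding Suc by simp
 qed
 then show ?thesis using y by blast
qed

definition GX :: "nat \<Rightarrow> ('k, 'a, ('k, 'a, 'm) prep_elt) rmodule" where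
 "GX n = \<lparr>carrier = G n, mult = mult P, one = one P, zero = zero P, add = add P, smult = smult P,
   ract = (\<lambda>y a. y \<otimes>\<^sub>P ps a)\<rparr>"

abbreviation gM where "gM \<equiv> \<lambda>y m. y \<otimes>\<^sub>P pm m"
abbreviation gD where "gD \<equiv> \<lambda>y \<mu>. y \<otimes>\<^sub>P pd \<mu>"

lemma GX_sels [simp]: "|GX n| = G n" "add (GX n) = add P" "zero (GX n) = zero P" "smult (GX n) = smult P"
 "y \<lhd>\<^bsub>GX n\<^esub> a = y \<otimes>\<^sub>P ps a"
 by (simp_all add: GX_def)

lemma GX_lsum: "lsum (GX n) = lsum P"
 by (simp add: lsum_def fun_eq_iff)

lemma GX_rmod: "right_module K A (GX n)"
proof (rule rmodI[OF A_alg])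
 show "vspace (GX n)"
  by (rule vs_image[OF vs_sub[OF P_simps(1) G_sub[of n]], where q = "\<lambda>x. x"]) simp_all
qed (use G_D1(2)[of _ n] G_A[of _ n] in \<open>simp_all add: P_rules ps klinD(4,5)[OF ps(1)]\<close>)

lemmas GX_vs = rmodD(2)[OF GX_rmod]

text \<open>
 Linear maps on \<open>G n\<close> that are compatible with \<open>M\<close> are compared on the generators of \<open>G n\<close>.
\<close>

lemma G_eq:
 assumes f: "klin (GX n) U f" and g: "klin (GX n) U g" and y: "y \<in> G n"
  and M: "\<And>u m. u \<in> G n ==> m \<in> |M| ==> f u = g u ==> f (u \<otimes>\<^sub>P pm m) = g (u \<otimes>\<^sub>P pm m)"
  and zero: "\<And>a. n = 0 ==> a \<in> |A| ==> f (ps a) = g (ps a)"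
  and Suc: "\<And>k y \<mu>. n = Suc k ==> y \<in> G k ==> \<mu> \<in> |DM| ==> f (y \<otimes>\<^sub>P pd \<mu>) = g (y \<otimes>\<^sub>P pd \<mu>)"
 shows "f y = g y"
proof -
 note k = klinD(4-6)[OF f, simplified] klinD(4-6)[OF g, simplified]
 have "f y = g y" if "G n = Mspan S" "S \<subseteq> |P|" "\<And>s. s \<in> S ==> f s = g s" for S
 proof -
  have "y \<in> Mspan S" using y that(1) by simp
  then show ?thesis using that(2) by (induction rule: Mspan_induct) (use that M in \<open>auto simp: k\<close>)
 qed
 note * = this
 show ?thesis
 proof (cases n)
  case 0
  then show ?thesis using zero by (intro *[of "ps ` |A|"] G_gens) auto
 next
  case (Suc k)
  then show ?thesis using Suc assms(6) by (intro *[OF _ G_gens(2)[of k]]) auto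
 qed
qed

lemma gM_blin: "blin A M (GX n) (GX n) gM"
 by (rule blinI; (rule klinI)?)
  (use G_D1(2)[of _ n] G_M[of _ n] in \<open>simp_all add: GX_vs P_rules pm ps klinD(4,5)[OF pm(1)]\<close>)

lemma gD_blin: "blin A DM (GX n) (GX (Suc n)) gD"
 by (rule blinI; (rule klinI)?)
  (use G_D1(2)[of _ n] G_DM[of _ n] in \<open>simp_all add: GX_vs P_rules pd ps klinD(4,5)[OF pd(1)] del: G.simps\<close>)

text \<open>
 This is the relation \<open>\<rho> = \<ell>\<close>, applied to \<open>y\<close>.
\<close>

lemma GX_rel:
 assumes "y \<in> |P|"
 shows "lsum P (map (\<lambda>p. y \<otimes>\<^sub>P pm (fst p) \<otimes>\<^sub>P pd (snd p)) rs) = lsum P (map (\<lambda>q. y \<otimes>\<^sub>P pd (fst q) \<otimes>\<^sub>P pm (snd q)) ls)"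
proof -
 note k = alg_klin(2)[OF P_alg assms]
 have "lsum P (map (\<lambda>p. y \<otimes>\<^sub>P pm (fst p) \<otimes>\<^sub>P pd (snd p)) rs) = lsum P (map (\<lambda>p. y \<otimes>\<^sub>P (pm (fst p) \<otimes>\<^sub>P pd (snd p))) rs)"
  by (rule lsum_cong) (simp add: P_rules(1) assms pm pd)
 also have "\<dots> = y \<otimes>\<^sub>P lsum P (map (\<lambda>p. pm (fst p) \<otimes>\<^sub>P pd (snd p)) rs)"
  by (rule lsum_klin[OF k, symmetric]) (simp add: pm pd)
 also have "\<dots> = y \<otimes>\<^sub>P lsum P (map (\<lambda>q. pd (fst q) \<otimes>\<^sub>P pm (snd q)) ls)" by (simp only: P_rel)
 also have "\<dots> = lsum P (map (\<lambda>q. y \<otimes>\<^sub>P (pd (fst q) \<otimes>\<^sub>P pm (snd q))) ls)"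
  by (rule lsum_klin[OF k]) (simp add: pm pd)
 also have "\<dots> = lsum P (map (\<lambda>q. y \<otimes>\<^sub>P pd (fst q) \<otimes>\<^sub>P pm (snd q)) ls)"
  by (rule lsum_cong) (simp add: P_rules(1) assms pm pd)
 finally show ?thesis .
qed

subsection \<open>Universal properties of the homogeneous parts\<close>

text \<open>\<open>G 0\<close> is free on \<open>1\<close>: let \<open>DM\<close> act by zero.\<close>

lemma G_zero_hom:
 fixes Z :: "('k, 'a, 'z) rmodule"
 assumes Z: "right_module K A Z" and aZ: "blin A M Z Z aZ" and w: "w \<in> |Z|"
 obtains \<omega> where "klin P Z \<omega>" "\<omega> \<one>\<^sub>P = w"
  "\<And>b a. b \<in> |P| ==> a \<in> |A| ==> \<omega> (b \<otimes>\<^sub>P ps a) = \<omega> b \<lhd>\<^sub>Z a"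
  "\<And>b m. b \<in> |P| ==> m \<in> |M| ==> \<omega> (b \<otimes>\<^sub>P pm m) = aZ (\<omega> b) m"
proof -
 note Zv = rmodD(2)[OF Z]
 have rel: "lsum Z (map (\<lambda>p. \<zero>\<^sub>Z) rs) = lsum Z (map (\<lambda>q. aZ \<zero>\<^sub>Z (snd q)) ls)"
  using Zv klinD(6)[OF blinD(1)[OF aZ]] by (simp add: lsum_zero)
 obtain R where R: "right_module K P (with_ract Z R)"
  "\<And>x a. x \<in> |Z| ==> a \<in> |A| ==> R x (ps a) = x \<lhd>\<^sub>Z a"
  "\<And>x m. x \<in> |Z| ==> m \<in> |M| ==> R x (pm m) = aZ x m"
  by (rule preprojective_module[OF Z aZ blin_zero[OF Zv Z DM_bimodule] rel]) (rule that, assumption+)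
 note r = rmodD[OF R(1), simplified]
 show ?thesis
 proof (rule that[of "R w"])
  show "klin P Z (R w)" using rmod_klin(2)[OF R(1), of w] w by (simp add: klin_def with_ract_vs)
 qed (use w r R in \<open>simp_all add: ps pm\<close>)
qed

text \<open>
 \<open>G (n + 1) = G n \<otimes>\<^sub>A DM \<otimes>\<^sub>A \<Lambda>\<close> modulo the relation.  To extend \<open>\<theta>\<close>, let \<open>\<Pi>\<close> act on sequences in
 \<open>G 0, G 1, \<dots>\<close>, on which \<open>DM\<close> shifts, together with an element of \<open>Z\<close> fed by \<open>\<theta>\<close> from position
 \<open>n\<close>, and let it act on \<open>1\<close> in position \<open>0\<close>.
\<close>

lemma G_Suc_hom:
 fixes Z :: "('k, 'a, 'z) rmodule"
 assumes Z: "right_module K A Z" and aZ: "blin A M Z Z aZ" and \<theta>: "blin A DM (GX n) Z \<theta>"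
  and rel: "\<And>y. y \<in> G n ==> lsum Z (map (\<lambda>p. \<theta> (gM y (fst p)) (snd p)) rs)
   = lsum Z (map (\<lambda>q. aZ (\<theta> y (fst q)) (snd q)) ls)"
 obtains \<omega> where "klin P Z \<omega>"
  "\<And>b a. b \<in> |P| ==> a \<in> |A| ==> \<omega> (b \<otimes>\<^sub>P ps a) = \<omega> b \<lhd>\<^sub>Z a"
  "\<And>b m. b \<in> |P| ==> m \<in> |M| ==> \<omega> (b \<otimes>\<^sub>P pm m) = aZ (\<omega> b) m"
  "\<And>y \<mu>. y \<in> G n ==> \<mu> \<in> |DM| ==> \<omega> (y \<otimes>\<^sub>P pd \<mu>) = \<theta> y \<mu>"
proof -
 note z = rmodD[OF Z] and Zv = rmodD(2)[OF Z]
 define E :: "('k, 'a, (nat \<Rightarrow> ('k, 'a, 'm) prep_elt) \<times> 'z) rmodule" where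
  "E = \<lparr>carrier = {f. \<forall>k. f k \<in> G k} \<times> |Z|, mult = undefined, one = undefined,
   zero = (\<lambda>k. \<zero>\<^sub>P, \<zero>\<^sub>Z), add = (\<lambda>x y. (\<lambda>k. fst x k \<oplus>\<^sub>P fst y k, snd x \<oplus>\<^sub>Z snd y)),
   smult = (\<lambda>c x. (\<lambda>k. c \<odot>\<^sub>P fst x k, c \<odot>\<^sub>Z snd x)),
   ract = (\<lambda>x a. (\<lambda>k. fst x k \<otimes>\<^sub>P ps a, snd x \<lhd>\<^sub>Z a))\<rparr>"
 have E_sels: "x \<in> |E| \<longleftrightarrow> (\<forall>k. fst x k \<in> G k) \<and> snd x \<in> |Z|" "\<zero>\<^sub>E = (\<lambda>k. \<zero>\<^sub>P, \<zero>\<^sub>Z)"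
  "x \<oplus>\<^sub>E y = (\<lambda>k. fst x k \<oplus>\<^sub>P fst y k, snd x \<oplus>\<^sub>Z snd y)" "c \<odot>\<^sub>E x = (\<lambda>k. c \<odot>\<^sub>P fst x k, c \<odot>\<^sub>Z snd x)"
  "x \<lhd>\<^sub>E a = (\<lambda>k. fst x k \<otimes>\<^sub>P ps a, snd x \<lhd>\<^sub>Z a)" for x y c a
  by (cases x; simp add: E_def)+
 have eqI: "x = y" if "\<And>k. fst x k = fst y k" "snd x = snd y" for x y :: "(nat \<Rightarrow> ('k, 'a, 'm) prep_elt) \<times> 'z"
  using that by (simp add: prod_eq_iff fun_eq_iff)
 have eqI': "x = y" if "fst x 0 = fst y 0" "\<And>k. fst x (Suc k) = fst y (Suc k)" "snd x = snd y"
  for x y :: "(nat \<Rightarrow> ('k, 'a, 'm) prep_elt) \<times> 'z"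
 proof (rule eqI[OF _ that(3)])
  show "fst x k = fst y k" for k using that(1,2) by (cases k) auto
 qed
 have GP: "f k \<in> |P|" if "f k \<in> G k" for f :: "nat \<Rightarrow> ('k, 'a, 'm) prep_elt" and k by (rule G_D1(2)[OF that])
 have Ev: "vspace E"
 proof (rule vsI)
  fix x y assume "x \<in> |E|" "y \<in> |E|"
  then show "x \<oplus>\<^sub>E y = y \<oplus>\<^sub>E x"
   by (intro eqI) (simp_all add: E_sels vs_ac(1)[OF Zv] vs_ac(1)[OF P_simps(1)] GP)
 qed ((intro eqI)?; simp add: E_sels G_D1(3-5) GP Zv P_simps(1) vs_ac(2)[OF Zv] vs_ac(2)[OF P_simps(1)]
    vs_smult[OF Zv] vs_smult[OF P_simps(1)])+
 have E: "right_module K A E"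
  by (rule rmodI[OF A_alg Ev]; (rule eqI)?; simp add: E_sels GP G_A z P_rules ps klinD(4,5)[OF ps(1)])
 have pr: "klin E P (\<lambda>x. fst x k)" "klin E Z snd" for k
  by (rule klinI; simp add: Ev Zv E_sels G_D1(2)[of _ k])+
 have zP: "\<zero>\<^sub>P \<otimes>\<^sub>P b = \<zero>\<^sub>P" if "b \<in> |P|" for b using algD(12)[OF P_alg that] .
 have zZ: "\<zero>\<^sub>Z \<lhd>\<^sub>Z a = \<zero>\<^sub>Z" if "a \<in> |A|" for a using klinD(6)[OF rmod_klin(1)[OF Z that]] .
 define aM where "aM = (\<lambda>x m. (\<lambda>k :: nat. fst x k \<otimes>\<^sub>P pm m, aZ (snd x) m))"
 \<comment> \<open>the shift, with the value of \<open>\<theta>\<close> at position \<open>n\<close> in the last component\<close>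
 define aD where "aD = (\<lambda>(x :: (nat \<Rightarrow> ('k, 'a, 'm) prep_elt) \<times> 'z) \<mu>. (\<lambda>k. case k of 0 \<Rightarrow> \<zero>\<^sub>P | Suc j \<Rightarrow> fst x j \<otimes>\<^sub>P pd \<mu>, \<theta> (fst x n) \<mu>))"
 have aM_sels: "fst (aM x m) k = fst x k \<otimes>\<^sub>P pm m" "snd (aM x m) = aZ (snd x) m" for x m k
  by (simp_all add: aM_def)
 have aD_sels: "fst (aD x \<mu>) 0 = \<zero>\<^sub>P" "fst (aD x \<mu>) (Suc j) = fst x j \<otimes>\<^sub>P pd \<mu>" "snd (aD x \<mu>) = \<theta> (fst x n) \<mu>"
  for x \<mu> j by (simp_all add: aD_def)
 note az = klinD(4,5,6)[OF blinD(1)[OF aZ]] klinD(4,5)[OF blinD(2)[OF aZ]] blinD(3-5)[OF aZ]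
 note th = klinD(4,5,6)[OF blinD(1)[OF \<theta>], simplified] klinD(4,5)[OF blinD(2)[OF \<theta>], simplified]
  blinD(3-5)[OF \<theta>, simplified]
 note ex = GP pm(2) pd(2) ps(2) P_rules
 have ext: "fst (x \<oplus>\<^sub>E y) k = fst x k \<oplus>\<^sub>P fst y k" "snd (x \<oplus>\<^sub>E y) = snd x \<oplus>\<^sub>Z snd y"
  "fst (c \<odot>\<^sub>E x) k = c \<odot>\<^sub>P fst x k" "snd (c \<odot>\<^sub>E x) = c \<odot>\<^sub>Z snd x"
  "fst (x \<lhd>\<^sub>E a) k = fst x k \<otimes>\<^sub>P ps a" "snd (x \<lhd>\<^sub>E a) = snd x \<lhd>\<^sub>Z a" for x y c a k
  by (simp_all add: E_sels)
 have mem: "fst x k \<in> G k" "snd x \<in> |Z|" if "x \<in> |E|" for x k using that by (simp_all add: E_sels(1))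
 have aM_c: "aM x m \<in> |E|" if "x \<in> |E|" "m \<in> |M|" for x m
  using that by (simp add: aM_sels E_sels(1) G_M az)
 have aD_c: "aD x \<mu> \<in> |E|" if "x \<in> |E|" "\<mu> \<in> |DM|" for x \<mu>
 proof -
  have "fst (aD x \<mu>) k \<in> G k" for k
   using that G_D1(3)[of 0] G_DM[of "fst x (k - 1)" "k - 1" \<mu>] mem(1)[OF that(1)]
   by (cases k) (simp_all add: aD_sels del: G.simps)
  then show ?thesis using th(8)[OF mem(1)[OF that(1)] that(2)] by (simp add: E_sels(1) aD_sels)
 qed
 have aM: "blin A M E E aM"
 proof (rule blinI)
  show "klin E E (\<lambda>x. aM x m)" if m: "m \<in> |M|" for m
   by (rule klinI[OF Ev Ev aM_c[OF _ m]]; (rule eqI)?; (assumption | simp add: m aM_sels ext ex mem az))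

  show "klin M E (aM x)" if x: "x \<in> |E|" for x
   by (rule klinI[OF M_simps(1) Ev aM_c[OF x]]; (rule eqI)?; (assumption | simp add: x aM_sels ext ex mem az klinD(4,5)[OF pm(1)]))

 qed (rule eqI; simp add: aM_sels ext ex mem az pm(3,4))+
 have aD: "blin A DM E E aD"
 proof (rule blinI)
  show "klin E E (\<lambda>x. aD x \<mu>)" if \<mu>: "\<mu> \<in> |DM|" for \<mu>
   by (rule klinI[OF Ev Ev aD_c[OF _ \<mu>]]; (rule eqI')?; (assumption | simp add: \<mu> aD_sels ext ex mem th))

  show "klin DM E (aD x)" if x: "x \<in> |E|" for x
   by (rule klinI[OF DM_simps(1) Ev aD_c[OF x]]; (rule eqI')?; (assumption | simp add: x aD_sels ext ex mem th klinD(4,5)[OF pd(1)]))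

 qed (rule eqI'; simp add: aD_sels ext ex mem th pd(3,4) zP)+
 have relE: "lsum E (map (\<lambda>p. aD (aM x (fst p)) (snd p)) rs) = lsum E (map (\<lambda>q. aM (aD x (fst q)) (snd q)) ls)"
  if x: "x \<in> |E|" for x
 proof -
  let ?r = "lsum E (map (\<lambda>p. aD (aM x (fst p)) (snd p)) rs)"
   and ?l = "lsum E (map (\<lambda>q. aM (aD x (fst q)) (snd q)) ls)"
  have c: "\<And>p. p \<in> set rs ==> aD (aM x (fst p)) (snd p) \<in> |E|" "\<And>q. q \<in> set ls ==> aM (aD x (fst q)) (snd q) \<in> |E|"
   using x by (simp_all add: aM_c aD_c)
  have s1: "f ?r = lsum U (map (\<lambda>p. f (aD (aM x (fst p)) (snd p))) rs)"
   and s2: "f ?l = lsum U (map (\<lambda>q. f (aM (aD x (fst q)) (snd q))) ls)"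
   if "klin E U f" for U :: "('k, 'u, 'y) module_scheme" and f
   by (rule lsum_klin[OF that c(1)], assumption) (rule lsum_klin[OF that c(2)], assumption)
  show ?thesis
  proof (rule eqI')
   show "fst ?r 0 = fst ?l 0"
    unfolding s1[OF pr(1)] s2[OF pr(1)] aM_sels aD_sels
    by (rule trans[OF lsum_zero lsum_zero[symmetric]]) (simp_all add: zP pm)
   show "fst ?r (Suc k) = fst ?l (Suc k)" for k
    unfolding s1[OF pr(1)] s2[OF pr(1)] aM_sels aD_sels by (rule GX_rel[OF G_D1(2)[OF mem(1)[OF x]]])
   show "snd ?r = snd ?l"
    unfolding s1[OF pr(2)] s2[OF pr(2)] aM_sels aD_sels by (rule rel[OF mem(1)[OF x]])
  qed
 qed
 obtain R where R: "right_module K P (with_ract E R)"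
  "\<And>x a. x \<in> |E| ==> a \<in> |A| ==> R x (ps a) = x \<lhd>\<^sub>E a"
  "\<And>x m. x \<in> |E| ==> m \<in> |M| ==> R x (pm m) = aM x m"
  "\<And>x \<mu>. x \<in> |E| ==> \<mu> \<in> |DM| ==> R x (pd \<mu>) = aD x \<mu>"
  by (rule preprojective_module[OF E aM aD relE]) (assumption, rule that, assumption+)
 note r = rmodD[OF R(1), simplified]
 define \<delta> where "\<delta> = (\<lambda>k y. (\<lambda>j :: nat. if j = k then y else \<zero>\<^sub>P, \<zero>\<^sub>Z))"
 have d_sels: "fst (\<delta> k y) j = (if j = k then y else \<zero>\<^sub>P)" "snd (\<delta> k y) = \<zero>\<^sub>Z" for k y j by (simp_all add: \<delta>_def)
 have d_E: "\<delta> k y \<in> |E|" if "y \<in> G k" for k y using that G_D1(3) Zv by (simp add: E_sels(1) d_sels)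
 define x0 where "x0 = \<delta> 0 \<one>\<^sub>P"
 have "\<one>\<^sub>P \<in> G 0" using G_zero_gen[of "\<one>\<^sub>A"] ps(3) by simp
 then have x0: "x0 \<in> |E|" unfolding x0_def by (rule d_E)
 have Rk: "klin P E (R x0)" using rmod_klin(2)[OF R(1), of x0] x0 by (simp add: klin_def with_ract_vs)
 have step: "R x0 (b \<otimes>\<^sub>P ps a) = R x0 b \<lhd>\<^sub>E a" "R x0 (b \<otimes>\<^sub>P pm m) = aM (R x0 b) m" "R x0 (b \<otimes>\<^sub>P pd \<mu>) = aD (R x0 b) \<mu>"
  if "b \<in> |P|" "a \<in> |A|" "m \<in> |M|" "\<mu> \<in> |DM|" for b a m \<mu>
  using that x0 klinD(3)[OF Rk that(1)] by (simp_all add: r(6) ps pm pd R)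
 note step = step[OF _ _ M_simps(1)[THEN vs_simps(2)] DM_simps(1)[THEN vs_simps(2)]] step(2)[OF _ A_simps(2) _ DM_simps(1)[THEN vs_simps(2)]]
  step(3)[OF _ A_simps(2) M_simps(1)[THEN vs_simps(2)]]
 \<comment> \<open>up to position \<open>n\<close> nothing has reached the last component\<close>
 have key: "R x0 y = \<delta> k y" if "k \<le> n" "y \<in> G k" for k y
 proof -
  have M: "R x0 (u \<otimes>\<^sub>P pm m) = \<delta> k (u \<otimes>\<^sub>P pm m)" if "u \<in> G k" "m \<in> |M|" "R x0 u = \<delta> k u" for u m k
   unfolding step(4)[OF G_D1(2)[OF that(1)] that(2)] that(3)
   by (rule eqI) (use that in \<open>simp_all add: aM_sels d_sels zP pm az\<close>)
  have k1: "klin (GX k) E (R x0)" for k using Rk G_D1(2)[of _ k] GX_vs[of k] Ev by (auto simp: klin_def simp del: G.simps)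
  have k2: "klin (GX k) E (\<delta> k)" for k
   by (rule klinI[OF GX_vs Ev]; (rule eqI)?; use Zv G_D1(2)[of _ k] in \<open>simp add: d_E d_sels ext P_simps(1)\<close>)
  show ?thesis using that
  proof (induction k arbitrary: y)
   case 0
   show ?case
   proof (rule G_eq[OF k1 k2 0(2) M])
    fix b assume "b \<in> |A|"
    then show "R x0 (ps b) = \<delta> 0 (ps b)" unfolding R(2)[OF x0 \<open>b \<in> _\<close>] unfolding x0_def
     by (intro eqI) (simp_all add: ext d_sels zP zZ ps P_rules)
   qed simp_all
  next
   case (Suc k)
   have k: "k \<le> n" "k \<noteq> n" using Suc.prems by auto
   show ?case
   proof (rule G_eq[OF k1 k2 Suc.prems(2) M])
    fix k' w \<mu> assume "Suc k = Suc k'" and b: "w \<in> G k'" "\<mu> \<in> |DM|"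
    then have b: "w \<in> G k" "\<mu> \<in> |DM|" and k': "k' = k" by simp_all
    show "R x0 (w \<otimes>\<^sub>P pd \<mu>) = \<delta> (Suc k) (w \<otimes>\<^sub>P pd \<mu>)"
     unfolding step(5)[OF G_D1(2)[OF b(1)] b(2)] Suc.IH[OF k(1) b(1)]
     by (rule eqI') (use b k in \<open>simp_all add: aD_sels d_sels zP pd th\<close>)
   qed simp_all
  qed
 qed
 show ?thesis
 proof (rule that[of "\<lambda>b. snd (R x0 b)"])
  show "klin P Z (\<lambda>b. snd (R x0 b))" by (rule klin_comp[OF Rk pr(2)])
 next
  fix y \<mu> assume "y \<in> G n" "\<mu> \<in> |DM|"
  then show "snd (R x0 (y \<otimes>\<^sub>P pd \<mu>)) = \<theta> y \<mu>"
   by (simp add: step(5)[OF G_D1(2)] key[of n] aD_sels d_sels)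
 qed (simp_all add: step ext aM_sels)
qed

subsection \<open>Extensions and homomorphisms\<close>

text \<open>
 The extension of \<open>Z\<close> by \<open>X\<close> that a derivation \<open>D : Z \<otimes> M \<rightarrow> X\<close> defines, on the space \<open>X \<oplus> Z\<close>.
\<close>

lemma extension_blin:
 fixes X :: "('k, 'a, 'x) rmodule" and Z :: "('k, 'a, 'z) rmodule"
 assumes X: "right_module K A X" and Z: "right_module K A Z"
  and aX: "blin A M X X aX" and aZ: "blin A M Z Z aZ" and D: "blin A M Z X D"
 shows "blin A M (rprod X Z) (rprod X Z) (\<lambda>x m. (aX (fst x) m \<oplus>\<^sub>X D (snd x) m, aZ (snd x) m))"
proof (rule blinI)
 note p = rprod_proj[OF X Z]
 fix m assume m: "m \<in> |M|"
 show "klin (rprod X Z) (rprod X Z) (\<lambda>x. (aX (fst x) m \<oplus>\<^sub>X D (snd x) m, aZ (snd x) m))"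
  by (intro rprod_klin[OF X Z] klin_add klin_comp[OF p(1) blinD(1)[OF aX m]] klin_comp[OF p(2) blinD(1)[OF D m]]
    klin_comp[OF p(2) blinD(1)[OF aZ m]])
next
 fix x assume "x \<in> |rprod X Z|"
 then have x: "fst x \<in> |X|" "snd x \<in> |Z|" by auto
 show "klin M (rprod X Z) (\<lambda>m. (aX (fst x) m \<oplus>\<^sub>X D (snd x) m, aZ (snd x) m))"
  by (intro rprod_klin[OF X Z] klin_add blinD(2)[OF aX] blinD(2)[OF D] blinD(2)[OF aZ] x)
 fix a m assume "a \<in> |A|" "m \<in> |M|"
 then show "(aX (fst (x \<lhd>\<^bsub>rprod X Z\<^esub> a)) m \<oplus>\<^sub>X D (snd (x \<lhd>\<^bsub>rprod X Z\<^esub> a)) m, aZ (snd (x \<lhd>\<^bsub>rprod X Z\<^esub> a)) m)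
   = (aX (fst x) (a \<rhd>\<^sub>M m) \<oplus>\<^sub>X D (snd x) (a \<rhd>\<^sub>M m), aZ (snd x) (a \<rhd>\<^sub>M m))"
  "(aX (fst x) m \<oplus>\<^sub>X D (snd x) m, aZ (snd x) m) \<lhd>\<^bsub>rprod X Z\<^esub> a
   = (aX (fst x) (m \<lhd>\<^sub>M a) \<oplus>\<^sub>X D (snd x) (m \<lhd>\<^sub>M a), aZ (snd x) (m \<lhd>\<^sub>M a))"
  using x by (simp_all add: blinD(3-5)[OF aX] blinD(3-5)[OF D] blinD(3-5)[OF aZ] rmodD(4)[OF X])
qed

text \<open>
 A derivation \<open>D\<close> of \<open>G n\<close> in \<open>X\<close> defines an extension of \<open>G n\<close> by \<open>X\<close>, and is inner if that
 extension splits, by a map that the universal property of \<open>G n\<close> provides.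
\<close>

lemma derivation_innerI:
 fixes X :: "('k, 'a, 'x) rmodule"
 assumes X: "right_module K A X" and \<omega>: "klin P (rprod X (GX n)) \<omega>"
  "\<And>b a. b \<in> |P| ==> a \<in> |A| ==> \<omega> (b \<otimes>\<^sub>P ps a) = \<omega> b \<lhd>\<^bsub>rprod X (GX n)\<^esub> a"
  "\<And>b m. b \<in> |P| ==> m \<in> |M|
   ==> \<omega> (b \<otimes>\<^sub>P pm m) = (aX (fst (\<omega> b)) m \<oplus>\<^sub>X D (snd (\<omega> b)) m, gM (snd (\<omega> b)) m)"
  and gens: "\<And>a. n = 0 ==> a \<in> |A| ==> snd (\<omega> (ps a)) = ps a"
   "\<And>k y \<mu>. n = Suc k ==> y \<in> G k ==> \<mu> \<in> |DM| ==> snd (\<omega> (y \<otimes>\<^sub>P pd \<mu>)) = y \<otimes>\<^sub>P pd \<mu>"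
 shows "\<exists>u. alin A (GX n) X u \<and> (\<forall>z\<in>|GX n|. \<forall>m\<in>|M|. u (gM z m) = aX (u z) m \<oplus>\<^sub>X D z m)"
proof -
 note p = rprod_proj[OF X GX_rmod[of n]]
 have k: "klin (GX n) P (\<lambda>z. z)" by (rule klinI) (use G_D1(2)[of _ n] GX_vs[of n] in \<open>simp_all del: G.simps\<close>)
 have k': "klin (GX n) (GX n) (\<lambda>z. snd (\<omega> z))" by (rule klin_comp[OF klin_comp[OF k \<omega>(1)] p(2)])
 have id: "snd (\<omega> z) = z" if "z \<in> G n" for z
  by (rule G_eq[OF k' klin_id[OF GX_vs] that]) (use gens \<omega>(3) G_D1(2)[of _ n] in simp_all)
 show ?thesis
 proof (intro exI conjI ballI)
  show "alin A (GX n) X (\<lambda>z. fst (\<omega> z))" unfolding alin_def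
   using klin_comp[OF klin_comp[OF k \<omega>(1)] p(1)] \<omega>(2) G_D1(2)[of _ n] by simp
  fix z m assume "z \<in> |GX n|" "m \<in> |M|"
  then show "fst (\<omega> (gM z m)) = aX (fst (\<omega> z)) m \<oplus>\<^sub>X D z m"
   using \<omega>(3)[of z m] id[of z] G_D1(2)[of z n] by simp
 qed
qed

text \<open>
 \<open>G 0 = \<Lambda>\<close> is free, so that \<open>1 \<mapsto> (0, 1)\<close> splits the extension.
\<close>

lemma derivation_inner_zero:
 fixes X :: "('k, 'a, 'x) rmodule"
 assumes X: "right_module K A X" and aX: "blin A M X X aX" and D: "blin A M (GX 0) X D"
 shows "\<exists>u. alin A (GX 0) X u \<and> (\<forall>z\<in>|GX 0|. \<forall>m\<in>|M|. u (gM z m) = aX (u z) m \<oplus>\<^sub>X D z m)"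
proof -
 let ?E = "rprod X (GX 0)"
 note E = rprod_rmod[OF X GX_rmod[of 0]] and p = rprod_proj[OF X GX_rmod[of 0]]
 have one: "\<one>\<^sub>P \<in> G 0" using G_zero_gen[of "\<one>\<^sub>A"] ps(3) by simp
 have w: "(\<zero>\<^sub>X, \<one>\<^sub>P) \<in> |?E|" using one rmodD(2)[OF X] by simp
 obtain \<omega> where \<omega>: "klin P ?E \<omega>" "\<omega> \<one>\<^sub>P = (\<zero>\<^sub>X, \<one>\<^sub>P)"
  "\<And>b a. b \<in> |P| ==> a \<in> |A| ==> \<omega> (b \<otimes>\<^sub>P ps a) = \<omega> b \<lhd>\<^sub>?E a"
  "\<And>b m. b \<in> |P| ==> m \<in> |M| ==> \<omega> (b \<otimes>\<^sub>P pm m) = (aX (fst (\<omega> b)) m \<oplus>\<^sub>X D (snd (\<omega> b)) m, gM (snd (\<omega> b)) m)"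
  by (rule G_zero_hom[OF E extension_blin[OF X GX_rmod aX gM_blin D] w]) (rule that, assumption+)
 have "snd (\<omega> (ps a)) = ps a" if "a \<in> |A|" for a
  using \<omega>(3)[of "\<one>\<^sub>P" a] that by (simp add: ps \<omega>(2))
 then show ?thesis by (intro derivation_innerI[OF X \<omega>(1,3,4)]) simp_all
qed

text \<open>
 A splitting is given by \<open>y \<otimes> \<mu> \<mapsto> (h(y, \<mu>), y \<mu>)\<close> with \<open>h : G n \<otimes> DM \<rightarrow> X\<close>.  The relation
 prescribes the difference of the two sums formed with \<open>h\<close>, as the value \<open>c(y) = \<Sum> D(y \<nu>\<^sub>j, n\<^sub>j)\<close>; such an
 \<open>h\<close> exists as there are no maps from \<open>X\<close> to \<open>G n\<close>.
\<close>

lemma derivation_inner_Suc: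
 fixes X :: "('k, 'a, 'x) rmodule"
 assumes X: "right_module K A X" and aX: "blin A M X X aX" and D: "blin A M (GX (Suc n)) X D"
  and fd: "fin_dim K (GX n)"
  and hom0: "\<And>f x. alin A X (GX n) f ==> (\<And>x m. x \<in> |X| ==> m \<in> |M| ==> f (aX x m) = gM (f x) m) ==>
   x \<in> |X| ==> f x = \<zero>\<^bsub>GX n\<^esub>"
 shows "\<exists>u. alin A (GX (Suc n)) X u \<and>
  (\<forall>z\<in>|GX (Suc n)|. \<forall>m\<in>|M|. u (gM z m) = aX (u z) m \<oplus>\<^sub>X D z m)"
proof -
 let ?Z = "GX (Suc n)"
 let ?E = "rprod X ?Z"
 note Xv = rmodD(2)[OF X]
 note E = rprod_rmod[OF X GX_rmod[of "Suc n"]] and p = rprod_proj[OF X GX_rmod[of "Suc n"]]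
 define c where "c = (\<lambda>y. lsum X (map (\<lambda>q. D (gD y (fst q)) (snd q)) ls))"
 have gDc: "gD y \<mu> \<in> |?Z|" if "y \<in> G n" "\<mu> \<in> |DM|" for y \<mu> using G_DM[OF that] by (simp del: G.simps)
 have Dc: "D (gD y (fst q)) (snd q) \<in> |X|" if "y \<in> G n" "q \<in> set ls" for y q
  by (rule blinD(5)[OF D]) (use gDc that in simp_all)
 have c: "alin A (GX n) X c" unfolding alin_def
 proof (intro conjI ballI)
  show "klin (GX n) X c" unfolding c_def
  proof (rule klin_lsum[OF GX_vs Xv])
   fix q assume "q \<in> set ls"
   then show "klin (GX n) X (\<lambda>y. D (gD y (fst q)) (snd q))"
    by (intro klin_comp[OF blinD(1)[OF gD_blin] blinD(1)[OF D]]) simp_all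
  qed
  fix y a assume "y \<in> |GX n|" "a \<in> |A|"
  then show "c (y \<lhd>\<^bsub>GX n\<^esub> a) = c y \<lhd>\<^sub>X a" unfolding c_def
   by (rule ell_central[OF GX_rmod GX_rmod X gD_blin D])
 qed
 obtain h where h: "blin A DM (GX n) X h"
  "\<And>y. y \<in> |GX n| ==> lsum X (map (\<lambda>p. h (gM y (fst p)) (snd p)) rs)
   = lsum X (map (\<lambda>q. aX (h y (fst q)) (snd q)) ls) \<oplus>\<^sub>X c y"
 proof (rule hom_zero_imp_surjective[OF X GX_rmod fd aX gM_blin _ c])
  show "f x = \<zero>\<^bsub>GX n\<^esub>" if "alin A X (GX n) f"
   "\<And>x m. x \<in> |X| ==> m \<in> |M| ==> f (aX x m) = gM (f x) m" "x \<in> |X|" for f x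
   by (rule hom0[OF that])
 qed (rule that, assumption+)
 define aE where "aE = (\<lambda>x m. (aX (fst x) m \<oplus>\<^sub>X D (snd x) m, gM (snd x) m))"
 have aE: "blin A M ?E ?E aE" unfolding aE_def by (rule extension_blin[OF X GX_rmod aX gM_blin D])
 define \<theta> where "\<theta> = (\<lambda>y \<mu>. (h y \<mu>, gD y \<mu>))"
 have \<theta>: "blin A DM (GX n) ?E \<theta>" unfolding \<theta>_def
 proof (rule blinI)
  fix \<mu> assume "\<mu> \<in> |DM|"
  then show "klin (GX n) ?E (\<lambda>y. (h y \<mu>, gD y \<mu>))"
   by (intro rprod_klin[OF X GX_rmod] blinD(1)[OF h(1)] blinD(1)[OF gD_blin])
 next
  fix y assume y: "y \<in> |GX n|"
  then show "klin DM ?E (\<lambda>\<mu>. (h y \<mu>, gD y \<mu>))"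
   by (intro rprod_klin[OF X GX_rmod] blinD(2)[OF h(1)] blinD(2)[OF gD_blin])
  fix a \<mu> assume "a \<in> |A|" "\<mu> \<in> |DM|"
  then show "(h (y \<lhd>\<^bsub>GX n\<^esub> a) \<mu>, gD (y \<lhd>\<^bsub>GX n\<^esub> a) \<mu>) = (h y (a \<rhd>\<^bsub>DM\<^esub> \<mu>), gD y (a \<rhd>\<^bsub>DM\<^esub> \<mu>))"
   "(h y \<mu>, gD y \<mu>) \<lhd>\<^sub>?E a = (h y (\<mu> \<lhd>\<^bsub>DM\<^esub> a), gD y (\<mu> \<lhd>\<^bsub>DM\<^esub> a))"
   using y blinD(3,4)[OF h(1)] blinD(3,4)[OF gD_blin[of n]] by simp_all
 qed
 have rel: "lsum ?E (map (\<lambda>p. \<theta> (gM y (fst p)) (snd p)) rs) = lsum ?E (map (\<lambda>q. aE (\<theta> y (fst q)) (snd q)) ls)"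
  if y: "y \<in> G n" for y
 proof (rule prod_eqI)
  let ?r = "lsum ?E (map (\<lambda>p. \<theta> (gM y (fst p)) (snd p)) rs)"
   and ?l = "lsum ?E (map (\<lambda>q. aE (\<theta> y (fst q)) (snd q)) ls)"
  have yP: "y \<in> |P|" by (rule G_D1(2)[OF y])
  have c1: "\<theta> (gM y (fst p)) (snd p) \<in> |?E|" if "p \<in> set rs" for p
   by (rule blinD(5)[OF \<theta>]) (use that y G_M in simp_all)
  have t: "\<theta> y (fst q) \<in> |?E|" if "q \<in> set ls" for q by (rule blinD(5)[OF \<theta>]) (use that y in simp_all)
  have c2: "aE (\<theta> y (fst q)) (snd q) \<in> |?E|" if "q \<in> set ls" for q
   by (rule blinD(5)[OF aE t[OF that]]) (use that in simp)
  have "fst ?r = lsum X (map (\<lambda>p. fst (\<theta> (gM y (fst p)) (snd p))) rs)"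
   by (rule lsum_klin[OF p(1) c1])
  also have "\<dots> = lsum X (map (\<lambda>q. aX (h y (fst q)) (snd q)) ls) \<oplus>\<^sub>X c y" using h(2)[of y] y by (simp add: \<theta>_def)
  also have "\<dots> = lsum X (map (\<lambda>q. aX (h y (fst q)) (snd q) \<oplus>\<^sub>X D (gD y (fst q)) (snd q)) ls)"
   unfolding c_def by (rule lsum_add[OF Xv _ Dc[OF y], symmetric])
    (use y blinD(5)[OF aX] blinD(5)[OF h(1)] in simp_all)
  also have "\<dots> = lsum X (map (\<lambda>q. fst (aE (\<theta> y (fst q)) (snd q))) ls)" by (simp add: aE_def \<theta>_def)
  also have "\<dots> = fst ?l" by (rule lsum_klin[OF p(1) c2, symmetric])
  finally show "fst ?r = fst ?l" .
  have "snd ?r = lsum ?Z (map (\<lambda>p. snd (\<theta> (gM y (fst p)) (snd p))) rs)"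
   by (rule lsum_klin[OF p(2) c1])
  also have "\<dots> = lsum ?Z (map (\<lambda>q. snd (aE (\<theta> y (fst q)) (snd q))) ls)"
   using GX_rel[OF yP] by (simp add: aE_def \<theta>_def GX_lsum)
  also have "\<dots> = snd ?l" by (rule lsum_klin[OF p(2) c2, symmetric])
  finally show "snd ?r = snd ?l" .
 qed
 obtain \<omega> where \<omega>: "klin P ?E \<omega>"
  "\<And>b a. b \<in> |P| ==> a \<in> |A| ==> \<omega> (b \<otimes>\<^sub>P ps a) = \<omega> b \<lhd>\<^sub>?E a"
  "\<And>b m. b \<in> |P| ==> m \<in> |M| ==> \<omega> (b \<otimes>\<^sub>P pm m) = aE (\<omega> b) m"
  "\<And>y \<mu>. y \<in> G n ==> \<mu> \<in> |DM| ==> \<omega> (y \<otimes>\<^sub>P pd \<mu>) = \<theta> y \<mu>"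
  by (rule G_Suc_hom[OF E aE \<theta> rel]) (assumption | rule that)+
 show ?thesis
  by (rule derivation_innerI[OF X \<omega>(1,2)]) (use \<omega>(3,4) in \<open>simp_all add: aE_def \<theta>_def\<close>)
qed

text \<open>
 A map on \<open>G (j + 1)\<close> is determined by \<open>\<theta>(x, \<mu>) = f(x \<mu>)\<close> on \<open>G j \<otimes> DM\<close>.
\<close>

lemma G_hom_zero_step:
 assumes fd: "fin_dim K (GX j)" and f: "alin A (GX (Suc j)) (GX n) f"
  and fM: "\<And>y m. y \<in> G (Suc j) ==> m \<in> |M| ==> f (gM y m) = gM (f y) m"
  and inner: "\<And>D. blin A M (GX n) (GX j) D ==> \<exists>u. alin A (GX n) (GX j) u \<and>
   (\<forall>z\<in>|GX n|. \<forall>m\<in>|M|. u (gM z m) = gM (u z) m \<oplus>\<^bsub>GX j\<^esub> D z m)"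
  and y: "y \<in> G (Suc j)"
 shows "f y = \<zero>\<^sub>P"
proof -
 note fk = alinD(1)[OF f]
 have gens: "f (gD x \<mu>) = \<zero>\<^bsub>GX n\<^esub>" if x: "x \<in> |GX j|" and \<mu>: "\<mu> \<in> |DM|" for x \<mu>
 proof (rule inner_imp_hom_zero[OF GX_rmod GX_rmod fd gM_blin gM_blin inner blin_alin[OF gD_blin f] _ x \<mu>])
  fix x assume "x \<in> |GX j|"
  then have x: "x \<in> G j" by simp
  have c1: "gD (gM x (fst p)) (snd p) \<in> |GX (Suc j)|" if "p \<in> set rs" for p
   using G_DM[OF G_M[OF x]] that by (simp del: G.simps)
  have c2: "gD x (fst q) \<in> G (Suc j)" if "q \<in> set ls" for q using G_DM[OF x] that by (simp del: G.simps)
  have c3: "gM (gD x (fst q)) (snd q) \<in> |GX (Suc j)|" if "q \<in> set ls" for q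
   using G_M[OF c2[OF that]] that by (simp del: G.simps)
  have "lsum (GX n) (map (\<lambda>p. f (gD (gM x (fst p)) (snd p))) rs) = f (lsum (GX (Suc j)) (map (\<lambda>p. gD (gM x (fst p)) (snd p)) rs))"
   by (rule lsum_klin[OF fk c1, symmetric])
  also have "\<dots> = f (lsum (GX (Suc j)) (map (\<lambda>q. gM (gD x (fst q)) (snd q)) ls))"
   using GX_rel[OF G_D1(2)[OF x]] by (simp add: GX_lsum)
  also have "\<dots> = lsum (GX n) (map (\<lambda>q. f (gM (gD x (fst q)) (snd q))) ls)" by (rule lsum_klin[OF fk c3])
  also have "\<dots> = lsum (GX n) (map (\<lambda>q. gM (f (gD x (fst q))) (snd q)) ls)"
   by (rule lsum_cong) (simp add: fM c2 del: G.simps)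
  finally show "lsum (GX n) (map (\<lambda>p. f (gD (gM x (fst p)) (snd p))) rs) = lsum (GX n) (map (\<lambda>q. gM (f (gD x (fst q))) (snd q)) ls)" .
 qed
 have zM: "\<zero>\<^sub>P \<otimes>\<^sub>P pm m = \<zero>\<^sub>P" if "m \<in> |M|" for m using algD(12)[OF P_alg pm(2)[OF that]] .
 have "f y = \<zero>\<^bsub>GX n\<^esub>"
  by (rule G_eq[OF fk klin_zero[OF GX_vs GX_vs] y]) (use gens fM zM in \<open>simp_all del: G.simps\<close>)
 then show ?thesis by simp
qed

text \<open>
 There are no nonzero maps from \<open>\<tau>\<^sup>-\<^sup>m \<Lambda>\<close> to \<open>\<tau>\<^sup>-\<^sup>n \<Lambda>\<close> for \<open>m > n\<close>: by the Auslander-Reiten formula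
 they are dual to the extensions of \<open>\<tau>\<^sup>-\<^sup>n \<Lambda>\<close> by \<open>\<tau>\<^sup>-\<^sup>m\<^sup>+\<^sup>1 \<Lambda>\<close>, which vanish for \<open>n = 0\<close> since \<open>\<Lambda>\<close> is
 projective, and otherwise because there are no maps from \<open>\<tau>\<^sup>-\<^sup>m\<^sup>+\<^sup>1 \<Lambda>\<close> to \<open>\<tau>\<^sup>-\<^sup>n\<^sup>+\<^sup>1 \<Lambda>\<close>.
\<close>

lemma G_hom_zero:
 assumes fd: "\<And>n. fin_dim K (GX n)"
  and f: "alin A (GX k) (GX n) f" "\<And>y m. y \<in> G k ==> m \<in> |M| ==> f (gM y m) = gM (f y) m"
  and "n < k" and "y \<in> G k"
 shows "f y = \<zero>\<^sub>P"
 using f assms(4,5)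
proof (induction n arbitrary: k f y)
 case (0 k f y)
 then obtain j where k: "k = Suc j" by (cases k) auto
 show ?case
  by (rule G_hom_zero_step[OF fd 0(1)[unfolded k] _ derivation_inner_zero[OF GX_rmod gM_blin]])
   (use 0(2,4) k in \<open>simp_all del: G.simps\<close>)
next
 case (Suc n k f y)
 then obtain j where k: "k = Suc j" by (cases k) auto
 then have nj: "n < j" using Suc.prems(3) by simp
 have hom0: "g x = \<zero>\<^bsub>GX n\<^esub>" if "alin A (GX j) (GX n) g"
  "\<And>x m. x \<in> |GX j| ==> m \<in> |M| ==> g (gM x m) = gM (g x) m" "x \<in> |GX j|" for g x
  using Suc.IH[OF that(1) _ nj] that(2,3) by simp
 show ?case
 proof (rule G_hom_zero_step[OF fd Suc.prems(1)[unfolded k]])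
  fix D assume D: "blin A M (GX (Suc n)) (GX j) D"
  show "\<exists>u. alin A (GX (Suc n)) (GX j) u \<and>
   (\<forall>z\<in>|GX (Suc n)|. \<forall>m\<in>|M|. u (gM z m) = gM (u z) m \<oplus>\<^bsub>GX j\<^esub> D z m)"
  proof (rule derivation_inner_Suc[OF GX_rmod gM_blin D fd])
   show "g x = \<zero>\<^bsub>GX n\<^esub>" if "alin A (GX j) (GX n) g"
    "\<And>x m. x \<in> |GX j| ==> m \<in> |M| ==> g (gM x m) = gM (g x) m" "x \<in> |GX j|" for g x
    by (rule hom0[OF that])
  qed
 qed (use Suc.prems(2,4) k in \<open>simp_all del: G.simps\<close>)
qed

end

subsection \<open>Indecomposable summands\<close>

context kfield
begin

lemma alin_comp: "alin B X Y f ==> alin B Y Z g ==> alin B X Z (\<lambda>x. g (f x))"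
 unfolding alin_def using klin_comp[of X Y f Z g] klinD(3)[of X Y f] by simp

text \<open>Representation-finiteness speaks of modules in the type of coordinate vectors.\<close>

lemma coordinate_copy:
 fixes X :: "('k, 'b, 'x) rmodule"
 assumes X: "right_module K B X" and fd: "fin_dim K X"
 obtains U :: "('k, 'b, nat \<Rightarrow> 'k) rmodule" and q j where "right_module K B U" "alin B X U q" "alin B U X j"
  "\<And>x. x \<in> |X| ==> j (q x) = x" "\<And>u. u \<in> |U| ==> q (j u) = u"
proof -
 note Xv = rmodD(2)[OF X]
 obtain bs where bs: "set bs \<subseteq> |X| \<times> linear_forms K X"
  "\<And>v. v \<in> |X| ==> v = lsum X (map (\<lambda>(b, \<phi>). \<phi> v \<odot>\<^sub>X b) bs)"
  using fin_dim_coordinates[OF Xv fd] by blast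
 define q where "q = (\<lambda>x i. if i < length bs then snd (bs ! i) x else \<zero>)"
 have form: "snd (bs ! i) \<in> linear_forms K X" if "i < length bs" for i using bs(1) nth_mem[OF that] by auto
 have inj: "inj_on q |X|"
 proof (rule inj_onI)
  fix x y assume xy: "x \<in> |X|" "y \<in> |X|" and e: "q x = q y"
  have "snd p x = snd p y" if p: "p \<in> set bs" for p
  proof -
   obtain i where "i < length bs" "bs ! i = p" using p by (auto simp: in_set_conv_nth)
   then show ?thesis using fun_cong[OF e, of i] by (simp add: q_def)
  qed
  then have "lsum X (map (\<lambda>(b, \<phi>). \<phi> x \<odot>\<^sub>X b) bs) = lsum X (map (\<lambda>(b, \<phi>). \<phi> y \<odot>\<^sub>X b) bs)"
   by (intro lsum_cong) (simp add: case_prod_beta')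
  from trans[OF bs(2)[OF xy(1)] this] show "x = y" unfolding bs(2)[OF xy(2), symmetric] .
 qed
 define j where "j = the_inv_into |X| q"
 have jq: "j (q x) = x" if "x \<in> |X|" for x unfolding j_def by (rule the_inv_into_f_f[OF inj that])
 define U :: "('k, 'b, nat \<Rightarrow> 'k) rmodule" where
  "U = \<lparr>carrier = q ` |X|, mult = undefined, one = undefined, zero = (\<lambda>i. \<zero>), add = (\<lambda>f g i. f i \<oplus> g i),
    smult = (\<lambda>c f i. c \<otimes> f i), ract = (\<lambda>f b. q (j f \<lhd>\<^sub>X b))\<rparr>"
 have s: "|U| = q ` |X|" "q x \<oplus>\<^sub>U q y = q (x \<oplus>\<^sub>X y)" "c \<odot>\<^sub>U q x = q (c \<odot>\<^sub>X x)"
  "\<zero>\<^sub>U = q \<zero>\<^sub>X" "q x \<lhd>\<^sub>U b = q (x \<lhd>\<^sub>X b)"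
  if "x \<in> |X|" "y \<in> |X|" "c \<in> |K|" for x y c b
  using that by (auto simp: U_def q_def fun_eq_iff formD[OF form] form_zero[OF form Xv] jq[unfolded q_def])
 note z = vs_simps(2)[OF Xv]
 have U: "right_module K B U"
  by (rule rmod_image[OF X s(1)[OF z z K.zero_closed]]) (simp_all add: s[OF _ z K.zero_closed] s(2)[OF _ _ K.zero_closed] s(3)[OF _ z] s(4)[OF z z K.zero_closed])
 have q: "alin B X U q" unfolding alin_def
  using s Xv rmodD(2)[OF U] by (intro conjI klinI) (simp_all add: s[OF _ z K.zero_closed] s(2)[OF _ _ K.zero_closed] s(3)[OF _ z])
 have "alin B U X j" unfolding alin_def
 proof (intro conjI klinI ballI)
  show "vspace U" by (rule rmodD(2)[OF U])
 qed (auto simp: Xv jq s(1)[OF z z K.zero_closed] s(5)[OF _ z K.zero_closed] s(2)[OF _ _ K.zero_closed] s(3)[OF _ z] rmodD(3)[OF X])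
 from that[OF U q this jq] show ?thesis using jq s(1)[OF z z K.zero_closed] by fastforce
qed

text \<open>A nonzero summand that needs the least number of generators as a vector space is indecomposable.\<close>

lemma indecomposable_summand:
 fixes X :: "('k, 'b, 'x) rmodule"
 assumes "spanned X n" and "right_module K B X" and "|X| \<noteq> {\<zero>\<^sub>X}"
 shows "\<exists>Z p. sub Z X \<and> right_module K B (X\<lparr>carrier := Z\<rparr>) \<and> indecomposable K B (X\<lparr>carrier := Z\<rparr>) \<and>
  alin B X (X\<lparr>carrier := Z\<rparr>) p \<and> (\<forall>z\<in>Z. p z = z)"
 using assms
proof (induction n arbitrary: X rule: less_induct)
 case (less n)
 note X = less.prems(2) and Xv = rmodD(2)[OF less.prems(2)]
 show ?case
 proof (cases "indecomposable K B X")
  case True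
  then show ?thesis using X Xv
   by (intro exI[of _ "|X|"] exI[of _ "\<lambda>x. x"]) (simp add: sub_carrier alin_def klin_id)
 next
  case False
  then obtain U W where UW: "right_submodule K B X U" "right_submodule K B X W" "U \<inter> W = {\<zero>\<^sub>X}"
   "U <+>\<^bsub>X\<^esub> W = |X|" "U \<noteq> {\<zero>\<^sub>X}" "W \<noteq> {\<zero>\<^sub>X}"
   using less.prems(3) unfolding indecomposable_def by blast
  have U: "sub U X" "\<And>u b. u \<in> U ==> b \<in> |B| ==> u \<lhd>\<^sub>X b \<in> U"
   and W: "sub W X" "\<And>u b. u \<in> W ==> b \<in> |B| ==> u \<lhd>\<^sub>X b \<in> W"
   using UW(1,2) unfolding right_submodule_def by auto
  note u = subD[OF U(1) Xv] and w = subD[OF W(1) Xv]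
  let ?U = "X\<lparr>carrier := U\<rparr>"
  have UX: "right_module K B ?U" by (rule rmod_sub[OF X U])
  have dec: "\<exists>y\<in>U. \<exists>z\<in>W. x = y \<oplus>\<^sub>X z" if "x \<in> |X|" for x
  proof -
   have "x \<in> U <+>\<^bsub>X\<^esub> W" using that UW(4) by simp
   then show ?thesis unfolding set_add_def set_mult_def by auto
  qed
  have uniq: "y = y'" if "y \<in> U" "z \<in> W" "y' \<in> U" "z' \<in> W" and e: "y \<oplus>\<^sub>X z = y' \<oplus>\<^sub>X z'" for y z y' z'
  proof -
   note c = u(2)[OF that(1)] w(2)[OF that(2)] u(2)[OF that(3)] w(2)[OF that(4)]
   have "y \<oplus>\<^sub>X z = (y' \<oplus>\<^sub>X z') \<ominus>\<^sub>X z \<oplus>\<^sub>X z" using c Xv e by (simp add: vs_minus_add_cancel)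
   then have "y = (y' \<oplus>\<^sub>X z') \<ominus>\<^sub>X z" using c Xv by (simp add: vs_add_cancel)
   also have "\<dots> = y' \<oplus>\<^sub>X (z' \<ominus>\<^sub>X z)" using c Xv by (simp add: a_minus_def vs_ac(2))
   finally have "y \<ominus>\<^sub>X y' = z' \<ominus>\<^sub>X z" using c Xv by (simp add: vs_minus_iff vs_ac(1))
   then have "y \<ominus>\<^sub>X y' \<in> U \<inter> W" using u(6)[OF that(1,3)] w(6)[OF that(4,2)] by simp
   then show ?thesis using UW(3) c Xv by (simp add: vs_minus_zero_iff)
  qed
  define p where "p = (\<lambda>x. THE y. y \<in> U \<and> (\<exists>z\<in>W. x = y \<oplus>\<^sub>X z))"
  have p: "p (y \<oplus>\<^sub>X z) = y" if "y \<in> U" "z \<in> W" for y z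
   unfolding p_def using that uniq by (intro the_equality) blast+
  have plin: "alin B X ?U p" unfolding alin_def
  proof (intro conjI klinI ballI)
   fix x assume "x \<in> |X|"
   then obtain y z where x: "y \<in> U" "z \<in> W" "x = y \<oplus>\<^sub>X z" using dec by blast
   note c = u(2)[OF x(1)] w(2)[OF x(2)]
   show "p x \<in> |?U|" using p x by simp
   show "p (c \<odot>\<^sub>X x) = c \<odot>\<^sub>?U p x" if "c \<in> |K|" for c
    using p[OF u(5)[OF that x(1)] w(5)[OF that x(2)]] p[OF x(1,2)] x(3) c that Xv by (simp add: vs_smult(1))
   show "p (x \<lhd>\<^sub>X b) = p x \<lhd>\<^sub>?U b" if "b \<in> |B|" for b
    using p[OF U(2)[OF x(1) that] W(2)[OF x(2) that]] p[OF x(1,2)] x(3) c that by (simp add: rmodD(4)[OF X])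
   fix x' assume "x' \<in> |X|"
   then obtain y' z' where x': "y' \<in> U" "z' \<in> W" "x' = y' \<oplus>\<^sub>X z'" using dec by blast
   have "x \<oplus>\<^sub>X x' = (y \<oplus>\<^sub>X y') \<oplus>\<^sub>X (z \<oplus>\<^sub>X z')"
    unfolding x(3) x'(3) using c u(2)[OF x'(1)] w(2)[OF x'(2)] Xv by (simp add: vs_ac)
   then show "p (x \<oplus>\<^sub>X x') = p x \<oplus>\<^sub>?U p x'"
    using p[OF u(4)[OF x(1) x'(1)] w(4)[OF x(2) x'(2)]] p[OF x(1,2)] p[OF x'(1,2)] x(3) x'(3) by simp
  qed (use Xv rmodD(2)[OF UX] in auto)
  have pU: "p y = y" if "y \<in> U" for y using p[OF that w(3)] u(2)[OF that] Xv by simp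
  obtain v where v: "v \<in> W" "v \<noteq> \<zero>\<^sub>X" using UW(6) w(3) by blast
  have "p v = \<zero>\<^sub>?U" using p[OF u(3) v(1)] w(2)[OF v(1)] Xv by simp
  moreover have "p ` |X| = |?U|"
   using pU alinD(2)[OF plin] u(2) by (auto simp: image_iff) metis
  ultimately obtain m where m: "m < n" "spanned ?U m"
   using spanned_image_drop[OF alinD(1)[OF plin] less.prems(1) _ w(2)[OF v(1)] v(2)] by blast
  have "|?U| \<noteq> {\<zero>\<^sub>?U}" using UW(5) by simp
  from less.IH[OF m UX this] obtain Z r where Z: "sub Z ?U" "right_module K B (?U\<lparr>carrier := Z\<rparr>)"
   "indecomposable K B (?U\<lparr>carrier := Z\<rparr>)" "alin B ?U (?U\<lparr>carrier := Z\<rparr>) r" "\<forall>z\<in>Z. r z = z" by blast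
  have eq: "?U\<lparr>carrier := Z\<rparr> = X\<lparr>carrier := Z\<rparr>" by simp
  have ZU: "Z \<subseteq> U" using subD(1)[OF Z(1) rmodD(2)[OF UX]] by simp
  have "sub Z X" by (rule subI[OF Xv]) (use ZU u(1) subD[OF Z(1) rmodD(2)[OF UX]] in auto)
  moreover have "\<forall>z\<in>Z. r (p z) = z" using Z(5) pU ZU by auto
  ultimately show ?thesis using alin_comp[OF plin Z(4)] Z(2,3) unfolding eq by blast
 qed
qed

text \<open>
 Finite dimensional modules have a summand on the list \<open>\<F>\<close> of indecomposables; as nothing is known
 about the members of \<open>\<F>\<close>, the retraction is described by additivity and compatibility with the action.
\<close>

definition act_hom where
 "act_hom B X Y f \<longleftrightarrow> (\<forall>x\<in>|X|. f x \<in> |Y| ) \<and>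
  (\<forall>x\<in>|X|. \<forall>y\<in>|X|. f (x \<oplus>\<^sub>X y) = f x \<oplus>\<^sub>Y f y) \<and>
  (\<forall>x\<in>|X|. \<forall>b\<in>|B|. f (x \<lhd>\<^sub>X b) = f x \<lhd>\<^sub>Y b)"

lemma alin_act_hom: "alin B X Y f ==> act_hom B X Y f"
 unfolding act_hom_def alin_def using klinD(3,4)[of X Y f] by simp

lemma act_hom_comp: "act_hom B X Y f ==> act_hom B Y Z g ==> act_hom B X Z (\<lambda>x. g (f x))"
 unfolding act_hom_def by simp

text \<open>
 Scalars act through the algebra, hence additive maps that commute with it are \<open>K\<close>-linear.
\<close>

lemma act_hom_alin:
 fixes X :: "('k, 'b, 'x, 's) rmodule_scheme" and Y :: "('k, 'b, 'y, 't) rmodule_scheme"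
 assumes X: "right_module K B X" and Y: "right_module K B Y" and f: "act_hom B X Y f"
 shows "alin B X Y f"
proof -
 note h = f[unfolded act_hom_def]
 note B = algD[OF rmodD(1)[OF X]]
 have sm: "c \<odot>\<^sub>Z z = z \<lhd>\<^sub>Z (c \<odot>\<^sub>B \<one>\<^sub>B)"
  if "right_module K B Z" "c \<in> |K|" "z \<in> |Z|" for Z :: "('k, 'b, 'z, 'u) rmodule_scheme" and c z
  using rmodD(7,9)[OF that(1)] that(2,3) B(2) by simp
 have "f (c \<odot>\<^sub>X x) = c \<odot>\<^sub>Y f x" if "c \<in> |K|" "x \<in> |X|" for c x
  using sm[OF X that] sm[OF Y that(1), of "f x"] h that B by simp
 then show ?thesis unfolding alin_def using h rmodD(2)[OF X] rmodD(2)[OF Y] by (intro conjI klinI) simp_all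
qed

lemma listed_summand:
 fixes X :: "('k, 'b, 'x) rmodule" and \<F> :: "('k, 'b, nat \<Rightarrow> 'k) rmodule set"
 assumes X: "right_module K B X" and fd: "fin_dim K X" and nz: "|X| \<noteq> {\<zero>\<^sub>X}"
  and \<F>: "\<And>X :: ('k, 'b, nat \<Rightarrow> 'k) rmodule. right_module K B X ==> fin_dim K X ==> indecomposable K B X
   ==> \<exists>Y\<in>\<F>. rmod_iso B X Y \<noteq> {}"
 shows "\<exists>Y\<in>\<F>. \<exists>p i. act_hom B X Y p \<and> act_hom B Y X i \<and> (\<forall>y\<in>|Y|. p (i y) = y) \<and>
  (\<exists>y\<in>|Y|. i y \<noteq> \<zero>\<^sub>X)"
proof -
 obtain U :: "('k, 'b, nat \<Rightarrow> 'k) rmodule" and q j where U: "right_module K B U" "alin B X U q" "alin B U X j"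
  "\<And>x. x \<in> |X| ==> j (q x) = x" "\<And>u. u \<in> |U| ==> q (j u) = u"
  using coordinate_copy[OF X fd] by blast
 have "q ` |X| = |U|" using alinD(2)[OF U(2)] alinD(2)[OF U(3)] U(5) by (auto simp: image_iff) metis
 then have fdU: "fin_dim K U" by (rule fin_dim_image[OF alinD(1)[OF U(2)] fd])
 obtain x where x: "x \<in> |X|" "x \<noteq> \<zero>\<^sub>X" using nz vs_simps(2)[OF rmodD(2)[OF X]] by blast
 have "q x \<noteq> \<zero>\<^sub>U" using U(4)[OF x(1)] x(2) klinD(6)[OF alinD(1)[OF U(3)]] by metis
 then have "|U| \<noteq> {\<zero>\<^sub>U}" using alinD(2)[OF U(2) x(1)] by auto
 then obtain Z r where Z: "sub Z U" "right_module K B (U\<lparr>carrier := Z\<rparr>)" "indecomposable K B (U\<lparr>carrier := Z\<rparr>)"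
  "alin B U (U\<lparr>carrier := Z\<rparr>) r" "\<forall>z\<in>Z. r z = z"
  using indecomposable_summand[OF _ U(1)] fdU unfolding fin_dim_spanned by metis
 let ?Z = "U\<lparr>carrier := Z\<rparr>"
 have ZU: "z \<in> |U|" if "z \<in> Z" for z using subD(2)[OF Z(1) rmodD(2)[OF U(1)] that] .
 have "r ` |U| = |?Z|" using alinD(2)[OF Z(4)] Z(5) ZU by (auto simp: image_iff) metis
 then have "fin_dim K ?Z" by (rule fin_dim_image[OF alinD(1)[OF Z(4)] fdU])
 then obtain Y h where Y: "Y \<in> \<F>" and h: "h \<in> rmod_iso B ?Z Y" using \<F>[OF Z(2) _ Z(3)] by blast
 have h': "act_hom B ?Z Y h" and bij: "bij_betw h Z |Y|"
  using h unfolding rmod_iso_def rmod_hom_def act_hom_def by auto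
 define g where "g = the_inv_into Z h"
 have gh: "g (h z) = z" if "z \<in> Z" for z
  unfolding g_def by (rule the_inv_into_f_f[OF bij_betw_imp_inj_on[OF bij] that])
 have surj: "\<exists>z\<in>Z. y = h z" if "y \<in> |Y|" for y using bij that unfolding bij_betw_def by auto
 have hs: "h z \<oplus>\<^sub>Y h z' = h (z \<oplus>\<^sub>U z')" "h z \<lhd>\<^sub>Y b = h (z \<lhd>\<^sub>U b)"
  if "z \<in> Z" "z' \<in> Z" "b \<in> |B|" for z z' b using h' that unfolding act_hom_def by simp_all
 note cl = subD(4)[OF Z(1) rmodD(2)[OF U(1)]] rmodD(3)[OF Z(2), simplified]
 have g: "act_hom B Y ?Z g" unfolding act_hom_def
 proof (intro conjI ballI)
  fix y assume "y \<in> |Y|"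
  then obtain z where z: "z \<in> Z" "y = h z" using surj by blast
  then show "g y \<in> |?Z|" by (simp add: gh)
  show "g (y \<lhd>\<^sub>Y b) = g y \<lhd>\<^sub>?Z b" if "b \<in> |B|" for b
   using z hs(2)[OF z(1) z(1) that] gh cl(2)[OF z(1) that] by simp
  fix y' assume "y' \<in> |Y|"
  then obtain z' where z': "z' \<in> Z" "y' = h z'" using surj by blast
  have "h z \<oplus>\<^sub>Y h z' = h (z \<oplus>\<^sub>U z')" using h' z z' unfolding act_hom_def by simp
  then show "g (y \<oplus>\<^sub>Y y') = g y \<oplus>\<^sub>?Z g y'" using z z' gh cl(1)[OF z(1) z'(1)] by simp
 qed
 have incl: "act_hom B ?Z U (\<lambda>z. z)" unfolding act_hom_def using ZU by simp
 note P = act_hom_comp[OF act_hom_comp[OF alin_act_hom[OF U(2)] alin_act_hom[OF Z(4)]] h']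
 note I = act_hom_comp[OF act_hom_comp[OF g incl] alin_act_hom[OF U(3)]]
 have "h (r (q (j (g y)))) = y" if y: "y \<in> |Y|" for y
 proof -
  obtain z where z: "z \<in> Z" "y = h z" using surj[OF y] by blast
  then show ?thesis using U(5)[OF ZU[OF z(1)]] Z(5) gh by simp
 qed
 moreover have "\<exists>y\<in>|Y|. j (g y) \<noteq> \<zero>\<^sub>X"
 proof -
  obtain z where z: "z \<in> Z" "z \<noteq> \<zero>\<^sub>U"
   using Z(3) subD(3)[OF Z(1) rmodD(2)[OF U(1)]] unfolding indecomposable_def by auto
  have "j z \<noteq> \<zero>\<^sub>X" using U(5)[OF ZU[OF z(1)]] z(2) klinD(6)[OF alinD(1)[OF U(2)]] by metis
  moreover have "h z \<in> |Y|" using h' z unfolding act_hom_def by simp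
  ultimately show ?thesis using gh[OF z(1)] by (intro bexI[of _ "h z"]) simp_all
 qed
 ultimately show ?thesis using Y P I by blast
qed

end

subsection \<open>Finite dimensional tensor algebras\<close>

context bimodule_data
begin

text \<open>
 \<open>A\<close> is a quotient of the tensor algebra: let \<open>V\<close> act by zero.
\<close>

lemma A_fin_dim:
 assumes fd: "fin_dim K T"
 shows "fin_dim K A"
proof -
 define X :: "('k, 'a, 'a) rmodule" where
  "X = \<lparr>carrier = |A|, mult = mult A, one = one A, zero = zero A, add = add A, smult = smult A, ract = mult A\<rparr>"
 have s: "|X| = |A|" "add X = add A" "zero X = zero A" "smult X = smult A" "ract X = mult A"
  by (simp_all add: X_def)
 have Xv: "vspace X" by (rule vs_image[OF A_simps(1), where q = "\<lambda>x. x"]) (simp_all add: s)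
 have X: "right_module K A X" by (rule rmodI[OF A_alg Xv]) (simp_all add: s A_rules)
 obtain R where R: "right_module K T (with_ract X R)"
  "\<And>x a. x \<in> |X| ==> a \<in> |A| ==> R x (ts a) = x \<lhd>\<^sub>X a"
  by (rule tensor_algebra_module[OF X blin_zero[OF Xv X V_bimodule]]) (rule that, assumption+)
 have "klin T (with_ract X R) (R \<one>\<^sub>A)" using rmod_klin(2)[OF R(1), of "\<one>\<^sub>A"] by (simp add: s)
 then have k: "klin T A (R \<one>\<^sub>A)" unfolding klin_def by (simp add: s)
 have "a \<in> R \<one>\<^sub>A ` |T|" if "a \<in> |A|" for a
  using R(2)[of "\<one>\<^sub>A" a] that by (intro image_eqI[of _ _ "ts a"]) (simp_all add: s ts)
 then have "R \<one>\<^sub>A ` |T| = |A|" using klinD(3)[OF k] by auto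
 then show ?thesis by (rule fin_dim_image[OF k fd])
qed

text \<open>
 If \<open>X\<close> is generated by \<open>S\<close> and the algebra is spanned by \<open>L\<close>, then the products \<open>s l\<close> span \<open>X\<close>.
\<close>

lemma fin_dim_generated:
 fixes X :: "('k, 'a, 'x) rmodule"
 assumes fd: "fin_dim K T" and X: "right_module K A X" and act: "blin A V X X act"
  and S: "finite S" "S \<subseteq> |X|"
  and gen: "\<And>U. sub U X ==> S \<subseteq> U ==> (\<And>u a. u \<in> U ==> a \<in> |A| ==> u \<lhd>\<^sub>X a \<in> U) ==> (
   \<And>u v. u \<in> U ==> v \<in> |V| ==> act u v \<in> U) ==> |X| \<subseteq> U"
 shows "fin_dim K X"
proof -
 note Xv = rmodD(2)[OF X]
 obtain R where R: "right_module K T (with_ract X R)"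
  "\<And>x a. x \<in> |X| ==> a \<in> |A| ==> R x (ts a) = x \<lhd>\<^sub>X a"
  "\<And>x v. x \<in> |X| ==> v \<in> |V| ==> R x (tg v) = act x v"
  by (rule tensor_algebra_module[OF X act]) (rule that, assumption+)
 note r = rmodD[OF R(1), simplified]
 have k1: "klin T X (R x)" if "x \<in> |X|" for x
  using rmod_klin(2)[OF R(1), of x] that by (simp add: klin_def with_ract_vs)
 have k2: "klin X X (\<lambda>x. R x t)" if "t \<in> |T|" for t
  using rmod_klin(1)[OF R(1) that] by (simp add: klin_def with_ract_vs)
 obtain L where L: "finite L" "L \<subseteq> |T|" "kspan K T L = |T|" using fd unfolding fin_dim_def by blast
 define S' where "S' = (\<lambda>p. R (fst p) (snd p)) ` (S \<times> L)"
 have S': "finite S'" "S' \<subseteq> |X|" using S L r(3) unfolding S'_def by (auto simp: subset_iff)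
 define U where "U = kspan K X S'"
 have U: "sub U X" unfolding U_def by (rule kspan_sub[OF Xv S'(2)])
 have SU: "R s t \<in> U" if "s \<in> S" "t \<in> |T|" for s t
 proof -
  have s: "s \<in> |X|" using S that by auto
  have "R s l \<in> U" if "l \<in> L" for l
   unfolding U_def by (rule subsetD[OF kspan_superset]) (use \<open>s \<in> S\<close> that in \<open>force simp: S'_def\<close>)
  then have "kspan K T L \<subseteq> {t \<in> |T|. R s t \<in> U}"
   using L(2) by (intro kspan_least[OF klin_preimage_sub[OF k1[OF s] U]]) auto
  then show ?thesis using that(2) L(3) by auto
 qed
 have UT: "R u t \<in> U" if u: "u \<in> U" and t: "t \<in> |T|" for u t
 proof -
  have "R x t \<in> U" if "x \<in> S'" for x
  proof -
   obtain s l where sl: "s \<in> S" "l \<in> L" "x = R s l" using \<open>x \<in> S'\<close> unfolding S'_def by auto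
   have l: "s \<in> |X|" "l \<in> |T|" using S(2) L(2) sl by auto
   show ?thesis unfolding sl(3) r(6)[OF l t, symmetric] by (rule SU[OF sl(1) algD(3)[OF T_alg l(2) t]])
  qed
  then have "U \<subseteq> {x \<in> |X|. R x t \<in> U}"
   unfolding U_def using S'(2) by (intro kspan_least[OF klin_preimage_sub[OF k2[OF t]]]) (auto simp: U_def[symmetric] U)
  then show ?thesis using u by auto
 qed
 note Uc = subD(2)[OF U Xv]
 have "|X| \<subseteq> U"
 proof (rule gen[OF U])
  show "S \<subseteq> U"
  proof
   fix s assume s: "s \<in> S"
   then show "s \<in> U" using SU[OF s algD(2)[OF T_alg]] r(7)[of s] S(2) by auto
  qed
  show "u \<lhd>\<^sub>X a \<in> U" if "u \<in> U" "a \<in> |A|" for u a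
   using UT[OF that(1) ts(4)[OF that(2)]] R(2)[OF Uc[OF that(1)] that(2)] by simp
  show "act u v \<in> U" if "u \<in> U" "v \<in> |V|" for u v
   using UT[OF that(1) tg(2)[OF that(2)]] R(3)[OF Uc[OF that(1)] that(2)] by simp
 qed
 then have "kspan K X S' = |X|" using subD(1)[OF U Xv] unfolding U_def by auto
 then show ?thesis unfolding fin_dim_def using S' by blast
qed

end

subsection \<open>Finiteness\<close>

context preprojective_data
begin

text \<open>
 \<open>G (n + 1)\<close> is generated by the products of a basis of \<open>G n\<close> with the finitely many \<open>\<mu>\<^sub>i\<close>, since
 every \<open>\<mu>\<close> is a left combination of these.
\<close>

lemma GX_fin_dim:
 assumes fd: "fin_dim K L.T"
 shows "fin_dim K (GX n)"
proof (induction n)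
 case 0
 have one: "\<one>\<^sub>P \<in> G 0" using G_zero_gen[of "\<one>\<^sub>A"] ps(3) by simp
 show ?case
 proof (rule L.fin_dim_generated[OF fd GX_rmod gM_blin, of "{\<one>\<^sub>P}"])
  fix U assume U: "submodule U K (GX 0)" "{\<one>\<^sub>P} \<subseteq> U" "\<And>u a. u \<in> U ==> a \<in> |A| ==> u \<lhd>\<^bsub>GX 0\<^esub> a \<in> U"
   "\<And>u m. u \<in> U ==> m \<in> |M| ==> gM u m \<in> U"
  note u = subD[OF U(1) GX_vs]
  have "Mspan (ps ` |A| ) \<subseteq> U"
  proof (rule Mspan_least)
   show "submodule U K P" by (rule subI[OF P_simps(1)]) (use u G_D1(1)[of 0] in auto)
   show "ps ` |A| \<subseteq> U" using U(2) U(3)[of "\<one>\<^sub>P"] ps(2) by auto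
  qed (rule U(4))
  then show "|GX 0| \<subseteq> U" by simp
 qed (use one in simp_all)
next
 case (Suc n)
 then obtain B where B: "finite B" "B \<subseteq> G n" "kspan K (GX n) B = G n" unfolding fin_dim_def by auto
 define S where "S = (\<lambda>p. gD (fst p) (snd p)) ` (B \<times> snd ` set rs)"
 show ?case
 proof (rule L.fin_dim_generated[OF fd GX_rmod gM_blin, of S])
  show "finite S" unfolding S_def using B(1) by simp
  show "S \<subseteq> |GX (Suc n)|"
  proof
   fix s assume "s \<in> S"
   then obtain b p where "b \<in> B" "p \<in> set rs" "s = gD b (snd p)" unfolding S_def by auto
   then show "s \<in> |GX (Suc n)|" using G_DM[of b n "snd p"] B(2) by (auto simp del: G.simps)
  qed
  fix U assume U: "submodule U K (GX (Suc n))" "S \<subseteq> U"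
   "\<And>u m. u \<in> U ==> m \<in> |M| ==> gM u m \<in> U"
  note u = subD[OF U(1) GX_vs]
  have gen: "gD y (snd p) \<in> U" if y: "y \<in> G n" and p: "p \<in> set rs" for y p
  proof -
   have "gD b (snd p) \<in> U" if "b \<in> B" for b
    by (rule subsetD[OF U(2)]) (use that p in \<open>force simp: S_def\<close>)
   then have "kspan K (GX n) B \<subseteq> {y \<in> |GX n|. gD y (snd p) \<in> U}"
    using B(2) by (intro kspan_least[OF klin_preimage_sub[OF blinD(1)[OF gD_blin rs_mem(2)[OF p]] U(1)]]) auto
   then show ?thesis using y B(3) by auto
  qed
  have gD: "gD y \<mu> \<in> U" if y: "y \<in> G n" and \<mu>: "\<mu> \<in> |DM|" for y \<mu>
  proof -
   have yX: "y \<in> |GX n|" using y by simp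
   have c: "rt \<mu> (fst p) \<in> |A|" if "p \<in> set rs" for p using rt(2)[OF \<mu>] that by simp
   have "gD y \<mu> = gD y (lsum DM (map (\<lambda>p. rt \<mu> (fst p) \<rhd>\<^bsub>DM\<^esub> snd p) rs))" by (simp only: dual_basis_rs[OF \<mu>])
   also have "\<dots> = lsum (GX (Suc n)) (map (\<lambda>p. gD y (rt \<mu> (fst p) \<rhd>\<^bsub>DM\<^esub> snd p)) rs)"
    by (rule lsum_klin[OF blinD(2)[OF gD_blin yX]]) (simp add: c)
   also have "\<dots> = lsum (GX (Suc n)) (map (\<lambda>p. gD (y \<lhd>\<^bsub>GX n\<^esub> rt \<mu> (fst p)) (snd p)) rs)"
    by (rule lsum_cong) (rule blinD(3)[OF gD_blin yX c rs_mem(2), symmetric])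
   also have "\<dots> \<in> U"
    by (rule lsum_in_sub[OF U(1) GX_vs]) (use gen G_A[OF y c] in auto)
   finally show ?thesis .
  qed
  have "Mspan {y \<otimes>\<^sub>P pd \<mu> | y \<mu>. y \<in> G n \<and> \<mu> \<in> |DM|} \<subseteq> U"
  proof (rule Mspan_least)
   show "submodule U K P" by (rule subI[OF P_simps(1)]) (use u G_D1(1)[of "Suc n"] in \<open>auto simp del: G.simps\<close>)
  qed (use gD U(3) in auto)
  then show "|GX (Suc n)| \<subseteq> U" by simp
 qed
qed

text \<open>
 If no \<open>G n\<close> vanished, two of them, \<open>G m\<close> and \<open>G n\<close> with \<open>m > n\<close>, would share an indecomposable
 summand, which gives a nonzero map from \<open>G m\<close> to \<open>G n\<close>.
\<close>

lemma G_vanishes: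
 assumes fd: "fin_dim K L.T" and rf: "representation_finite K L.T"
 shows "\<exists>n. G n = {\<zero>\<^sub>P}"
proof (rule ccontr)
 assume nz: "\<nexists>n. G n = {\<zero>\<^sub>P}"
 obtain \<F> :: "('k, (('a, 'm) tword \<Rightarrow> 'k) set, nat \<Rightarrow> 'k) rmodule set" where \<F>: "finite \<F>"
  "\<And>X :: ('k, (('a, 'm) tword \<Rightarrow> 'k) set, nat \<Rightarrow> 'k) rmodule.
   right_module K L.T X ==> fin_dim K X ==> indecomposable K L.T X ==> \<exists>Y\<in>\<F>. rmod_iso L.T X Y \<noteq> {}"
  using rf unfolding representation_finite_def by blast
 have "\<exists>R. right_module K L.T (with_ract (GX n) R) \<and> (\<forall>x\<in>G n. \<forall>a\<in>|A|. R x (L.ts a) = x \<otimes>\<^sub>P ps a) \<and>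
  (\<forall>x\<in>G n. \<forall>m\<in>|M|. R x (L.tg m) = gM x m)" for n
  by (rule L.tensor_algebra_module[OF GX_rmod gM_blin, of n]) auto
 then obtain R where R: "\<And>n. right_module K L.T (with_ract (GX n) (R n))"
  "\<And>n x a. x \<in> G n ==> a \<in> |A| ==> R n x (L.ts a) = x \<otimes>\<^sub>P ps a"
  "\<And>n x m. x \<in> G n ==> m \<in> |M| ==> R n x (L.tg m) = gM x m" by metis
 define Q where "Q = (\<lambda>n. with_ract (GX n) (R n))"
 have Q: "right_module K L.T (Q n)" for n unfolding Q_def by (rule R(1))
 have Qs: "|Q n| = G n" "zero (Q n) = zero P" "x \<lhd>\<^bsub>Q n\<^esub> t = R n x t" for n x t by (simp_all add: Q_def)
 have Qk: "klin (Q m) (Q n) f \<longleftrightarrow> klin (GX m) (GX n) f" for m n f by (simp add: Q_def klin_def with_ract_vs)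
 have fdQ: "fin_dim K (Q n)" for n
 proof (rule fin_dim_image[OF _ GX_fin_dim[OF fd, of n]])
  show "klin (GX n) (Q n) (\<lambda>x. x)" using klin_id[OF GX_vs[of n]] by (simp add: Q_def klin_def with_ract_vs)
 qed (simp add: Qs)
 have "\<exists>Y\<in>\<F>. \<exists>p i. act_hom L.T (Q n) Y p \<and> act_hom L.T Y (Q n) i \<and> (\<forall>y\<in>|Y|. p (i y) = y) \<and>
  (\<exists>y\<in>|Y|. i y \<noteq> \<zero>\<^bsub>Q n\<^esub>)" for n
  by (rule listed_summand[OF Q fdQ _ \<F>(2)]) (use nz in \<open>simp_all add: Qs\<close>)
 then obtain Y p i where Y: "\<And>n. Y n \<in> \<F>" and p: "\<And>n. act_hom L.T (Q n) (Y n) (p n)"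
  and i: "\<And>n. act_hom L.T (Y n) (Q n) (i n)" and pi: "\<And>n y. y \<in> |Y n| ==> p n (i n y) = y"
  and inz: "\<And>n. \<exists>y\<in>|Y n|. i n y \<noteq> \<zero>\<^bsub>Q n\<^esub>" by metis
 \<comment> \<open>pigeonhole principle: two of the \<open>G n\<close> have isomorphic summands \<open>Y n\<close>\<close>
 have "\<not> inj Y" using finite_subset[OF _ \<F>(1), of "range Y"] Y finite_imageD[of Y UNIV] by auto
 then obtain m n where mn: "n < m" "Y m = Y n" unfolding inj_def by (metis nat_neq_iff)
 obtain y where y: "y \<in> |Y n|" "i n y \<noteq> \<zero>\<^bsub>Q n\<^esub>" using inz by blast
 define f where "f = (\<lambda>x. i n (p m x))"
 have "act_hom L.T (Q m) (Q n) f"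
  unfolding f_def by (rule act_hom_comp[OF p[of m, unfolded mn(2)] i[of n]])
 then have f: "alin L.T (Q m) (Q n) f" by (rule act_hom_alin[OF Q Q])
 note fc = alinD(2)[OF f, unfolded Qs] and fr = alinD(3)[OF f, unfolded Qs]
 have "alin A (GX m) (GX n) f" unfolding alin_def
 proof (intro conjI ballI)
  show "klin (GX m) (GX n) f" using alinD(1)[OF f] by (simp only: Qk)
  fix x a assume x: "x \<in> |GX m|" and a: "a \<in> |A|"
  then show "f (x \<lhd>\<^bsub>GX m\<^esub> a) = f x \<lhd>\<^bsub>GX n\<^esub> a" using fr[of x "L.ts a"] R(2)[of x m a] R(2)[of "f x" n a] fc[of x] L.ts(4) by simp
 qed
 moreover have "f (gM x l) = gM (f x) l" if "x \<in> G m" "l \<in> |M|" for x l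
  using fr[of x "L.tg l"] R(3)[of x m l] R(3)[of "f x" n l] fc[of x] L.tg(2) that by simp
 moreover have "i m y \<in> G m" using i[of m] y(1) mn(2) unfolding act_hom_def Qs by simp
 ultimately have "f (i m y) = \<zero>\<^sub>P" using G_hom_zero[OF GX_fin_dim[OF fd], of m n f] mn(1) by blast
 then show False using y pi[of y m] mn(2) by (simp add: f_def Qs)
qed

text \<open>
 The sum of the nonzero \<open>G n\<close> contains \<open>1\<close> and is stable under right multiplication by the
 generators of \<open>\<Pi>\<close>.
\<close>

lemma preprojective_fin_dim:
 assumes fd: "fin_dim K L.T" and rf: "representation_finite K L.T"
 shows "fin_dim K P"
proof -
 obtain N where N: "G N = {\<zero>\<^sub>P}" using G_vanishes[OF assms] by blast
 have zero: "G n = {\<zero>\<^sub>P}" if "N \<le> n" for n using that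
 proof (induction n rule: dec_induct)
  case (step n)
  have "G (Suc n) \<subseteq> {\<zero>\<^sub>P}" unfolding G.simps step
   by (rule Mspan_least[OF sub_zero[OF P_simps(1)]]) (use algD(12)[OF P_alg] pd(2) pm(2) in auto)
  then show ?case using G_D1(3)[of "Suc n"] by (auto simp del: G.simps)
 qed (rule N)
 have "\<exists>B. finite B \<and> B \<subseteq> G n \<and> kspan K (GX n) B = G n" for n using GX_fin_dim[OF fd, of n] unfolding fin_dim_def by simp
 then obtain B where B: "\<And>n. finite (B n)" "\<And>n. B n \<subseteq> G n" "\<And>n. kspan K (GX n) (B n) = G n" by metis
 define S where "S = (\<Union>n<N. B n)"
 have S: "finite S" "S \<subseteq> |P|" unfolding S_def using B(1,2) G_D1(1) by blast+
 define U where "U = kspan K P S"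
 have U: "submodule U K P" unfolding U_def by (rule kspan_sub[OF P_simps(1) S(2)])
 note u = subD[OF U P_simps(1)]
 have GU: "G n \<subseteq> U" for n
 proof (cases "n < N")
  case True
  have k: "klin (GX n) P (\<lambda>x. x)" by (rule klinI) (use G_D1(2)[of _ n] GX_vs[of n] in simp_all)
  have "B n \<subseteq> U" unfolding U_def using True kspan_superset[of S P] by (auto simp: S_def)
  then have "kspan K (GX n) (B n) \<subseteq> {x \<in> |GX n|. x \<in> U}"
   using B(2)[of n] by (intro kspan_least[OF klin_preimage_sub[OF k U]]) auto
  then show ?thesis using B(3) by auto
 next
  case False
  then show ?thesis using zero[of n] u(3) by simp
 qed
 have step: "x \<otimes>\<^sub>P b \<in> U" if x: "x \<in> U" and b: "b \<in> |P|" and G: "\<And>n y. y \<in> G n ==> y \<otimes>\<^sub>P b \<in> U" for x b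
 proof -
  have "S \<subseteq> {x \<in> |P|. x \<otimes>\<^sub>P b \<in> U}" using S(2) G B(2) unfolding S_def by blast
  then have "U \<subseteq> {x \<in> |P|. x \<otimes>\<^sub>P b \<in> U}"
   using kspan_least[OF klin_preimage_sub[OF alg_klin(1)[OF P_alg b] U]] unfolding U_def by blast
  then show ?thesis using x by blast
 qed
 have "x \<in> U" if "x \<in> |P|" for x using that
 proof (induction rule: P_induct)
  case (scalar a)
  then show ?case using GU[of 0] G_zero_gen by blast
 next
  case (M t m)
  then show ?case using step[OF M(3) pm(2)[OF M(2)]] GU G_M by blast
 next
  case (DM t \<mu>)
  then show ?case using step[OF DM(3) pd(2)[OF DM(2)]] GU G_DM by blast
 qed (use u in simp_all)
 then have "kspan K P S = |P|" using u(1) unfolding U_def by blast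
 then show ?thesis unfolding fin_dim_def using S by blast
qed

end

section \<open>Products of division algebras\<close>

text \<open>
 Von Neumann regularity is the form in which the semisimplicity of \<open>A\<close> provides dual bases; in a
 product of division algebras, invert each nonzero coordinate.
\<close>

lemma division_product_regular:
 fixes A :: "('k, 'a) module"
 assumes "product_of_division_algebras K A" and a: "a \<in> |A|"
 shows "\<exists>u\<in>|A|. (a \<otimes>\<^sub>A u) \<otimes>\<^sub>A a = a"
proof -
 obtain n :: nat and D :: "nat \<Rightarrow> ('k, 'a) module" and \<phi> where D: "\<And>i. i < n ==> division_algebra K (D i)"
  and \<phi>: "\<phi> \<in> ring_iso A (product_algebra {..<n} D)" and A: "assoc_algebra K A"
  using assms(1) unfolding product_of_division_algebras_def by blast
 interpret A: ring A using A by (simp add: assoc_algebra_def)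
 let ?P = "product_algebra {..<n} D"
 have bij: "bij_betw \<phi> |A| |?P|"
  and mult: "\<And>x y. x \<in> |A| ==> y \<in> |A| ==> \<phi> (x \<otimes>\<^sub>A y) = \<phi> x \<otimes>\<^sub>?P \<phi> y"
  using \<phi> unfolding ring_iso_def ring_hom_def by auto
 define b where "b = \<phi> a"
 have b: "b i \<in> |D i|" if "i < n" for i
  using bij_betwE[OF bij] a that unfolding b_def product_algebra_def by (auto simp: PiE_iff)
 define c where "c = (\<lambda>i\<in>{..<n}. if b i = \<zero>\<^bsub>D i\<^esub> then \<zero>\<^bsub>D i\<^esub> else inv\<^bsub>D i\<^esub> (b i))"
 have c: "c i \<in> |D i| \<and> (b i \<otimes>\<^bsub>D i\<^esub> c i) \<otimes>\<^bsub>D i\<^esub> b i = b i" if i: "i < n" for i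
 proof -
  interpret D: ring "D i" using D[OF i] by (simp add: division_algebra_def assoc_algebra_def)
  show ?thesis
  proof (cases "b i = \<zero>\<^bsub>D i\<^esub>")
   case False
   then have "b i \<in> Units (D i)" using D[OF i] b[OF i] unfolding division_algebra_def by simp
   then show ?thesis using False i b[OF i] by (simp add: c_def)
  qed (use i in \<open>simp add: c_def\<close>)
 qed
 have cP: "c \<in> |?P|" using c unfolding product_algebra_def by (auto simp: PiE_iff c_def)
 have "c \<in> \<phi> ` |A|" using cP bij_betw_imp_surj_on[OF bij] by simp
 then obtain u where u: "u \<in> |A|" "\<phi> u = c" by (elim imageE) simp
 have "\<phi> ((a \<otimes>\<^sub>A u) \<otimes>\<^sub>A a) = (b \<otimes>\<^sub>?P c) \<otimes>\<^sub>?P b" using mult a u by (simp add: b_def)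
 also have "\<dots> = b"
 proof (rule extensionalityI[where A = "{..<n}"])
  show "b \<in> extensional {..<n}" using bij_betwE[OF bij] a unfolding b_def product_algebra_def by (auto simp: PiE_def)
 qed (use c in \<open>simp_all add: product_algebra_def\<close>)
 finally have "(a \<otimes>\<^sub>A u) \<otimes>\<^sub>A a = a"
  using inj_onD[OF bij_betw_imp_inj_on[OF bij], of "(a \<otimes>\<^sub>A u) \<otimes>\<^sub>A a" a] a u by (simp add: b_def)
 then show ?thesis using u by blast
qed

section \<open>The third syzygy and the inverse Nakayama functor\<close>

context frobenius_algebra
begin

lemma lsum_append:
 "vspace V ==> set xs \<subseteq> |V| ==> set ys \<subseteq> |V| ==> lsum V (xs @ ys) = lsum V xs \<oplus>\<^sub>V lsum V ys"
 by (induction xs) (auto simp: vs_ac(2))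

subsection \<open>Contractions\<close>

text \<open>
 The elements of \<open>Z \<otimes>\<^sub>A N\<close> are studied through the maps \<open>Z \<otimes> \<xi>\<close> to \<open>Z\<close>, for left linear
 \<open>\<xi> : N \<rightarrow> A\<close>.
\<close>

definition contract :: "('k, 'a, 'z) rmodule \<Rightarrow> ('k, 'a, 'b, 'n) bimodule \<Rightarrow> ('n \<Rightarrow> 'a) \<Rightarrow> ('z \<times> 'n \<Rightarrow> 'k) set \<Rightarrow> 'z" where
 "contract Z N \<xi> = (SOME h. klin (tensor K A Z N) Z h \<and>
   (\<forall>z\<in>|Z|. \<forall>n\<in>|N|. h (pure_tensor K A Z N z n) = z \<lhd>\<^sub>Z \<xi> n))"

context
 fixes Z :: "('k, 'a, 'z) rmodule" and N :: "('k, 'a, 'b, 'n) bimodule" and B :: "('k, 'b, 'y) module_scheme"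
 assumes Z: "right_module K A Z" and N: "bimodule K A B N"
begin

abbreviation (input) "ZN \<equiv> tensor K A Z N"
abbreviation (input) "pu \<equiv> pure_tensor K A Z N"

lemma contract:
 assumes \<xi>: "llin N \<xi>"
 shows "klin ZN Z (contract Z N \<xi>)"
  "z \<in> |Z| ==> n \<in> |N| ==> contract Z N \<xi> (pu z n) = z \<lhd>\<^sub>Z \<xi> n"
proof -
 note x = llinD[OF \<xi>]
 have "balanced A Z N Z (\<lambda>z n. z \<lhd>\<^sub>Z \<xi> n)" unfolding balanced_def
  using rmod_klin(1)[OF Z x(2)] klin_comp[OF x(1) rmod_klin(2)[OF Z]] by (simp add: rmodD(6)[OF Z] x)
 then obtain h where "klin ZN Z h" "\<And>z n. z \<in> |Z| ==> n \<in> |N| ==> h (pu z n) = z \<lhd>\<^sub>Z \<xi> n"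
  by (rule tensor_lift[OF Z N rmodD(2)[OF Z]]) (rule that, assumption+)
 then have "\<exists>h. klin ZN Z h \<and> (\<forall>z\<in>|Z|. \<forall>n\<in>|N|. h (pu z n) = z \<lhd>\<^sub>Z \<xi> n)" by blast
 from someI_ex[OF this, folded contract_def]
 show "klin ZN Z (contract Z N \<xi>)" "z \<in> |Z| ==> n \<in> |N| ==> contract Z N \<xi> (pu z n) = z \<lhd>\<^sub>Z \<xi> n" by auto
qed

text \<open>Two linear maps out of \<open>Z \<otimes>\<^sub>A N\<close> that are both assembled from contractions are compared on pure tensors.\<close>

lemma contract_ops:
 assumes \<xi>: "llin N \<xi>" and t: "t \<in> |ZN|"
 shows "llin N \<xi>' ==> llin N \<zeta> ==> (\<And>n. n \<in> |N| ==> \<zeta> n = \<xi> n \<oplus>\<^sub>A \<xi>' n)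
   ==> contract Z N \<zeta> t = contract Z N \<xi> t \<oplus>\<^sub>Z contract Z N \<xi>' t"
  and "llin N \<zeta> ==> c \<in> |K| ==> (\<And>n. n \<in> |N| ==> \<zeta> n = c \<odot>\<^sub>A \<xi> n)
   ==> contract Z N \<zeta> t = c \<odot>\<^sub>Z contract Z N \<xi> t"
  and "llin N \<zeta> ==> a \<in> |A| ==> (\<And>n. n \<in> |N| ==> \<zeta> n = \<xi> n \<otimes>\<^sub>A a)
   ==> contract Z N \<zeta> t = contract Z N \<xi> t \<lhd>\<^sub>Z a"
  and "llin N \<zeta> ==> b \<in> |B| ==> (\<And>n. n \<in> |N| ==> \<zeta> n = \<xi> (n \<lhd>\<^sub>N b))
   ==> contract Z N \<xi> (t \<lhd>\<^bsub>ZN\<^esub> b) = contract Z N \<zeta> t"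
proof -
 note x = llinD[OF \<xi>] and z = rmodD[OF Z] and c = contract[OF \<xi>] and n = rmodD(3)[OF bimodD(1)[OF N]]
 show "contract Z N \<zeta> t = contract Z N \<xi> t \<oplus>\<^sub>Z contract Z N \<xi>' t"
  if "llin N \<xi>'" "llin N \<zeta>" "\<And>n. n \<in> |N| ==> \<zeta> n = \<xi> n \<oplus>\<^sub>A \<xi>' n"
  by (rule tensor_eqI[OF Z N contract(1)[OF that(2)] klin_add[OF c(1) contract(1)[OF that(1)]] _ t])
   (simp add: contract(2) c \<xi> that llinD(2)[OF that(1)] x z)
 show "contract Z N \<zeta> t = c \<odot>\<^sub>Z contract Z N \<xi> t"
  if "llin N \<zeta>" "c \<in> |K|" "\<And>n. n \<in> |N| ==> \<zeta> n = c \<odot>\<^sub>A \<xi> n"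
  by (rule tensor_eqI[OF Z N contract(1)[OF that(1)] klin_smult[OF c(1) that(2)] _ t])
   (simp add: contract(2) c that x z)
 show "contract Z N \<zeta> t = contract Z N \<xi> t \<lhd>\<^sub>Z a"
  if "llin N \<zeta>" "a \<in> |A|" "\<And>n. n \<in> |N| ==> \<zeta> n = \<xi> n \<otimes>\<^sub>A a"
  by (rule tensor_eqI[OF Z N contract(1)[OF that(1)] klin_comp[OF c(1) rmod_klin(1)[OF Z that(2)]] _ t])
   (simp add: contract(2) c that x z)
 show "contract Z N \<xi> (t \<lhd>\<^bsub>ZN\<^esub> b) = contract Z N \<zeta> t"
  if "llin N \<zeta>" "b \<in> |B|" "\<And>n. n \<in> |N| ==> \<zeta> n = \<xi> (n \<lhd>\<^sub>N b)"
  by (rule tensor_eqI[OF Z N klin_comp[OF rmod_klin(1)[OF tensor_right_module(1)[OF Z N] that(2)] c(1)] contract(1)[OF that(1)] _ t])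
   (simp add: contract(2) c that x z n tensor_right_module(2)[OF Z N])
qed

lemma contract_expansion:
 assumes bs: "set bs \<subseteq> |N| \<times> Collect (llin N)"
  "\<And>n. n \<in> |N| ==> n = lsum N (map (\<lambda>(b, \<xi>). \<xi> n \<rhd>\<^sub>N b) bs)" and t: "t \<in> |ZN|"
 shows "t = lsum ZN (map (\<lambda>p. pu (contract Z N (snd p) t) (fst p)) bs)"
proof -
 have b: "fst p \<in> |N|" "llin N (snd p)" if "p \<in> set bs" for p using bs(1) that by auto
 note bal = balanced_pure[OF Z N] and ZNv = tensor_vs[OF Z N]
 have k: "klin ZN ZN (\<lambda>t. lsum ZN (map (\<lambda>p. pu (contract Z N (snd p) t) (fst p)) bs))"
  by (rule klin_lsum[OF ZNv ZNv]) (rule klin_comp[OF contract(1)[OF b(2)] balancedD(1)[OF bal b(1)]])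
 show ?thesis
 proof (rule tensor_eqI[OF Z N klin_id[OF ZNv] k _ t])
  fix z n assume z: "z \<in> |Z|" and n: "n \<in> |N|"
  have c: "snd p n \<in> |A|" if "p \<in> set bs" for p using llinD(2)[OF b(2)[OF that] n] .
  have "pu z n = pu z (lsum N (map (\<lambda>p. snd p n \<rhd>\<^sub>N fst p) bs))"
   using bs(2)[OF n] by (simp add: case_prod_beta')
  also have "\<dots> = lsum ZN (map (\<lambda>p. pu z (snd p n \<rhd>\<^sub>N fst p)) bs)"
   by (rule lsum_klin[OF balancedD(2)[OF bal z]]) (rule bimodD(4)[OF N c b(1)])
  also have "\<dots> = lsum ZN (map (\<lambda>p. pu (contract Z N (snd p) (pu z n)) (fst p)) bs)"
   by (rule lsum_cong) (simp add: contract(2)[OF b(2) z n] balancedD(3)[OF bal z c b(1)])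
  finally show "pu z n = lsum ZN (map (\<lambda>p. pu (contract Z N (snd p) (pu z n)) (fst p)) bs)" .
 qed
qed

lemma contract_eqI:
 assumes bs: "set bs \<subseteq> |N| \<times> Collect (llin N)"
  "\<And>n. n \<in> |N| ==> n = lsum N (map (\<lambda>(b, \<xi>). \<xi> n \<rhd>\<^sub>N b) bs)" and t: "t \<in> |ZN|" "s \<in> |ZN|"
  and eq: "\<And>p. p \<in> set bs ==> contract Z N (snd p) t = contract Z N (snd p) s"
 shows "t = s"
proof -
 have "lsum ZN (map (\<lambda>p. pu (contract Z N (snd p) t) (fst p)) bs) = lsum ZN (map (\<lambda>p. pu (contract Z N (snd p) s) (fst p)) bs)"
  by (rule lsum_cong) (simp add: eq)
 then show ?thesis using contract_expansion[OF bs t(1)] contract_expansion[OF bs t(2)] by simp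
qed

end

lemma contract_natural:
 assumes Z: "right_module K A Z" and Z': "right_module K A Z'" and N: "bimodule K A B N"
  and f: "alin A Z Z' f" and \<xi>: "llin N \<xi>" and t: "t \<in> |tensor K A Z N|"
 shows "contract Z' N \<xi> (tensor_map K A Z N Z' N f (\<lambda>n. n) t) = f (contract Z N \<xi> t)"
proof -
 have f': "f (x \<lhd>\<^sub>Z a) = f x \<lhd>\<^sub>Z' a" if "x \<in> |Z|" "a \<in> |A|" for x a by (rule alinD(3)[OF f that])
 note m = tensor_map_props[OF Z N Z' N alinD(1)[OF f] f' klin_id[OF bimodD(3)[OF N]] refl]
 show ?thesis
  by (rule tensor_eqI[OF Z N klin_comp[OF m(1) contract(1)[OF Z' N \<xi>]] klin_comp[OF contract(1)[OF Z N \<xi>] alinD(1)[OF f]] _ t])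
   (simp_all add: m(2) contract(2)[OF Z' N \<xi>] contract(2)[OF Z N \<xi>] alinD[OF f] llinD(2)[OF \<xi>])
qed

end

context preprojective_data
begin

subsection \<open>Forms on the preprojective algebra\<close>

abbreviation PB where "PB \<equiv> prep_bimodule K A M rs ls"
abbreviation DP where "DP \<equiv> dual K (regular P)"
abbreviation al where "al \<equiv> llift PB"

lemma PB_sels [simp]: "|PB| = |P|" "add PB = add P" "zero PB = zero P" "smult PB = smult P"
 "x \<lhd>\<^bsub>PB\<^esub> y = x \<otimes>\<^sub>P y" "a \<rhd>\<^bsub>PB\<^esub> y = ps a \<otimes>\<^sub>P y"
 by (simp_all add: prep_bimodule_def restrict_left_def regular_def)

lemmas reg_bimodule = regular_bimodule[OF P_alg]

lemma PB_bimodule: "bimodule K A P PB"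
proof (rule bimodI)
 have "vspace PB" by (rule vs_image[OF P_simps(1), where q = "\<lambda>x. x"]) simp_all
 then show "right_module K P PB" by (rule rmodI[OF P_alg]) (simp_all add: P_rules)
qed (simp_all add: P_rules A_alg ps klinD(4,5)[OF ps(1)])

lemma PB_klin: "klin PB U f \<longleftrightarrow> klin P U f" "klin W PB g \<longleftrightarrow> klin W P g"
 using bimodD(3)[OF PB_bimodule] P_simps(1) by (auto simp: klin_def)

lemma DP_rmod: "right_module K P DP"
 by (rule bimodD(1)[OF dual_bimodule[OF reg_bimodule]])

lemma DP_lact: "\<phi> \<in> |DP| ==> b \<in> |P| ==> b \<rhd>\<^bsub>DP\<^esub> \<phi> \<in> |DP|"
 by (rule bimodD(4)[OF dual_bimodule[OF reg_bimodule]])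

lemmas DP_ract = rmodD(3)[OF DP_rmod]
lemmas DP_vs = rmodD(2)[OF DP_rmod]

lemma DP_sels:
 assumes "p \<in> |P|"
 shows "(\<phi> \<oplus>\<^bsub>DP\<^esub> \<psi>) p = \<phi> p \<oplus> \<psi> p" "(c \<odot>\<^bsub>DP\<^esub> \<phi>) p = c \<otimes> \<phi> p" "(\<phi> \<lhd>\<^bsub>DP\<^esub> b) p = \<phi> (b \<otimes>\<^sub>P p)"
  "(b \<rhd>\<^bsub>DP\<^esub> \<phi>) p = \<phi> (p \<otimes>\<^sub>P b)"
 using assms dual_sels(4-7)[of p "regular P"] by simp_all

lemma DP_klin: "\<phi> \<in> |DP| ==> klin P Kv \<phi>"
 using form_klin[of \<phi> "regular P"] bimodD(3)[OF reg_bimodule] P_simps(1) by (simp add: dual_sels klin_def)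

lemma DP_eqI: "\<phi> \<in> |DP| ==> \<psi> \<in> |DP| ==> (\<And>p. p \<in> |P| ==> \<phi> p = \<psi> p) ==> \<phi> = \<psi>"
 using form_eqI[of \<phi> "regular P" \<psi>] by (simp add: dual_sels)

lemma al:
 assumes "\<phi> \<in> |DP|"
 shows "llin PB (al \<phi>)" "p \<in> |P| ==> al \<phi> p \<in> |A|"
  "p \<in> |P| ==> a \<in> |A| ==> al \<phi> (ps a \<otimes>\<^sub>P p) = a \<otimes>\<^sub>A al \<phi> p"
  "p \<in> |P| ==> \<sigma> (al \<phi> p) = \<phi> p"
  "p \<in> |P| ==> a \<in> |A| ==> \<sigma> (a \<otimes>\<^sub>A al \<phi> p) = \<phi> (ps a \<otimes>\<^sub>P p)"
proof -
 have "klin PB Kv \<phi>" using DP_klin[OF assms] by (simp add: PB_klin)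
 note l = llift[OF PB_bimodule this, simplified]
 show "llin PB (al \<phi>)" unfolding llin_def using l(1,3) by simp
qed (use llift[OF PB_bimodule DP_klin[OF assms, folded PB_klin(1)], simplified] in simp_all)

lemma A_eqI:
 assumes "b \<in> |A|" "c \<in> |A|" "\<And>a. a \<in> |A| ==> \<sigma> (a \<otimes>\<^sub>A b) = \<sigma> (a \<otimes>\<^sub>A c)"
 shows "b = c"
 by (rule \<sigma>_eqI[OF assms(1,2)]) (use assms \<sigma>_comm in simp)

lemma al_unique:
 assumes "\<phi> \<in> |DP|" "p \<in> |P|" "c \<in> |A|" "\<And>a. a \<in> |A| ==> \<sigma> (a \<otimes>\<^sub>A c) = \<phi> (ps a \<otimes>\<^sub>P p)"
 shows "al \<phi> p = c"
 by (rule A_eqI[OF al(2)[OF assms(1,2)] assms(3)]) (simp add: al(5) assms)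

lemma al_ops:
 assumes \<phi>: "\<phi> \<in> |DP|" and p: "p \<in> |P|"
 shows "\<psi> \<in> |DP| ==> al (\<phi> \<oplus>\<^bsub>DP\<^esub> \<psi>) p = al \<phi> p \<oplus>\<^sub>A al \<psi> p"
  and "c \<in> |K| ==> al (c \<odot>\<^bsub>DP\<^esub> \<phi>) p = c \<odot>\<^sub>A al \<phi> p"
  and "a \<in> |A| ==> al (\<phi> \<lhd>\<^bsub>DP\<^esub> ps a) p = al \<phi> p \<otimes>\<^sub>A a"
  and "b \<in> |P| ==> al (b \<rhd>\<^bsub>DP\<^esub> \<phi>) p = al \<phi> (p \<otimes>\<^sub>P b)"
proof -
 have k: "klin A Kv (\<lambda>x. \<sigma> (b \<otimes>\<^sub>A x))" if "b \<in> |A|" for b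
  by (rule klin_comp[OF alg_klin(2)[OF A_alg that] \<sigma>_klin])
 note kl = klinD(4,5)[OF k, simplified]
 note P = ps(2) DP_sels al p
 show "al (\<phi> \<oplus>\<^bsub>DP\<^esub> \<psi>) p = al \<phi> p \<oplus>\<^sub>A al \<psi> p" if "\<psi> \<in> |DP|"
  by (rule al_unique[OF vs_simps(1)[OF DP_vs \<phi> that] p]) (simp_all add: kl P \<phi> that)
 show "al (c \<odot>\<^bsub>DP\<^esub> \<phi>) p = c \<odot>\<^sub>A al \<phi> p" if "c \<in> |K|"
  by (rule al_unique[OF vs_simps(3)[OF DP_vs that \<phi>] p]) (simp_all add: kl P \<phi> that)
 show "al (\<phi> \<lhd>\<^bsub>DP\<^esub> ps a) p = al \<phi> p \<otimes>\<^sub>A a" if a: "a \<in> |A|"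
 proof (rule al_unique[OF DP_ract[OF \<phi> ps(2)[OF a]] p])
  fix b assume b: "b \<in> |A|"
  have "\<sigma> (b \<otimes>\<^sub>A (al \<phi> p \<otimes>\<^sub>A a)) = \<sigma> ((b \<otimes>\<^sub>A al \<phi> p) \<otimes>\<^sub>A a)" using a b al(2)[OF \<phi> p] by (simp add: A_assoc)
  also have "\<dots> = \<sigma> (a \<otimes>\<^sub>A (b \<otimes>\<^sub>A al \<phi> p))" using a b al(2)[OF \<phi> p] by (intro \<sigma>_comm) simp_all
  also have "\<dots> = \<sigma> ((a \<otimes>\<^sub>A b) \<otimes>\<^sub>A al \<phi> p)" using a b al(2)[OF \<phi> p] by (simp add: A_assoc)
  also have "\<dots> = \<phi> (ps (a \<otimes>\<^sub>A b) \<otimes>\<^sub>P p)" using al(5)[OF \<phi> p] a b by simp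
  also have "\<dots> = (\<phi> \<lhd>\<^bsub>DP\<^esub> ps a) (ps b \<otimes>\<^sub>P p)" using a b p by (simp add: DP_sels ps P_rules(1))
  finally show "\<sigma> (b \<otimes>\<^sub>A (al \<phi> p \<otimes>\<^sub>A a)) = (\<phi> \<lhd>\<^bsub>DP\<^esub> ps a) (ps b \<otimes>\<^sub>P p)" .
 qed (simp add: a al(2)[OF \<phi> p])
 show "al (b \<rhd>\<^bsub>DP\<^esub> \<phi>) p = al \<phi> (p \<otimes>\<^sub>P b)" if "b \<in> |P|"
  by (rule al_unique[OF DP_lact[OF \<phi> that] p]) (simp_all add: P \<phi> that P_rules(1))
qed

text \<open>Multiplication by \<open>M\<close> and \<open>DM\<close> on forms, through the elements \<open>\<ell>\<close> and \<open>\<rho>\<close>.\<close>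

lemma al_pm:
 assumes \<phi>: "\<phi> \<in> |DP|" and p: "p \<in> |P|" and m: "m \<in> |M|"
 shows "lsum A (map (\<lambda>q. rt (fst q) (al \<phi> (pm (snd q) \<otimes>\<^sub>P p) \<rhd>\<^sub>M m)) ls) = al (\<phi> \<lhd>\<^bsub>DP\<^esub> pm m) p"
proof (rule al_unique[symmetric, OF DP_ract[OF \<phi> pm(2)[OF m]] p])
 have b: "al \<phi> (pm (snd q) \<otimes>\<^sub>P p) \<in> |A|" if "q \<in> set ls" for q using that p by (simp add: al(2)[OF \<phi>] pm)
 have c: "rt (fst q) (al \<phi> (pm (snd q) \<otimes>\<^sub>P p) \<rhd>\<^sub>M m) \<in> |A|" if "q \<in> set ls" for q
  using that b[OF that] m by (simp add: rt(2))
 show "lsum A (map (\<lambda>q. rt (fst q) (al \<phi> (pm (snd q) \<otimes>\<^sub>P p) \<rhd>\<^sub>M m)) ls) \<in> |A|"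
  by (rule lsum_map_closed[OF A_simps(1) c])
 fix a assume a: "a \<in> |A|"
 have ma: "m \<lhd>\<^sub>M a \<in> |M|" using m a by simp
 have "\<sigma> (a \<otimes>\<^sub>A lsum A (map (\<lambda>q. rt (fst q) (al \<phi> (pm (snd q) \<otimes>\<^sub>P p) \<rhd>\<^sub>M m)) ls))
  = lsum Kv (map (\<lambda>q. \<sigma> (a \<otimes>\<^sub>A rt (fst q) (al \<phi> (pm (snd q) \<otimes>\<^sub>P p) \<rhd>\<^sub>M m))) ls)"
  by (rule lsum_klin[OF klin_comp[OF alg_klin(2)[OF A_alg a] \<sigma>_klin] c])
 also have "\<dots> = lsum Kv (map (\<lambda>q. \<phi> (pm (lt (fst q) (m \<lhd>\<^sub>M a) \<rhd>\<^sub>M snd q) \<otimes>\<^sub>P p)) ls)"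
 proof (rule lsum_cong)
  fix q assume q: "q \<in> set ls"
  note \<nu> = ls_mem(1)[OF q] and n = ls_mem(2)[OF q] and l = lt(2)[OF ls_mem(1)[OF q] ma]
  have "\<sigma> (a \<otimes>\<^sub>A rt (fst q) (al \<phi> (pm (snd q) \<otimes>\<^sub>P p) \<rhd>\<^sub>M m)) = fst q (al \<phi> (pm (snd q) \<otimes>\<^sub>P p) \<rhd>\<^sub>M (m \<lhd>\<^sub>M a))"
   using rt(6)[OF \<nu>] a m b[OF q] by (simp add: M_rules)
  also have "\<dots> = \<sigma> (lt (fst q) (m \<lhd>\<^sub>M a) \<otimes>\<^sub>A al \<phi> (pm (snd q) \<otimes>\<^sub>P p))" using lt(6)[OF \<nu> ma b[OF q]] by simp
  also have "\<dots> = \<phi> (ps (lt (fst q) (m \<lhd>\<^sub>M a)) \<otimes>\<^sub>P (pm (snd q) \<otimes>\<^sub>P p))" using al(5)[OF \<phi> _ l] n p pm(2) by simp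
  also have "\<dots> = \<phi> (pm (lt (fst q) (m \<lhd>\<^sub>M a) \<rhd>\<^sub>M snd q) \<otimes>\<^sub>P p)" using l n p by (simp add: pm(2,3) ps(2) P_rules(1))
  finally show "\<sigma> (a \<otimes>\<^sub>A rt (fst q) (al \<phi> (pm (snd q) \<otimes>\<^sub>P p) \<rhd>\<^sub>M m)) = \<phi> (pm (lt (fst q) (m \<lhd>\<^sub>M a) \<rhd>\<^sub>M snd q) \<otimes>\<^sub>P p)" .
 qed
 also have "\<dots> = \<phi> (pm (lsum M (map (\<lambda>q. lt (fst q) (m \<lhd>\<^sub>M a) \<rhd>\<^sub>M snd q) ls)) \<otimes>\<^sub>P p)"
  by (rule lsum_klin[OF klin_comp[OF klin_comp[OF pm(1) alg_klin(1)[OF P_alg p]] DP_klin[OF \<phi>]], symmetric]) (simp add: lt(2) ma)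
 also have "\<dots> = (\<phi> \<lhd>\<^bsub>DP\<^esub> pm m) (ps a \<otimes>\<^sub>P p)"
  unfolding basis_ls[OF ma] using a m p by (simp add: DP_sels ps pm P_rules(1))
 finally show "\<sigma> (a \<otimes>\<^sub>A lsum A (map (\<lambda>q. rt (fst q) (al \<phi> (pm (snd q) \<otimes>\<^sub>P p) \<rhd>\<^sub>M m)) ls)) = (\<phi> \<lhd>\<^bsub>DP\<^esub> pm m) (ps a \<otimes>\<^sub>P p)" .
qed

lemma al_pd:
 assumes \<phi>: "\<phi> \<in> |DP|" and p: "p \<in> |P|" and \<nu>: "\<nu> \<in> |DM|"
 shows "lsum A (map (\<lambda>q. lt \<nu> (fst q \<lhd>\<^sub>M al \<phi> (pd (snd q) \<otimes>\<^sub>P p))) rs) = al (\<phi> \<lhd>\<^bsub>DP\<^esub> pd \<nu>) p"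
proof (rule al_unique[symmetric, OF DP_ract[OF \<phi> pd(2)[OF \<nu>]] p])
 have b: "al \<phi> (pd (snd q) \<otimes>\<^sub>P p) \<in> |A|" if "q \<in> set rs" for q using that p by (simp add: al(2)[OF \<phi>] pd)
 have c: "lt \<nu> (fst q \<lhd>\<^sub>M al \<phi> (pd (snd q) \<otimes>\<^sub>P p)) \<in> |A|" if "q \<in> set rs" for q
  using that b[OF that] \<nu> by (simp add: lt(2))
 show "lsum A (map (\<lambda>q. lt \<nu> (fst q \<lhd>\<^sub>M al \<phi> (pd (snd q) \<otimes>\<^sub>P p))) rs) \<in> |A|"
  by (rule lsum_map_closed[OF A_simps(1) c])
 fix a assume a: "a \<in> |A|"
 have \<nu>a: "\<nu> \<lhd>\<^bsub>DM\<^esub> a \<in> |DM|" using \<nu> a by simp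
 have "\<sigma> (a \<otimes>\<^sub>A lsum A (map (\<lambda>q. lt \<nu> (fst q \<lhd>\<^sub>M al \<phi> (pd (snd q) \<otimes>\<^sub>P p))) rs))
  = lsum Kv (map (\<lambda>q. \<sigma> (a \<otimes>\<^sub>A lt \<nu> (fst q \<lhd>\<^sub>M al \<phi> (pd (snd q) \<otimes>\<^sub>P p)))) rs)"
  by (rule lsum_klin[OF klin_comp[OF alg_klin(2)[OF A_alg a] \<sigma>_klin] c])
 also have "\<dots> = lsum Kv (map (\<lambda>q. \<phi> (pd (rt (\<nu> \<lhd>\<^bsub>DM\<^esub> a) (fst q) \<rhd>\<^bsub>DM\<^esub> snd q) \<otimes>\<^sub>P p)) rs)"
 proof (rule lsum_cong)
  fix q assume q: "q \<in> set rs"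
  note m = rs_mem(1)[OF q] and \<mu> = rs_mem(2)[OF q] and l = rt(2)[OF \<nu>a rs_mem(1)[OF q]]
  have "\<sigma> (a \<otimes>\<^sub>A lt \<nu> (fst q \<lhd>\<^sub>M al \<phi> (pd (snd q) \<otimes>\<^sub>P p))) = (\<nu> \<lhd>\<^bsub>DM\<^esub> a) (fst q \<lhd>\<^sub>M al \<phi> (pd (snd q) \<otimes>\<^sub>P p))"
   using lt(5)[OF \<nu>] a m b[OF q] by (simp add: dual_sels)
  also have "\<dots> = \<sigma> (rt (\<nu> \<lhd>\<^bsub>DM\<^esub> a) (fst q) \<otimes>\<^sub>A al \<phi> (pd (snd q) \<otimes>\<^sub>P p))" using rt(5)[OF \<nu>a m b[OF q]] by simp
  also have "\<dots> = \<phi> (ps (rt (\<nu> \<lhd>\<^bsub>DM\<^esub> a) (fst q)) \<otimes>\<^sub>P (pd (snd q) \<otimes>\<^sub>P p))" using al(5)[OF \<phi> _ l] \<mu> p pd(2) by simp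
  also have "\<dots> = \<phi> (pd (rt (\<nu> \<lhd>\<^bsub>DM\<^esub> a) (fst q) \<rhd>\<^bsub>DM\<^esub> snd q) \<otimes>\<^sub>P p)" using l \<mu> p by (simp add: pd(2,3) ps(2) P_rules(1))
  finally show "\<sigma> (a \<otimes>\<^sub>A lt \<nu> (fst q \<lhd>\<^sub>M al \<phi> (pd (snd q) \<otimes>\<^sub>P p))) = \<phi> (pd (rt (\<nu> \<lhd>\<^bsub>DM\<^esub> a) (fst q) \<rhd>\<^bsub>DM\<^esub> snd q) \<otimes>\<^sub>P p)" .
 qed
 also have "\<dots> = \<phi> (pd (lsum DM (map (\<lambda>q. rt (\<nu> \<lhd>\<^bsub>DM\<^esub> a) (fst q) \<rhd>\<^bsub>DM\<^esub> snd q) rs)) \<otimes>\<^sub>P p)"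
  by (rule lsum_klin[OF klin_comp[OF klin_comp[OF pd(1) alg_klin(1)[OF P_alg p]] DP_klin[OF \<phi>]], symmetric]) (simp add: rt(2) \<nu>a)
 also have "\<dots> = (\<phi> \<lhd>\<^bsub>DP\<^esub> pd \<nu>) (ps a \<otimes>\<^sub>P p)"
  unfolding dual_basis_rs[OF \<nu>a] using a \<nu> p by (simp add: DP_sels ps pd P_rules(1))
 finally show "\<sigma> (a \<otimes>\<^sub>A lsum A (map (\<lambda>q. lt \<nu> (fst q \<lhd>\<^sub>M al \<phi> (pd (snd q) \<otimes>\<^sub>P p))) rs)) = (\<phi> \<lhd>\<^bsub>DP\<^esub> pd \<nu>) (ps a \<otimes>\<^sub>P p)" .
qed

text \<open>A left dual basis of \<open>\<Pi>\<close> over \<open>A\<close>, in terms of forms.\<close>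

lemma P_dual_basis:
 assumes fd: "fin_dim K P"
 obtains bs where "set bs \<subseteq> |P| \<times> |DP|" "\<And>p. p \<in> |P| ==> p = lsum P (map (\<lambda>q. ps (al (snd q) p) \<otimes>\<^sub>P fst q) bs)"
proof -
 have fd': "fin_dim K PB"
  by (rule fin_dim_image[OF _ fd, of PB "\<lambda>x. x"]) (simp_all add: PB_klin klin_id)
 obtain bs where bs: "set bs \<subseteq> |PB| \<times> Collect (llin PB)"
  "\<And>x. x \<in> |PB| ==> x = lsum PB (map (\<lambda>(b, \<xi>). \<xi> x \<rhd>\<^bsub>PB\<^esub> b) bs)"
  using left_dual_basis[OF PB_bimodule fd'] by blast
 define F where "F = (\<lambda>\<xi>. \<lambda>p\<in>|P|. \<sigma> (\<xi> p))"
 have F: "F \<xi> \<in> |DP| \<and> (\<forall>p\<in>|P|. al (F \<xi>) p = \<xi> p)" if \<xi>: "llin PB \<xi>" for \<xi>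
 proof -
  note x = llinD[OF \<xi>, simplified]
  have "klin (regular P) Kv (\<lambda>p. \<sigma> (\<xi> p))"
   using klin_comp[OF x(1) \<sigma>_klin] bimodD(3)[OF reg_bimodule] by (simp add: klin_def)
  from klin_form[OF this] have F: "F \<xi> \<in> |DP|" by (simp add: dual_sels F_def)
  moreover have "al (F \<xi>) p = \<xi> p" if p: "p \<in> |P|" for p
   by (rule al_unique[OF F p]) (simp_all add: x p F_def ps(2))
  ultimately show ?thesis by simp
 qed
 define cs where "cs = map (\<lambda>p. (fst p, F (snd p))) bs"
 show ?thesis
 proof (rule that[of cs])
  show "set cs \<subseteq> |P| \<times> |DP|" unfolding cs_def using bs(1) F by auto
  fix p assume p: "p \<in> |P|"
  have "p = lsum P (map (\<lambda>q. ps (snd q p) \<otimes>\<^sub>P fst q) bs)"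
   using bs(2)[of p] p by (simp add: case_prod_beta' lsum_def)
  also have "\<dots> = lsum P (map (\<lambda>q. ps (al (snd q) p) \<otimes>\<^sub>P fst q) cs)"
  proof -
   have "map (\<lambda>q. ps (snd q p) \<otimes>\<^sub>P fst q) bs = map (\<lambda>q. ps (al (snd q) p) \<otimes>\<^sub>P fst q) cs"
    unfolding cs_def using bs(1) F p by auto
   then show ?thesis by simp
  qed
  finally show "p = lsum P (map (\<lambda>q. ps (al (snd q) p) \<otimes>\<^sub>P fst q) cs)" .
 qed
qed

end

context preprojective_data
begin

subsection \<open>The presentation\<close>

definition bM :: "'m \<Rightarrow> 'm \<times> ('m \<Rightarrow> 'k) \<Rightarrow> 'a" where "bM m v = rt (snd v) m"
definition bD :: "('m \<Rightarrow> 'k) \<Rightarrow> 'm \<times> ('m \<Rightarrow> 'k) \<Rightarrow> 'a" where "bD \<nu> v = lt \<nu> (fst v)"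

lemma V_proj: "klin V M fst" "klin V DM snd"
 by (rule klinI; auto simp: V_sels bimodD(3)[OF V_bimodule])+

lemma bM_llin: "m \<in> |M| ==> llin V (bM m)"
 unfolding llin_def bM_def using klin_comp[OF V_proj(2) rt_klin] by (auto simp: V_sels rt(8))

lemma bD_llin: "\<nu> \<in> |DM| ==> llin V (bD \<nu>)"
 unfolding llin_def bD_def using klin_comp[OF V_proj(1) lt(1)] by (auto simp: V_sels lt(3))

lemma b_values:
 assumes "m \<in> |M|" "\<nu> \<in> |DM|" "a \<in> |A|" "n \<in> |M|" "\<mu> \<in> |DM|"
 shows "bM m (iM n \<lhd>\<^sub>V a) = \<zero>\<^sub>A" "bM m (iD \<mu> \<lhd>\<^sub>V a) = rt \<mu> (a \<rhd>\<^sub>M m)"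
  "bD \<nu> (iD \<mu> \<lhd>\<^sub>V a) = \<zero>\<^sub>A" "bD \<nu> (iM n \<lhd>\<^sub>V a) = lt \<nu> (n \<lhd>\<^sub>M a)"
proof -
 show "bM m (iM n \<lhd>\<^sub>V a) = \<zero>\<^sub>A" "bD \<nu> (iD \<mu> \<lhd>\<^sub>V a) = \<zero>\<^sub>A"
  unfolding bM_def bD_def inj_M_def inj_D_def V_sels
  using klinD(6)[OF rt_klin[OF assms(1)]] klinD(6)[OF lt(1)[OF assms(2)]] DM_zero_act(2,4)[OF assms(3)] by simp_all
 show "bM m (iD \<mu> \<lhd>\<^sub>V a) = rt \<mu> (a \<rhd>\<^sub>M m)" "bD \<nu> (iM n \<lhd>\<^sub>V a) = lt \<nu> (n \<lhd>\<^sub>M a)"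
  unfolding bM_def bD_def inj_M_def inj_D_def V_sels using assms by (simp_all add: rt(7))
qed

text \<open>
 A left dual basis of \<open>M \<oplus> DM\<close>, from the dual bases of its two summands.
\<close>

definition vbs where
 "vbs = map (\<lambda>q. (iM (snd q), bD (fst q))) ls @ map (\<lambda>p. (iD (snd p), bM (fst p))) rs"

lemma V_dual_basis:
 shows "set vbs \<subseteq> |V| \<times> Collect (llin V)"
  and "v \<in> |V| ==> v = lsum V (map (\<lambda>(b, \<xi>). \<xi> v \<rhd>\<^sub>V b) vbs)"
proof -
 have "fst s \<in> |V| \<and> llin V (snd s)" if "s \<in> set vbs" for s
  using that unfolding vbs_def set_append set_map by (elim UnE imageE) (simp_all add: iM iD bM_llin bD_llin)
 then show "set vbs \<subseteq> |V| \<times> Collect (llin V)" by (intro subsetI) (simp add: mem_Times_iff)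
 assume v: "v \<in> |V|"
 then have v': "fst v \<in> |M|" "snd v \<in> |DM|" by (auto simp: V_sels)
 have c1: "lt (fst q) (fst v) \<in> |A|" if "q \<in> set ls" for q using that v'(1) by (simp add: lt(2))
 have c2: "rt (snd v) (fst p) \<in> |A|" if "p \<in> set rs" for p using that v'(2) by (simp add: rt(2))
 have "v = iM (lsum M (map (\<lambda>q. lt (fst q) (fst v) \<rhd>\<^sub>M snd q) ls)) \<oplus>\<^sub>V iD (lsum DM (map (\<lambda>p. rt (snd v) (fst p) \<rhd>\<^bsub>DM\<^esub> snd p) rs))"
  unfolding basis_ls[OF v'(1)] dual_basis_rs[OF v'(2)] by (rule V_split[OF v])
 also have "iM (lsum M (map (\<lambda>q. lt (fst q) (fst v) \<rhd>\<^sub>M snd q) ls)) = lsum V (map (\<lambda>q. iM (lt (fst q) (fst v) \<rhd>\<^sub>M snd q)) ls)"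
  by (rule lsum_klin[OF iM(1)]) (simp add: c1)
 also have "\<dots> = lsum V (map (\<lambda>q. bD (fst q) v \<rhd>\<^sub>V iM (snd q)) ls)"
  by (rule lsum_cong) (simp add: c1 iM(3) bD_def)
 also have "iD (lsum DM (map (\<lambda>p. rt (snd v) (fst p) \<rhd>\<^bsub>DM\<^esub> snd p) rs)) = lsum V (map (\<lambda>p. iD (rt (snd v) (fst p) \<rhd>\<^bsub>DM\<^esub> snd p)) rs)"
  by (rule lsum_klin[OF iD(1)]) (simp add: c2)
 also have "\<dots> = lsum V (map (\<lambda>p. bM (fst p) v \<rhd>\<^sub>V iD (snd p)) rs)"
  by (rule lsum_cong) (simp add: c2 iD(3) bM_def)
 also have "lsum V (map (\<lambda>q. bD (fst q) v \<rhd>\<^sub>V iM (snd q)) ls) \<oplus>\<^sub>V lsum V (map (\<lambda>p. bM (fst p) v \<rhd>\<^sub>V iD (snd p)) rs)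
  = lsum V (map (\<lambda>q. bD (fst q) v \<rhd>\<^sub>V iM (snd q)) ls @ map (\<lambda>p. bM (fst p) v \<rhd>\<^sub>V iD (snd p)) rs)"
  by (rule lsum_append[OF bimodD(3)[OF V_bimodule], symmetric];
    simp only: set_map; rule image_subsetI; simp add: bD_def bM_def c1 c2 iM(2) iD(2) bimodD(4)[OF V_bimodule])
 also have "map (\<lambda>q. bD (fst q) v \<rhd>\<^sub>V iM (snd q)) ls @ map (\<lambda>p. bM (fst p) v \<rhd>\<^sub>V iD (snd p)) rs
  = map (\<lambda>(b, \<xi>). \<xi> v \<rhd>\<^sub>V b) vbs" by (simp add: vbs_def)
 finally show "v = lsum V (map (\<lambda>(b, \<xi>). \<xi> v \<rhd>\<^sub>V b) vbs)" .
qed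

lemma restrict_sels [simp]: "|restrict_to_A K A M rs ls X| = |X|" "add (restrict_to_A K A M rs ls X) = add X"
 "zero (restrict_to_A K A M rs ls X) = zero X" "smult (restrict_to_A K A M rs ls X) = smult X"
 "x \<lhd>\<^bsub>restrict_to_A K A M rs ls X\<^esub> a = x \<lhd>\<^sub>X ps a"
 by (simp_all add: restrict_to_A_def restrict_right_def)

context
 fixes X :: "('k, ('k, 'a, 'm) prep_elt, 'x) rmodule"
 assumes X: "right_module K P X" and fdP: "fin_dim K P"
begin

abbreviation (input) "XA \<equiv> restrict_to_A K A M rs ls X"
abbreviation (input) "XV \<equiv> tensor K A XA V"
abbreviation (input) "Src \<equiv> pres_src K A M rs ls X"
abbreviation (input) "Tgt \<equiv> pres_tgt K A M rs ls X"
abbreviation (input) "sp \<equiv> pure_tensor K A XA PB"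
abbreviation (input) "vp \<equiv> pure_tensor K A XA V"
abbreviation (input) "tp \<equiv> \<lambda>x v p. pure_tensor K A XV PB (vp x v) p"
abbreviation (input) "ev \<equiv> \<lambda>\<phi>. contract XA PB (al \<phi>)"

lemmas x_rules = rmodD[OF X]

lemma XA_klin: "klin XA U f \<longleftrightarrow> klin X U f" "klin W XA g \<longleftrightarrow> klin W X g"
proof -
 have "vspace XA \<longleftrightarrow> vspace X" using vs_image[of X XA "\<lambda>x. x"] vs_image[of XA X "\<lambda>x. x"] by auto
 then show "klin XA U f \<longleftrightarrow> klin X U f" "klin W XA g \<longleftrightarrow> klin W X g" by (auto simp: klin_def)
qed

lemma XA_rmod: "right_module K A XA"
proof (rule rmodI[OF A_alg])
 show "vspace XA" by (rule vs_image[OF x_rules(2), where q = "\<lambda>x. x"]) simp_all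
qed (simp_all add: x_rules ps klinD(4,5)[OF ps(1)])

lemmas XV_rmod = tensor_right_module(1)[OF XA_rmod V_bimodule]

lemma Src_eq: "Src = tensor K A XA PB" and Tgt_eq: "Tgt = tensor K A XV PB"
 by (simp_all add: pres_src_def pres_tgt_def)

lemmas Src_rmod = tensor_right_module(1)[OF XA_rmod PB_bimodule, folded Src_eq]
lemmas Tgt_rmod = tensor_right_module(1)[OF XV_rmod PB_bimodule, folded Tgt_eq]
lemmas sp_bal = balanced_pure[OF XA_rmod PB_bimodule, folded Src_eq]
lemmas vp_bal = balanced_pure[OF XA_rmod V_bimodule]
lemmas tp_bal = balanced_pure[OF XV_rmod PB_bimodule, folded Tgt_eq]

lemma ev:
 assumes "\<phi> \<in> |DP|"
 shows "klin Src X (ev \<phi>)" "x \<in> |X| ==> p \<in> |P| ==> ev \<phi> (sp x p) = x \<lhd>\<^sub>X ps (al \<phi> p)"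
 using contract[OF XA_rmod PB_bimodule al(1)[OF assms]] by (simp_all add: XA_klin Src_eq)

lemma ev_ops:
 assumes \<phi>: "\<phi> \<in> |DP|" and t: "t \<in> |Src|"
 shows "\<psi> \<in> |DP| ==> ev (\<phi> \<oplus>\<^bsub>DP\<^esub> \<psi>) t = ev \<phi> t \<oplus>\<^sub>X ev \<psi> t"
  and "c \<in> |K| ==> ev (c \<odot>\<^bsub>DP\<^esub> \<phi>) t = c \<odot>\<^sub>X ev \<phi> t"
  and "a \<in> |A| ==> ev (\<phi> \<lhd>\<^bsub>DP\<^esub> ps a) t = ev \<phi> t \<lhd>\<^sub>X ps a"
  and "b \<in> |P| ==> ev \<phi> (t \<lhd>\<^bsub>Src\<^esub> b) = ev (b \<rhd>\<^bsub>DP\<^esub> \<phi>) t"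
 using contract_ops[OF XA_rmod PB_bimodule al(1)[OF \<phi>], of t] t al(1) al_ops[OF \<phi>] vs_simps(1,3)[OF DP_vs] \<phi>
  DP_ract[OF \<phi> ps(2)] DP_lact[OF \<phi>] by (simp_all add: Src_eq)

text \<open>
 The maps \<open>ev \<phi>\<close> detect the elements of \<open>X \<otimes>\<^sub>A \<Pi>\<close>.
\<close>

lemma ev_expansion:
 assumes bs: "set bs \<subseteq> |P| \<times> |DP|" "\<And>p. p \<in> |P| ==> p = lsum P (map (\<lambda>q. ps (al (snd q) p) \<otimes>\<^sub>P fst q) bs)"
  and t: "t \<in> |Src|" "s \<in> |Src|" and eq: "\<And>\<phi>. \<phi> \<in> |DP| ==> ev \<phi> t = ev \<phi> s"
 shows "t = s"
proof (rule contract_eqI[OF XA_rmod PB_bimodule])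
 show "set (map (\<lambda>q. (fst q, al (snd q))) bs) \<subseteq> |PB| \<times> Collect (llin PB)" using bs(1) al(1) by auto
 show "n = lsum PB (map (\<lambda>(b, \<xi>). \<xi> n \<rhd>\<^bsub>PB\<^esub> b) (map (\<lambda>q. (fst q, al (snd q))) bs))" if "n \<in> |PB|" for n
  using bs(2)[of n] that by (simp add: lsum_def comp_def)
qed (use t bs(1) eq in \<open>auto simp: Src_eq\<close>)

lemma ev_eqI:
 assumes "t \<in> |Src|" "s \<in> |Src|" "\<And>\<phi>. \<phi> \<in> |DP| ==> ev \<phi> t = ev \<phi> s"
 shows "t = s"
 by (rule P_dual_basis[OF fdP], rule ev_expansion) (assumption | rule assms)+

text \<open>The elements of \<open>X \<otimes>\<^sub>A (M \<oplus> DM) \<otimes>\<^sub>A \<Pi>\<close> are seen by double contractions.\<close>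

definition cc where "cc \<beta> \<phi> y = contract XA V \<beta> (contract XV PB (al \<phi>) y)"

lemma cc:
 assumes \<beta>: "llin V \<beta>" and \<phi>: "\<phi> \<in> |DP|"
 shows "klin Tgt X (cc \<beta> \<phi>)"
  and "x \<in> |X| ==> v \<in> |V| ==> p \<in> |P| ==> cc \<beta> \<phi> (tp x v p) = x \<lhd>\<^sub>X ps (\<beta> (v \<lhd>\<^sub>V al \<phi> p))"
  and "y \<in> |Tgt| ==> b \<in> |P| ==> cc \<beta> \<phi> (y \<lhd>\<^bsub>Tgt\<^esub> b) = cc \<beta> (b \<rhd>\<^bsub>DP\<^esub> \<phi>) y"
proof -
 note c1 = contract[OF XA_rmod V_bimodule \<beta>] and c2 = contract[OF XV_rmod PB_bimodule al(1)[OF \<phi>]]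
 show "klin Tgt X (cc \<beta> \<phi>)" unfolding cc_def
  using klin_comp[OF c2(1) c1(1)] by (simp add: XA_klin Tgt_eq)
 show "cc \<beta> \<phi> (tp x v p) = x \<lhd>\<^sub>X ps (\<beta> (v \<lhd>\<^sub>V al \<phi> p))" if "x \<in> |X|" "v \<in> |V|" "p \<in> |P|"
  unfolding cc_def using that klinD(3)[OF balancedD(2)[OF vp_bal, of x], of v] rmodD(3)[OF bimodD(1)[OF V_bimodule]] al(2)[OF \<phi>]
  by (simp add: c2(2) tensor_right_module(2)[OF XA_rmod V_bimodule] c1(2))
 show "cc \<beta> \<phi> (y \<lhd>\<^bsub>Tgt\<^esub> b) = cc \<beta> (b \<rhd>\<^bsub>DP\<^esub> \<phi>) y" if "y \<in> |Tgt|" "b \<in> |P|"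
  unfolding cc_def using contract_ops(4)[OF XV_rmod PB_bimodule al(1)[OF \<phi>], of y "al (b \<rhd>\<^bsub>DP\<^esub> \<phi>)" b] that
   al(1)[OF DP_lact[OF \<phi> that(2)]] al_ops(4)[OF \<phi>] by (simp add: Tgt_eq)
qed

lemma cc_eqI:
 assumes y: "y \<in> |Tgt|" "z \<in> |Tgt|"
  and M: "\<And>m \<phi>. m \<in> |M| ==> \<phi> \<in> |DP| ==> cc (bM m) \<phi> y = cc (bM m) \<phi> z"
  and D: "\<And>\<nu> \<phi>. \<nu> \<in> |DM| ==> \<phi> \<in> |DP| ==> cc (bD \<nu>) \<phi> y = cc (bD \<nu>) \<phi> z"
 shows "y = z"
proof -
 obtain bs where bs: "set bs \<subseteq> |P| \<times> |DP|" "\<And>p. p \<in> |P| ==> p = lsum P (map (\<lambda>q. ps (al (snd q) p) \<otimes>\<^sub>P fst q) bs)"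
  by (rule P_dual_basis[OF fdP]) (rule that)
 show ?thesis
 proof (rule contract_eqI[OF XV_rmod PB_bimodule])
  show "set (map (\<lambda>q. (fst q, al (snd q))) bs) \<subseteq> |PB| \<times> Collect (llin PB)" using bs(1) al(1) by auto
  show "n = lsum PB (map (\<lambda>(b, \<xi>). \<xi> n \<rhd>\<^bsub>PB\<^esub> b) (map (\<lambda>q. (fst q, al (snd q))) bs))" if "n \<in> |PB|" for n
   using bs(2)[of n] that by (simp add: lsum_def comp_def)
  fix r assume "r \<in> set (map (\<lambda>q. (fst q, al (snd q))) bs)"
  then obtain \<phi> where \<phi>: "\<phi> \<in> |DP|" "snd r = al \<phi>" using bs(1) by auto
  note c = klinD(3)[OF contract(1)[OF XV_rmod PB_bimodule al(1)[OF \<phi>(1)]], folded Tgt_eq]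
  show "contract XV PB (snd r) y = contract XV PB (snd r) z" unfolding \<phi>(2)
  proof (rule contract_eqI[OF XA_rmod V_bimodule V_dual_basis c[OF y(1)] c[OF y(2)]])
   fix s assume "s \<in> set vbs"
   then have "(\<exists>m\<in>|M|. snd s = bM m) \<or> (\<exists>\<nu>\<in>|DM|. snd s = bD \<nu>)"
    unfolding vbs_def set_append set_map by (elim UnE imageE; simp; use ls_mem(1) rs_mem(1) in blast)
   then show "contract XA V (snd s) (contract XV PB (al \<phi>) y) = contract XA V (snd s) (contract XV PB (al \<phi>) z)"
    using M[OF _ \<phi>(1)] D[OF _ \<phi>(1)] unfolding cc_def by auto
  qed
 qed (use y in \<open>simp_all add: Tgt_eq\<close>)
qed

text \<open>
 The value of the left hand map on \<open>x \<otimes> p\<close>.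
\<close>

definition dterm where
 "dterm x p = lsum Tgt (map (\<lambda>q. tp (x \<lhd>\<^sub>X pm (fst q)) (iD (snd q)) p \<oplus>\<^bsub>Tgt\<^esub> tp x (iM (fst q)) (pd (snd q) \<otimes>\<^sub>P p)) rs)
  \<ominus>\<^bsub>Tgt\<^esub> lsum Tgt (map (\<lambda>q. tp (x \<lhd>\<^sub>X pd (fst q)) (iM (snd q)) p \<oplus>\<^bsub>Tgt\<^esub> tp x (iD (fst q)) (pm (snd q) \<otimes>\<^sub>P p)) ls)"

lemma tp_klin:
 assumes v: "v \<in> |V|"
 shows "p \<in> |P| ==> klin X Tgt (\<lambda>x. tp x v p)" "x \<in> |X| ==> klin P Tgt (tp x v)"
proof -
 have k: "klin X XV (\<lambda>x. vp x v)" using balancedD(1)[OF vp_bal v] by (simp add: XA_klin)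
 show "klin X Tgt (\<lambda>x. tp x v p)" if "p \<in> |P|"
  by (rule klin_comp[OF k balancedD(1)[OF tp_bal]]) (use that in simp)
 show "klin P Tgt (tp x v)" if "x \<in> |X|"
  using balancedD(2)[OF tp_bal klinD(3)[OF k that]] by (simp add: PB_klin)
qed

lemma tp_closed: "x \<in> |X| ==> v \<in> |V| ==> p \<in> |P| ==> tp x v p \<in> |Tgt|"
 using klinD(3)[OF tp_klin(1)] by simp

lemma dterm_klin:
 shows "p \<in> |P| ==> klin X Tgt (\<lambda>x. dterm x p)" "x \<in> |X| ==> klin P Tgt (dterm x)"
proof -
 note T = rmodD(2)[OF Tgt_rmod]
 show "klin X Tgt (\<lambda>x. dterm x p)" if p: "p \<in> |P|" unfolding dterm_def
  by (intro klin_minus klin_lsum klin_add x_rules(2) T klin_comp[OF rmod_klin(1)[OF X] tp_klin(1)] tp_klin(1))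
   (simp_all add: p pm pd iM iD)
 show "klin P Tgt (dterm x)" if x: "x \<in> |X|" unfolding dterm_def
  by (intro klin_minus klin_lsum klin_add P_simps(1) T klin_comp[OF alg_klin(2)[OF P_alg] tp_klin(2)] tp_klin(2))
   (simp_all add: x x_rules(3) pm pd iM iD)
qed

lemmas ps_zero = klinD(6)[OF ps(1)]

lemma x_zero: "x \<in> |X| ==> x \<lhd>\<^sub>X \<zero>\<^sub>P = \<zero>\<^sub>X"
 by (rule klinD(6)[OF rmod_klin(2)[OF X]])

text \<open>
 Contracting with \<open>m \<in> M\<close> kills the terms with \<open>M\<close> in the middle, and \<open>\<ell>\<close> and \<open>\<rho>\<close> recombine the
 others: \<open>\<Sum> m\<^sub>i \<mu>\<^sub>i(a m) = a m\<close> gives one summand, the formula \<open>al_pm\<close> for \<open>\<phi> m\<close> the other.  In the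
 same way for \<open>\<nu> \<in> DM\<close>.
\<close>

lemma cc_dterm:
 assumes \<phi>: "\<phi> \<in> |DP|" and x: "x \<in> |X|" and p: "p \<in> |P|"
 shows "m \<in> |M| ==> cc (bM m) \<phi> (dterm x p)
   = x \<lhd>\<^sub>X ps (al \<phi> p) \<lhd>\<^sub>X pm m \<ominus>\<^sub>X x \<lhd>\<^sub>X ps (al (\<phi> \<lhd>\<^bsub>DP\<^esub> pm m) p)"
  and "\<nu> \<in> |DM| ==> cc (bD \<nu>) \<phi> (dterm x p)
   = x \<lhd>\<^sub>X ps (al (\<phi> \<lhd>\<^bsub>DP\<^esub> pd \<nu>) p) \<ominus>\<^sub>X x \<lhd>\<^sub>X ps (al \<phi> p) \<lhd>\<^sub>X pd \<nu>"
proof -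
 note T = rmodD(2)[OF Tgt_rmod] and al2 = al(2)[OF \<phi>]
 let ?d = "\<lambda>q. al \<phi> (pd (snd q) \<otimes>\<^sub>P p)" and ?m = "\<lambda>q. al \<phi> (pm (snd q) \<otimes>\<^sub>P p)"
 let ?s = "\<lambda>\<beta> q. x \<lhd>\<^sub>X pm (fst q) \<lhd>\<^sub>X ps (\<beta> (iD (snd q) \<lhd>\<^sub>V al \<phi> p)) \<oplus>\<^sub>X x \<lhd>\<^sub>X ps (\<beta> (iM (fst q) \<lhd>\<^sub>V ?d q))"
  and ?t = "\<lambda>\<beta> q. x \<lhd>\<^sub>X pd (fst q) \<lhd>\<^sub>X ps (\<beta> (iM (snd q) \<lhd>\<^sub>V al \<phi> p)) \<oplus>\<^sub>X x \<lhd>\<^sub>X ps (\<beta> (iD (fst q) \<lhd>\<^sub>V ?m q))"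
 have split: "cc \<beta> \<phi> (dterm x p) = lsum X (map (?s \<beta>) rs)
   \<ominus>\<^sub>X lsum X (map (?t \<beta>) ls)" if \<beta>: "llin V \<beta>" for \<beta>
 proof -
  let ?u = "\<lambda>q. tp (x \<lhd>\<^sub>X pm (fst q)) (iD (snd q)) p \<oplus>\<^bsub>Tgt\<^esub> tp x (iM (fst q)) (pd (snd q) \<otimes>\<^sub>P p)"
   and ?v = "\<lambda>q. tp (x \<lhd>\<^sub>X pd (fst q)) (iM (snd q)) p \<oplus>\<^bsub>Tgt\<^esub> tp x (iD (fst q)) (pm (snd q) \<otimes>\<^sub>P p)"
  note c = cc[OF \<beta> \<phi>]
  have 1: "tp (x \<lhd>\<^sub>X pm (fst q)) (iD (snd q)) p \<in> |Tgt| \<and> tp x (iM (fst q)) (pd (snd q) \<otimes>\<^sub>P p) \<in> |Tgt|"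
   if "q \<in> set rs" for q using that x p by (auto intro!: tp_closed x_rules(3) simp: pm pd iM iD)
  have 2: "tp (x \<lhd>\<^sub>X pd (fst q)) (iM (snd q)) p \<in> |Tgt| \<and> tp x (iD (fst q)) (pm (snd q) \<otimes>\<^sub>P p) \<in> |Tgt|"
   if "q \<in> set ls" for q using that x p by (auto intro!: tp_closed x_rules(3) simp: pm pd iM iD)
  have 3: "lsum Tgt (map ?u rs) \<in> |Tgt|"
   "lsum Tgt (map ?v ls) \<in> |Tgt|"
   by (rule lsum_map_closed[OF T]; use 1 2 T in simp)+
  have 4: "cc \<beta> \<phi> (lsum Tgt (map ?u rs))
   = lsum X (map (\<lambda>q. cc \<beta> \<phi> (?u q)) rs)"
   by (rule lsum_klin[OF c(1)]) (use 1 T in simp)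
  have 5: "cc \<beta> \<phi> (lsum Tgt (map ?v ls))
   = lsum X (map (\<lambda>q. cc \<beta> \<phi> (?v q)) ls)"
   by (rule lsum_klin[OF c(1)]) (use 2 T in simp)
  have 6: "cc \<beta> \<phi> (?u q) = ?s \<beta> q"
   if q: "q \<in> set rs" for q
   unfolding klinD(4)[OF c(1) conjunct1[OF 1[OF q]] conjunct2[OF 1[OF q]]]
   using q x p by (simp add: c(2) x_rules(3) pm pd iM iD)
  have 7: "cc \<beta> \<phi> (?v q) = ?t \<beta> q"
   if q: "q \<in> set ls" for q
   unfolding klinD(4)[OF c(1) conjunct1[OF 2[OF q]] conjunct2[OF 2[OF q]]]
   using q x p by (simp add: c(2) x_rules(3) pm pd iM iD)
  show ?thesis unfolding dterm_def klinD(8)[OF c(1) 3] 4 5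
   by (intro arg_cong2[where f = "a_minus X"] lsum_cong; (rule 6 | rule 7); assumption)
 qed
 have a: "al \<phi> p \<in> |A|" by (rule al2[OF p])
 have xP: "klin A X (\<lambda>a. x \<lhd>\<^sub>X ps a)" by (rule klin_comp[OF ps(1) rmod_klin(2)[OF X x]])
 show "cc (bM m) \<phi> (dterm x p) = x \<lhd>\<^sub>X ps (al \<phi> p) \<lhd>\<^sub>X pm m \<ominus>\<^sub>X x \<lhd>\<^sub>X ps (al (\<phi> \<lhd>\<^bsub>DP\<^esub> pm m) p)"
  if m: "m \<in> |M|"
 proof -
  have am: "al \<phi> p \<rhd>\<^sub>M m \<in> |M|" using a m by simp
  have r: "rt (snd q) (al \<phi> p \<rhd>\<^sub>M m) \<in> |A|" if "q \<in> set rs" for q using that am by (simp add: rt(2))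
  have "lsum X (map (?s (bM m)) rs)
   = lsum X (map (\<lambda>q. x \<lhd>\<^sub>X pm (fst q \<lhd>\<^sub>M rt (snd q) (al \<phi> p \<rhd>\<^sub>M m))) rs)"
  proof (rule lsum_cong)
   fix q assume q: "q \<in> set rs"
   have z: "bM m (iM (fst q) \<lhd>\<^sub>V ?d q) = \<zero>\<^sub>A"
    by (rule b_values(1)[OF m rs_mem(2)[OF q] al2 rs_mem[OF q]]) (use q p pd in simp)
   have y: "bM m (iD (snd q) \<lhd>\<^sub>V al \<phi> p) = rt (snd q) (al \<phi> p \<rhd>\<^sub>M m)"
    by (rule b_values(2)[OF m rs_mem(2)[OF q] a rs_mem[OF q]])
   show "?s (bM m) q
    = x \<lhd>\<^sub>X pm (fst q \<lhd>\<^sub>M rt (snd q) (al \<phi> p \<rhd>\<^sub>M m))"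
    unfolding z y using q x r[OF q] by (simp add: ps_zero x_zero x_rules(2,3) pm(2,4) ps(2) x_rules(6)[symmetric])
  qed
  also have "\<dots> = x \<lhd>\<^sub>X pm (lsum M (map (\<lambda>q. fst q \<lhd>\<^sub>M rt (snd q) (al \<phi> p \<rhd>\<^sub>M m)) rs))"
   by (rule lsum_klin[OF klin_comp[OF pm(1) rmod_klin(2)[OF X x]], symmetric]) (simp add: r)
  also have "\<dots> = x \<lhd>\<^sub>X ps (al \<phi> p) \<lhd>\<^sub>X pm m"
   unfolding basis_rs[OF am] using a m x by (simp add: pm(2,3) ps(2) x_rules(6))
  finally have 1: "lsum X (map (?s (bM m)) rs) = x \<lhd>\<^sub>X ps (al \<phi> p) \<lhd>\<^sub>X pm m" .
  have s: "?m q \<in> |A|" if "q \<in> set ls" for q using that p pm by (simp add: al2)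
  have "lsum X (map (?t (bM m)) ls)
   = lsum X (map (\<lambda>q. x \<lhd>\<^sub>X ps (rt (fst q) (?m q \<rhd>\<^sub>M m))) ls)"
  proof (rule lsum_cong)
   fix q assume q: "q \<in> set ls"
   have z: "bM m (iM (snd q) \<lhd>\<^sub>V al \<phi> p) = \<zero>\<^sub>A" by (rule b_values(1)[OF m ls_mem(1)[OF q] a ls_mem(2)[OF q] ls_mem(1)[OF q]])
   have y: "bM m (iD (fst q) \<lhd>\<^sub>V ?m q) = rt (fst q) (?m q \<rhd>\<^sub>M m)"
    by (rule b_values(2)[OF m ls_mem(1)[OF q] s[OF q] ls_mem(2)[OF q] ls_mem(1)[OF q]])
   show "?t (bM m) q
    = x \<lhd>\<^sub>X ps (rt (fst q) (?m q \<rhd>\<^sub>M m))"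
    unfolding z y using q x s[OF q] m by (simp add: ps_zero x_zero x_rules(2,3) pd(2) ps(2) rt(2))
  qed
  also have "\<dots> = x \<lhd>\<^sub>X ps (lsum A (map (\<lambda>q. rt (fst q) (?m q \<rhd>\<^sub>M m)) ls))"
   by (rule lsum_klin[OF xP, symmetric]) (simp add: rt(2) s m)
  also have "\<dots> = x \<lhd>\<^sub>X ps (al (\<phi> \<lhd>\<^bsub>DP\<^esub> pm m) p)" unfolding al_pm[OF \<phi> p m] ..
  finally show ?thesis unfolding split[OF bM_llin[OF m]] 1 by simp
 qed
 show "cc (bD \<nu>) \<phi> (dterm x p) = x \<lhd>\<^sub>X ps (al (\<phi> \<lhd>\<^bsub>DP\<^esub> pd \<nu>) p) \<ominus>\<^sub>X x \<lhd>\<^sub>X ps (al \<phi> p) \<lhd>\<^sub>X pd \<nu>"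
  if \<nu>: "\<nu> \<in> |DM|"
 proof -
  have a\<nu>: "al \<phi> p \<rhd>\<^bsub>DM\<^esub> \<nu> \<in> |DM|" using a \<nu> by simp
  have r: "lt (al \<phi> p \<rhd>\<^bsub>DM\<^esub> \<nu>) (snd q) \<in> |A|" if "q \<in> set ls" for q using that by (simp add: lt(2)[OF a\<nu>])
  have m0: "\<zero>\<^sub>M \<in> |M|" by simp
  have "lsum X (map (?t (bD \<nu>)) ls)
   = lsum X (map (\<lambda>q. x \<lhd>\<^sub>X pd (fst q \<lhd>\<^bsub>DM\<^esub> lt (al \<phi> p \<rhd>\<^bsub>DM\<^esub> \<nu>) (snd q))) ls)"
  proof (rule lsum_cong)
   fix q assume q: "q \<in> set ls"
   have z: "bD \<nu> (iD (fst q) \<lhd>\<^sub>V ?m q) = \<zero>\<^sub>A"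
    by (rule b_values(3)[OF m0 \<nu> al2 m0 ls_mem(1)[OF q]]) (use q p pm in simp)
   have y: "bD \<nu> (iM (snd q) \<lhd>\<^sub>V al \<phi> p) = lt (al \<phi> p \<rhd>\<^bsub>DM\<^esub> \<nu>) (snd q)"
    using b_values(4)[OF m0 \<nu> a ls_mem(2)[OF q] ls_mem(1)[OF q]] lt(8)[OF \<nu> ls_mem(2)[OF q] a] by simp
   show "?t (bD \<nu>) q
    = x \<lhd>\<^sub>X pd (fst q \<lhd>\<^bsub>DM\<^esub> lt (al \<phi> p \<rhd>\<^bsub>DM\<^esub> \<nu>) (snd q))"
    unfolding z y using q x r[OF q] by (simp add: ps_zero x_zero x_rules(2,3) pd(2,4) ps(2) x_rules(6)[symmetric])
  qed
  also have "\<dots> = x \<lhd>\<^sub>X pd (lsum DM (map (\<lambda>q. fst q \<lhd>\<^bsub>DM\<^esub> lt (al \<phi> p \<rhd>\<^bsub>DM\<^esub> \<nu>) (snd q)) ls))"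
   by (rule lsum_klin[OF klin_comp[OF pd(1) rmod_klin(2)[OF X x]], symmetric]) (simp add: r)
  also have "\<dots> = x \<lhd>\<^sub>X ps (al \<phi> p) \<lhd>\<^sub>X pd \<nu>"
   unfolding dual_basis_ls[OF a\<nu>] using a \<nu> x by (simp add: pd(2,3) ps(2) x_rules(6))
  finally have 1: "lsum X (map (?t (bD \<nu>)) ls) = x \<lhd>\<^sub>X ps (al \<phi> p) \<lhd>\<^sub>X pd \<nu>" .
  have s: "?d q \<in> |A|" if "q \<in> set rs" for q using that p pd by (simp add: al2)
  have "lsum X (map (?s (bD \<nu>)) rs)
   = lsum X (map (\<lambda>q. x \<lhd>\<^sub>X ps (lt \<nu> (fst q \<lhd>\<^sub>M ?d q))) rs)"
  proof (rule lsum_cong)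
   fix q assume q: "q \<in> set rs"
   have z: "bD \<nu> (iD (snd q) \<lhd>\<^sub>V al \<phi> p) = \<zero>\<^sub>A" by (rule b_values(3)[OF m0 \<nu> a rs_mem[OF q]])
   have y: "bD \<nu> (iM (fst q) \<lhd>\<^sub>V ?d q) = lt \<nu> (fst q \<lhd>\<^sub>M ?d q)"
    by (rule b_values(4)[OF m0 \<nu> s[OF q] rs_mem[OF q]])
   show "?s (bD \<nu>) q
    = x \<lhd>\<^sub>X ps (lt \<nu> (fst q \<lhd>\<^sub>M ?d q))"
    unfolding z y using q x s[OF q] \<nu> by (simp add: ps_zero x_zero x_rules(2,3) pm(2) ps(2) lt(2))
  qed
  also have "\<dots> = x \<lhd>\<^sub>X ps (lsum A (map (\<lambda>q. lt \<nu> (fst q \<lhd>\<^sub>M ?d q)) rs))"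
   by (rule lsum_klin[OF xP, symmetric]) (simp add: lt(2) s \<nu>)
  also have "\<dots> = x \<lhd>\<^sub>X ps (al (\<phi> \<lhd>\<^bsub>DP\<^esub> pd \<nu>) p)" unfolding al_pd[OF \<phi> p \<nu>] ..
  finally show ?thesis unfolding split[OF bD_llin[OF \<nu>]] 1 by simp
 qed
qed

text \<open>
 By the formulas for the double contractions the left hand map of the presentation is well
 defined and commutes with \<open>\<Pi>\<close>.
\<close>

lemma pres_map:
 shows "pres_map K A M rs ls X \<in> rmod_hom P Src Tgt"
  and "t \<in> |Src| ==> \<phi> \<in> |DP| ==> m \<in> |M| ==> cc (bM m) \<phi> (pres_map K A M rs ls X t)
   = ev \<phi> t \<lhd>\<^sub>X pm m \<ominus>\<^sub>X ev (\<phi> \<lhd>\<^bsub>DP\<^esub> pm m) t"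
  and "t \<in> |Src| ==> \<phi> \<in> |DP| ==> \<nu> \<in> |DM| ==> cc (bD \<nu>) \<phi> (pres_map K A M rs ls X t)
   = ev (\<phi> \<lhd>\<^bsub>DP\<^esub> pd \<nu>) t \<ominus>\<^sub>X ev \<phi> t \<lhd>\<^sub>X pd \<nu>"
proof -
 have dc: "dterm x p \<in> |Tgt|" if "x \<in> |X|" "p \<in> |P|" for x p
  by (rule klinD(3)[OF dterm_klin(1)[OF that(2)] that(1)])
 have bal: "balanced A XA PB Tgt dterm" unfolding balanced_def
 proof (intro conjI ballI)
  fix x a p assume x: "x \<in> |XA|" and a: "a \<in> |A|" and p: "p \<in> |PB|"
  note c = x p a
  have q: "x \<lhd>\<^sub>X ps a \<in> |X|" "ps a \<otimes>\<^sub>P p \<in> |P|" using c ps(2) by (simp_all add: x_rules(3))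
  have e: "x \<lhd>\<^sub>X ps a \<lhd>\<^sub>X ps (al \<phi> p) = x \<lhd>\<^sub>X ps (al \<phi> (ps a \<otimes>\<^sub>P p))" if "\<phi> \<in> |DP|" for \<phi>
   using that c al(2,3)[OF that] by (simp add: ps x_rules(6))
  have "dterm (x \<lhd>\<^sub>X ps a) p = dterm x (ps a \<otimes>\<^sub>P p)"
   by (rule cc_eqI) (use c q in \<open>simp_all add: dc cc_dterm e DP_ract pm pd\<close>)
  then show "dterm (x \<lhd>\<^bsub>XA\<^esub> a) p = dterm x (a \<rhd>\<^bsub>PB\<^esub> p)" by simp
 qed (use dterm_klin in \<open>simp_all add: XA_klin PB_klin\<close>)
 obtain d where d: "klin Src Tgt d" "\<And>x p. x \<in> |X| ==> p \<in> |P| ==> d (sp x p) = dterm x p"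
  using tensor_lift[OF XA_rmod PB_bimodule rmodD(2)[OF Tgt_rmod] bal] unfolding Src_eq[symmetric] by auto
 note S = Src_rmod and T = Tgt_rmod
 have kM: "cc (bM m) \<phi> (d t) = ev \<phi> t \<lhd>\<^sub>X pm m \<ominus>\<^sub>X ev (\<phi> \<lhd>\<^bsub>DP\<^esub> pm m) t"
  if t: "t \<in> |Src|" and \<phi>: "\<phi> \<in> |DP|" and m: "m \<in> |M|" for t \<phi> m
 proof -
  note \<phi>' = DP_ract[OF \<phi> pm(2)[OF m]]
  show ?thesis
   by (rule tensor_eqI[OF XA_rmod PB_bimodule, folded Src_eq, OF klin_comp[OF d(1) cc(1)[OF bM_llin[OF m] \<phi>]]
      klin_minus[OF klin_comp[OF ev(1)[OF \<phi>] rmod_klin(1)[OF X pm(2)[OF m]]] ev(1)[OF \<phi>']] _ t])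
    (simp add: d(2) cc_dterm(1)[OF \<phi> _ _ m] ev(2)[OF \<phi>] ev(2)[OF \<phi>'])
 qed
 have kD: "cc (bD \<nu>) \<phi> (d t) = ev (\<phi> \<lhd>\<^bsub>DP\<^esub> pd \<nu>) t \<ominus>\<^sub>X ev \<phi> t \<lhd>\<^sub>X pd \<nu>"
  if t: "t \<in> |Src|" and \<phi>: "\<phi> \<in> |DP|" and \<nu>: "\<nu> \<in> |DM|" for t \<phi> \<nu>
 proof -
  note \<phi>' = DP_ract[OF \<phi> pd(2)[OF \<nu>]]
  show ?thesis
   by (rule tensor_eqI[OF XA_rmod PB_bimodule, folded Src_eq, OF klin_comp[OF d(1) cc(1)[OF bD_llin[OF \<nu>] \<phi>]]
      klin_minus[OF ev(1)[OF \<phi>'] klin_comp[OF ev(1)[OF \<phi>] rmod_klin(1)[OF X pd(2)[OF \<nu>]]]] _ t])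
    (simp add: d(2) cc_dterm(2)[OF \<phi> _ _ \<nu>] ev(2)[OF \<phi>] ev(2)[OF \<phi>'])
 qed
 have dr: "d (t \<lhd>\<^bsub>Src\<^esub> b) = d t \<lhd>\<^bsub>Tgt\<^esub> b" if t: "t \<in> |Src|" and b: "b \<in> |P|" for t b
 proof -
  note tb = rmodD(3)[OF S t b] and dt = klinD(3)[OF d(1) t]
  have e: "ev (\<phi> \<lhd>\<^bsub>DP\<^esub> q) (t \<lhd>\<^bsub>Src\<^esub> b) = ev ((b \<rhd>\<^bsub>DP\<^esub> \<phi>) \<lhd>\<^bsub>DP\<^esub> q) t" if "\<phi> \<in> |DP|" "q \<in> |P|" for \<phi> q
   using ev_ops(4)[OF DP_ract[OF that] t b] bimodD(11)[OF dual_bimodule[OF reg_bimodule] b that] by simp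
  show ?thesis
   by (rule cc_eqI[OF klinD(3)[OF d(1) tb] rmodD(3)[OF T dt b]])
    (simp_all add: kM kD tb cc(3)[OF bM_llin _ dt b] cc(3)[OF bD_llin _ dt b] t DP_lact b e pm pd ev_ops(4)[OF _ t b])
 qed
 define e where "e = restrict d |Src|"
 have e: "e \<in> rmod_hom P Src Tgt" unfolding rmod_hom_def e_def
  using klinD(3,4)[OF d(1)] dr rmodD(2,3)[OF S] by auto
 let ?F = "\<lambda>x. lsum Tgt (map (\<lambda>(m, \<mu>). tp (x \<lhd>\<^sub>X pm m) (iD \<mu>) \<one>\<^sub>P \<oplus>\<^bsub>Tgt\<^esub> tp x (iM m) (pd \<mu>)) rs) \<ominus>\<^bsub>Tgt\<^esub>
  lsum Tgt (map (\<lambda>(\<nu>, n). tp (x \<lhd>\<^sub>X pd \<nu>) (iM n) \<one>\<^sub>P \<oplus>\<^bsub>Tgt\<^esub> tp x (iD \<nu>) (pm n)) ls)"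
 have F: "?F x = dterm x \<one>\<^sub>P" for x
 proof -
  have "lsum Tgt (map (\<lambda>(m, \<mu>). tp (x \<lhd>\<^sub>X pm m) (iD \<mu>) \<one>\<^sub>P \<oplus>\<^bsub>Tgt\<^esub> tp x (iM m) (pd \<mu>)) rs)
   = lsum Tgt (map (\<lambda>q. tp (x \<lhd>\<^sub>X pm (fst q)) (iD (snd q)) \<one>\<^sub>P \<oplus>\<^bsub>Tgt\<^esub> tp x (iM (fst q)) (pd (snd q) \<otimes>\<^sub>P \<one>\<^sub>P)) rs)"
   by (rule lsum_cong) (simp add: case_prod_beta' pd(2))
  moreover have "lsum Tgt (map (\<lambda>(\<nu>, n). tp (x \<lhd>\<^sub>X pd \<nu>) (iM n) \<one>\<^sub>P \<oplus>\<^bsub>Tgt\<^esub> tp x (iD \<nu>) (pm n)) ls)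
   = lsum Tgt (map (\<lambda>q. tp (x \<lhd>\<^sub>X pd (fst q)) (iM (snd q)) \<one>\<^sub>P \<oplus>\<^bsub>Tgt\<^esub> tp x (iD (fst q)) (pm (snd q) \<otimes>\<^sub>P \<one>\<^sub>P)) ls)"
   by (rule lsum_cong) (simp add: case_prod_beta' pm(2))
  ultimately show ?thesis unfolding dterm_def by simp
 qed
 have sp: "sp x p = sp x \<one>\<^sub>P \<lhd>\<^bsub>Src\<^esub> p" "sp x p \<in> |Src|" if "x \<in> |X|" "p \<in> |P|" for x p
  using tensor_right_module(2)[OF XA_rmod PB_bimodule, of x "\<one>\<^sub>P" p] klinD(3)[OF balancedD(2)[OF sp_bal, of x], of p] that
  by (simp_all add: Src_eq)
 have "pres_map K A M rs ls X = (THE d. d \<in> rmod_hom P Src Tgt \<and> (\<forall>x\<in>|X|. d (sp x \<one>\<^sub>P) = ?F x))"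
  unfolding pres_map_def Let_def ..
 also have "\<dots> = e"
 proof (rule the_equality)
  have "e (sp x \<one>\<^sub>P) = ?F x" if "x \<in> |X|" for x unfolding F e_def using d(2) sp(2) that by simp
  then show "e \<in> rmod_hom P Src Tgt \<and> (\<forall>x\<in>|X|. e (sp x \<one>\<^sub>P) = ?F x)" using e by blast
  fix d' assume d': "d' \<in> rmod_hom P Src Tgt \<and> (\<forall>x\<in>|X|. d' (sp x \<one>\<^sub>P) = ?F x)"
  have h: "act_hom P Src Tgt f" if "f \<in> rmod_hom P Src Tgt" for f
   using that unfolding rmod_hom_def act_hom_def by auto
  note l = act_hom_alin[OF S T h]
  show "d' = e"
  proof (rule extensionalityI[where A = "|Src|"])
   fix t assume t: "t \<in> |Src|"
   show "d' t = e t"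
   proof (rule tensor_eqI[OF XA_rmod PB_bimodule, folded Src_eq, OF alinD(1)[OF l] alinD(1)[OF l[OF e]] _ t])
    show "d' \<in> rmod_hom P Src Tgt" using d' by simp
    fix x p assume "x \<in> |XA|" "p \<in> |PB|"
    then have x: "x \<in> |X|" and p: "p \<in> |P|" by simp_all
    have "f (sp x p) = f (sp x \<one>\<^sub>P) \<lhd>\<^bsub>Tgt\<^esub> p" if "f \<in> rmod_hom P Src Tgt" for f
     unfolding sp(1)[OF x p] by (rule alinD(3)[OF l[OF that] sp(2)[OF x] p]) simp
    note r = this
    have "d' (sp x p) = d' (sp x \<one>\<^sub>P) \<lhd>\<^bsub>Tgt\<^esub> p" using d' by (intro r) blast
    also have "d' (sp x \<one>\<^sub>P) = ?F x" using d' x by blast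
    also have "?F x = e (sp x \<one>\<^sub>P)" by (rule \<open>\<And>x. x \<in> |X| ==> e (sp x \<one>\<^sub>P) = ?F x\<close>[OF x, symmetric])
    also have "e (sp x \<one>\<^sub>P) \<lhd>\<^bsub>Tgt\<^esub> p = e (sp x p)" by (rule r[OF e, symmetric])
    finally show "d' (sp x p) = e (sp x p)" .
   qed
  qed (use d' e in \<open>auto simp: rmod_hom_def PiE_def\<close>)
 qed
 finally have pe: "pres_map K A M rs ls X = e" .
 show "pres_map K A M rs ls X \<in> rmod_hom P Src Tgt" unfolding pe by (rule e)
 show "t \<in> |Src| ==> \<phi> \<in> |DP| ==> m \<in> |M| ==> cc (bM m) \<phi> (pres_map K A M rs ls X t)
   = ev \<phi> t \<lhd>\<^sub>X pm m \<ominus>\<^sub>X ev (\<phi> \<lhd>\<^bsub>DP\<^esub> pm m) t" unfolding pe e_def by (simp add: kM)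
 show "t \<in> |Src| ==> \<phi> \<in> |DP| ==> \<nu> \<in> |DM| ==> cc (bD \<nu>) \<phi> (pres_map K A M rs ls X t)
   = ev (\<phi> \<lhd>\<^bsub>DP\<^esub> pd \<nu>) t \<ominus>\<^sub>X ev \<phi> t \<lhd>\<^sub>X pd \<nu>" unfolding pe e_def by (simp add: kD)
qed

end

end

context preprojective_data
begin

subsection \<open>The isomorphism\<close>

definition \<eta> :: "('k, ('k, 'a, 'm) prep_elt, 'x) rmodule \<Rightarrow> ('x \<times> ('k, 'a, 'm) prep_elt \<Rightarrow> 'k) set \<Rightarrow> (('k, 'a, 'm) prep_elt \<Rightarrow> 'k) \<Rightarrow> 'x" where
 "\<eta> X = (\<lambda>t\<in>|third_syzygy K A M rs ls X|. \<lambda>\<phi>\<in>|DP|. contract (restrict_to_A K A M rs ls X) PB (al \<phi>) t)"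

context
 fixes X :: "('k, ('k, 'a, 'm) prep_elt, 'x) rmodule"
 assumes X: "right_module K P X" and fdP: "fin_dim K P"
begin

abbreviation (input) "XA' \<equiv> restrict_to_A K A M rs ls X"
abbreviation (input) "S \<equiv> pres_src K A M rs ls X"
abbreviation (input) "Z \<equiv> third_syzygy K A M rs ls X"
abbreviation (input) "H \<equiv> inverse_nakayama K P X"
abbreviation (input) "\<epsilon> \<equiv> \<lambda>\<phi>. contract XA' PB (al \<phi>)"

lemmas S_rmod = Src_rmod[OF X fdP]
lemmas \<epsilon> = ev[OF X fdP]
lemmas \<epsilon>_ops = ev_ops[OF X fdP]

lemma Z_sels: "t \<in> |Z| \<longleftrightarrow> t \<in> |S| \<and> pres_map K A M rs ls X t = \<zero>\<^bsub>pres_tgt K A M rs ls X\<^esub>"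
 "add Z = add S" "ract Z = ract S"
 by (simp_all add: third_syzygy_def)

lemma H_sels: "|H| = rmod_hom P DP X" "(f \<oplus>\<^sub>H g) = (\<lambda>n\<in>|DP|. f n \<oplus>\<^sub>X g n)"
 "f \<lhd>\<^sub>H b = (\<lambda>n\<in>|DP|. f (b \<rhd>\<^bsub>DP\<^esub> n))"
 by (simp_all add: inverse_nakayama_def hom_module_def)

text \<open>
 By \<open>pres_map\<close> the double contractions of the image of \<open>t\<close> measure how far \<open>\<phi> \<mapsto> \<epsilon> \<phi> t\<close> is from
 commuting with \<open>M\<close> and \<open>DM\<close>.  It commutes with \<open>A\<close>, and together these generate \<open>\<Pi>\<close>.
\<close>

lemma kernel_iff:
 assumes t: "t \<in> |S|"
 shows "t \<in> |Z| \<longleftrightarrow> (\<forall>\<phi>\<in>|DP|. \<forall>b\<in>|P|. \<epsilon> \<phi> t \<lhd>\<^sub>X b = \<epsilon> (\<phi> \<lhd>\<^bsub>DP\<^esub> b) t)"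
proof
 let ?d = "pres_map K A M rs ls X" and ?T = "pres_tgt K A M rs ls X"
 note Tv = rmodD(2)[OF Tgt_rmod[OF X fdP]] and x = rmodD[OF X]
 note kM = pres_map(2)[OF X fdP t] and kD = pres_map(3)[OF X fdP t]
 have c: "\<epsilon> \<phi> t \<in> |X|" if "\<phi> \<in> |DP|" for \<phi> by (rule klinD(3)[OF \<epsilon>(1)[OF that] t])
 have z: "cc X \<beta> \<phi> \<zero>\<^sub>?T = \<zero>\<^sub>X" if "llin V \<beta>" "\<phi> \<in> |DP|" for \<beta> \<phi> by (rule klinD(6)[OF cc(1)[OF X fdP that]])
 show "t \<in> |Z|" if h: "\<forall>\<phi>\<in>|DP|. \<forall>b\<in>|P|. \<epsilon> \<phi> t \<lhd>\<^sub>X b = \<epsilon> (\<phi> \<lhd>\<^bsub>DP\<^esub> b) t"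
 proof -
  have "?d t \<in> |?T|" using pres_map(1)[OF X fdP] t unfolding rmod_hom_def by auto
  then have "?d t = \<zero>\<^sub>?T"
   by (rule cc_eqI[OF X fdP])
    (use h in \<open>simp_all add: Tv kM kD z bM_llin bD_llin pm pd c DP_ract x(2)\<close>)
  then show ?thesis using t by (simp add: Z_sels)
 qed
 assume "t \<in> |Z|"
 then have d: "?d t = \<zero>\<^sub>?T" by (simp add: Z_sels)
 have M: "\<epsilon> \<phi> t \<lhd>\<^sub>X pm m = \<epsilon> (\<phi> \<lhd>\<^bsub>DP\<^esub> pm m) t" if "\<phi> \<in> |DP|" "m \<in> |M|" for \<phi> m
 proof -
  have "\<epsilon> \<phi> t \<lhd>\<^sub>X pm m \<ominus>\<^sub>X \<epsilon> (\<phi> \<lhd>\<^bsub>DP\<^esub> pm m) t = \<zero>\<^sub>X" using kM[OF that] z[OF bM_llin[OF that(2)] that(1)] by (simp add: d)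
  then show ?thesis using vs_minus_zero_iff[OF x(2) x(3)[OF c pm(2)] c[OF DP_ract[OF _ pm(2)]]] that by simp
 qed
 have D: "\<epsilon> \<phi> t \<lhd>\<^sub>X pd \<nu> = \<epsilon> (\<phi> \<lhd>\<^bsub>DP\<^esub> pd \<nu>) t" if "\<phi> \<in> |DP|" "\<nu> \<in> |DM|" for \<phi> \<nu>
 proof -
  have "\<epsilon> (\<phi> \<lhd>\<^bsub>DP\<^esub> pd \<nu>) t \<ominus>\<^sub>X \<epsilon> \<phi> t \<lhd>\<^sub>X pd \<nu> = \<zero>\<^sub>X" using kD[OF that] z[OF bD_llin[OF that(2)] that(1)] by (simp add: d)
  then show ?thesis using vs_minus_zero_iff[OF x(2) c[OF DP_ract[OF _ pd(2)]] x(3)[OF c pd(2)]] that by simp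
 qed
 have "\<forall>\<phi>\<in>|DP|. \<epsilon> \<phi> t \<lhd>\<^sub>X b = \<epsilon> (\<phi> \<lhd>\<^bsub>DP\<^esub> b) t" if "b \<in> |P|" for b using that
 proof (induction rule: P_induct)
  case (scalar a)
  then show ?case using \<epsilon>_ops(3)[OF _ t] by simp
 next
  case (M b m)
  then show ?case using \<open>\<And>\<phi> m. \<phi> \<in> |DP| ==> m \<in> |M| ==> \<epsilon> \<phi> t \<lhd>\<^sub>X pm m = \<epsilon> (\<phi> \<lhd>\<^bsub>DP\<^esub> pm m) t\<close>
   by (simp add: x(6) c pm rmodD(6)[OF DP_rmod] DP_ract)
 next
  case (DM b \<mu>)
  then show ?case using D by (simp add: x(6) c pd rmodD(6)[OF DP_rmod] DP_ract)
 next
  case (add b b')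
  then show ?case by (simp add: x(5) c rmodD(5)[OF DP_rmod] DP_ract \<epsilon>_ops(1)[OF _ t])
 next
  case (smult k b)
  then show ?case by (simp add: x(9) c rmodD(9)[OF DP_rmod] DP_ract \<epsilon>_ops(2)[OF _ t])
 qed
 then show "\<forall>\<phi>\<in>|DP|. \<forall>b\<in>|P|. \<epsilon> \<phi> t \<lhd>\<^sub>X b = \<epsilon> (\<phi> \<lhd>\<^bsub>DP\<^esub> b) t" by blast
qed

lemma Z_closed:
 shows "s \<in> |Z| ==> t \<in> |Z| ==> s \<oplus>\<^sub>S t \<in> |Z|"
  and "t \<in> |Z| ==> b \<in> |P| ==> t \<lhd>\<^sub>S b \<in> |Z|"
proof -
 note Tv = rmodD(2)[OF Tgt_rmod[OF X fdP]] and Sv = rmodD(2)[OF S_rmod]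
 note h = pres_map(1)[OF X fdP, unfolded rmod_hom_def, simplified]
 show "s \<oplus>\<^sub>S t \<in> |Z|" if "s \<in> |Z|" "t \<in> |Z|" using that h Tv Sv by (simp add: Z_sels)
 show "t \<lhd>\<^sub>S b \<in> |Z|" if "t \<in> |Z|" "b \<in> |P|"
  using that h klinD(6)[OF rmod_klin(1)[OF Tgt_rmod[OF X fdP] that(2)]] rmodD(3)[OF S_rmod] by (simp add: Z_sels)
qed

lemma \<eta>_apply: "t \<in> |Z| ==> \<eta> X t = (\<lambda>\<phi>\<in>|DP|. \<epsilon> \<phi> t)"
 by (simp add: \<eta>_def)

lemma \<eta>_hom: "t \<in> |Z| ==> \<eta> X t \<in> rmod_hom P DP X"
proof -
 assume tZ: "t \<in> |Z|"
 then have t: "t \<in> |S|" by (simp add: Z_sels)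
 have k: "\<epsilon> \<phi> t \<lhd>\<^sub>X b = \<epsilon> (\<phi> \<lhd>\<^bsub>DP\<^esub> b) t" if "\<phi> \<in> |DP|" "b \<in> |P|" for \<phi> b
  using kernel_iff[OF t] tZ that by blast
 show ?thesis unfolding rmod_hom_def \<eta>_apply[OF tZ]
  using klinD(3)[OF \<epsilon>(1) t] vs_simps(1)[OF DP_vs] DP_ract \<epsilon>_ops(1)[OF _ t] k by simp
qed

text \<open>With a dual basis \<open>p = \<Sum> \<phi>\<^sub>i^(p) p\<^sub>i\<close> of \<open>\<Pi>\<close>, a homomorphism \<open>h\<close> is the image of \<open>\<Sum> h(\<phi>\<^sub>i) \<otimes> p\<^sub>i\<close>.\<close>

lemma \<eta>_surj:
 assumes h: "h \<in> rmod_hom P DP X"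
 shows "\<exists>t\<in>|Z|. \<eta> X t = h"
proof -
 note x = rmodD[OF X] and Sv = rmodD(2)[OF S_rmod]
 have "act_hom P DP X h" using h unfolding rmod_hom_def act_hom_def by auto
 then have hl: "alin P DP X h" by (rule act_hom_alin[OF DP_rmod X])
 obtain bs where bs: "set bs \<subseteq> |P| \<times> |DP|" "\<And>p. p \<in> |P| ==> p = lsum P (map (\<lambda>q. ps (al (snd q) p) \<otimes>\<^sub>P fst q) bs)"
  by (rule P_dual_basis[OF fdP]) (rule that)
 have b: "fst q \<in> |P|" "snd q \<in> |DP|" if "q \<in> set bs" for q using bs(1) that by auto
 define t where "t = lsum S (map (\<lambda>q. pure_tensor K A XA' PB (h (snd q)) (fst q)) bs)"
 have pc: "pure_tensor K A XA' PB (h (snd q)) (fst q) \<in> |S|" if "q \<in> set bs" for q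
  using klinD(3)[OF balancedD(2)[OF sp_bal[OF X fdP], of "h (snd q)"], of "fst q"] alinD(2)[OF hl b(2)[OF that]] b(1)[OF that] by simp
 have t: "t \<in> |S|" unfolding t_def by (rule lsum_map_closed[OF Sv pc])
 have val: "\<epsilon> \<phi> t = h \<phi>" if \<phi>: "\<phi> \<in> |DP|" for \<phi>
 proof -
  have aA: "al \<phi> (fst q) \<in> |A|" if "q \<in> set bs" for q by (rule al(2)[OF \<phi> b(1)[OF that]])
  have r: "snd q \<lhd>\<^bsub>DP\<^esub> ps (al \<phi> (fst q)) \<in> |DP|" if "q \<in> set bs" for q
   by (rule DP_ract[OF b(2)[OF that] ps(2)[OF aA[OF that]]])
  have eq: "lsum DP (map (\<lambda>q. snd q \<lhd>\<^bsub>DP\<^esub> ps (al \<phi> (fst q))) bs) = \<phi>"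
  proof (rule DP_eqI[OF lsum_map_closed[OF DP_vs r] \<phi>])
   fix p assume p: "p \<in> |P|"
   have lA: "al (snd q) p \<in> |A|" if "q \<in> set bs" for q by (rule al(2)[OF b(2)[OF that] p])
   have "lsum DP (map (\<lambda>q. snd q \<lhd>\<^bsub>DP\<^esub> ps (al \<phi> (fst q))) bs) p = lsum K (map (\<lambda>q. (snd q \<lhd>\<^bsub>DP\<^esub> ps (al \<phi> (fst q))) p) bs)"
    by (rule lsum_dual) (use bimodD(3)[OF reg_bimodule] p r in \<open>simp_all add: dual_sels\<close>)
   also have "\<dots> = lsum K (map (\<lambda>q. \<phi> (ps (al (snd q) p) \<otimes>\<^sub>P fst q)) bs)"
   proof (rule lsum_cong)
    fix q assume q: "q \<in> set bs"
    have "(snd q \<lhd>\<^bsub>DP\<^esub> ps (al \<phi> (fst q))) p = \<sigma> (al \<phi> (fst q) \<otimes>\<^sub>A al (snd q) p)"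
     using al(5)[OF b(2)[OF q] p aA[OF q]] p by (simp add: DP_sels)
    also have "\<dots> = \<sigma> (al (snd q) p \<otimes>\<^sub>A al \<phi> (fst q))" by (rule \<sigma>_comm[OF aA[OF q] lA[OF q]])
    also have "\<dots> = \<phi> (ps (al (snd q) p) \<otimes>\<^sub>P fst q)" by (rule al(5)[OF \<phi> b(1)[OF q] lA[OF q]])
    finally show "(snd q \<lhd>\<^bsub>DP\<^esub> ps (al \<phi> (fst q))) p = \<phi> (ps (al (snd q) p) \<otimes>\<^sub>P fst q)" .
   qed
   also have "\<dots> = \<phi> (lsum P (map (\<lambda>q. ps (al (snd q) p) \<otimes>\<^sub>P fst q) bs))"
    using lsum_klin[OF DP_klin[OF \<phi>], of bs "\<lambda>q. ps (al (snd q) p) \<otimes>\<^sub>P fst q"] lA b(1) by (simp add: ps)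
   also have "\<dots> = \<phi> p" using bs(2)[OF p] by simp
   finally show "lsum DP (map (\<lambda>q. snd q \<lhd>\<^bsub>DP\<^esub> ps (al \<phi> (fst q))) bs) p = \<phi> p" .
  qed
  have "\<epsilon> \<phi> t = lsum X (map (\<lambda>q. \<epsilon> \<phi> (pure_tensor K A XA' PB (h (snd q)) (fst q))) bs)"
   unfolding t_def by (rule lsum_klin[OF \<epsilon>(1)[OF \<phi>] pc])
  also have "\<dots> = lsum X (map (\<lambda>q. h (snd q \<lhd>\<^bsub>DP\<^esub> ps (al \<phi> (fst q)))) bs)"
   by (rule lsum_cong) (simp add: \<epsilon>(2)[OF \<phi>] alinD(2,3)[OF hl] b ps(2) aA)
  also have "\<dots> = h (lsum DP (map (\<lambda>q. snd q \<lhd>\<^bsub>DP\<^esub> ps (al \<phi> (fst q))) bs))"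
   by (rule lsum_klin[OF alinD(1)[OF hl] r, symmetric])
  finally show ?thesis unfolding eq .
 qed
 have tZ: "t \<in> |Z|" unfolding kernel_iff[OF t] by (simp add: val DP_ract alinD(3)[OF hl])
 have "\<eta> X t = h" unfolding \<eta>_apply[OF tZ]
  by (rule extensionalityI[where A = "|DP|"]) (use h val in \<open>auto simp: rmod_hom_def PiE_def\<close>)
 then show ?thesis using tZ by blast
qed

text \<open>
 Injectivity is \<open>ev_eqI\<close>: elements of \<open>X \<otimes>\<^sub>A \<Pi>\<close> are detected by forms.
\<close>

lemma \<eta>_iso: "\<eta> X \<in> rmod_iso P Z H"
proof -
 note a = klinD(4)[OF \<epsilon>(1)]
 have ZS: "t \<in> |S|" if "t \<in> |Z|" for t using that by (simp add: Z_sels)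
 have hom: "\<eta> X \<in> rmod_hom P Z H" unfolding rmod_hom_def
 proof (rule CollectI, intro conjI ballI)
  show "\<eta> X \<in> |Z| \<rightarrow>\<^sub>E |H|" using \<eta>_hom by (auto simp: H_sels) (simp add: \<eta>_def)
  fix s assume s: "s \<in> |Z|"
  show "\<eta> X (s \<oplus>\<^sub>Z t) = \<eta> X s \<oplus>\<^sub>H \<eta> X t" if "t \<in> |Z|" for t
   unfolding Z_sels(2) H_sels \<eta>_apply[OF Z_closed(1)[OF s that]] \<eta>_apply[OF s] \<eta>_apply[OF that]
   by (rule restrict_ext) (simp add: a ZS s that)
  show "\<eta> X (s \<lhd>\<^sub>Z b) = \<eta> X s \<lhd>\<^sub>H b" if "b \<in> |P|" for b
   unfolding Z_sels(3) H_sels \<eta>_apply[OF Z_closed(2)[OF s that]] \<eta>_apply[OF s]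
   by (rule restrict_ext) (simp add: \<epsilon>_ops(4) ZS s that DP_lact)
 qed
 have "inj_on (\<eta> X) |Z|"
 proof (rule inj_onI)
  fix s t assume st: "s \<in> |Z|" "t \<in> |Z|" and e: "\<eta> X s = \<eta> X t"
  show "s = t"
  proof (rule ev_eqI[OF X fdP ZS[OF st(1)] ZS[OF st(2)]])
   fix \<phi> assume "\<phi> \<in> |DP|"
   then show "\<epsilon> \<phi> s = \<epsilon> \<phi> t" using fun_cong[OF e, of \<phi>] by (simp add: \<eta>_apply st)
  qed
 qed
 moreover have "\<eta> X ` |Z| = |H|"
  using \<eta>_hom \<eta>_surj unfolding H_sels by (intro subset_antisym subsetI) (blast, metis imageI)
 ultimately show ?thesis using hom unfolding rmod_iso_def bij_betw_def by simp
qed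

end

text \<open>
 Both sides send \<open>\<phi>\<close> to \<open>f (ev \<phi> t)\<close>.
\<close>

lemma \<eta>_natural:
 assumes X: "right_module K P X" and Y: "right_module K P Y" and fd: "fin_dim K P"
  and f: "f \<in> rmod_hom P X Y" and t: "t \<in> |third_syzygy K A M rs ls X|"
 shows "\<eta> Y (third_syzygy_map K A M rs ls X Y f t) = inverse_nakayama_map K P X Y f (\<eta> X t)"
proof -
 let ?r = "restrict_to_A K A M rs ls"
 let ?t = "tensor_map K A (?r X) PB (?r Y) PB f (\<lambda>p. p) t"
 have tS: "t \<in> |tensor K A (?r X) PB|" using t by (simp add: Z_sels[OF X fd] pres_src_def)
 have "act_hom P X Y f" using f unfolding rmod_hom_def act_hom_def by auto
 then have fl: "alin P X Y f" by (rule act_hom_alin[OF X Y])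
 have fA: "alin A (?r X) (?r Y) f" unfolding alin_def
  using alinD[OF fl] by (simp add: XA_klin[OF X fd] XA_klin[OF Y fd] ps)
 have nat: "contract (?r Y) PB (al \<phi>) ?t = f (contract (?r X) PB (al \<phi>) t)" if "\<phi> \<in> |DP|" for \<phi>
  by (rule contract_natural[OF XA_rmod[OF X fd] XA_rmod[OF Y fd] PB_bimodule fA al(1)[OF that] tS])
 have fa: "f (x \<lhd>\<^bsub>?r X\<^esub> a) = f x \<lhd>\<^bsub>?r Y\<^esub> a" if "x \<in> |?r X|" "a \<in> |A|" for x a by (rule alinD(3)[OF fA that])
 have tS': "?t \<in> |pres_src K A M rs ls Y|"
  using klinD(3)[OF tensor_map_props(1)[OF XA_rmod[OF X fd] PB_bimodule XA_rmod[OF Y fd] PB_bimodule alinD(1)[OF fA] fa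
   klin_id[OF bimodD(3)[OF PB_bimodule]] refl] tS] by (simp add: pres_src_def)
 have c: "contract (?r X) PB (al \<phi>) t \<in> |X|" if "\<phi> \<in> |DP|" for \<phi>
  using klinD(3)[OF ev(1)[OF X fd that]] t by (simp add: Z_sels[OF X fd])
 have "?t \<in> |third_syzygy K A M rs ls Y|" unfolding kernel_iff[OF Y fd tS']
  using kernel_iff[OF X fd, of t] t by (simp add: nat DP_ract alinD(3)[OF fl, symmetric] c Z_sels[OF X fd])
 then have "\<eta> Y ?t = (\<lambda>\<phi>\<in>|DP|. contract (?r Y) PB (al \<phi>) ?t)" by (rule \<eta>_apply[OF Y fd])
 also have "\<dots> = (\<lambda>\<phi>\<in>|DP|. f (contract (?r X) PB (al \<phi>) t))" by (rule restrict_ext) (rule nat)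
 also have "\<dots> = inverse_nakayama_map K P X Y f (\<eta> X t)"
  using \<eta>_hom[OF X fd t] by (simp add: inverse_nakayama_map_def H_sels[OF X fd] compose_def \<eta>_apply[OF X fd t] cong: restrict_cong)
 finally show ?thesis using t by (simp add: third_syzygy_map_def)
qed

theorem third_syzygy_inverse_nakayama:
 assumes fd: "fin_dim K P"
 shows "naturally_isomorphic K P (third_syzygy K A M rs ls) (third_syzygy_map K A M rs ls)
  (inverse_nakayama K P) (inverse_nakayama_map K P)"
 unfolding naturally_isomorphic_def
 using \<eta>_iso[OF _ fd] \<eta>_natural[OF _ _ fd] by (intro exI[of _ \<eta>]) blast

end

theorem theorem7p3:
  fixes K :: "('k, 'c) ring_scheme"
    and A :: "('k, 'a) module"
    and M :: "('k, 'a, 'a, 'm) bimodule"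
    and \<sigma> :: "'a \<Rightarrow> 'k"
    and rs :: "('m \<times> ('m \<Rightarrow> 'k)) list"
    and ls :: "(('m \<Rightarrow> 'k) \<times> 'm) list"
    and \<Lambda> :: "('k, (('a, 'm) tword \<Rightarrow> 'k) set) module"
    and P :: "('k, ('k, 'a, 'm) prep_elt) module"
    and \<Omega> :: "('k, ('k, 'a, 'm) prep_elt, 'x) rmodule
        \<Rightarrow> ('k, ('k, 'a, 'm) prep_elt, ('x \<times> ('k, 'a, 'm) prep_elt \<Rightarrow> 'k) set) rmodule"
  assumes "field K"
    and "product_of_division_algebras K A"
    and "bimodule K A A M" and "fin_dim K M"
    and "\<Lambda> = tensor_algebra K A M"
    and "fin_dim K \<Lambda>" and "basic_algebra K \<Lambda>" and "hereditary_algebra K \<Lambda>"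
    and "representation_finite K \<Lambda>"
    and "symmetrising K A \<sigma>"
    and "dual_bases K A M \<sigma> rs ls"
    and "P = preprojective K A M rs ls"
    and "\<Omega> = third_syzygy K A M rs ls"
  shows "naturally_isomorphic K P
    \<Omega> (third_syzygy_map K A M rs ls)
    (inverse_nakayama K P) (inverse_nakayama_map K P)"
proof -
 interpret k: kfield K by (rule kfield.intro[OF assms(1)])
 interpret b: bimodule_data K A M
  by (rule bimodule_data.intro[OF k.kfield_axioms bimodule_data_axioms.intro[OF assms(3)]])
 have fdA: "fin_dim K A" by (rule b.A_fin_dim) (use assms(5,6) in simp)
 interpret preprojective_data K A \<sigma> M rs ls
  by (intro preprojective_data.intro dualised_bimodule.intro frobenius_algebra.intro symmetric_algebra.intro
    symmetric_algebra_axioms.intro frobenius_algebra_axioms.intro dualised_bimodule_axioms.intro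
    k.kfield_axioms b.A_alg fdA assms(3,10,11) division_product_regular[OF assms(2)])
 have "fin_dim K (preprojective K A M rs ls)"
  by (rule preprojective_fin_dim) (use assms(5,6,9) in simp_all)
 then show ?thesis unfolding assms(12,13) by (rule third_syzygy_inverse_nakayama)
qed

end
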